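(* Let $\omega_1\in\mathbb{R}\setminus\mathbb{Q}$. Assume that $f$ satisfies assumption (H) (stated in the context), that $\int_0^{2\pi}a_{2d-1}(\varphi_1)\,d\varphi_1\ne0$, and that $f(\cdot,u)\in H^s(\mathbb{T})$ (Sobolev space), $s\ge1$, for all $u$. Let $0<\gamma<1/6$ and let $\mathcal{C}_\gamma\subset D\equiv(-\varepsilon_0,\varepsilon_0)\times(1,2)$ be the uncountable zero-measure Cantor set defined in the context. Fix any $0<\overline s<s-1/2$. There exist positive constants $\overline\varepsilon,\overline C,\overline\sigma>0$ such that, for all $(\varepsilon,\omega_1)\in\mathcal{C}_\gamma$ with $|\varepsilon|\gamma^{-1}<\overline\varepsilon$ and $\varepsilon\int_0^{2\pi}a_{2d-1}(\varphi_1)\,d\varphi_1>0$, there exists a nontrivial solution $u(\varepsilon,\varphi)\in\mathcal{H}_{\overline\sigma,\overline s}$ of the equation $$\Big[\omega_1^2\partial^2_{\varphi_1}+(\omega_2^2-1)\partial^2_{\varphi_2}+2\omega_1\omega_2\partial_{\varphi_1}\partial_{\varphi_2}\Big]u(\varphi)+f(\varphi_1,u)=0$$ with $(\omega_1,\omega_2)=(\omega_1,1+\varepsilon)$, satisfying $$\Big|u(\varepsilon,\varphi)-|\varepsilon|^{\frac1{2(d-1)}}\bar q_\varepsilon(\varphi_2)\Big|_{\overline\sigma,\overline s}\le\overline C\,\frac{|\varepsilon|}{\gamma}\,|\varepsilon|^{\frac1{2(d-1)}}$$ for some function $\bar q_\varepsilon(\varphi_2)\in H^{\overline\sigma}_{\mathrm{an}}(\mathbb{T})\setminus\{0\}$.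 As a consequence, the equation $$v_{tt}-v_{xx}+f(\omega_1t,v)=0,\qquad v(t,x)=v(t,x+2\pi),$$ admits the non-trivial quasi-periodic solution $v(\varepsilon,t,x):=u(\varepsilon,\omega_1t,x+\omega_2t)$ with two frequencies $(\omega_1,\omega_2)=(\omega_1,1+\varepsilon)$, and the map $t\mapsto v(\varepsilon,t,\cdot)\in H^{\overline\sigma}_{\mathrm{an}}(\mathbb{T})$ has the form $$\Big|v(\varepsilon,t,x)-|\varepsilon|^{\frac1{2(d-1)}}\bar q_\varepsilon(x+(1+\varepsilon)t)\Big|_{H^{\overline\sigma}_{\mathrm{an}}(\mathbb{T})}=O\Big(\gamma^{-1}|\varepsilon|^{\frac{2d-1}{2(d-1)}}\Big).$$
   Context: $\mathbb{T}=\mathbb{R}/2\pi\mathbb{Z}$, $\varphi=(\varphi_1,\varphi_2)\in\mathbb{T}^2$, and $\varepsilon_0>0$ is a fixed small number. Assumption (H): $f(\varphi_1,u)=\sum_{k=2d-1}^\infty a_k(\varphi_1)u^k$ with $d\in\mathbb{N}$, $d>1$, where the real-valued coefficients $a_k$ belong to the Sobolev space $H^1(\mathbb{T})$ and, for some $r>0$, $\sum_{k\ge 2d-1}|a_k|_{H^1}r^k<\infty$. The function $f(\varphi_1,u)$ is not identically constant in $\varphi_1$. The Cantor set: with $\omega_2=1+\varepsilon$, $\mathcal{C}_\gamma$ is the set of $(\varepsilon,\omega_1)\in D=(-\varepsilon_0,\varepsilon_0)\times(1,2)$ such that $\omega_1\notin\mathbb{Q}$, $\omega_1/\omega_2\notin\mathbb{Q}$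 and, for all $l_1,l_2\in\mathbb{Z}\setminus\{0\}$, $$|\omega_1l_1+\varepsilon l_2|>\frac{\gamma}{|l_1|+|l_2|},\qquad|\omega_1l_1+(2+\varepsilon)l_2|>\frac{\gamma}{|l_1|+|l_2|}.$$ For $\sigma>0$, $s\ge0$, with $[l_1]:=\max\{|l_1|,1\}$, $$\mathcal{H}_{\sigma,s}:=\Big\{u(\varphi)=\sum_{l\in\mathbb{Z}^2}\hat u_l e^{\mathrm{i}l\cdot\varphi}\ :\ \hat u_l^*=\hat u_{-l},\ |u|_{\sigma,s}:=\sum_{l\in\mathbb{Z}^2}|\hat u_l|e^{|l_2|\sigma}[l_1]^s<+\infty\Big\},$$ where $z^*$ is the complex conjugate of $z$. For $\sigma>0$, $H^\sigma_{\mathrm{an}}(\mathbb{T}):=\{u(\varphi)=\sum_{l\in\mathbb{Z}}\hat u_le^{\mathrm{i}l\varphi}:\ \hat u_l^*=\hat u_{-l},\ |u|_{H^\sigma_{\mathrm{an}}(\mathbb{T})}:=\sum_l|\hat u_l|e^{\sigma|l|}<\infty\}$. Solutions are understood in the weak (distributional, i.e. Fourier-coefficientwise) sense. Quasi-periodic solutions with two frequencies $(\omega_1,\omega_2)$ are solutions of the form $v(t,x)=u(\omega_1t,\omega_2t+x)$ with $u$ being $2\pi$-periodic in each of its two variables. *)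

theory Defs
  imports "HOL-Analysis.Analysis"
begin

text \<open>
  Functions on the torus \<open>\<real> / 2\<pi>\<int>\<close> (resp. its square) are \<open>2\<pi>\<close>-periodic functions on
  \<^typ>\<open>real\<close> (resp. \<^typ>\<open>real \<times> real\<close>). They are real-valued throughout; for the Fourier
  coefficients this is exactly the reality condition that the conjugate of the \<open>l\<close>-th coefficient
  is the \<open>(-l)\<close>-th one.
\<close>

definition fourier1 :: "(real \<Rightarrow> real) \<Rightarrow> int \<Rightarrow> complex" where
  "fourier1 g l =
     integral {0..2*pi} (\<lambda>x. of_real (g x) * cis (- (of_int l * x))) / of_real (2*pi)"

definition fourier2 :: "(real \<times> real \<Rightarrow> real) \<Rightarrow> int \<times> int \<Rightarrow> complex" where
  "fourier2 u l =
     integral (cbox (0, 0) (2*pi, 2*pi))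
       (\<lambda>x. of_real (u x) * cis (- (of_int (fst l) * fst x + of_int (snd l) * snd x)))
       / of_real ((2*pi)\<^sup>2)"

definition sobolev :: "real \<Rightarrow> (real \<Rightarrow> real) set" where
  "sobolev s = {g. (\<forall>x. g (x + 2*pi) = g x) \<and>
     g \<in> borel_measurable lebesgue \<and>
     (\<lambda>x. (g x)\<^sup>2) absolutely_integrable_on {0..2*pi} \<and>
     (\<lambda>l. (1 + (of_int l)\<^sup>2) powr s * (cmod (fourier1 g l))\<^sup>2) summable_on UNIV}"

definition sobolev_norm :: "real \<Rightarrow> (real \<Rightarrow> real) \<Rightarrow> real" where
  "sobolev_norm s g =
     sqrt (\<Sum>\<^sub>\<infinity>l. (1 + (of_int l)\<^sup>2) powr s * (cmod (fourier1 g l))\<^sup>2)"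

definition H_an :: "real \<Rightarrow> (real \<Rightarrow> real) set" where
  "H_an \<sigma> = {q. (\<lambda>l. cmod (fourier1 q l) * exp (\<sigma> * of_int \<bar>l\<bar>)) summable_on UNIV \<and>
     (\<forall>x. ((\<lambda>l. fourier1 q l * cis (of_int l * x)) has_sum of_real (q x)) UNIV)}"

definition H_an_norm :: "real \<Rightarrow> (real \<Rightarrow> real) \<Rightarrow> real" where
  "H_an_norm \<sigma> q = (\<Sum>\<^sub>\<infinity>l. cmod (fourier1 q l) * exp (\<sigma> * of_int \<bar>l\<bar>))"

definition H_weight :: "real \<Rightarrow> real \<Rightarrow> int \<times> int \<Rightarrow> real" where
  "H_weight \<sigma> s l = exp (of_int \<bar>snd l\<bar> * \<sigma>) * of_int (max \<bar>fst l\<bar> 1) powr s"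

definition H_space :: "real \<Rightarrow> real \<Rightarrow> (real \<times> real \<Rightarrow> real) set" where
  "H_space \<sigma> s = {u. (\<lambda>l. cmod (fourier2 u l) * H_weight \<sigma> s l) summable_on UNIV \<and>
     (\<forall>x. ((\<lambda>l. fourier2 u l * cis (of_int (fst l) * fst x + of_int (snd l) * snd x))
             has_sum of_real (u x)) UNIV)}"

definition H_norm :: "real \<Rightarrow> real \<Rightarrow> (real \<times> real \<Rightarrow> real) \<Rightarrow> real" where
  "H_norm \<sigma> s u = (\<Sum>\<^sub>\<infinity>l. cmod (fourier2 u l) * H_weight \<sigma> s l)"

text \<open>
  The power series is only meaningful where it converges; under \<open>assumption_H d a r\<close> below it does
  so for \<open>\<bar>u\<bar> \<le> r\<close>, which is taken as the domain of the nonlinearity.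
\<close>

definition nonlin :: "nat \<Rightarrow> (nat \<Rightarrow> real \<Rightarrow> real) \<Rightarrow> real \<Rightarrow> real \<Rightarrow> real" where
  "nonlin d a x u = (\<Sum>\<^sub>\<infinity>k\<in>{2*d-1..}. a k x * u ^ k)"

text \<open>
  Elements of \<open>H\<^sup>1\<close> are identified with their continuous representatives.
\<close>

definition assumption_H :: "nat \<Rightarrow> (nat \<Rightarrow> real \<Rightarrow> real) \<Rightarrow> real \<Rightarrow> bool" where
  "assumption_H d a r \<longleftrightarrow> 1 < d \<and> 0 < r \<and>
     (\<forall>k\<ge>2*d-1. a k \<in> sobolev 1 \<and> continuous_on UNIV (a k)) \<and>
     (\<lambda>k. sobolev_norm 1 (a k) * r ^ k) summable_on {2*d-1..} \<and>
     (\<exists>x y u. \<bar>u\<bar> \<le> r \<and> nonlin d a x u \<noteq> nonlin d a y u)"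

definition cantor_set :: "real \<Rightarrow> real \<Rightarrow> (real \<times> real) set" where
  "cantor_set \<epsilon>\<^sub>0 \<gamma> = {(\<epsilon>, \<omega>\<^sub>1). \<epsilon> \<in> {-\<epsilon>\<^sub>0<..<\<epsilon>\<^sub>0} \<and> \<omega>\<^sub>1 \<in> {1<..<2} \<and>
     \<omega>\<^sub>1 \<notin> \<rat> \<and> \<omega>\<^sub>1 / (1 + \<epsilon>) \<notin> \<rat> \<and>
     (\<forall>l\<^sub>1 l\<^sub>2 :: int. l\<^sub>1 \<noteq> 0 \<longrightarrow> l\<^sub>2 \<noteq> 0 \<longrightarrow>
        \<bar>\<omega>\<^sub>1 * of_int l\<^sub>1 + \<epsilon> * of_int l\<^sub>2\<bar> > \<gamma> / of_int (\<bar>l\<^sub>1\<bar> + \<bar>l\<^sub>2\<bar>) \<and>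
        \<bar>\<omega>\<^sub>1 * of_int l\<^sub>1 + (2 + \<epsilon>) * of_int l\<^sub>2\<bar> > \<gamma> / of_int (\<bar>l\<^sub>1\<bar> + \<bar>l\<^sub>2\<bar>))}"

text \<open>
  Weak solutions, Fourier coefficient by Fourier coefficient, of
  \<open>[\<omega>\<^sub>1\<^sup>2 \<partial>\<^sub>1\<^sub>1 + (\<omega>\<^sub>2\<^sup>2 - 1) \<partial>\<^sub>2\<^sub>2 + 2 \<omega>\<^sub>1 \<omega>\<^sub>2 \<partial>\<^sub>1\<^sub>2] u + F (\<phi>\<^sub>1, u) = 0\<close>
  on the two-dimensional torus: \<open>\<partial>\<^sub>j\<close> acts on the \<open>l\<close>-th coefficient as multiplication by \<open>\<i> l\<^sub>j\<close>.
\<close>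

definition weak_solution_torus ::
  "(real \<Rightarrow> real \<Rightarrow> real) \<Rightarrow> real \<Rightarrow> real \<Rightarrow> (real \<times> real \<Rightarrow> real) \<Rightarrow> bool" where
  "weak_solution_torus F \<omega>\<^sub>1 \<omega>\<^sub>2 u \<longleftrightarrow>
     u absolutely_integrable_on cbox (0, 0) (2*pi, 2*pi) \<and>
     (\<lambda>x. F (fst x) (u x)) absolutely_integrable_on cbox (0, 0) (2*pi, 2*pi) \<and>
     (\<forall>l\<^sub>1 l\<^sub>2 :: int.
        (\<omega>\<^sub>1\<^sup>2 * (\<i> * of_int l\<^sub>1)\<^sup>2 + (\<omega>\<^sub>2\<^sup>2 - 1) * (\<i> * of_int l\<^sub>2)\<^sup>2
           + 2 * \<omega>\<^sub>1 * \<omega>\<^sub>2 * (\<i> * of_int l\<^sub>1) * (\<i> * of_int l\<^sub>2)) * fourier2 u (l\<^sub>1, l\<^sub>2)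
          + fourier2 (\<lambda>x. F (fst x) (u x)) (l\<^sub>1, l\<^sub>2) = 0)"

text \<open>
  \<open>test_function D\<close>: \<open>D 0 0\<close> is a compactly supported smooth function on the plane, and
  \<open>D i j\<close> is its partial derivative of order \<open>i\<close> in the first and \<open>j\<close> in the second variable.
\<close>

definition test_function :: "(nat \<Rightarrow> nat \<Rightarrow> real \<times> real \<Rightarrow> real) \<Rightarrow> bool" where
  "test_function D \<longleftrightarrow>
     (\<exists>R. \<forall>z. norm z > R \<longrightarrow> D 0 0 z = 0) \<and>
     (\<forall>i j. continuous_on UNIV (D i j) \<and>
        (\<forall>t x. ((\<lambda>t. D i j (t, x)) has_real_derivative D (Suc i) j (t, x)) (at t) \<and>
               ((\<lambda>x. D i j (t, x)) has_real_derivative D i (Suc j) (t, x)) (at x)))"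

text \<open>Distributional solutions of \<open>v\<^sub>t\<^sub>t - v\<^sub>x\<^sub>x + F (\<omega>\<^sub>1 t, v) = 0\<close>, \<open>2\<pi>\<close>-periodic in \<open>x\<close>.\<close>

definition weak_solution_wave ::
  "(real \<Rightarrow> real \<Rightarrow> real) \<Rightarrow> real \<Rightarrow> (real \<Rightarrow> real \<Rightarrow> real) \<Rightarrow> bool" where
  "weak_solution_wave F \<omega>\<^sub>1 v \<longleftrightarrow>
     (\<forall>t x. v t x = v t (x + 2*pi)) \<and>
     (\<forall>p q. (\<lambda>(t, x). v t x) absolutely_integrable_on cbox p q \<and>
            (\<lambda>(t, x). F (\<omega>\<^sub>1 * t) (v t x)) absolutely_integrable_on cbox p q) \<and>
     (\<forall>D. test_function D \<longrightarrow>
        ((\<lambda>(t, x). v t x * (D 2 0 (t, x) - D 0 2 (t, x)) + F (\<omega>\<^sub>1 * t) (v t x) * D 0 0 (t, x))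
           has_integral 0) UNIV)"

definition quasi_periodic :: "real \<Rightarrow> real \<Rightarrow> (real \<Rightarrow> real \<Rightarrow> real) \<Rightarrow> bool" where
  "quasi_periodic \<omega>\<^sub>1 \<omega>\<^sub>2 v \<longleftrightarrow> (\<exists>w :: real \<times> real \<Rightarrow> real.
     (\<forall>x y. w (x + 2*pi, y) = w (x, y) \<and> w (x, y + 2*pi) = w (x, y)) \<and>
     (\<forall>t x. v t x = w (\<omega>\<^sub>1 * t, \<omega>\<^sub>2 * t + x)))"

end

theory Submission
  imports Defs
begin

text \<open>
  Put \<open>\<delta> = |\<epsilon>|\<^bsup>1/(2(d-1))\<^esup>\<close> and \<open>u = \<delta> w\<close>. On Fourier coefficients the equation reads
  \<open>D\<^sub>l w\<^sub>l = |\<epsilon>| N(w)\<^sub>l\<close> with \<open>D\<^sub>l = (\<omega>\<^sub>1 l\<^sub>1 + \<epsilon> l\<^sub>2)(\<omega>\<^sub>1 l\<^sub>1 + (2+\<epsilon>) l\<^sub>2)\<close>. For \<open>l\<^sub>1 \<noteq> 0\<close> one factor is at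
  least \<open>3/8 (|l\<^sub>1|+|l\<^sub>2|)\<close>, so the Diophantine condition gives \<open>|D\<^sub>l| \<ge> 3/8 \<gamma>\<close> and these modes are of order
  \<open>|\<epsilon>|/\<gamma>\<close>. The modes with \<open>l\<^sub>1 = 0\<close> solve a perturbation of \<open>q'' + c q\<^bsup>2d-1\<^esup> = 0\<close>. The linearisation of
  this oscillator at an odd periodic solution has the kernel \<open>q'\<close>; it is inverted up to a multiple
  \<open>\<nu> cos\<close>, which makes the whole problem a contraction in the algebra of absolutely convergent Fourier
  series. Afterwards \<open>\<nu> = 0\<close>: the equation is variational and invariant under translations in \<open>\<phi>\<^sub>2\<close>, so
  pairing it with \<open>\<partial>\<^sub>2 w\<close> leaves only \<open>\<nu>\<close> times a coefficient of \<open>w\<close> that does not vanish.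

  The weighted regularity needs \<open>\<Sum>\<^sub>k \<rho>\<^sup>k |a\<^sub>k| < \<infinity>\<close> in a norm with \<open>[l\<^sub>1]\<^bsup>s\<^esup>\<close>, \<open>s\<close> below the one for which
  \<open>f(\<cdot>,u)\<close> is only known to be finite for each single \<open>u\<close>; this is extracted by interpolation in \<open>u\<close>.
\<close>

text \<open>The exponent in \<delta> is the balance on the modes with \<open>l1 = 0\<close>: there D
  is \<open>\<epsilon> (2+\<epsilon>) l2^2\<close> and
  \<open>\<delta>^(2d-2) = |\<epsilon>|\<close>, so a factor |\<epsilon>| cancels and an equation of
  order one is left. The sign condition on \<epsilon> makes its force restoring. The limit equation
  is autonomous, so solutions come in circles of translates and the linearisation cannot be
  invertible. The kernel has no second dimension: the scaling
  \<open>\<lambda>^\<alpha> q(\<lambda> t)\<close> changes the period, so the other solution of the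
  linearised equation is not periodic. The cosine is a usable multiplier because the integral of
  \<open>q' cos\<close> equals that of \<open>q sin\<close>, which is positive. The inverse of the
  linearised operator is controlled only in the unweighted norm. Exponential decay in
  \<open>l2\<close> and the weight in \<open>l1\<close> are therefore obtained after the fixed
  point, and only this decay makes the derivative of w in the second variable, hence the pairing
  that removes \<nu>, available. All smallness conditions are uniform over the Cantor set:
  frequencies enter only through the lower bound on |D|, its values at \<open>l1 = 0\<close> and its
  evenness.\<close>

no_notation Infinite_Set_Sum.abs_summable_on (infix "abs'_summable'_on" 50)

section \<open>The algebra of absolutely summable sequences on an abelian group\<close>

text \<open>A type of its own, rather than a predicate on sequences, lets the class instances for
  Banach spaces and commutative normed algebras supply powers, power series and the contraction
  principle. Over \<open>int\<close> it models functions on the circle, over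
  \<open>int \<times> int\<close> functions on the torus.\<close>

typedef 'a l1 = "{w :: 'a \<Rightarrow> complex. w abs_summable_on UNIV}"
  morphisms coef Abs_l1
  by (rule exI[of _ "\<lambda>_. 0"]) simp

lemma coef_abs_summable: "coef w abs_summable_on UNIV"
  using coef[of w] by simp

lemma coef_Abs_l1: "w abs_summable_on UNIV \<Longrightarrow> coef (Abs_l1 w) = w"
  by (simp add: Abs_l1_inverse)

lemma l1_eqI: "(\<And>l. coef v l = coef w l) \<Longrightarrow> v = w"
  by (metis coef_inject ext)

lemma abs_summable_add:
  fixes v w :: "'a \<Rightarrow> complex"
  assumes "v abs_summable_on A" "w abs_summable_on A"
  shows "(\<lambda>l. v l + w l) abs_summable_on A"
  by (rule Infinite_Sum.abs_summable_on_comparison_test'[OF summable_on_add[OF assms]]) (rule norm_triangle_ineq)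

instantiation l1 :: (type) real_normed_vector
begin

definition "0 = Abs_l1 (\<lambda>_. 0)"
definition "v + w = Abs_l1 (\<lambda>l. coef v l + coef w l)"
definition "v - w = Abs_l1 (\<lambda>l. coef v l - coef w l)"
definition "- w = Abs_l1 (\<lambda>l. - coef w l)"
definition "c *\<^sub>R w = Abs_l1 (\<lambda>l. c *\<^sub>R coef w l)"
definition "norm w = (\<Sum>\<^sub>\<infinity>l. norm (coef w l))"
definition "dist v w = norm (v - w :: 'a l1)"
definition "sgn w = scaleR (inverse (norm w)) (w :: 'a l1)"
definition [code del]: "(uniformity :: ('a l1 \<times> 'a l1) filter) = (INF e\<in>{0<..}. principal {(x, y). dist x y < e})"
definition [code del]: "open (U :: 'a l1 set) \<longleftrightarrow> (\<forall>x\<in>U. eventually (\<lambda>(x', y). x' = x \<longrightarrow> y \<in> U) uniformity)"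

lemma coef_zero: "coef 0 = (\<lambda>_. 0 :: complex)"
  by (simp add: zero_l1_def coef_Abs_l1)

lemma coef_plus: "coef (v + w) = (\<lambda>l. coef v l + coef w l)"
  by (simp add: plus_l1_def coef_Abs_l1 abs_summable_add coef_abs_summable)

lemma coef_uminus: "coef (- w) = (\<lambda>l. - coef w l)"
  by (simp add: uminus_l1_def coef_Abs_l1 coef_abs_summable)

lemma coef_minus: "coef (v - w) = (\<lambda>l. coef v l - coef w l)"
  using abs_summable_add[OF coef_abs_summable[of v] coef_abs_summable[of "- w"]]
  by (simp add: minus_l1_def coef_Abs_l1 coef_uminus)

lemma coef_scaleR: "coef (c *\<^sub>R w) = (\<lambda>l. c *\<^sub>R coef w l)"
  by (simp add: scaleR_l1_def coef_Abs_l1 summable_on_cmult_right coef_abs_summable)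

instance
proof
  fix u v w :: "'a l1" and b c :: real
  show "u + v + w = u + (v + w)" "u + v = v + u" "0 + u = u" "- u + u = 0" "u - v = u + - v"
    "c *\<^sub>R (u + v) = c *\<^sub>R u + c *\<^sub>R v" "(b + c) *\<^sub>R u = b *\<^sub>R u + c *\<^sub>R u"
    "b *\<^sub>R c *\<^sub>R u = (b * c) *\<^sub>R u" "1 *\<^sub>R u = u"
    by (rule l1_eqI; simp add: coef_zero coef_plus coef_uminus coef_minus coef_scaleR algebra_simps)+
  show "dist u v = norm (u - v)" "sgn u = scaleR (inverse (norm u)) u"
    by (simp_all add: dist_l1_def sgn_l1_def)
  show "norm u = 0 \<longleftrightarrow> u = 0"
  proof
    assume "norm u = 0"
    then have "norm (coef u l) = 0" for l
      using nonneg_infsum_le_0D[of "\<lambda>l. norm (coef u l)" UNIV l] coef_abs_summable[of u]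
      by (simp add: norm_l1_def)
    then show "u = 0" by (intro l1_eqI) (simp add: coef_zero)
  qed (simp add: norm_l1_def coef_zero)
  show "norm (u + v) \<le> norm u + norm v"
    unfolding norm_l1_def coef_plus infsum_add[OF coef_abs_summable coef_abs_summable, symmetric]
    by (intro infsum_mono abs_summable_add summable_on_add coef_abs_summable norm_triangle_ineq)
  show "norm (c *\<^sub>R u) = \<bar>c\<bar> * norm u"
    by (simp add: norm_l1_def coef_scaleR infsum_cmult_right')
qed (simp_all add: uniformity_l1_def open_l1_def)

end

lemmas coef_simps = coef_zero coef_plus coef_uminus coef_minus coef_scaleR

lemma has_sum_norm_l1: "((\<lambda>l. norm (coef w l)) has_sum norm w) UNIV"
  unfolding norm_l1_def by (rule has_sum_infsum[OF coef_abs_summable])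

lemma sum_coef_le_norm: "finite F \<Longrightarrow> (\<Sum>l\<in>F. norm (coef w l)) \<le> norm w"
  by (rule finite_sum_le_has_sum[OF has_sum_norm_l1]) auto

lemma norm_coef_le: "norm (coef w l) \<le> norm w"
  using sum_coef_le_norm[of "{l}" w] by simp

lemma norm_l1_le: 
  assumes "\<And>F. finite F \<Longrightarrow> (\<Sum>l\<in>F. norm (coef w l)) \<le> B"
  shows "norm w \<le> B"
  by (rule has_sum_le_finite_sums[OF has_sum_norm_l1]) (use assms in auto)

lemma abs_summable_bdd:
  fixes x :: "'a \<Rightarrow> 'b::real_normed_vector"
  assumes "\<And>F. finite F \<Longrightarrow> (\<Sum>l\<in>F. norm (x l)) \<le> B"
  shows "x abs_summable_on A"
  by (rule abs_summable_iff_bdd_above[THEN iffD2], rule bdd_aboveI[of _ B]) (use assms in auto)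

lemma bounded_linear_coef: "bounded_linear (\<lambda>w. coef w l)"
  by (rule bounded_linear_intro[of _ 1]) (simp_all add: coef_simps norm_coef_le)

lemma tendsto_coef: "(f \<longlongrightarrow> w) F \<Longrightarrow> ((\<lambda>x. coef (f x) l) \<longlongrightarrow> coef w l) F"
  by (rule bounded_linear.tendsto[OF bounded_linear_coef])

instance l1 :: (type) banach
proof
  fix X :: "nat \<Rightarrow> 'a l1"
  assume X: "Cauchy X"
  have "Cauchy (\<lambda>n. coef (X n) l)" for l
    by (rule bounded_linear.Cauchy[OF bounded_linear_coef X])
  then have "\<exists>y. (\<lambda>n. coef (X n) l) \<longlonglongrightarrow> y" for l
    by (simp add: Cauchy_convergent_iff convergent_def)
  then obtain x where x: "\<And>l. (\<lambda>n. coef (X n) l) \<longlonglongrightarrow> x l" by metis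
  \<comment> \<open>Fatou on finite sets: the estimate for \<open>X n - X m\<close> passes to the
    coefficientwise limit on every finite set of indices, and finite sums determine the
    norm.\<close>
  have bound: "(\<Sum>l\<in>F. norm (coef (X n) l - x l)) \<le> e"
    if "finite F" and n: "\<forall>m\<ge>N. norm (X n - X m) \<le> e" for F n e N
  proof (rule LIMSEQ_le_const2)
    show "(\<lambda>m. \<Sum>l\<in>F. norm (coef (X n) l - coef (X m) l)) \<longlonglongrightarrow> (\<Sum>l\<in>F. norm (coef (X n) l - x l))"
      by (intro tendsto_intros x)
    have "(\<Sum>l\<in>F. norm (coef (X n) l - coef (X m) l)) \<le> e" if "m \<ge> N" for m
      using sum_coef_le_norm[OF \<open>finite F\<close>, of "X n - X m"] n that by (force simp: coef_minus)
    then show "\<exists>N. \<forall>m\<ge>N. (\<Sum>l\<in>F. norm (coef (X n) l - coef (X m) l)) \<le> e" by blast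
  qed
  have small: "\<exists>N. \<forall>n\<ge>N. \<forall>m\<ge>N. norm (X n - X m) \<le> e" if e: "e > 0" for e :: real
  proof -
    obtain N where "\<forall>m\<ge>N. \<forall>n\<ge>N. dist (X m) (X n) < e" using metric_CauchyD[OF X e] by blast
    then show ?thesis by (intro exI[of _ N]) (auto simp: dist_norm intro: less_imp_le)
  qed
  obtain N1 where N1: "\<forall>n\<ge>N1. \<forall>m\<ge>N1. norm (X n - X m) \<le> 1" using small[of 1] by auto
  have "(\<lambda>l. coef (X N1) l - x l) abs_summable_on UNIV"
    by (rule abs_summable_bdd[of _ 1], rule bound, use N1 in auto)
  from abs_summable_add[OF coef_abs_summable[of "- X N1"] this]
  have "x abs_summable_on UNIV" by (simp add: coef_simps)
  then have cx: "coef (Abs_l1 x) = x" by (rule coef_Abs_l1)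
  have "X \<longlonglongrightarrow> Abs_l1 x"
  proof (rule LIMSEQ_I)
    fix e :: real assume "0 < e"
    then obtain N where N: "\<forall>n\<ge>N. \<forall>m\<ge>N. norm (X n - X m) \<le> e / 2" using small[of "e/2"] by auto
    have "norm (X n - Abs_l1 x) \<le> e / 2" if "n \<ge> N" for n
      by (rule norm_l1_le) (unfold coef_minus cx, rule bound, use N that in auto)
    then show "\<exists>N. \<forall>n\<ge>N. norm (X n - Abs_l1 x) < e" using \<open>0 < e\<close> by fastforce
  qed
  then show "convergent X" by (auto simp: convergent_def)
qed

definition mono_l1 :: "'a \<Rightarrow> complex \<Rightarrow> 'a l1" where
  "mono_l1 l c = Abs_l1 (\<lambda>m. if m = l then c else 0)"

lemma coef_mono: "coef (mono_l1 l c) = (\<lambda>m. if m = l then c else 0)"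
proof -
  have "(\<lambda>m. if m = l then c else 0) abs_summable_on UNIV"
    by (rule finite_nonzero_values_imp_summable_on) (auto intro: finite_subset[of _ "{l}"])
  then show ?thesis by (simp add: mono_l1_def coef_Abs_l1)
qed

lemma norm_mono: "norm (mono_l1 l c) = norm c"
proof -
  have "((\<lambda>m. norm (coef (mono_l1 l c) m)) has_sum norm c) UNIV"
    by (rule has_sum_finite_neutralI[of "{l}"]) (auto simp: coef_mono)
  then show ?thesis using has_sum_norm_l1 has_sum_unique by blast
qed

lemma has_sum_mono_l1: "((\<lambda>l. mono_l1 l (coef w l)) has_sum w) UNIV"
proof -
  have "(\<lambda>l. mono_l1 l (coef w l)) summable_on UNIV"
    by (rule abs_summable_summable) (simp add: norm_mono coef_abs_summable)
  then obtain z where z: "((\<lambda>l. mono_l1 l (coef w l)) has_sum z) UNIV"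
    by (auto simp: summable_on_def)
  have "z = w"
  proof (rule l1_eqI)
    fix m
    have "((\<lambda>l. coef (mono_l1 l (coef w l)) m) has_sum coef z m) UNIV"
      by (rule has_sum_bounded_linear[OF bounded_linear_coef z])
    moreover have "((\<lambda>l. coef (mono_l1 l (coef w l)) m) has_sum coef w m) UNIV"
      by (rule has_sum_finite_neutralI[of "{m}"]) (auto simp: coef_mono)
    ultimately show "coef z m = coef w m" using has_sum_unique by blast
  qed
  with z show ?thesis by simp
qed

lemma bounded_linear_has_sum_mono:
  assumes "bounded_linear F"
  shows "((\<lambda>l. F (mono_l1 l (coef w l))) has_sum F w) UNIV"
  by (rule has_sum_bounded_linear[OF assms has_sum_mono_l1])

text \<open>Reduces an identity between bounded linear maps to single modes. The ring laws,
  multiplicativity of evaluation and the Fourier coefficients of a series are all obtained this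
  way.\<close>

lemma bounded_linear_eq_mono:
  assumes "bounded_linear F" "bounded_linear G" "\<And>l c. F (mono_l1 l c) = G (mono_l1 l c)"
  shows "F w = G w"
  using bounded_linear_has_sum_mono[OF assms(1), of w] bounded_linear_has_sum_mono[OF assms(2), of w]
  by (simp add: assms(3)) (metis has_sum_unique)

section \<open>Convolution product and ring structure\<close>

definition conv :: "'a::ab_group_add l1 \<Rightarrow> 'a l1 \<Rightarrow> 'a l1" where
  "conv v w = Abs_l1 (\<lambda>l. \<Sum>\<^sub>\<infinity>m. coef v m * coef w (l - m))"

lemma has_sum_norm_l1_shift: "((\<lambda>l. norm (coef w (l - m))) has_sum norm w) UNIV"
  for w :: "'a::ab_group_add l1"
proof -
  have "bij (\<lambda>l. l - m)" by (rule bij_betwI[of _ _ _ "\<lambda>l. l + m"]) auto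
  from has_sum_reindex_bij_betw[OF this, of "\<lambda>l. norm (coef w l)"] show ?thesis
    using has_sum_norm_l1[of w] by simp
qed

text \<open>Tonelli: for fixed \<open>m\<close> the inner sum is a translate of the series for
  \<open>norm w\<close>. Swapping the order afterwards gives absolute convergence of every
  convolution coefficient.\<close>

lemma conv_has_sum_aux:
  fixes v w :: "'a::ab_group_add l1"
  shows "((\<lambda>(m, l). norm (coef v m) * norm (coef w (l - m))) has_sum norm v * norm w) (UNIV \<times> UNIV)"
proof -
  have 1: "((\<lambda>l. case (m, l) of (m, l) \<Rightarrow> norm (coef v m) * norm (coef w (l - m))) has_sum
        norm (coef v m) * norm w) UNIV" for m
    by (simp add: has_sum_cmult_right has_sum_norm_l1_shift)
  have 2: "((\<lambda>m. norm (coef v m) * norm w) has_sum norm v * norm w) UNIV"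
    by (rule has_sum_cmult_left[OF has_sum_norm_l1])
  show ?thesis
    by (rule has_sum_SigmaI[OF 1 2], rule summable_on_SigmaI[OF 1 has_sum_imp_summable[OF 2]]) auto
qed

lemma conv_has_sum_aux':
  fixes v w :: "'a::ab_group_add l1"
  shows "((\<lambda>(l, m). norm (coef v m) * norm (coef w (l - m))) has_sum norm v * norm w) (UNIV \<times> UNIV)"
  using conv_has_sum_aux[of v w, THEN has_sum_swap[THEN iffD1]]
  by (simp add: case_prod_unfold)

lemma conv_summable:
  fixes v w :: "'a::ab_group_add l1"
  shows "(\<lambda>m. coef v m * coef w (l - m)) abs_summable_on UNIV"
  using summable_on_SigmaD1[OF has_sum_imp_summable[OF conv_has_sum_aux'[of v w]], of l]
  by (simp add: norm_mult)

lemma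
  fixes v w :: "'a::ab_group_add l1"
  shows conv_norm_summable: "(\<lambda>l. \<Sum>\<^sub>\<infinity>m. norm (coef v m * coef w (l - m))) summable_on UNIV"
    and conv_norm_infsum: "(\<Sum>\<^sub>\<infinity>l. \<Sum>\<^sub>\<infinity>m. norm (coef v m * coef w (l - m))) = norm v * norm w"
proof -
  have "((\<lambda>l. \<Sum>\<^sub>\<infinity>m. norm (coef v m * coef w (l - m))) has_sum norm v * norm w) UNIV"
    by (rule has_sum_SigmaD[OF conv_has_sum_aux'[of v w]])
       (use conv_summable[of v w] in \<open>simp add: norm_mult has_sum_infsum\<close>)
  then show "(\<lambda>l. \<Sum>\<^sub>\<infinity>m. norm (coef v m * coef w (l - m))) summable_on UNIV"
    "(\<Sum>\<^sub>\<infinity>l. \<Sum>\<^sub>\<infinity>m. norm (coef v m * coef w (l - m))) = norm v * norm w"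
    by (simp_all add: has_sum_iff)
qed

lemma coef_conv: "coef (conv v w) = (\<lambda>l. \<Sum>\<^sub>\<infinity>m. coef v m * coef w (l - m))"
  unfolding conv_def
  by (rule coef_Abs_l1, rule Infinite_Sum.abs_summable_on_comparison_test'[OF conv_norm_summable[of v w]])
     (rule norm_infsum_bound[OF conv_summable])

lemma norm_conv: "norm (conv v w) \<le> norm v * norm w"
proof -
  have "norm (conv v w) \<le> (\<Sum>\<^sub>\<infinity>l. \<Sum>\<^sub>\<infinity>m. norm (coef v m * coef w (l - m)))"
    unfolding norm_l1_def
    by (rule infsum_mono[OF coef_abs_summable conv_norm_summable])
       (simp only: coef_conv, rule norm_infsum_bound[OF conv_summable])
  then show ?thesis by (simp add: conv_norm_infsum)
qed

lemma bounded_bilinear_conv: "bounded_bilinear conv"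
proof
  note S = abs_summable_summable[OF conv_summable]
  fix u v w :: "'a l1" and c :: real
  show "conv (u + v) w = conv u w + conv v w"
    by (rule l1_eqI) (simp add: coef_conv coef_simps distrib_right infsum_add[OF S S])
  show "conv u (v + w) = conv u v + conv u w"
    by (rule l1_eqI) (simp add: coef_conv coef_simps distrib_left infsum_add[OF S S])
  show "conv (c *\<^sub>R u) v = c *\<^sub>R conv u v" "conv u (c *\<^sub>R v) = c *\<^sub>R conv u v"
    by (rule l1_eqI, simp add: coef_conv coef_simps infsum_scaleR_right)+
qed (auto intro!: exI[of _ 1] norm_conv)

lemma conv_mono: "conv (mono_l1 a x) (mono_l1 b y) = mono_l1 (a + b) (x * y)"
proof (rule l1_eqI)
  fix l
  have "((\<lambda>m. coef (mono_l1 a x) m * coef (mono_l1 b y) (l - m)) has_sum coef (mono_l1 (a + b) (x * y)) l) UNIV"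
    by (rule has_sum_finite_neutralI[of "{a}"]) (auto simp: coef_mono algebra_simps)
  then show "coef (conv (mono_l1 a x) (mono_l1 b y)) l = coef (mono_l1 (a + b) (x * y)) l"
    by (simp add: coef_conv infsumI)
qed

lemmas bounded_linear_conv_left = bounded_bilinear.bounded_linear_left[OF bounded_bilinear_conv]
lemmas bounded_linear_conv_right = bounded_bilinear.bounded_linear_right[OF bounded_bilinear_conv]

lemma conv_commute: "conv v w = conv w v"
proof -
  have 1: "conv (mono_l1 a x) w = conv w (mono_l1 a x)" for a x w
    by (rule bounded_linear_eq_mono[of "conv (mono_l1 a x)" "\<lambda>w. conv w (mono_l1 a x)"])
       (auto simp: conv_mono add_ac mult_ac bounded_linear_conv_left bounded_linear_conv_right)
  show ?thesis
    by (rule bounded_linear_eq_mono[of "\<lambda>v. conv v w" "\<lambda>v. conv w v"])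
       (auto simp: 1 bounded_linear_conv_left bounded_linear_conv_right)
qed

lemma conv_assoc: "conv (conv u v) w = conv u (conv v w)"
proof -
  note BL = bounded_linear_compose[OF bounded_linear_conv_left bounded_linear_conv_left]
    bounded_linear_compose[OF bounded_linear_conv_left bounded_linear_conv_right]
    bounded_linear_compose[OF bounded_linear_conv_right bounded_linear_conv_left]
    bounded_linear_compose[OF bounded_linear_conv_right bounded_linear_conv_right]
    bounded_linear_conv_left bounded_linear_conv_right
  have 1: "conv (conv (mono_l1 a x) (mono_l1 b y)) w = conv (mono_l1 a x) (conv (mono_l1 b y) w)" for a x b y w
    by (rule bounded_linear_eq_mono[of "conv (conv (mono_l1 a x) (mono_l1 b y))" "\<lambda>w. conv (mono_l1 a x) (conv (mono_l1 b y) w)"])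
       (auto intro: BL simp: conv_mono add_ac mult_ac)
  have 2: "conv (conv (mono_l1 a x) v) w = conv (mono_l1 a x) (conv v w)" for a x v w
    by (rule bounded_linear_eq_mono[of "\<lambda>v. conv (conv (mono_l1 a x) v) w" "\<lambda>v. conv (mono_l1 a x) (conv v w)"])
       (auto intro: BL simp: 1)
  show ?thesis
    by (rule bounded_linear_eq_mono[of "\<lambda>u. conv (conv u v) w" "\<lambda>u. conv u (conv v w)"])
       (auto intro: BL simp: 2)
qed

instantiation l1 :: (ab_group_add) comm_ring_1
begin

definition "1 = mono_l1 0 1"
definition "v * w = conv v w"

instance
proof
  fix u v w :: "'a l1"
  show "u * v * w = u * (v * w)" by (simp add: times_l1_def conv_assoc)
  show "u * v = v * u" by (simp only: times_l1_def conv_commute)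
  show "(u + v) * w = u * w + v * w"
    by (simp add: times_l1_def bounded_bilinear.add_left[OF bounded_bilinear_conv])
  show "1 * u = u"
    unfolding times_l1_def one_l1_def
    by (rule bounded_linear_eq_mono[of "conv (mono_l1 0 1)" "\<lambda>u. u"])
       (auto simp: conv_mono bounded_linear_conv_right bounded_linear_ident)
  have "norm (1 :: 'a l1) = 1" by (simp add: one_l1_def norm_mono)
  then show "0 \<noteq> (1 :: 'a l1)" by (metis norm_zero zero_neq_one)
qed

end

instance l1 :: (ab_group_add) real_normed_algebra_1
proof
  fix u v w :: "'a l1" and c :: real
  show "c *\<^sub>R u * v = c *\<^sub>R (u * v)" "u * c *\<^sub>R v = c *\<^sub>R (u * v)"
    by (simp_all add: times_l1_def bounded_bilinear.scaleR_left[OF bounded_bilinear_conv]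
        bounded_bilinear.scaleR_right[OF bounded_bilinear_conv])
  show "norm (u * v) \<le> norm u * norm v" by (simp add: times_l1_def norm_conv)
  show "norm (1 :: 'a l1) = 1" by (simp add: one_l1_def norm_mono)
qed

lemma mono_mult: "mono_l1 a x * mono_l1 b y = mono_l1 (a + b) (x * y)"
  by (simp add: times_l1_def conv_mono)

lemma coef_mult: "coef (v * w) l = (\<Sum>\<^sub>\<infinity>m. coef v m * coef w (l - m))"
  by (simp add: times_l1_def coef_conv)

lemma coef_mult_has_sum: "((\<lambda>m. coef v m * coef w (l - m)) has_sum coef (v * w) l) UNIV"
  unfolding coef_mult by (rule has_sum_infsum[OF abs_summable_summable[OF conv_summable]])

subsection \<open>Evaluation at characters and Fourier coefficients\<close>

text \<open>For a character \<psi> this is the value of the Fourier series at a point (the Gelfand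
  transform). Leaving \<psi> arbitrary lets the same lemmas serve the circle, the torus and the
  plane wrapped around the torus by the wave variables.\<close>

definition evl1 :: "('a \<Rightarrow> complex) \<Rightarrow> 'a l1 \<Rightarrow> complex" where
  "evl1 \<psi> w = (\<Sum>\<^sub>\<infinity>l. coef w l * \<psi> l)"

lemma evl1_abs_summable:
  assumes "\<And>l. norm (\<psi> l) \<le> 1"
  shows "(\<lambda>l. coef w l * \<psi> l) abs_summable_on UNIV"
  by (rule Infinite_Sum.abs_summable_on_comparison_test'[OF coef_abs_summable[of w]])
     (simp add: norm_mult mult_left_le assms)

lemma evl1_has_sum:
  assumes "\<And>l. norm (\<psi> l) \<le> 1"
  shows "((\<lambda>l. coef w l * \<psi> l) has_sum evl1 \<psi> w) UNIV"
  unfolding evl1_def by (rule has_sum_infsum[OF abs_summable_summable[OF evl1_abs_summable[OF assms]]])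

lemma norm_evl1_le:
  assumes "\<And>l. norm (\<psi> l) \<le> 1"
  shows "norm (evl1 \<psi> w) \<le> norm w"
proof -
  have "norm (evl1 \<psi> w) \<le> (\<Sum>\<^sub>\<infinity>l. norm (coef w l * \<psi> l))"
    unfolding evl1_def by (rule norm_infsum_bound[OF evl1_abs_summable[OF assms]])
  also have "\<dots> \<le> norm w"
    unfolding norm_l1_def
    by (rule infsum_mono[OF evl1_abs_summable[OF assms] coef_abs_summable])
       (simp add: norm_mult mult_left_le assms)
  finally show ?thesis .
qed

lemma bounded_linear_evl1:
  assumes "\<And>l. norm (\<psi> l) \<le> 1"
  shows "bounded_linear (evl1 \<psi>)"
proof (rule bounded_linear_intro[of _ 1])
  fix v w :: "'a l1" and c :: real
  have S: "(\<lambda>l. coef w l * \<psi> l) summable_on UNIV" for w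
    by (rule abs_summable_summable[OF evl1_abs_summable[OF assms]])
  show "evl1 \<psi> (v + w) = evl1 \<psi> v + evl1 \<psi> w"
    by (simp add: evl1_def coef_simps distrib_right infsum_add[OF S S])
  show "evl1 \<psi> (c *\<^sub>R v) = c *\<^sub>R evl1 \<psi> v"
    by (simp add: evl1_def coef_simps infsum_scaleR_right)
qed (simp add: norm_evl1_le assms)

lemma evl1_mono: "evl1 \<psi> (mono_l1 l c) = c * \<psi> l"
proof -
  have "((\<lambda>m. coef (mono_l1 l c) m * \<psi> m) has_sum c * \<psi> l) UNIV"
    by (rule has_sum_finite_neutralI[of "{l}"]) (auto simp: coef_mono)
  then show ?thesis by (simp add: evl1_def infsumI)
qed

locale char =
  fixes \<psi> :: "'a::ab_group_add \<Rightarrow> complex"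
  assumes char_add: "\<psi> (l + m) = \<psi> l * \<psi> m"
    and norm_char: "norm (\<psi> l) = 1"
begin

lemma char_le: "norm (\<psi> l) \<le> 1"
  by (simp add: norm_char)

lemma evl1_mult: "evl1 \<psi> (v * w) = evl1 \<psi> v * evl1 \<psi> w"
proof -
  note BL = bounded_linear_evl1[OF char_le]
  have 1: "evl1 \<psi> (mono_l1 a x * w) = evl1 \<psi> (mono_l1 a x) * evl1 \<psi> w" for a x w
    by (rule bounded_linear_eq_mono[of "\<lambda>w. evl1 \<psi> (mono_l1 a x * w)" "\<lambda>w. evl1 \<psi> (mono_l1 a x) * evl1 \<psi> w"])
       (auto simp: mono_mult evl1_mono char_add
         intro: bounded_linear_compose[OF BL bounded_linear_mult_right] bounded_linear_compose[OF bounded_linear_mult_right BL])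
  show ?thesis
    by (rule bounded_linear_eq_mono[of "\<lambda>v. evl1 \<psi> (v * w)" "\<lambda>v. evl1 \<psi> v * evl1 \<psi> w"])
       (auto simp: 1
         intro: bounded_linear_compose[OF BL bounded_linear_mult_left] bounded_linear_compose[OF bounded_linear_mult_left BL])
qed

lemma char_0: "\<psi> 0 = 1"
  using char_add[of 0 0] norm_char[of 0] by auto

lemma evl1_one: "evl1 \<psi> 1 = 1"
  by (simp add: one_l1_def evl1_mono char_0)

lemma evl1_power: "evl1 \<psi> (w ^ n) = evl1 \<psi> w ^ n"
  by (induction n) (simp_all add: evl1_one evl1_mult)

end

lemma continuous_on_evl1:
  assumes "\<And>l. continuous_on S (\<lambda>x. \<psi> x l)" "\<And>x l. norm (\<psi> x l) \<le> 1"
  shows "continuous_on S (\<lambda>x. evl1 (\<psi> x) w)"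
proof (rule uniform_limit_theorem[OF _ _ finite_subsets_at_top_neq_bot])
  show "uniform_limit S (\<lambda>F x. \<Sum>l\<in>F. coef w l * \<psi> x l) (\<lambda>x. evl1 (\<psi> x) w) (finite_subsets_at_top UNIV)"
    by (rule Weierstrass_m_test_general'[of _ _ _ "\<lambda>l. norm (coef w l)"])
       (use assms(2) in \<open>auto simp: norm_mult coef_abs_summable mult_left_le intro: evl1_has_sum\<close>)
  show "\<forall>\<^sub>F F in finite_subsets_at_top UNIV. continuous_on S (\<lambda>x. \<Sum>l\<in>F. coef w l * \<psi> x l)"
    by (intro always_eventually allI continuous_intros assms)
qed

text \<open>Integration against a continuous factor is continuous in the coefficients and may
  therefore be done mode by mode. It serves both for Fourier coefficients and for testing against
  smooth functions.\<close>

lemma bounded_linear_integral_evl1: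
  fixes \<psi> :: "'b::euclidean_space \<Rightarrow> 'a \<Rightarrow> complex"
  assumes \<psi>: "\<And>l. continuous_on (cbox a b) (\<lambda>x. \<psi> x l)" "\<And>x l. norm (\<psi> x l) \<le> 1"
    and \<Phi>: "continuous_on (cbox a b) \<Phi>"
  shows "bounded_linear (\<lambda>w. integral (cbox a b) (\<lambda>x. evl1 (\<psi> x) w * \<Phi> x))"
proof -
  obtain B where B: "\<And>x. x \<in> cbox a b \<Longrightarrow> norm (\<Phi> x) \<le> B" "0 \<le> B"
  proof -
    have "bounded (\<Phi> ` cbox a b)" by (intro compact_imp_bounded compact_continuous_image \<Phi> compact_cbox)
    then obtain B where "\<forall>x\<in>cbox a b. norm (\<Phi> x) \<le> B" by (auto simp: bounded_iff)
    then show ?thesis using that[of "max B 0"] by (auto simp: le_max_iff_disj)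
  qed
  have I: "(\<lambda>x. evl1 (\<psi> x) w * \<Phi> x) integrable_on cbox a b" for w
    by (intro integrable_continuous continuous_intros continuous_on_evl1 assms)
  note lin = bounded_linear.linear[OF bounded_linear_evl1[OF \<psi>(2)]]
  show ?thesis
  proof (rule bounded_linear_intro[of _ "B * measure lborel (cbox a b)"])
    fix v w :: "'a l1" and c :: real
    show "integral (cbox a b) (\<lambda>x. evl1 (\<psi> x) (v + w) * \<Phi> x) =
        integral (cbox a b) (\<lambda>x. evl1 (\<psi> x) v * \<Phi> x) + integral (cbox a b) (\<lambda>x. evl1 (\<psi> x) w * \<Phi> x)"
      by (simp add: linear_add[OF lin] distrib_right integral_add[OF I I])
    show "integral (cbox a b) (\<lambda>x. evl1 (\<psi> x) (c *\<^sub>R v) * \<Phi> x) =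
        c *\<^sub>R integral (cbox a b) (\<lambda>x. evl1 (\<psi> x) v * \<Phi> x)"
      by (simp add: linear_scale[OF lin] flip: integral_cmul)
    have "norm (integral (cbox a b) (\<lambda>x. evl1 (\<psi> x) v * \<Phi> x)) \<le> (norm v * B) * measure lborel (cbox a b)"
      by (rule has_integral_bound[OF _ integrable_integral[OF I]])
         (use B norm_evl1_le[OF \<psi>(2)] in \<open>auto simp: norm_mult intro!: mult_mono\<close>)
    then show "norm (integral (cbox a b) (\<lambda>x. evl1 (\<psi> x) v * \<Phi> x)) \<le> norm v * (B * measure lborel (cbox a b))"
      by (simp add: mult.assoc)
  qed
qed

definition e1 :: "real \<Rightarrow> int \<Rightarrow> complex" where
  "e1 x l = cis (of_int l * x)"

definition e2 :: "real \<times> real \<Rightarrow> int \<times> int \<Rightarrow> complex" where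
  "e2 x l = cis (of_int (fst l) * fst x + of_int (snd l) * snd x)"

interpretation e1: char "e1 x" for x
  by unfold_locales (simp_all add: e1_def cis_mult algebra_simps)

interpretation e2: char "e2 x" for x
  by unfold_locales (simp_all add: e2_def cis_mult algebra_simps)

lemma continuous_e1: "continuous_on S (\<lambda>x. e1 x l)"
  unfolding e1_def by (intro continuous_intros)

lemma continuous_e2: "continuous_on S (\<lambda>x. e2 x l)"
  unfolding e2_def by (intro continuous_intros)

abbreviation ev1 :: "int l1 \<Rightarrow> real \<Rightarrow> complex" where "ev1 w x \<equiv> evl1 (e1 x) w"
abbreviation ev2 :: "(int \<times> int) l1 \<Rightarrow> real \<times> real \<Rightarrow> complex" where "ev2 w x \<equiv> evl1 (e2 x) w"

lemma continuous_ev1: "continuous_on S (ev1 w)"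
  by (rule continuous_on_evl1[OF continuous_e1 e1.char_le])

lemma continuous_ev2: "continuous_on S (ev2 w)"
  by (rule continuous_on_evl1[OF continuous_e2 e2.char_le])

lemma cis_vector_derivative:
  "((\<lambda>x. cis (a * x + b)) has_vector_derivative (\<i> * of_real a * cis (a * x + b))) (at x within S)"
  unfolding has_vector_derivative_def
  by (auto intro!: derivative_eq_intros simp: scaleR_conv_of_real algebra_simps)

lemma integral_cis:
  fixes k :: int
  shows "integral {0..2*pi} (\<lambda>x. cis (of_int k * x + b)) = (if k = 0 then of_real (2*pi) * cis b else 0)"
proof (cases "k = 0")
  case False
  have "((\<lambda>x. \<i> * of_real (of_int k) * cis (of_int k * x + b)) has_integral
      cis (of_int k * (2*pi) + b) - cis (of_int k * 0 + b)) {0..2*pi}"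
    by (rule fundamental_theorem_of_calculus) (use cis_vector_derivative[of "of_int k" b] in auto)
  moreover have "cis (of_int k * (2*pi) + b) = cis b"
    using cis_multiple_2pi[of "of_int k"] by (simp add: cis_mult[symmetric] mult_ac)
  ultimately have "((\<lambda>x. \<i> * of_real (of_int k) * cis (of_int k * x + b)) has_integral 0) {0..2*pi}"
    by simp
  from has_integral_mult_right[OF this, of "1 / (\<i> * of_int k)"] False
  have "((\<lambda>x. cis (of_int k * x + b)) has_integral 0) {0..2*pi}" by simp
  then show ?thesis using False by (simp add: integral_unique)
qed (simp add: scaleR_conv_of_real)

text \<open>Complex-valued versions of \<open>fourier1\<close> and \<open>fourier2\<close>, needed
  because single modes are not real-valued.\<close>

definition fc :: "(real \<Rightarrow> complex) \<Rightarrow> int \<Rightarrow> complex" where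
  "fc g l = integral {0..2*pi} (\<lambda>x. g x * cis (- (of_int l * x))) / of_real (2*pi)"

definition fc2 :: "(real \<times> real \<Rightarrow> complex) \<Rightarrow> int \<times> int \<Rightarrow> complex" where
  "fc2 u l = integral (cbox (0, 0) (2*pi, 2*pi))
       (\<lambda>x. u x * cis (- (of_int (fst l) * fst x + of_int (snd l) * snd x))) / of_real ((2*pi)\<^sup>2)"

lemma fourier1_fc: "fourier1 g l = fc (\<lambda>x. of_real (g x)) l"
  by (simp add: fourier1_def fc_def)

lemma fourier2_fc2: "fourier2 u l = fc2 (\<lambda>x. of_real (u x)) l"
  by (simp add: fourier2_def fc2_def)

text \<open>Both sides are bounded linear in \<open>w\<close>, so single modes suffice, and there it
  is orthogonality of the exponentials.\<close>

lemma fc_ev1: "fc (ev1 w) l = coef w l"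
proof (rule bounded_linear_eq_mono[of "\<lambda>w. fc (ev1 w) l" "\<lambda>w. coef w l"])
  show "bounded_linear (\<lambda>w. fc (ev1 w) l)"
    unfolding fc_def
    by (rule bounded_linear_compose[OF bounded_linear_divide, unfolded o_def],
        rule bounded_linear_integral_evl1[of 0 "2*pi", unfolded box_real])
       (auto intro!: continuous_intros continuous_e1 simp: e1.norm_char)
  fix m c
  have "fc (ev1 (mono_l1 m c)) l = c * integral {0..2*pi} (\<lambda>x. cis (of_int (m - l) * x + 0)) / of_real (2*pi)"
    unfolding fc_def evl1_mono e1_def
    by (simp add: mult.assoc cis_mult algebra_simps flip: integral_mult_right)
  also have "\<dots> = coef (mono_l1 m c) l"
    unfolding integral_cis by (simp add: coef_mono)
  finally show "fc (ev1 (mono_l1 m c)) l = coef (mono_l1 m c) l" .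
qed (rule bounded_linear_coef)

lemma fc2_ev2: "fc2 (ev2 w) l = coef w l"
proof (rule bounded_linear_eq_mono[of "\<lambda>w. fc2 (ev2 w) l" "\<lambda>w. coef w l"])
  show "bounded_linear (\<lambda>w. fc2 (ev2 w) l)"
    unfolding fc2_def
    by (rule bounded_linear_compose[OF bounded_linear_divide, unfolded o_def],
        rule bounded_linear_integral_evl1)
       (auto intro!: continuous_intros continuous_e2 simp: e2.norm_char)
  fix m c
  define k1 k2 where "k1 = fst m - fst l" and "k2 = snd m - snd l"
  have "fc2 (ev2 (mono_l1 m c)) l = c * integral (cbox (0, 0) (2*pi, 2*pi))
      (\<lambda>x. cis (of_int k1 * fst x + of_int k2 * snd x)) / of_real ((2*pi)\<^sup>2)"
    unfolding fc2_def evl1_mono e2_def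
    by (simp add: mult.assoc cis_mult algebra_simps k1_def k2_def flip: integral_mult_right)
  also have "integral (cbox (0, 0) (2*pi, 2*pi)) (\<lambda>x. cis (of_int k1 * fst x + of_int k2 * snd x)) =
      integral {0..2*pi} (\<lambda>x. integral {0..2*pi} (\<lambda>y. cis (of_int k2 * y + of_int k1 * x)))"
    by (subst integral_prod_continuous) (auto intro!: continuous_intros simp: add.commute)
  also have "\<dots> = (if k1 = 0 \<and> k2 = 0 then of_real ((2*pi)\<^sup>2) else 0)"
  proof -
    have "integral {0..2*pi} (\<lambda>x. cis (of_int k1 * x)) = (if k1 = 0 then of_real (2*pi) else 0)"
      using integral_cis[of k1 0] by simp
    then show ?thesis unfolding integral_cis by (cases "k2 = 0") (auto simp: power2_eq_square scaleR_conv_of_real)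
  qed
  finally show "fc2 (ev2 (mono_l1 m c)) l = coef (mono_l1 m c) l"
    by (auto simp: coef_mono k1_def k2_def prod_eq_iff)
qed (rule bounded_linear_coef)

section \<open>Series with real values\<close>

definition real_l1 :: "'a::ab_group_add l1 \<Rightarrow> bool" where
  "real_l1 w \<longleftrightarrow> (\<forall>l. coef w (- l) = cnj (coef w l))"

lemma real_evl1:
  assumes "\<And>l. norm (\<psi> l) \<le> 1" "\<And>l. \<psi> (- l) = cnj (\<psi> l)" "real_l1 w"
  shows "of_real (Re (evl1 \<psi> w)) = evl1 \<psi> w"
proof -
  have H: "((\<lambda>l. coef w l * \<psi> l) has_sum evl1 \<psi> w) UNIV" by (rule evl1_has_sum[OF assms(1)])
  have "(\<lambda>l. coef w (- l) * \<psi> (- l)) = (\<lambda>l. cnj (coef w l * \<psi> l))"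
    using assms(3) unfolding real_l1_def by (intro ext) (simp only: complex_cnj_mult assms(2))
  then have "((\<lambda>l. coef w (- l) * \<psi> (- l)) has_sum cnj (evl1 \<psi> w)) UNIV"
    using H by (simp only: has_sum_cnj_iff)
  then have "((\<lambda>l. coef w l * \<psi> l) has_sum cnj (evl1 \<psi> w)) UNIV"
    using has_sum_reindex_bij_betw[OF bij_uminus, of "\<lambda>l. coef w l * \<psi> l" "cnj (evl1 \<psi> w)"] by (simp only:)
  then have "cnj (evl1 \<psi> w) = evl1 \<psi> w"
    using H has_sum_unique by blast
  then show ?thesis by (simp add: complex_eq_iff)
qed

lemma real_ev1: "real_l1 w \<Longrightarrow> of_real (Re (ev1 w x)) = ev1 w x"
  by (rule real_evl1) (simp_all add: e1.char_le e1_def cis_cnj)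

lemma real_ev2: "real_l1 w \<Longrightarrow> of_real (Re (ev2 w x)) = ev2 w x"
  by (rule real_evl1) (simp_all add: e2.char_le e2_def cis_cnj)

lemma fc_cnj: "fc (\<lambda>x. cnj (g x)) (- l) = cnj (fc g l)"
proof -
  have "integral {0..2*pi} (\<lambda>x. cnj (g x) * cis (- (of_int (- l) * x))) =
      integral {0..2*pi} (\<lambda>x. cnj (g x * cis (- (of_int l * x))))"
    by (simp add: cis_cnj)
  also have "\<dots> = cnj (integral {0..2*pi} (\<lambda>x. g x * cis (- (of_int l * x))))"
    by (rule integral_cnj[symmetric])
  finally show ?thesis by (simp add: fc_def)
qed

lemma real_l1_zero: "real_l1 0"
  and real_l1_add: "real_l1 v \<Longrightarrow> real_l1 w \<Longrightarrow> real_l1 (v + w)"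
  and real_l1_diff: "real_l1 v \<Longrightarrow> real_l1 w \<Longrightarrow> real_l1 (v - w)"
  and real_l1_scaleR: "real_l1 v \<Longrightarrow> real_l1 (c *\<^sub>R v)"
  by (simp_all add: real_l1_def coef_simps)

lemma real_l1_mult:
  assumes "real_l1 v" "real_l1 w"
  shows "real_l1 (v * w)"
  unfolding real_l1_def
proof
  fix l
  have "bij (uminus :: 'a \<Rightarrow> 'a)" by (rule bij_uminus)
  then have "((\<lambda>m. coef v (- m) * coef w (- l - - m)) has_sum coef (v * w) (- l)) UNIV"
    using has_sum_reindex_bij_betw[of uminus UNIV UNIV "\<lambda>m. coef v m * coef w (- l - m)"]
    by (simp only: coef_mult_has_sum)
  moreover have "coef v (- m) * coef w (- l - - m) = cnj (coef v m * coef w (l - m))" for m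
  proof -
    have "coef w (- (l - m)) = cnj (coef w (l - m))" "coef v (- m) = cnj (coef v m)"
      using assms unfolding real_l1_def by blast+
    moreover have "- l - - m = - (l - m)" by simp
    ultimately show ?thesis by (simp only: complex_cnj_mult)
  qed
  ultimately have "((\<lambda>m. cnj (coef v m * coef w (l - m))) has_sum coef (v * w) (- l)) UNIV"
    by simp
  moreover have "((\<lambda>m. cnj (coef v m * coef w (l - m))) has_sum cnj (coef (v * w) l)) UNIV"
    by (simp only: has_sum_cnj_iff coef_mult_has_sum)
  ultimately show "coef (v * w) (- l) = cnj (coef (v * w) l)" by (rule has_sum_unique)
qed

lemma real_l1_one: "real_l1 1"
  by (auto simp: real_l1_def one_l1_def coef_mono)

lemma real_l1_power: "real_l1 v \<Longrightarrow> real_l1 (v ^ n)"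
  by (induction n) (simp_all add: real_l1_one real_l1_mult)

lemma closed_real_l1: "closed {w. real_l1 w}"
  unfolding real_l1_def
  by (intro closed_Collect_all closed_Collect_eq linear_continuous_on bounded_linear_coef
      bounded_linear_compose[OF bounded_linear_cnj bounded_linear_coef])

lemma real_l1_suminf:
  assumes "summable f" "\<And>n. real_l1 (f n)"
  shows "real_l1 (suminf f)"
proof -
  have "real_l1 (\<Sum>i<n. f i)" for n by (induction n) (simp_all add: real_l1_zero real_l1_add assms)
  then show ?thesis
    using closed_sequentially[OF closed_real_l1, of "\<lambda>n. \<Sum>i<n. f i"] summable_LIMSEQ[OF assms(1)] by simp
qed

section \<open>Fourier multipliers and transport along index embeddings\<close>

definition mulop :: "('a \<Rightarrow> complex) \<Rightarrow> 'a l1 \<Rightarrow> 'a l1" where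
  "mulop k w = Abs_l1 (\<lambda>l. k l * coef w l)"

lemma coef_mulop:
  assumes "\<And>l. norm (k l) \<le> B"
  shows "coef (mulop k w) l = k l * coef w l"
proof -
  have "(\<lambda>l. k l * coef w l) abs_summable_on UNIV"
    by (rule Infinite_Sum.abs_summable_on_comparison_test'[OF summable_on_cmult_right[OF coef_abs_summable[of w], of B]])
       (use assms in \<open>auto simp: norm_mult intro: mult_right_mono\<close>)
  then show ?thesis by (simp add: mulop_def coef_Abs_l1)
qed

lemma norm_mulop_le:
  assumes "\<And>l. norm (k l) \<le> B"
  shows "norm (mulop k w) \<le> B * norm w"
proof (rule norm_l1_le)
  fix F :: "'a set" assume F: "finite F"
  have "0 \<le> B" using assms order_trans[OF norm_ge_zero] by blast
  have "(\<Sum>l\<in>F. norm (coef (mulop k w) l)) \<le> (\<Sum>l\<in>F. B * norm (coef w l))"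
    by (intro sum_mono) (simp add: coef_mulop[OF assms] norm_mult mult_right_mono assms)
  also have "\<dots> \<le> B * norm w"
    using \<open>0 \<le> B\<close> sum_coef_le_norm[OF F, of w] by (simp add: mult_left_mono flip: sum_distrib_left)
  finally show "(\<Sum>l\<in>F. norm (coef (mulop k w) l)) \<le> B * norm w" .
qed

lemma bounded_linear_mulop:
  assumes "\<And>l. norm (k l) \<le> B"
  shows "bounded_linear (mulop k)"
  by (rule bounded_linear_intro[of _ B])
     (use norm_mulop_le[OF assms] in \<open>auto intro!: l1_eqI simp: coef_mulop[OF assms] coef_simps algebra_simps\<close>)

text \<open>For an embedding of index groups, \<open>push\<close> reads a function of one variable
  as a function of two, and \<open>pull\<close> averages over the other variable.\<close>

definition push :: "('a \<Rightarrow> 'b) \<Rightarrow> 'a l1 \<Rightarrow> 'b l1" where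
  "push j w = Abs_l1 (\<lambda>m. if m \<in> range j then coef w (inv j m) else 0)"

definition pull :: "('a \<Rightarrow> 'b) \<Rightarrow> 'b l1 \<Rightarrow> 'a l1" where
  "pull j w = Abs_l1 (\<lambda>l. coef w (j l))"

lemma coef_pull:
  assumes "inj j"
  shows "coef (pull j w) l = coef w (j l)"
proof -
  have "(\<lambda>l. coef w (j l)) abs_summable_on UNIV"
    using summable_on_reindex[OF assms, of "\<lambda>m. norm (coef w m)"]
      summable_on_subset_banach[OF coef_abs_summable[of w], of "range j"] by (simp add: o_def)
  then show ?thesis by (simp add: pull_def coef_Abs_l1)
qed

lemma norm_pull_le:
  assumes "inj j"
  shows "norm (pull j w) \<le> norm w"
proof (rule norm_l1_le)
  fix F :: "'a set" assume F: "finite F"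
  have "(\<Sum>l\<in>F. norm (coef (pull j w) l)) = (\<Sum>m\<in>j ` F. norm (coef w m))"
    using assms by (subst sum.reindex) (auto simp: coef_pull inj_def inj_on_def)
  also have "\<dots> \<le> norm w" using F by (intro sum_coef_le_norm) auto
  finally show "(\<Sum>l\<in>F. norm (coef (pull j w) l)) \<le> norm w" .
qed

lemma bounded_linear_pull: "inj j \<Longrightarrow> bounded_linear (pull j)"
  by (rule bounded_linear_intro[of _ 1])
     (auto intro!: l1_eqI simp: coef_pull coef_simps norm_pull_le)

lemma coef_push:
  assumes "inj j"
  shows "coef (push j w) = (\<lambda>m. if m \<in> range j then coef w (inv j m) else 0)"
proof -
  have "(\<lambda>m. norm (coef w (inv j m))) summable_on range j"
    using summable_on_reindex[OF assms, of "\<lambda>m. norm (coef w (inv j m))"] coef_abs_summable[of w]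
    by (simp add: o_def inv_f_f[OF assms])
  moreover have "(\<lambda>m. norm (if m \<in> range j then coef w (inv j m) else 0)) summable_on UNIV
      \<longleftrightarrow> (\<lambda>m. norm (coef w (inv j m))) summable_on range j"
    by (rule summable_on_cong_neutral) auto
  ultimately have "(\<lambda>m. if m \<in> range j then coef w (inv j m) else 0) abs_summable_on UNIV"
    by blast
  then show ?thesis by (simp add: push_def coef_Abs_l1)
qed

lemma coef_push_image: "inj j \<Longrightarrow> coef (push j w) (j l) = coef w l"
  by (simp add: coef_push inv_f_f)

lemma norm_push_le:
  assumes "inj j"
  shows "norm (push j w) \<le> norm w"
proof (rule norm_l1_le)
  fix F :: "'b set" assume F: "finite F"
  have "(\<Sum>m\<in>F. norm (coef (push j w) m)) = (\<Sum>m\<in>F \<inter> range j. norm (coef w (inv j m)))"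
    using F by (simp add: coef_push[OF assms] if_distrib sum.If_cases cong: if_cong)
  also have "\<dots> = (\<Sum>l\<in>inv j ` (F \<inter> range j). norm (coef w l))"
    by (subst sum.reindex) (auto intro: inj_on_inv_into)
  also have "\<dots> \<le> norm w" using F by (intro sum_coef_le_norm) auto
  finally show "(\<Sum>m\<in>F. norm (coef (push j w) m)) \<le> norm w" .
qed

lemma bounded_linear_push: "inj j \<Longrightarrow> bounded_linear (push j)"
  by (rule bounded_linear_intro[of _ 1])
     (auto intro!: l1_eqI simp: coef_push coef_simps norm_push_le)

lemma push_mono: "inj j \<Longrightarrow> push j (mono_l1 l c) = mono_l1 (j l) c"
  by (rule l1_eqI) (auto simp: coef_push coef_mono inv_f_f)

lemma push_mult:
  assumes "inj j" "\<And>l m. j (l + m) = j l + j m"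
  shows "push j (v * w) = push j v * push j w"
proof -
  note BL = bounded_linear_push[OF assms(1)]
  have 1: "push j (mono_l1 a x * w) = push j (mono_l1 a x) * push j w" for a x w
    by (rule bounded_linear_eq_mono[of "\<lambda>w. push j (mono_l1 a x * w)" "\<lambda>w. push j (mono_l1 a x) * push j w"])
       (auto simp: mono_mult push_mono assms
         intro: bounded_linear_compose[OF BL bounded_linear_mult_right] bounded_linear_compose[OF bounded_linear_mult_right BL])
  show ?thesis
    by (rule bounded_linear_eq_mono[of "\<lambda>v. push j (v * w)" "\<lambda>v. push j v * push j w"])
       (auto simp: 1
         intro: bounded_linear_compose[OF BL bounded_linear_mult_left] bounded_linear_compose[OF bounded_linear_mult_left BL])
qed

lemma push_one: "inj j \<Longrightarrow> (\<And>l m. j (l + m) = j l + j m) \<Longrightarrow> push j 1 = 1"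
  unfolding one_l1_def by (subst push_mono) (auto, metis add_cancel_right_right)

lemma push_power:
  assumes "inj j" "\<And>l m. j (l + m) = j l + j m"
  shows "push j (v ^ n) = push j v ^ n"
  by (induction n) (simp_all add: push_one[OF assms] push_mult[OF assms])

lemma evl1_push:
  assumes "inj j" "\<And>l. norm (\<psi> l) \<le> 1"
  shows "evl1 \<psi> (push j w) = evl1 (\<psi> \<circ> j) w"
  by (rule bounded_linear_eq_mono[of "\<lambda>w. evl1 \<psi> (push j w)" "evl1 (\<psi> \<circ> j)"])
     (auto intro!: bounded_linear_compose[OF bounded_linear_evl1 bounded_linear_push] bounded_linear_evl1
       simp: assms push_mono evl1_mono)

section \<open>Weighted norms\<close>

text \<open>Membership in a weighted space and a norm bound in one predicate: bounding the finite
  sums already includes convergence and is stable under coefficientwise limits.\<close>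

definition wle :: "('a \<Rightarrow> real) \<Rightarrow> 'a l1 \<Rightarrow> real \<Rightarrow> bool" where
  "wle W w B \<longleftrightarrow> (\<forall>F. finite F \<longrightarrow> (\<Sum>l\<in>F. norm (coef w l) * W l) \<le> B)"

lemma wleD: "wle W w B \<Longrightarrow> finite F \<Longrightarrow> (\<Sum>l\<in>F. norm (coef w l) * W l) \<le> B"
  by (simp add: wle_def)

lemma wle_nonneg: "wle W w B \<Longrightarrow> 0 \<le> B"
  using wleD[of W w B "{}"] by simp

lemma wle_le: "wle W w B \<Longrightarrow> B \<le> C \<Longrightarrow> wle W w C"
  unfolding wle_def by (meson order_trans)

lemma wle_summable:
  assumes "wle W w B" "\<And>l. 0 \<le> W l"
  shows "(\<lambda>l. norm (coef w l) * W l) summable_on UNIV" "(\<Sum>\<^sub>\<infinity>l. norm (coef w l) * W l) \<le> B"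
proof -
  show "(\<lambda>l. norm (coef w l) * W l) summable_on UNIV"
    using abs_summable_bdd[of "\<lambda>l. norm (coef w l) * W l" B UNIV] assms by (simp add: wle_def)
  then show "(\<Sum>\<^sub>\<infinity>l. norm (coef w l) * W l) \<le> B"
    by (rule infsum_le_finite_sums) (use assms in \<open>auto simp: wle_def\<close>)
qed

lemma wle_norm:
  assumes "wle W w B" "\<And>l. 1 \<le> W l"
  shows "norm w \<le> B"
proof (rule norm_l1_le)
  fix F :: "'a set" assume F: "finite F"
  have "(\<Sum>l\<in>F. norm (coef w l)) \<le> (\<Sum>l\<in>F. norm (coef w l) * W l)"
    by (intro sum_mono) (use assms(2) in \<open>simp add: mult_le_cancel_left1\<close>)
  also have "\<dots> \<le> B" using assms(1) F by (rule wleD)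
  finally show "(\<Sum>l\<in>F. norm (coef w l)) \<le> B" .
qed

lemma wle_add:
  assumes "wle W v B" "wle W w C" "\<And>l. 0 \<le> W l"
  shows "wle W (v + w) (B + C)"
  unfolding wle_def
proof safe
  fix F :: "'a set" assume F: "finite F"
  have "(\<Sum>l\<in>F. norm (coef (v + w) l) * W l) \<le> (\<Sum>l\<in>F. norm (coef v l) * W l + norm (coef w l) * W l)"
    by (intro sum_mono) (simp add: coef_simps mult_right_mono norm_triangle_ineq assms(3) flip: distrib_right)
  then show "(\<Sum>l\<in>F. norm (coef (v + w) l) * W l) \<le> B + C"
    using wleD[OF assms(1) F] wleD[OF assms(2) F] by (simp add: sum.distrib)
qed

lemma wle_dominated:
  assumes "wle W v B" "\<And>l. 0 \<le> W l" "0 \<le> c" "\<And>l. norm (coef w l) \<le> c * norm (coef v l)"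
  shows "wle W w (c * B)"
  unfolding wle_def
proof safe
  fix F :: "'a set" assume F: "finite F"
  have "(\<Sum>l\<in>F. norm (coef w l) * W l) \<le> (\<Sum>l\<in>F. c * (norm (coef v l) * W l))"
    by (intro sum_mono) (use assms(2) mult_right_mono[OF assms(4)] in \<open>auto simp: mult.assoc\<close>)
  also have "\<dots> \<le> c * B"
    using wleD[OF assms(1) F] assms(3) by (simp add: mult_left_mono flip: sum_distrib_left)
  finally show "(\<Sum>l\<in>F. norm (coef w l) * W l) \<le> c * B" .
qed

lemma wle_scaleR: "wle W v B \<Longrightarrow> (\<And>l. 0 \<le> W l) \<Longrightarrow> wle W (c *\<^sub>R v) (\<bar>c\<bar> * B)"
  by (rule wle_dominated) (auto simp: coef_simps)

text \<open>Multiply the coefficients by the weight and apply the unweighted convolution estimate;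
  submultiplicativity distributes the weight over the two factors.\<close>

lemma wle_mult:
  assumes v: "wle W v B" and w: "wle W w C"
    and W: "\<And>l. 0 \<le> W l" "\<And>l m. W (l + m) \<le> W l * W m"
  shows "wle W (v * w) (B * C)"
proof -
  define v' w' where "v' = Abs_l1 (\<lambda>l. of_real (W l) * coef v l)" and "w' = Abs_l1 (\<lambda>l. of_real (W l) * coef w l)"
  have "(\<lambda>l. of_real (W l) * coef v l) abs_summable_on UNIV" "(\<lambda>l. of_real (W l) * coef w l) abs_summable_on UNIV"
    using wle_summable(1)[OF v W(1)] wle_summable(1)[OF w W(1)] by (simp_all add: norm_mult W(1) mult.commute)
  then have v': "coef v' l = of_real (W l) * coef v l" and w': "coef w' l = of_real (W l) * coef w l" for l
    by (simp_all add: v'_def w'_def coef_Abs_l1)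
  have nv: "norm v' \<le> B" "norm w' \<le> C"
    by (rule norm_l1_le; use wleD[OF v] wleD[OF w] W(1) in \<open>simp add: v' w' norm_mult mult.commute\<close>)+
  have le: "norm (coef (v * w) l) * W l \<le> (\<Sum>\<^sub>\<infinity>m. norm (coef v' m * coef w' (l - m)))" for l
  proof -
    have "norm (coef (v * w) l) * W l \<le> (\<Sum>\<^sub>\<infinity>m. norm (coef v m * coef w (l - m))) * W l"
      unfolding coef_mult by (rule mult_right_mono[OF norm_infsum_bound[OF conv_summable] W(1)])
    also have "\<dots> = (\<Sum>\<^sub>\<infinity>m. norm (coef v m * coef w (l - m)) * W l)"
      by (rule infsum_cmult_left'[symmetric])
    also have "\<dots> \<le> (\<Sum>\<^sub>\<infinity>m. norm (coef v' m * coef w' (l - m)))"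
    proof (rule infsum_mono[OF summable_on_cmult_left[OF conv_summable] conv_summable])
      fix m
      have "norm (coef v m * coef w (l - m)) * W l \<le> norm (coef v m * coef w (l - m)) * (W m * W (l - m))"
        using W(2)[of m "l - m"] by (intro mult_left_mono) auto
      then show "norm (coef v m * coef w (l - m)) * W l \<le> norm (coef v' m * coef w' (l - m))"
        using W(1) by (simp add: v' w' norm_mult mult_ac)
    qed
    finally show ?thesis .
  qed
  show ?thesis
    unfolding wle_def
  proof safe
    fix F :: "'a set" assume F: "finite F"
    have "(\<Sum>l\<in>F. norm (coef (v * w) l) * W l) \<le> (\<Sum>l\<in>F. \<Sum>\<^sub>\<infinity>m. norm (coef v' m * coef w' (l - m)))"
      by (intro sum_mono le)
    also have "\<dots> \<le> norm v' * norm w'"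
      unfolding conv_norm_infsum[symmetric]
      by (rule finite_sum_le_infsum[OF conv_norm_summable F]) (auto intro: infsum_nonneg)
    also have "\<dots> \<le> B * C" using nv by (intro mult_mono) (auto intro: order_trans[OF norm_ge_zero])
    finally show "(\<Sum>l\<in>F. norm (coef (v * w) l) * W l) \<le> B * C" .
  qed
qed

text \<open>Positive powers only, because the unit has weighted norm \<open>W 0\<close>, which may
  exceed 1.\<close>

lemma wle_power:
  assumes "wle W w B" "\<And>l. 0 \<le> W l" "\<And>l m. W (l + m) \<le> W l * W m"
  shows "wle W (w ^ Suc n) (B ^ Suc n)"
proof (induction n)
  case (Suc n)
  from wle_mult[OF assms(1) this assms(2,3)] show ?case by simp
qed (use assms in simp)

text \<open>Weighted balls are closed in the unweighted norm. Hence a contraction in the weaker norm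
  that maps such a ball to itself has its fixed point inside the ball.\<close>

lemma wle_limit:
  assumes "X \<longlonglongrightarrow> w" "\<And>n. wle W (X n) B"
  shows "wle W w B"
  unfolding wle_def
proof safe
  fix F :: "'a set" assume F: "finite F"
  have "(\<lambda>n. \<Sum>l\<in>F. norm (coef (X n) l) * W l) \<longlonglongrightarrow> (\<Sum>l\<in>F. norm (coef w l) * W l)"
    by (intro tendsto_intros tendsto_coef assms(1))
  then show "(\<Sum>l\<in>F. norm (coef w l) * W l) \<le> B"
    by (rule LIMSEQ_le_const2) (use assms(2) F in \<open>auto simp: wle_def\<close>)
qed

lemma wle_suminf:
  assumes "summable f" "\<And>n. wle W (f n) (b n)" "summable b" "\<And>l. 0 \<le> W l"
  shows "wle W (suminf f) (suminf b)"
proof (rule wle_limit[OF summable_LIMSEQ[OF assms(1)]])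
  fix n
  have "wle W (\<Sum>i<n. f i) (\<Sum>i<n. b i)" for n
    by (induction n) (use wle_add[OF _ assms(2) assms(4)] in \<open>simp_all add: wle_def coef_zero\<close>)
  then show "wle W (\<Sum>i<n. f i) (suminf b)"
    by (rule wle_le) (use assms(2,3) wle_nonneg in \<open>auto intro!: sum_le_suminf\<close>)
qed

subsection \<open>Fourier inversion on the circle\<close>

lemma integral_nonneg_0D:
  fixes f :: "real \<Rightarrow> real"
  assumes "continuous_on {0..2*pi} f" "\<And>x. x \<in> {0..2*pi} \<Longrightarrow> 0 \<le> f x" "integral {0..2*pi} f = 0"
    "x \<in> {0..2*pi}"
  shows "f x = 0"
  using integral_cbox_eq_0_iff[of 0 "2*pi" f] assms pi_gt_zero by (auto simp: box_real)

lemma cos_2pi_diff: "cos (2 * pi - x) = cos (x :: real)" and sin_2pi_diff: "sin (2 * pi - x) = - sin (x :: real)"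
  by (simp_all add: cos_diff sin_diff)

lemma has_integral_2pi_diff:
  fixes f :: "real \<Rightarrow> real"
  assumes "(f has_integral i) {0..2*pi}"
  shows "((\<lambda>x. f (2*pi - x)) has_integral i) {0..2*pi}"
proof -
  have "((\<lambda>x. f (- x)) has_integral i) {- (2*pi)..-0}"
    using assms by (subst has_integral_reflect_real) simp
  from has_integral_shift_real_ivl[OF this, of "- (2*pi)"] show ?thesis by simp
qed

text \<open>Symmetry about \<pi> makes \<open>e\<close> a continuous function of
  \<open>cos t\<close> on the whole period, and Weierstrass approximates that function by
  polynomials, to which \<open>e\<close> is orthogonal.\<close>

lemma even_cos_moments_zero:
  fixes e :: "real \<Rightarrow> real"
  assumes cont: "continuous_on {0..2*pi} e" and even: "\<And>t. t \<in> {0..2*pi} \<Longrightarrow> e (2*pi - t) = e t"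
    and moments: "\<And>n. ((\<lambda>t. e t * cos t ^ n) has_integral 0) {0..2*pi}"
    and t: "t \<in> {0..2*pi}"
  shows "e t = 0"
proof -
  define G where "G = (\<lambda>x. e (arccos x))"
  have "arccos ` {-1..1} \<subseteq> {0..2*pi}"
  proof clarify
    fix x :: real assume "x \<in> {-1..1}"
    then have "0 \<le> arccos x" "arccos x \<le> pi" by (simp_all add: arccos_lbound arccos_ubound)
    then show "arccos x \<in> {0..2*pi}" using pi_ge_zero unfolding atLeastAtMost_iff by linarith
  qed
  then have G: "continuous_on {-1..1} G"
    unfolding G_def by (rule continuous_on_compose2[OF cont continuous_on_arccos'])
  have eG: "e t = G (cos t)" if "t \<in> {0..2*pi}" for t
  proof (cases "t \<le> pi")
    case True
    then show ?thesis using that by (simp add: G_def arccos_cos)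
  next
    case False
    then have "arccos (cos (2*pi - t)) = 2*pi - t" using that by (intro arccos_cos) auto
    then show ?thesis using even[OF that] by (simp add: G_def cos_2pi_diff)
  qed
  have int_poly: "((\<lambda>t. e t * p (cos t)) has_integral 0) {0..2*pi}" if p: "real_polynomial_function p" for p
  proof -
    obtain a n where p: "p = (\<lambda>x. \<Sum>i\<le>n. a i * x ^ i)"
      using p unfolding real_polynomial_function_iff_sum by (elim exE)
    have "((\<lambda>t. \<Sum>i\<le>n. a i * (e t * cos t ^ i)) has_integral (\<Sum>i\<le>n. a i * 0)) {0..2*pi}"
      by (intro has_integral_sum has_integral_mult_right moments) auto
    then show ?thesis by (simp add: p sum_distrib_left mult_ac)
  qed
  \<comment> \<open>Replacing one factor \<open>e t\<close> by \<open>p (cos t)\<close> costs at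
    most \<epsilon>, and the polynomial part integrates to zero.\<close>
  have "integral {0..2*pi} (\<lambda>t. (e t)\<^sup>2) \<le> 0 + \<epsilon>" if \<epsilon>: "\<epsilon> > 0" for \<epsilon>
  proof -
    obtain M where M: "\<And>t. t \<in> {0..2*pi} \<Longrightarrow> \<bar>e t\<bar> \<le> M" "0 < M"
    proof -
      have "bounded (e ` {0..2*pi})" by (intro compact_imp_bounded compact_continuous_image cont compact_Icc)
      then obtain M where "0 < M" "\<forall>x\<in>e ` {0..2*pi}. norm x \<le> M" unfolding bounded_pos by blast
      then show ?thesis by (intro that[of M]) (simp_all del: atLeastAtMost_iff)
    qed
    define \<eta> where "\<eta> = \<epsilon> / (M * (2 * pi))"
    have "\<eta> > 0" using \<epsilon> M(2) by (simp add: \<eta>_def)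
    obtain p where p: "real_polynomial_function p" "\<And>x. x \<in> {-1..1} \<Longrightarrow> \<bar>G x - p x\<bar> < \<eta>"
      by (rule Stone_Weierstrass_real_polynomial_function[OF compact_Icc G \<open>\<eta> > 0\<close>]) blast
    have "((\<lambda>t. (e t)\<^sup>2) has_integral integral {0..2*pi} (\<lambda>t. (e t)\<^sup>2)) {0..2*pi}"
      by (intro integrable_integral integrable_continuous_interval continuous_intros cont)
    from has_integral_diff[OF this int_poly[OF p(1)]]
    have "((\<lambda>t. (e t)\<^sup>2 - e t * p (cos t)) has_integral integral {0..2*pi} (\<lambda>t. (e t)\<^sup>2)) (cbox 0 (2*pi))"
      by (simp add: box_real)
    then have "norm (integral {0..2*pi} (\<lambda>t. (e t)\<^sup>2)) \<le> (M * \<eta>) * measure lborel (cbox 0 (2*pi))"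
    proof (rule has_integral_bound[rotated])
      fix t :: real assume "t \<in> cbox 0 (2*pi)"
      then have t: "t \<in> {0..2*pi}" by simp
      have "(e t)\<^sup>2 - e t * p (cos t) = e t * (G (cos t) - p (cos t))"
        by (subst eG[OF t, symmetric]) (simp add: power2_eq_square algebra_simps)
      moreover have "\<bar>G (cos t) - p (cos t)\<bar> \<le> \<eta>" using p(2)[of "cos t"] by simp
      ultimately show "norm ((e t)\<^sup>2 - e t * p (cos t)) \<le> M * \<eta>"
        using M(1)[OF t] \<open>M > 0\<close> by (simp add: abs_mult mult_mono)
    qed (use M(2) \<open>\<eta> > 0\<close> in simp)
    also have "\<dots> = \<epsilon>" using M(2) pi_gt_zero by (simp add: \<eta>_def)
    finally show ?thesis by simp
  qed
  then have "integral {0..2*pi} (\<lambda>t. (e t)\<^sup>2) \<le> 0" by (rule field_le_epsilon)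
  moreover have "0 \<le> integral {0..2*pi} (\<lambda>t. (e t)\<^sup>2)" by (rule integral_nonneg) (auto intro!: integrable_continuous_interval continuous_intros cont)
  ultimately have "(e t)\<^sup>2 = 0"
    by (intro integral_nonneg_0D[where f = "\<lambda>t. (e t)\<^sup>2"]) (use t in \<open>auto intro!: continuous_intros cont\<close>)
  then show ?thesis by simp
qed

text \<open>Split \<open>h\<close> into its even and odd parts about \<pi>. The odd part becomes
  even after multiplication by the sine, so both are covered by the cosine moments.\<close>

lemma real_fourier_zero:
  fixes h :: "real \<Rightarrow> real"
  assumes cont: "continuous_on {0..2*pi} h"
    and zero: "\<And>l :: int. ((\<lambda>t. of_real (h t) * cis (of_int l * t)) has_integral 0) {0..2*pi}"
    and t: "t \<in> {0..2*pi}"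
  shows "h t = 0"
proof -
  \<comment> \<open>Multiplication by \<open>cos t\<close> averages the frequencies
    \<open>l + 1\<close> and \<open>l - 1\<close>, so vanishing for all \<open>l\<close> is
    inherited by every power of the cosine.\<close>
  have 1: "((\<lambda>t. of_real (h t * cos t ^ n) * cis (of_int l * t)) has_integral 0) {0..2*pi}" for n and l :: int
  proof (induction n arbitrary: l)
    case (Suc n)
    have "((\<lambda>t. (1/2) * (of_real (h t * cos t ^ n) * cis (of_int (l + 1) * t)
        + of_real (h t * cos t ^ n) * cis (of_int (l - 1) * t))) has_integral (1/2) * (0 + 0)) {0..2*pi}"
      by (intro has_integral_mult_right has_integral_add Suc)
    moreover have "(1/2) * (of_real (h t * cos t ^ n) * cis (of_int (l + 1) * t)
        + of_real (h t * cos t ^ n) * cis (of_int (l - 1) * t)) = of_real (h t * cos t ^ Suc n) * cis (of_int l * t)" for t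
    proof -
      have "cis (of_int (l + 1) * t) = cis (of_int l * t) * cis t" "cis (of_int (l - 1) * t) = cis (of_int l * t) * cis (- t)"
        by (simp_all add: cis_mult algebra_simps)
      moreover have "cis t + cis (- t) = 2 * of_real (cos t)" by (simp add: complex_eq_iff)
      moreover have "(1/2) * (X * (L * cis t) + X * (L * cis (- t))) = X * L * ((cis t + cis (- t)) / 2)" for X L
        by (simp add: algebra_simps add_divide_distrib)
      ultimately show ?thesis by (simp only:) (simp add: mult_ac)
    qed
    ultimately show ?case by simp
  qed (use zero in simp)
  have 2: "((\<lambda>t. h t * cos t ^ n) has_integral 0) {0..2*pi}" for n
    using has_integral_linear[OF 1[of n 0] bounded_linear_Re] by (simp add: o_def)
  have 3: "((\<lambda>t. h t * cos t ^ n * sin t) has_integral 0) {0..2*pi}" for n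
    using has_integral_linear[OF 1[of n 1] bounded_linear_Im] by (simp add: o_def)
  have refl: "continuous_on {0..2*pi} (\<lambda>t. h (2*pi - t))"
    by (rule continuous_on_compose2[OF cont]) (auto intro!: continuous_intros)
  have e0: "h t + h (2*pi - t) = 0" if "t \<in> {0..2*pi}" for t
  proof (rule even_cos_moments_zero[where e = "\<lambda>t. h t + h (2*pi - t)"])
    fix n
    show "((\<lambda>t. (h t + h (2*pi - t)) * cos t ^ n) has_integral 0) {0..2*pi}"
      using has_integral_add[OF 2[of n] has_integral_2pi_diff[OF 2[of n]]]
      by (simp add: cos_2pi_diff distrib_right)
  qed (use that in \<open>auto intro!: continuous_intros cont refl\<close>)
  have o0: "(h t - h (2*pi - t)) * sin t = 0" if "t \<in> {0..2*pi}" for t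
  proof (rule even_cos_moments_zero[where e = "\<lambda>t. (h t - h (2*pi - t)) * sin t"])
    fix n
    show "((\<lambda>t. (h t - h (2*pi - t)) * sin t * cos t ^ n) has_integral 0) {0..2*pi}"
      using has_integral_add[OF 3[of n] has_integral_2pi_diff[OF 3[of n]]]
      by (simp only: cos_2pi_diff sin_2pi_diff) (simp add: algebra_simps)
  qed (use that in \<open>auto intro!: continuous_intros cont refl simp: sin_2pi_diff left_diff_distrib\<close>)
  have off: "h t = 0" if "t \<in> {0..2*pi}" "t \<notin> {0, pi, 2*pi}" for t
  proof -
    have "sin t \<noteq> 0"
    proof (cases "t < pi")
      case True
      then have "0 < sin t" using that by (intro sin_gt_zero) auto
      then show ?thesis by simp
    next
      case False
      then have "0 < sin (2*pi - t)" using that by (intro sin_gt_zero) auto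
      then show ?thesis by (simp add: sin_2pi_diff)
    qed
    then show ?thesis using e0[OF that(1)] o0[OF that(1)] by simp
  qed
  \<comment> \<open>The zeros of the sine are finitely many and invisible to the integral of the
    square; continuity then covers them too.\<close>
  have "((\<lambda>t. (h t)\<^sup>2) has_integral 0) {0..2*pi}"
    by (rule has_integral_spike_finite[of "{0, pi, 2*pi}" _ _ "\<lambda>_. 0"]) (use off in auto)
  then have "integral {0..2*pi} (\<lambda>t. (h t)\<^sup>2) = 0" by (rule integral_unique)
  then have "(h t)\<^sup>2 = 0"
    by (intro integral_nonneg_0D[where f = "\<lambda>t. (h t)\<^sup>2"]) (use t in \<open>auto intro!: continuous_intros cont\<close>)
  then show ?thesis by simp
qed

section \<open>Calculus of Fourier coefficients and quadratic decay\<close>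

lemma fc_has_integral:
  assumes "continuous_on {0..2*pi} g"
  shows "((\<lambda>x. g x * cis (- (of_int l * x))) has_integral (of_real (2*pi) * fc g l)) {0..2*pi}"
  using integrable_integral[OF integrable_continuous_interval[of 0 "2*pi" "\<lambda>x. g x * cis (- (of_int l * x))"]] assms
  by (simp add: fc_def continuous_on_mult continuous_on_cis continuous_intros)

lemma fc_add:
  assumes "continuous_on {0..2*pi} g" "continuous_on {0..2*pi} h"
  shows "fc (\<lambda>x. g x + h x) l = fc g l + fc h l"
  using integral_unique[OF has_integral_add[OF fc_has_integral[OF assms(1)] fc_has_integral[OF assms(2)]], of l l]
  by (simp add: fc_def distrib_right add_divide_distrib)

lemma fc_diff:
  assumes "continuous_on {0..2*pi} g" "continuous_on {0..2*pi} h"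
  shows "fc (\<lambda>x. g x - h x) l = fc g l - fc h l"
  using integral_unique[OF has_integral_diff[OF fc_has_integral[OF assms(1)] fc_has_integral[OF assms(2)]], of l l]
  by (simp add: fc_def left_diff_distrib diff_divide_distrib)

lemma fc_cmult: "fc (\<lambda>x. c * g x) l = c * fc g l"
  by (simp add: fc_def mult.assoc flip: integral_mult_right)

lemma fc_cong: "(\<And>x. x \<in> {0..2*pi} \<Longrightarrow> g x = h x) \<Longrightarrow> fc g l = fc h l"
  unfolding fc_def by (intro arg_cong2[of _ _ _ _ "(/)"] integral_cong) auto

lemma norm_fc_le:
  assumes "continuous_on {0..2*pi} g" "\<And>x. x \<in> {0..2*pi} \<Longrightarrow> norm (g x) \<le> B"
  shows "norm (fc g l) \<le> B"
proof -
  have "norm (integral {0..2*pi} (\<lambda>x. g x * cis (- (of_int l * x)))) \<le> B * (2*pi - 0)"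
    by (rule integral_bound) (use assms in \<open>auto simp: norm_mult intro!: continuous_intros\<close>)
  then show ?thesis by (simp add: fc_def norm_divide field_simps)
qed

lemma fc_zero_imp_zero:
  assumes cont: "continuous_on {0..2*pi} g" and zero: "\<And>l. fc g l = 0" and x: "x \<in> {0..2*pi}"
  shows "g x = 0"
proof -
  have ccont: "continuous_on {0..2*pi} (\<lambda>x. cnj (g x))" by (intro continuous_intros cont)
  have czero: "fc (\<lambda>x. cnj (g x)) l = 0" for l
    using fc_cnj[of g "- l"] zero by simp
  have 1: "((\<lambda>x. g x * cis (of_int l * x)) has_integral 0) {0..2*pi}" for l
    using fc_has_integral[OF cont, of "- l"] by (simp add: zero)
  have 2: "((\<lambda>x. cnj (g x) * cis (of_int l * x)) has_integral 0) {0..2*pi}" for l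
    using fc_has_integral[OF ccont, of "- l"] by (simp add: czero)
  have "Re (g x) = 0"
  proof (rule real_fourier_zero[OF _ _ x])
    fix l
    have "of_real (Re z) = (1/2) * (z + cnj z)" for z by (simp add: complex_eq_iff)
    then have "of_real (Re z) * c = (1/2) * (z * c + cnj z * c)" for z c by (simp add: distrib_right[symmetric])
    then show "((\<lambda>t. of_real (Re (g t)) * cis (of_int l * t)) has_integral 0) {0..2*pi}"
      using has_integral_mult_right[OF has_integral_add[OF 1[of l] 2[of l]], of "1/2"]
      by (simp only:) simp
  qed (intro continuous_intros cont)
  moreover have "Im (g x) = 0"
  proof (rule real_fourier_zero[OF _ _ x])
    fix l
    have "of_real (Im z) = (- \<i>/2) * (z - cnj z)" for z by (simp add: complex_eq_iff)
    then have "of_real (Im z) * c = (- \<i>/2) * (z * c - cnj z * c)" for z c by (simp add: left_diff_distrib[symmetric])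
    then show "((\<lambda>t. of_real (Im (g t)) * cis (of_int l * t)) has_integral 0) {0..2*pi}"
      using has_integral_mult_right[OF has_integral_diff[OF 1[of l] 2[of l]], of "- \<i>/2"]
      by (simp only:) simp
  qed (intro continuous_intros cont)
  ultimately show ?thesis by (simp add: complex_eq_iff)
qed

lemma fourier_inversion:
  assumes cont: "continuous_on {0..2*pi} g" and summ: "fc g abs_summable_on UNIV"
    and x: "x \<in> {0..2*pi}"
  shows "g x = ev1 (Abs_l1 (fc g)) x"
proof -
  have "g x - ev1 (Abs_l1 (fc g)) x = 0"
    by (rule fc_zero_imp_zero[OF _ _ x])
       (auto simp: fc_diff cont continuous_ev1 fc_ev1 coef_Abs_l1 summ intro!: continuous_intros)
  then show ?thesis by simp
qed

lemma fc_deriv: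
  assumes g: "\<And>x. x \<in> {0..2*pi} \<Longrightarrow> (g has_vector_derivative g' x) (at x within {0..2*pi})"
    and cont: "continuous_on {0..2*pi} g'" and per: "g 0 = g (2*pi)"
  shows "fc g' l = \<i> * of_int l * fc g l"
proof -
  have gcont: "continuous_on {0..2*pi} g"
    using g has_vector_derivative_continuous continuous_on_eq_continuous_within by blast
  have "((\<lambda>x. g x * (- (\<i> * of_int l) * cis (- (of_int l * x))) + g' x * cis (- (of_int l * x))) has_integral
      g (2*pi) * cis (- (of_int l * (2*pi))) - g 0 * cis (- (of_int l * 0))) {0..2*pi}"
  proof (rule fundamental_theorem_of_calculus)
    fix x :: real assume x: "x \<in> {0..2*pi}"
    have "((\<lambda>x. cis (- (of_int l * x))) has_vector_derivative (- (\<i> * of_int l) * cis (- (of_int l * x)))) (at x within {0..2*pi})"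
      using cis_vector_derivative[of "- of_int l" 0] by simp
    from has_vector_derivative_mult[OF g[OF x] this]
    show "((\<lambda>x. g x * cis (- (of_int l * x))) has_vector_derivative
      g x * (- (\<i> * of_int l) * cis (- (of_int l * x))) + g' x * cis (- (of_int l * x))) (at x within {0..2*pi})" .
  qed simp
  moreover have "cis (- (of_int l * (2*pi))) = 1"
    using cis_multiple_2pi[of "of_int (- l)"] by (simp add: mult_ac)
  ultimately have A: "((\<lambda>x. g x * (- (\<i> * of_int l) * cis (- (of_int l * x))) + g' x * cis (- (of_int l * x))) has_integral 0) {0..2*pi}"
    using per by simp
  have B: "((\<lambda>x. g x * (- (\<i> * of_int l) * cis (- (of_int l * x))) + g' x * cis (- (of_int l * x))) has_integral
      (- (\<i> * of_int l) * (of_real (2*pi) * fc g l) + of_real (2*pi) * fc g' l)) {0..2*pi}"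
    using has_integral_add[OF has_integral_mult_right[OF fc_has_integral[OF gcont, of l], of "- (\<i> * of_int l)"] fc_has_integral[OF cont, of l]]
    by (simp add: mult_ac)
  from has_integral_unique[OF A B] have "of_real (2*pi) * (fc g' l - \<i> * of_int l * fc g l) = 0"
    by (simp add: algebra_simps)
  then show ?thesis by simp
qed

lemma summable_on_inverse_squares_int: "(\<lambda>l :: int. 1 / (1 + (real_of_int l)\<^sup>2)) summable_on UNIV"
proof -
  have "summable (\<lambda>n. 1 / (1 + (real n)\<^sup>2))"
  proof (rule summable_comparison_test_ev[OF _ inverse_power_summable[of 2]])
    show "\<forall>\<^sub>F n in sequentially. norm (1 / (1 + (real n)\<^sup>2)) \<le> inverse ((of_nat n)\<^sup>2)"
      using eventually_gt_at_top[of 0] by eventually_elim (auto simp: divide_simps add_pos_nonneg not_less intro!: add_nonneg_nonneg)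
  qed simp
  then have N: "(\<lambda>n. 1 / (1 + (real n)\<^sup>2)) summable_on UNIV"
    by (intro norm_summable_imp_summable_on) simp
  have "(\<lambda>l :: int. 1 / (1 + (real_of_int l)\<^sup>2)) summable_on range int"
    by (subst summable_on_reindex) (use N in \<open>auto simp: o_def\<close>)
  moreover have "(\<lambda>l :: int. 1 / (1 + (real_of_int l)\<^sup>2)) summable_on range (\<lambda>n. - int n)"
    by (subst summable_on_reindex) (use N in \<open>auto simp: o_def inj_def\<close>)
  moreover have "(UNIV :: int set) = range int \<union> range (\<lambda>n. - int n)"
    by (auto, metis int_cases4 rangeI)
  ultimately show ?thesis by (metis summable_on_union)
qed

definition sum_inv_sq :: real where
  "sum_inv_sq = (\<Sum>\<^sub>\<infinity>l. 1 / (1 + (real_of_int l)\<^sup>2))"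

lemma inv_sq_has_sum: "((\<lambda>l :: int. 1 / (1 + (real_of_int l)\<^sup>2)) has_sum sum_inv_sq) UNIV"
  unfolding sum_inv_sq_def by (rule has_sum_infsum[OF summable_on_inverse_squares_int])

lemma
  assumes "\<And>l :: int. (1 + (real_of_int l)\<^sup>2) * norm (x l) \<le> B"
  shows inv_sq_abs_summable: "x abs_summable_on UNIV"
    and inv_sq_norm_le: "norm (Abs_l1 x) \<le> B * sum_inv_sq"
proof -
  have le: "norm (x l) \<le> B * (1 / (1 + (real_of_int l)\<^sup>2))" for l
    using assms[of l] by (simp add: field_simps add_pos_nonneg)
  have H: "((\<lambda>l. B * (1 / (1 + (real_of_int l)\<^sup>2))) has_sum B * sum_inv_sq) UNIV"
    by (intro has_sum_cmult_right inv_sq_has_sum)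
  show *: "x abs_summable_on UNIV"
    by (rule Infinite_Sum.abs_summable_on_comparison_test'[OF has_sum_imp_summable[OF H]]) (rule le)
  have H2: "((\<lambda>l. norm (x l)) has_sum norm (Abs_l1 x)) UNIV"
    using has_sum_norm_l1[of "Abs_l1 x"] by (simp add: coef_Abs_l1[OF *])
  show "norm (Abs_l1 x) \<le> B * sum_inv_sq"
    by (rule has_sum_mono[OF H2 H]) (rule le)
qed

text \<open>Adding the bounds for the coefficients of \<open>g\<close> and of its second derivative
  gives quadratic decay. Through \<open>inv_sq_norm_le\<close> this is the passage from pointwise
  bounds to the sequence norm.\<close>

lemma C2_fc:
  assumes g: "\<And>x. x \<in> {0..2*pi} \<Longrightarrow> (g has_vector_derivative g' x) (at x within {0..2*pi})"
    and g': "\<And>x. x \<in> {0..2*pi} \<Longrightarrow> (g' has_vector_derivative g'' x) (at x within {0..2*pi})"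
    and cont: "continuous_on {0..2*pi} g''"
    and per: "g 0 = g (2*pi)" "g' 0 = g' (2*pi)"
    and bd: "\<And>x. x \<in> {0..2*pi} \<Longrightarrow> norm (g x) \<le> A" "\<And>x. x \<in> {0..2*pi} \<Longrightarrow> norm (g'' x) \<le> B"
  shows fc_deriv2: "fc g'' l = - (of_int l)\<^sup>2 * fc g l"
    and C2_fc_bound: "(1 + (real_of_int l)\<^sup>2) * norm (fc g l) \<le> A + B"
proof -
  have gcont: "continuous_on {0..2*pi} g" "continuous_on {0..2*pi} g'"
    using g g' has_vector_derivative_continuous continuous_on_eq_continuous_within by blast+
  show *: "fc g'' l = - (of_int l)\<^sup>2 * fc g l"
    using fc_deriv[OF g' cont per(2), of l] fc_deriv[OF g gcont(2) per(1), of l]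
    by (simp add: power2_eq_square algebra_simps)
  have "norm (fc g'' l) = (real_of_int l)\<^sup>2 * norm (fc g l)"
    by (simp add: * norm_mult norm_power)
  then show "(1 + (real_of_int l)\<^sup>2) * norm (fc g l) \<le> A + B"
    using norm_fc_le[OF cont bd(2), of l] norm_fc_le[OF gcont(1) bd(1), of l] by (simp add: distrib_right)
qed

subsection \<open>The unperturbed oscillator\<close>

lemma real_antiderivative:
  fixes g :: "real \<Rightarrow> real"
  assumes cont: "continuous_on UNIV g"
  shows "\<exists>F. F 0 = 0 \<and> (\<forall>x. (F has_real_derivative g x) (at x))"
proof -
  define F where "F x = (if 0 \<le> x then integral {0..x} g else - integral {x..0} g)" for x
  have "(F has_real_derivative g x) (at x)" for x
  proof -
  define N where "N = \<bar>x\<bar> + 1"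
  have gc: "continuous_on {a..b} g" for a b by (rule continuous_on_subset[OF cont]) simp
  have F: "F y = integral {-N..y} g - integral {-N..0} g" if "y \<in> {-N..N}" for y
  proof (cases "0 \<le> y")
    case True
    have "integral {-N..0} g + integral {0..y} g = integral {-N..y} g"
      by (rule Henstock_Kurzweil_Integration.integral_combine) (use True in \<open>auto simp: N_def intro!: integrable_continuous_interval gc\<close>)
    then show ?thesis using True by (simp add: F_def)
  next
    case False
    have "integral {-N..y} g + integral {y..0} g = integral {-N..0} g"
      by (rule Henstock_Kurzweil_Integration.integral_combine) (use False that in \<open>auto intro!: integrable_continuous_interval gc\<close>)
    then show ?thesis using False by (simp add: F_def)
  qed
  have "((\<lambda>y. integral {-N..y} g - integral {-N..0} g) has_real_derivative g x - 0) (at x within {-N..N})"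
    by (intro DERIV_diff integral_has_real_derivative gc DERIV_const) (auto simp: N_def)
  then have "((\<lambda>y. integral {-N..y} g - integral {-N..0} g) has_real_derivative g x) (at x)"
    by (simp add: N_def at_within_Icc_at)
  then show ?thesis
    by (rule has_field_derivative_transform_within_open[of _ _ _ "{-N<..<N}"]) (auto simp: N_def F)
  qed
  moreover have "F 0 = 0" by (simp add: F_def)
  ultimately show ?thesis by blast
qed

text \<open>The lower bound \<open>m\<close> on the slope yields surjectivity by linear growth and a
  Lipschitz inverse; its continuity is what the inverse function rule asks for.\<close>

lemma increasing_inverse:
  fixes F g :: "real \<Rightarrow> real"
  assumes F: "\<And>x. (F has_real_derivative g x) (at x)" and m: "0 < m" "\<And>x. m \<le> g x"
  obtains T where "\<And>x. F (T x) = x" "\<And>x. T (F x) = x" "\<And>x. (T has_real_derivative 1 / g (T x)) (at x)"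
    "strict_mono F"
proof -
  have grow: "F v - F u \<ge> m * (v - u)" if "u \<le> v" for u v
  proof -
    have "F u - m * u \<le> F v - m * v"
    proof (rule DERIV_nonneg_imp_nondecreasing[OF that])
      fix x
      have "((\<lambda>x. F x - m * x) has_real_derivative g x - m) (at x)"
        by (auto intro!: derivative_eq_intros F)
      then show "\<exists>y. DERIV (\<lambda>x. F x - m * x) x :> y \<and> 0 \<le> y" using m(2) by fastforce
    qed
    then show ?thesis by (simp add: algebra_simps)
  qed
  have smono: "strict_mono F"
  proof (rule strict_monoI)
    fix u v :: real assume "u < v"
    then have "0 < m * (v - u)" using m(1) by simp
    then show "F u < F v" using grow[of u v] \<open>u < v\<close> by linarith
  qed
  have Fcont: "isCont F x" for x using F DERIV_isCont by blast
  have surj: "\<exists>x. F x = y" for y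
  proof -
    define K where "K = (\<bar>y\<bar> + \<bar>F 0\<bar>) / m"
    have K: "0 \<le> K" "m * K = \<bar>y\<bar> + \<bar>F 0\<bar>" using m(1) by (simp_all add: K_def)
    have "F (- K) \<le> y" "y \<le> F K"
      using grow[of "- K" 0] grow[of 0 K] K by simp_all
    then show ?thesis using IVT[of F "- K" y K] K(1) Fcont by auto
  qed
  define T where "T = inv F"
  have FT: "F (T x) = x" for x unfolding T_def using surj by (metis f_inv_into_f rangeI)
  have TF: "T (F x) = x" for x unfolding T_def by (rule inv_f_f) (rule strict_mono_imp_inj_on[OF smono])
  have lip: "\<bar>T a - T b\<bar> \<le> \<bar>a - b\<bar> / m" for a b
  proof (cases "T a \<le> T b")
    case True
    then have "m * (T b - T a) \<le> b - a" using grow[of "T a" "T b"] by (simp add: FT)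
    then show ?thesis using m(1) True by (simp add: field_simps)
  next
    case False
    then have "m * (T a - T b) \<le> a - b" using grow[of "T b" "T a"] by (simp add: FT)
    then show ?thesis using m(1) False by (simp add: field_simps)
  qed
  have Tcont: "isCont T x" for x
  proof -
    have "((\<lambda>a. T a - T x) \<longlongrightarrow> 0) (at x)"
    proof (rule tendsto_0_le[where f = "\<lambda>a. a - x" and K = "1 / m"])
      show "((\<lambda>a. a - x) \<longlongrightarrow> 0) (at x)" by (rule LIM_zero) simp
    qed (use lip in simp)
    then show ?thesis by (simp add: isCont_def LIM_zero_iff)
  qed
  have "(T has_real_derivative 1 / g (T x)) (at x)" for x
    using DERIV_inverse_function[where f = F and g = T and a = "x - 1" and b = "x + 1", OF F _ _ _ _ Tcont] m(2)[of "T x"] m(1)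
    by (simp add: FT inverse_eq_divide)
  then show ?thesis using that[of T] FT TF smono by blast
qed

text \<open>Half the derivative of \<open>(1 - s^2) * (\<Sum>j<d. s^(2*j)) = 1 - s^(2*d)\<close>. At
  \<open>j = 0\<close> the truncated exponent is harmless because of the factor
  \<open>real j\<close>.\<close>

lemma sum_even_powers_identity:
  fixes s :: real
  shows "- s * (\<Sum>j<d. s ^ (2*j)) + (1 - s\<^sup>2) * (\<Sum>j<d. real j * s ^ (2*j - 1)) = - real d * s ^ (2*d - 1)"
proof (induction d)
  case (Suc d)
  have "s * (s * s ^ (2*d - 1)) = s * s ^ (2*d)" if "d > 0" using that by (cases d) auto
  then have e: "s\<^sup>2 * (real d * s ^ (2*d - 1)) = real d * s ^ (2*d + 1)"
    by (cases "d = 0") (auto simp: power2_eq_square mult_ac)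
  have "- s * (\<Sum>j<Suc d. s ^ (2*j)) + (1 - s\<^sup>2) * (\<Sum>j<Suc d. real j * s ^ (2*j - 1))
      = - real d * s ^ (2*d - 1) - s ^ (2*d + 1) + (real d * s ^ (2*d - 1) - s\<^sup>2 * (real d * s ^ (2*d - 1)))"
    unfolding Suc.IH[symmetric] by (simp add: algebra_simps)
  then show ?case unfolding e by (simp add: algebra_simps)
qed simp

text \<open>With \<open>y = sin \<theta>\<close> the energy identity \<open>y'\<^sup>2 = \<kappa>\<^sup>2 (1 - y\<^sup>2\<^sup>d)\<close> becomes the scalar equation
  \<open>\<theta>' = \<kappa> sqrt (\<Sum>j<d. sin \<theta> ^ (2 j))\<close>, whose right-hand side is positive and \<open>\<pi>\<close>-periodic.\<close>

lemma oscillator_exists: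
  fixes c :: real
  assumes d: "2 \<le> d" and c: "0 < c"
  obtains q q1 where "\<And>t. (q has_real_derivative q1 t) (at t)"
    "\<And>t. (q1 has_real_derivative - c * q t ^ (2*d - 1)) (at t)"
    "\<And>t. q (t + 2*pi) = q t" "\<And>t. q1 (t + 2*pi) = q1 t"
    "0 < integral {0..2*pi} (\<lambda>t. q t * sin t)"
proof -
  define S where "S x = (\<Sum>j<d. sin x ^ (2*j))" for x :: real
  define S1 where "S1 x = (\<Sum>j<d. real j * sin x ^ (2*j - 1))" for x :: real
  have S1: "1 \<le> S x" for x
  proof -
    have "(\<Sum>j\<in>{0}. sin x ^ (2*j)) \<le> S x"
      unfolding S_def by (rule sum_mono2) (use d in \<open>auto simp: power_mult\<close>)
    then show ?thesis by simp
  qed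
  have Sd: "S x \<le> real d" for x
  proof -
    have "S x \<le> (\<Sum>j<d. 1)"
      unfolding S_def by (rule sum_mono) (simp add: power_mult power_le_one abs_square_le_1)
    then show ?thesis by simp
  qed
  have Sper: "S (x + pi) = S x" for x by (simp add: S_def power_mult)
  have dS: "(S has_real_derivative 2 * cos x * S1 x) (at x)" for x
    unfolding S_def S1_def
    by (auto intro!: derivative_eq_intros sum.cong simp: sum_distrib_left mult_ac)
  have Scont: "continuous_on A S" for A
    using dS by (intro DERIV_continuous_on) (rule DERIV_subset, auto)
  \<comment> \<open>Time as a function of the angle: with \<kappa> = 1, \<open>g\<close> is the
    reciprocal of the angular speed, \<open>F\<close> the time needed to reach an angle and its
    inverse \<open>T\<close> the angle at a given time.\<close>
  define g where "g x = 1 / sqrt (S x)" for x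
  have gcont: "continuous_on UNIV g"
    unfolding g_def using S1 by (intro continuous_intros Scont) (smt (verit) real_sqrt_gt_zero)
  have gm: "1 / sqrt (real d) \<le> g x" for x
    unfolding g_def using S1[of x] Sd[of x] by (intro divide_left_mono) (auto intro!: mult_pos_pos)
  obtain F where F0: "F 0 = 0" and F: "\<And>x. (F has_real_derivative g x) (at x)"
    using real_antiderivative[OF gcont] by blast
  have "0 < 1 / sqrt (real d)" using d by simp
  then obtain T where FT: "\<And>x. F (T x) = x" and TF: "\<And>x. T (F x) = x"
    and dT: "\<And>x. (T has_real_derivative 1 / g (T x)) (at x)" and Fmono: "strict_mono F"
    using increasing_inverse[OF F _ gm] by metis
  have Fper: "F (x + pi) = F x + F pi" for x
  proof -
    have "((\<lambda>x. F (x + pi) - F x) has_real_derivative 0) (at x)" for x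
      using DERIV_diff[OF DERIV_shift[THEN iffD1, OF F[of "x + pi"]] F[of x]] by (simp add: g_def Sper)
    then have "F (x + pi) - F x = F (0 + pi) - F 0" by (intro DERIV_isconst_all) auto
    then show ?thesis by (simp add: F0)
  qed
  \<comment> \<open>Rescales time so that the angle gains \<pi> in time \<pi>; then \<open>y\<close>
    changes sign under the shift by \<pi> and has period \<open>2*pi\<close>.\<close>
  define k where "k = F pi / pi"
  have Fpi: "0 < F pi" using strict_monoD[OF Fmono, of 0 pi] F0 pi_gt_zero by simp
  then have k: "0 < k" "k * pi = F pi" by (simp_all add: k_def)
  have Tper: "T (k * (t + pi)) = T (k * t) + pi" for t
  proof -
    have "F (T (k * t) + pi) = k * (t + pi)" by (simp add: Fper FT k(2) distrib_left)
    then show ?thesis by (metis TF)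
  qed
  define y where "y t = sin (T (k * t))" for t
  define y1 where "y1 t = k * (cos (T (k * t)) * sqrt (S (T (k * t))))" for t
  have dTk: "((\<lambda>t. T (k * t)) has_real_derivative k * sqrt (S (T (k * t)))) (at t)" for t
    using DERIV_chain2[where f = T and g = "\<lambda>t. k * t", OF dT DERIV_cmult_Id, of t UNIV]
    by (simp add: g_def mult.commute[of _ k])
  have dy: "(y has_real_derivative y1 t) (at t)" for t
    unfolding y_def y1_def using DERIV_chain2[where f = sin, OF DERIV_sin dTk, of t] by (simp add: mult.left_commute)
  have dy1: "(y1 has_real_derivative - (k\<^sup>2 * real d) * y t ^ (2*d - 1)) (at t)" for t
  proof -
    define \<theta> where "\<theta> = T (k * t)"
    have pos: "0 < S \<theta>" using S1[of \<theta>] by linarith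
    have dsq: "((\<lambda>t. sqrt (S (T (k * t)))) has_real_derivative
        inverse (sqrt (S \<theta>)) / 2 * (2 * cos \<theta> * S1 \<theta> * (k * sqrt (S \<theta>)))) (at t)"
      unfolding \<theta>_def
      by (rule DERIV_chain2[where f = sqrt, OF DERIV_real_sqrt] DERIV_chain2[where f = S, OF dS] dTk
          pos[unfolded \<theta>_def])+
    then have dsq: "((\<lambda>t. sqrt (S (T (k * t)))) has_real_derivative k * (cos \<theta> * S1 \<theta>)) (at t)"
      using pos by (simp add: field_simps)
    have dcos: "((\<lambda>t. cos (T (k * t))) has_real_derivative - sin \<theta> * (k * sqrt (S \<theta>))) (at t)"
      unfolding \<theta>_def by (rule DERIV_chain2[where f = cos, OF DERIV_cos dTk])
    have "(y1 has_real_derivative k * ((- sin \<theta> * (k * sqrt (S \<theta>))) * sqrt (S \<theta>) + (k * (cos \<theta> * S1 \<theta>)) * cos \<theta>)) (at t)"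
      unfolding y1_def using DERIV_cmult[OF DERIV_mult[OF dcos dsq]] by (simp add: \<theta>_def)
    also have "k * ((- sin \<theta> * (k * sqrt (S \<theta>))) * sqrt (S \<theta>) + (k * (cos \<theta> * S1 \<theta>)) * cos \<theta>)
        = k\<^sup>2 * (- sin \<theta> * (sqrt (S \<theta>) * sqrt (S \<theta>)) + (cos \<theta>)\<^sup>2 * S1 \<theta>)"
      by (simp add: power2_eq_square algebra_simps)
    also have "\<dots> = k\<^sup>2 * (- sin \<theta> * S \<theta> + (1 - (sin \<theta>)\<^sup>2) * S1 \<theta>)"
      using pos by (simp add: cos_squared_eq)
    also have "\<dots> = k\<^sup>2 * (- real d * y t ^ (2*d - 1))"
      unfolding S_def S1_def sum_even_powers_identity by (simp add: y_def \<theta>_def)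
    finally show ?thesis by (simp add: mult.assoc)
  qed
  have yanti: "y (t + pi) = - y t" for t unfolding y_def Tper by simp
  have y1anti: "y1 (t + pi) = - y1 t" for t unfolding y1_def Tper by (simp add: Sper)
  have ypos: "0 < y t" if "0 < t" "t < pi" for t
  proof -
    have T: "T (k * t) < pi" "0 < T (k * t)"
    proof -
      have "k * t < k * pi" by (rule mult_strict_left_mono[OF that(2) k(1)])
      then have "F (T (k * t)) < F pi" by (simp add: FT k(2))
      then show "T (k * t) < pi" using strict_mono_less[OF Fmono] by blast
      have "F 0 < F (T (k * t))" using that k by (simp add: FT F0)
      then show "0 < T (k * t)" using strict_mono_less[OF Fmono] by blast
    qed
    then show ?thesis unfolding y_def by (intro sin_gt_zero)
  qed
  have y0: "y 0 = 0" using TF[of 0] by (simp add: y_def F0)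
  \<comment> \<open>Both factors are positive on the open interval from 0 to \<pi> and change sign
    under the shift by \<pi>.\<close>
  have ysin: "0 \<le> y t * sin t" if "t \<in> {0..2*pi}" for t
  proof -
    have *: "0 \<le> y t * sin t" if "0 \<le> t" "t \<le> pi" for t
    proof (cases "t = 0 \<or> t = pi")
      case False
      then have "0 < y t" "0 < sin t" using that by (auto intro: ypos sin_gt_zero)
      then show ?thesis by simp
    qed auto
    show ?thesis
    proof (cases "t \<le> pi")
      case False
      then have "0 \<le> y (t - pi) * sin (t - pi)" using that by (intro *) auto
      then show ?thesis using yanti[of "t - pi"] by (simp add: sin_diff)
    qed (use * that in auto)
  qed
  \<comment> \<open>The amplitude is still free: for \<open>q = b * y\<close> the force constant
    becomes \<open>k^2 * d / b^(2*d-2)\<close>, and this must equal \<open>c\<close>.\<close>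
  define b where "b = root (2*d - 2) (k\<^sup>2 * real d / c)"
  have b: "0 < b" "b ^ (2*d - 2) = k\<^sup>2 * real d / c"
    unfolding b_def using d k c by (auto simp: real_root_pow_pos2 intro!: divide_pos_pos mult_pos_pos real_root_gt_zero)
  define q where "q t = b * y t" for t
  define q1 where "q1 t = b * y1 t" for t
  show ?thesis
  proof (rule that[of q q1])
    fix t
    show "(q has_real_derivative q1 t) (at t)" unfolding q_def q1_def by (rule DERIV_cmult[OF dy])
    have "2*d - 1 = Suc (2*d - 2)" using d by simp
    then have "c * (b * y t) ^ (2*d - 1) = c * b ^ (2*d - 2) * b * y t ^ (2*d - 1)"
      by (simp add: power_mult_distrib)
    also have "\<dots> = b * ((k\<^sup>2 * real d) * y t ^ (2*d - 1))" using c by (simp add: b(2))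
    finally have "- c * q t ^ (2*d - 1) = b * (- (k\<^sup>2 * real d) * y t ^ (2*d - 1))" by (simp add: q_def)
    then show "(q1 has_real_derivative - c * q t ^ (2*d - 1)) (at t)"
      using DERIV_cmult[OF dy1[of t], of b] unfolding q1_def by simp
    have "t + 2*pi = (t + pi) + pi" by simp
    then show "q (t + 2*pi) = q t" "q1 (t + 2*pi) = q1 t"
      by (simp_all only: q_def q1_def yanti y1anti minus_minus)
  next
    have qc: "continuous_on {0..2*pi} (\<lambda>t. q t * sin t)"
      unfolding q_def
      by (intro continuous_intros DERIV_continuous_on[of _ y y1] DERIV_subset[OF dy]) auto
    have nn: "0 \<le> q t * sin t" if "t \<in> {0..2*pi}" for t
      using mult_nonneg_nonneg[OF less_imp_le[OF b(1)] ysin[OF that]] by (simp add: q_def mult_ac)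
    have "integral {0..2*pi} (\<lambda>t. q t * sin t) \<noteq> 0"
    proof
      assume "integral {0..2*pi} (\<lambda>t. q t * sin t) = 0"
      then have "q (pi/2) * sin (pi/2) = 0" by (rule integral_nonneg_0D[OF qc nn, rotated]) auto
      then show False using b ypos[of "pi/2"] by (simp add: q_def)
    qed
    moreover have "0 \<le> integral {0..2*pi} (\<lambda>t. q t * sin t)"
      by (rule integral_nonneg[OF integrable_continuous_interval[OF qc] nn])
    ultimately show "0 < integral {0..2*pi} (\<lambda>t. q t * sin t)" by simp
  qed
qed

subsection \<open>A right inverse of the linearised oscillator\<close>

lemma real_l1_ivp:
  assumes "continuous_on {0..2*pi} g" "\<And>x. x \<in> {0..2*pi} \<Longrightarrow> cnj (g x) = g x" "fc g abs_summable_on UNIV"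
  shows "real_l1 (Abs_l1 (fc g))"
  unfolding real_l1_def coef_Abs_l1[OF assms(3)]
  using fc_cnj[of g] fc_cong[of "\<lambda>x. cnj (g x)" g] assms(2) by simp

definition cos_l1 :: "int l1" where
  "cos_l1 = mono_l1 1 (1/2) + mono_l1 (-1) (1/2)"

lemma ev1_lin: "ev1 (v + w) t = ev1 v t + ev1 w t" "ev1 (a *\<^sub>R v) t = of_real a * ev1 v t"
proof -
  have L: "linear (evl1 (e1 t))" by (rule bounded_linear.linear[OF bounded_linear_evl1[OF e1.char_le]])
  show "ev1 (v + w) t = ev1 v t + ev1 w t" "ev1 (a *\<^sub>R v) t = of_real a * ev1 v t"
    by (simp add: linear_add[OF L], subst linear_scale[OF L], simp add: scaleR_conv_of_real)
qed

lemma ev1_cos_l1: "ev1 cos_l1 t = of_real (cos t)"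
  by (simp add: cos_l1_def ev1_lin evl1_mono e1_def complex_eq_iff)

lemma coef_cos_l1: "coef cos_l1 l = (if l = 1 \<or> l = -1 then 1/2 else 0)"
  by (auto simp: cos_l1_def coef_simps coef_mono)

text \<open>The assumption \<open>pos\<close> fixes the phase. It keeps the derivative
  \<open>q1\<close> from being orthogonal to the cosine and the first Fourier coefficient of
  \<open>q\<close> from vanishing.\<close>

locale oscillator =
  fixes d :: nat and c :: real and q q1 :: "real \<Rightarrow> real"
  assumes d: "2 \<le> d" and c: "0 < c"
    and dq: "\<And>t. (q has_real_derivative q1 t) (at t)"
    and dq1: "\<And>t. (q1 has_real_derivative - c * q t ^ (2*d - 1)) (at t)"
    and per: "\<And>t. q (t + 2*pi) = q t" "\<And>t. q1 (t + 2*pi) = q1 t"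
    and pos: "0 < integral {0..2*pi} (\<lambda>t. q t * sin t)"
begin

text \<open>\<open>\<lambda>^al * q (\<lambda> * t)\<close> solves the oscillator equation for every
  \<lambda>. Its derivative at \<lambda> = 1 is \<open>p2\<close>, a second solution of the
  linearised equation besides \<open>q1\<close>; its secular term \<open>t * q1 t\<close> records
  how the period depends on the amplitude.\<close>

definition "al = 1 / (real d - 1)"
definition "pot t = c * real (2*d - 1) * q t ^ (2*d - 2)"
definition "p2 t = al * q t + t * q1 t"
definition "p2' t = (al + 1) * q1 t - t * (c * q t ^ (2*d - 1))"
text \<open>The constant Wronskian of \<open>q1\<close> and \<open>p2\<close>. It equals
  \<open>2 * (al + 1)\<close> times the energy, which is why it is positive.\<close>

definition "wron = (al + 1) * (q1 0)\<^sup>2 + al * c * q 0 ^ (2*d)"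

lemma al: "0 < al" "al * real (2*d - 1) = al + 2"
  using d by (auto simp: al_def of_nat_diff field_simps)

lemma pow_m: "x * x ^ (2*d - 2) = x ^ (2*d - 1)" "x * x ^ (2*d - 1) = x ^ (2*d)" for x :: "'b::comm_ring_1"
proof -
  have "2*d - 1 = Suc (2*d - 2)" "2*d = Suc (2*d - 1)" using d by auto
  then show "x * x ^ (2*d - 2) = x ^ (2*d - 1)" "x * x ^ (2*d - 1) = x ^ (2*d)"
    by (metis power_Suc)+
qed

lemma dqm: "((\<lambda>t. q t ^ (2*d - 1)) has_real_derivative real (2*d - 1) * (q t ^ (2*d - 2) * q1 t)) (at t)"
proof -
  have "2*d - 1 - Suc 0 = 2*d - 2" using d by simp
  then show ?thesis using DERIV_power[OF dq[of t], of "2*d - 1"] by (simp add: mult_ac)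
qed

lemma dp2: "(p2 has_real_derivative p2' t) (at t)"
  unfolding p2_def p2'_def
  by (rule derivative_eq_intros dq dq1 refl | simp add: algebra_simps)+

lemma dp2': "(p2' has_real_derivative - pot t * p2 t) (at t)"
proof -
  have "(p2' has_real_derivative (al + 1) * (- c * q t ^ (2*d - 1)) -
      (1 * (c * q t ^ (2*d - 1)) + c * (real (2*d - 1) * (q t ^ (2*d - 2) * q1 t)) * t)) (at t)"
    unfolding p2'_def by (intro DERIV_diff DERIV_cmult dq1 DERIV_mult DERIV_ident dqm)
  moreover have "- pot t * p2 t = - c * (al * real (2*d - 1)) * (q t * q t ^ (2*d - 2))
      - c * (real (2*d - 1) * (q t ^ (2*d - 2) * q1 t)) * t"
    by (simp add: pot_def p2_def algebra_simps)
  then have "(al + 1) * (- c * q t ^ (2*d - 1)) -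
      (1 * (c * q t ^ (2*d - 1)) + c * (real (2*d - 1) * (q t ^ (2*d - 2) * q1 t)) * t) = - pot t * p2 t"
    unfolding al(2) pow_m by (simp add: algebra_simps)
  ultimately show ?thesis by (simp only:)
qed

lemma wron: "q1 t * p2' t + c * q t ^ (2*d - 1) * p2 t = wron"
proof -
  define E where "E t = (al + 1) * (q1 t)\<^sup>2 + al * c * q t ^ (2*d)" for t
  have "2 * d - Suc 0 = 2*d - 1" by simp
  have dE: "(E has_real_derivative (al + 1) * (2 * q1 t * (- c * q t ^ (2*d - 1)))
      + al * c * (real (2*d) * (q t ^ (2*d - 1) * q1 t))) (at t)" for t
    unfolding E_def
    using DERIV_power[OF dq[of t], of "2*d"] DERIV_power[OF dq1[of t], of 2]
    by (intro DERIV_add DERIV_cmult) (simp_all add: mult_ac)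
  have "real (2*d) = real (2*d - 1) + 1" using d by (simp add: of_nat_diff)
  then have al2: "al * real (2*d) = 2 * (al + 1)" by (simp only: distrib_left al(2))
  have "(al + 1) * (2 * q1 t * (- c * q t ^ (2*d - 1))) + al * c * (real (2*d) * (q t ^ (2*d - 1) * q1 t)) = 0" for t
  proof -
    have "al * c * (R * (X * Y)) = c * (al * R) * X * Y" for R X Y by (simp only: mult_ac)
    note this[of "real (2*d)", unfolded al2]
    then show ?thesis by (simp only:) (simp add: algebra_simps)
  qed
  then have "(E has_real_derivative 0) (at t)" for t using dE[of t] by (simp only:)
  then have "E t = E 0" for t by (intro DERIV_isconst_all) auto
  moreover have "E 0 = wron" by (simp add: E_def wron_def)
  moreover have "q1 t * p2' t + c * q t ^ (2*d - 1) * p2 t = (al + 1) * (q1 t)\<^sup>2 + al * c * (q t * q t ^ (2*d - 1))"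
    by (simp add: p2_def p2'_def power2_eq_square algebra_simps)
  ultimately show ?thesis unfolding pow_m E_def by metis
qed

lemma cont: "continuous_on A q" "continuous_on A q1" "continuous_on A p2" "continuous_on A p2'" "continuous_on A pot"
proof -
  show 1: "continuous_on A q" "continuous_on A q1" "continuous_on A p2" "continuous_on A p2'"
    using dq dq1 dp2 dp2' by (meson DERIV_isCont continuous_at_imp_continuous_on)+
  show "continuous_on A pot" unfolding pot_def by (intro continuous_intros 1)
qed

lemma wron_pos: "0 < wron"
proof (rule ccontr)
  assume "\<not> 0 < wron"
  moreover have "wron = (al + 1) * (q1 t)\<^sup>2 + al * c * (q t ^ d)\<^sup>2" for t
  proof -
    have "wron = (al + 1) * (q1 t)\<^sup>2 + al * c * (q t * q t ^ (2*d - 1))"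
      unfolding wron[of t, symmetric] by (simp add: p2_def p2'_def power2_eq_square algebra_simps)
    moreover have "(q t ^ d)\<^sup>2 = q t ^ (2*d)" by (simp add: power_mult[symmetric] mult.commute)
    ultimately show ?thesis by (simp only: pow_m)
  qed
  moreover have "0 \<le> (al + 1) * (q1 t)\<^sup>2" for t using al by simp
  ultimately have "al * c * (q t ^ d)\<^sup>2 \<le> 0" for t by (smt (verit))
  then have "q t = 0" for t
    using al c mult_pos_pos[OF mult_pos_pos[OF al(1) c], of "(q t ^ d)\<^sup>2"]
    by (metis linorder_not_le power_not_zero zero_less_power2)
  then show False using pos by simp
qed

definition "s0 = integral {0..2*pi} (\<lambda>t. cos t * q1 t)"

text \<open>Integration by parts turns \<open>s0\<close> into the integral of
  \<open>q t * sin t\<close>. So the cosine is transversal to the functions orthogonal to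
  \<open>q1\<close>, on which the linearised equation has periodic solutions.\<close>

lemma s0_pos: "0 < s0"
proof -
  have "((\<lambda>t. cos t * q1 t - q t * sin t) has_integral q (2*pi) * cos (2*pi) - q 0 * cos 0) {0..2*pi}"
  proof (rule fundamental_theorem_of_calculus)
    fix t
    have "((\<lambda>t. q t * cos t) has_real_derivative cos t * q1 t - q t * sin t) (at t)"
      by (rule derivative_eq_intros dq refl | simp)+
    then show "((\<lambda>t. q t * cos t) has_vector_derivative cos t * q1 t - q t * sin t) (at t within {0..2*pi})"
      by (simp add: has_real_derivative_iff_has_vector_derivative has_vector_derivative_at_within)
  qed simp
  then have "integral {0..2*pi} (\<lambda>t. cos t * q1 t - q t * sin t) = 0"
    using per(1)[of 0] by (simp add: integral_unique)
  moreover have "integral {0..2*pi} (\<lambda>t. cos t * q1 t - q t * sin t) = s0 - integral {0..2*pi} (\<lambda>t. q t * sin t)"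
    unfolding s0_def by (rule integral_diff) (intro integrable_continuous_interval continuous_intros cont)+
  ultimately show ?thesis using pos by simp
qed

text \<open>\<open>zf f\<close> is \<open>f\<close> corrected by the multiple of the cosine that
  makes it orthogonal to \<open>q1\<close>, the solvability condition for periodic
  solutions.\<close>

definition mu :: "(real \<Rightarrow> complex) \<Rightarrow> complex" where
  "mu f = integral {0..2*pi} (\<lambda>s. f s * of_real (q1 s)) / of_real s0"
definition zf :: "(real \<Rightarrow> complex) \<Rightarrow> real \<Rightarrow> complex" where
  "zf f t = f t - mu f * of_real (cos t)"
definition J1 :: "(real \<Rightarrow> complex) \<Rightarrow> real \<Rightarrow> complex" where
  "J1 f t = integral {0..t} (\<lambda>s. zf f s * of_real (q1 s))"
definition J2 :: "(real \<Rightarrow> complex) \<Rightarrow> real \<Rightarrow> complex" where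
  "J2 f t = integral {0..t} (\<lambda>s. zf f s * of_real (p2 s))"
text \<open>Variation of constants with the fundamental system \<open>q1\<close>, \<open>p2\<close>.
  The constant added to \<open>J1\<close> restores periodicity: over one period \<open>p2\<close>
  gains \<open>2*pi * q1 0\<close>, which cancels the end value of \<open>J2\<close>.\<close>

definition H :: "(real \<Rightarrow> complex) \<Rightarrow> real \<Rightarrow> complex" where
  "H f t = (of_real (p2 t) * (J1 f t + J2 f (2*pi) / of_real (2*pi)) - of_real (q1 t) * J2 f t) / of_real wron"
definition H' :: "(real \<Rightarrow> complex) \<Rightarrow> real \<Rightarrow> complex" where
  "H' f t = (of_real (p2' t) * (J1 f t + J2 f (2*pi) / of_real (2*pi)) + of_real (c * q t ^ (2*d - 1)) * J2 f t) / of_real wron"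

abbreviation "I2 \<equiv> {0..2*pi}"

lemma contc: "continuous_on A (\<lambda>t. complex_of_real (q1 t))" "continuous_on A (\<lambda>t. complex_of_real (p2 t))"
  "continuous_on A (\<lambda>t. complex_of_real (pot t))" "continuous_on A (\<lambda>t. complex_of_real (q t))"
  "continuous_on A (\<lambda>t. complex_of_real (cos t))"
  by (intro continuous_intros cont)+

lemma cont_zf: "continuous_on I2 f \<Longrightarrow> continuous_on I2 (zf f)"
  unfolding zf_def by (intro continuous_intros contc)

lemma intJ:
  assumes f: "continuous_on I2 f" and g: "continuous_on I2 g" and t: "t \<in> I2"
  shows "(\<lambda>s. zf f s * g s) integrable_on {0..t}"
  by (rule integrable_continuous_interval) (use t in \<open>auto intro!: continuous_intros continuous_on_subset[OF cont_zf[OF f]] continuous_on_subset[OF g]\<close>)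

lemma mu_lin:
  assumes "continuous_on I2 f" "continuous_on I2 g"
  shows "mu (\<lambda>t. f t + g t) = mu f + mu g" "mu (\<lambda>t. a * f t) = a * mu f" "mu (\<lambda>t. cnj (f t)) = cnj (mu f)"
proof -
  have I: "(\<lambda>s. f s * of_real (q1 s)) integrable_on I2" "(\<lambda>s. g s * of_real (q1 s)) integrable_on I2"
    by (intro integrable_continuous_interval continuous_intros contc assms)+
  show "mu (\<lambda>t. f t + g t) = mu f + mu g"
    by (simp add: mu_def distrib_right integral_add[OF I] add_divide_distrib)
  show "mu (\<lambda>t. a * f t) = a * mu f"
    by (simp add: mu_def mult.assoc flip: integral_mult_right)
  show "mu (\<lambda>t. cnj (f t)) = cnj (mu f)"
    by (simp add: mu_def integral_cnj)
qed

lemma zf_lin: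
  assumes "continuous_on I2 f" "continuous_on I2 g"
  shows "zf (\<lambda>t. f t + g t) t = zf f t + zf g t" "zf (\<lambda>t. a * f t) t = a * zf f t" "zf (\<lambda>t. cnj (f t)) t = cnj (zf f t)"
  by (simp_all add: zf_def mu_lin[OF assms] algebra_simps)

lemma J_lin:
  assumes "continuous_on I2 f" "continuous_on I2 g" "t \<in> I2"
  shows "J1 (\<lambda>t. f t + g t) t = J1 f t + J1 g t" "J1 (\<lambda>t. a * f t) t = a * J1 f t" "J1 (\<lambda>t. cnj (f t)) t = cnj (J1 f t)"
    "J2 (\<lambda>t. f t + g t) t = J2 f t + J2 g t" "J2 (\<lambda>t. a * f t) t = a * J2 f t" "J2 (\<lambda>t. cnj (f t)) t = cnj (J2 f t)"
proof -
  have A: "integral {0..t} (\<lambda>s. zf f s * h s + zf g s * h s) = integral {0..t} (\<lambda>s. zf f s * h s) + integral {0..t} (\<lambda>s. zf g s * h s)"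
    if "continuous_on I2 h" for h
    by (rule integral_add[OF intJ[OF assms(1) that assms(3)] intJ[OF assms(2) that assms(3)]])
  show "J1 (\<lambda>t. f t + g t) t = J1 f t + J1 g t" "J1 (\<lambda>t. a * f t) t = a * J1 f t" "J1 (\<lambda>t. cnj (f t)) t = cnj (J1 f t)"
    "J2 (\<lambda>t. f t + g t) t = J2 f t + J2 g t" "J2 (\<lambda>t. a * f t) t = a * J2 f t" "J2 (\<lambda>t. cnj (f t)) t = cnj (J2 f t)"
    unfolding J1_def J2_def zf_lin[OF assms(1,2)]
    by (simp_all add: distrib_right A[OF contc(1)] A[OF contc(2)] mult.assoc integral_cnj flip: integral_mult_right)
qed

lemma H_lin:
  assumes "continuous_on I2 f" "continuous_on I2 g" "t \<in> I2"
  shows "H (\<lambda>t. f t + g t) t = H f t + H g t" "H (\<lambda>t. a * f t) t = a * H f t" "H (\<lambda>t. cnj (f t)) t = cnj (H f t)"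
  using assms
  by (simp_all add: H_def J_lin[OF assms(1,2)] add_divide_distrib diff_divide_distrib algebra_simps)

lemma dJ:
  assumes "continuous_on I2 f" "t \<in> I2"
  shows "(J1 f has_vector_derivative zf f t * of_real (q1 t)) (at t within I2)"
    "(J2 f has_vector_derivative zf f t * of_real (p2 t)) (at t within I2)"
  unfolding J1_def J2_def
  by (rule integral_has_vector_derivative[OF _ assms(2)], intro continuous_intros cont_zf contc assms)+

lemma vd_of_real: "(g has_real_derivative D) (at t) \<Longrightarrow>
    ((\<lambda>t. complex_of_real (g t)) has_vector_derivative of_real D) (at t within A)"
  by (rule has_vector_derivative_of_real) (rule has_field_derivative_at_within)

lemma wronc: "of_real (p2' t) * of_real (q1 t) + of_real (c * q t ^ (2*d - 1)) * of_real (p2 t) = complex_of_real wron"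
  unfolding wron[of t, symmetric] by (simp add: mult_ac)

lemma dH:
  assumes "continuous_on I2 f" "t \<in> I2"
  shows "(H f has_vector_derivative H' f t) (at t within I2)"
proof -
  define K where "K = J2 f (2*pi) / of_real (2*pi)"
  have "((\<lambda>t. of_real (p2 t) * (J1 f t + K) - of_real (q1 t) * J2 f t) has_vector_derivative
     (of_real (p2 t) * (zf f t * of_real (q1 t) + 0) + of_real (p2' t) * (J1 f t + K)) -
     (of_real (q1 t) * (zf f t * of_real (p2 t)) + of_real (- c * q t ^ (2*d - 1)) * J2 f t)) (at t within I2)"
    by (intro has_vector_derivative_diff has_vector_derivative_mult has_vector_derivative_add
        has_vector_derivative_const dJ assms vd_of_real dp2 dq1)
  also have "(of_real (p2 t) * (zf f t * of_real (q1 t) + 0) + of_real (p2' t) * (J1 f t + K)) -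
     (of_real (q1 t) * (zf f t * of_real (p2 t)) + of_real (- c * q t ^ (2*d - 1)) * J2 f t) = H' f t * of_real wron"
  proof -
    have "H' f t * of_real wron = of_real (p2' t) * (J1 f t + K) + of_real (c * q t ^ (2*d - 1)) * J2 f t"
      using wron_pos by (simp add: H'_def K_def)
    then show ?thesis by (simp add: algebra_simps)
  qed
  finally have "((\<lambda>t. of_real (p2 t) * (J1 f t + K) - of_real (q1 t) * J2 f t) has_vector_derivative
     H' f t * of_real wron) (at t within I2)" .
  from has_vector_derivative_mult[OF this has_vector_derivative_const[of "1 / complex_of_real wron"]]
  have "((\<lambda>t. (of_real (p2 t) * (J1 f t + K) - of_real (q1 t) * J2 f t) / of_real wron) has_vector_derivative H' f t) (at t within I2)"
    using wron_pos by simp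
  then show ?thesis unfolding H_def K_def .
qed

lemma dH':
  assumes "continuous_on I2 f" "t \<in> I2"
  shows "(H' f has_vector_derivative zf f t - of_real (pot t) * H f t) (at t within I2)"
proof -
  define K where "K = J2 f (2*pi) / of_real (2*pi)"
  have dc: "((\<lambda>t. c * q t ^ (2*d - 1)) has_real_derivative pot t * q1 t) (at t)"
    using DERIV_cmult[OF dqm[of t], of c] by (simp add: pot_def mult_ac)
  define z where "z = zf f t"
  have "((\<lambda>t. of_real (p2' t) * (J1 f t + K) + of_real (c * q t ^ (2*d - 1)) * J2 f t) has_vector_derivative
     (of_real (p2' t) * (z * of_real (q1 t) + 0) + of_real (- pot t * p2 t) * (J1 f t + K)) +
     (of_real (c * q t ^ (2*d - 1)) * (z * of_real (p2 t)) + of_real (pot t * q1 t) * J2 f t)) (at t within I2)"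
    unfolding z_def
    by (intro has_vector_derivative_diff has_vector_derivative_mult has_vector_derivative_add
        has_vector_derivative_const dJ assms vd_of_real dp2' dc)
  also have "(of_real (p2' t) * (z * of_real (q1 t) + 0) + of_real (- pot t * p2 t) * (J1 f t + K)) +
     (of_real (c * q t ^ (2*d - 1)) * (z * of_real (p2 t)) + of_real (pot t * q1 t) * J2 f t)
     = z * (of_real (p2' t) * of_real (q1 t) + of_real (c * q t ^ (2*d - 1)) * of_real (p2 t))
       - of_real (pot t) * (of_real (p2 t) * (J1 f t + K) - of_real (q1 t) * J2 f t)"
    by (simp add: algebra_simps)
  also have "\<dots> = (z - of_real (pot t) * H f t) * of_real wron"
    unfolding wronc using wron_pos by (simp add: H_def K_def left_diff_distrib)
  finally have "((\<lambda>t. of_real (p2' t) * (J1 f t + K) + of_real (c * q t ^ (2*d - 1)) * J2 f t) has_vector_derivative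
     (z - of_real (pot t) * H f t) * of_real wron) (at t within I2)" .
  from has_vector_derivative_mult[OF this has_vector_derivative_const[of "1 / complex_of_real wron"]]
  have "((\<lambda>t. (of_real (p2' t) * (J1 f t + K) + of_real (c * q t ^ (2*d - 1)) * J2 f t) / of_real wron) has_vector_derivative
     (z - of_real (pot t) * H f t)) (at t within I2)"
    using wron_pos by simp
  then show ?thesis unfolding H'_def K_def z_def .
qed

lemma J1_end:
  assumes "continuous_on I2 f"
  shows "J1 f (2*pi) = 0"
proof -
  have I: "(\<lambda>s. f s * of_real (q1 s)) integrable_on I2" "(\<lambda>s. mu f * of_real (cos s * q1 s)) integrable_on I2"
    by (intro integrable_continuous_interval continuous_intros contc cont assms)+
  have "((\<lambda>s. complex_of_real (cos s * q1 s)) has_integral of_real s0) I2"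
    unfolding s0_def by (intro has_integral_of_real integrable_integral integrable_continuous_interval continuous_intros cont)
  from integral_unique[OF has_integral_mult_right[OF this, of "mu f"]]
  have "integral I2 (\<lambda>s. mu f * of_real (cos s * q1 s)) = mu f * of_real s0" .
  moreover have "J1 f (2*pi) = integral I2 (\<lambda>s. f s * of_real (q1 s) - mu f * of_real (cos s * q1 s))"
    unfolding J1_def zf_def by (simp add: left_diff_distrib mult.assoc)
  moreover have "mu f * of_real s0 = integral I2 (\<lambda>s. f s * of_real (q1 s))"
    using s0_pos by (simp add: mu_def)
  ultimately show ?thesis by (simp only: integral_diff[OF I]) simp
qed

lemma H_per:
  assumes "continuous_on I2 f"
  shows "H f 0 = H f (2*pi)" "H' f 0 = H' f (2*pi)"
proof -
  have "p2 (2*pi) = p2 0 + 2*pi * q1 0" "q1 (2*pi) = q1 0" "q (2*pi) = q 0"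
    "p2' (2*pi) = p2' 0 - 2*pi * (c * q 0 ^ (2*d - 1))"
    using per[of 0] by (simp_all add: p2_def p2'_def)
  then have e: "complex_of_real (p2 (2*pi)) = of_real (p2 0) + of_real (2*pi) * of_real (q1 0)"
    "complex_of_real (p2' (2*pi)) = of_real (p2' 0) - of_real (2*pi) * of_real (c * q 0 ^ (2*d - 1))"
    "q1 (2*pi) = q1 0" "q (2*pi) = q 0"
    by simp_all
  have P: "complex_of_real (2*pi) \<noteq> 0" by simp
  have "(a + P * b) * (0 + X / P) - b * X = a * (0 + X / P) - b * 0"
    "(a - P * b) * (0 + X / P) + b * X = a * (0 + X / P) + b * 0" if "P \<noteq> 0" for a b X P :: complex
    using that by (simp_all add: field_simps)
  note this[OF P]
  moreover have "J1 f 0 = 0" "J2 f 0 = 0" by (simp_all add: J1_def J2_def)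
  ultimately show "H f 0 = H f (2*pi)" "H' f 0 = H' f (2*pi)"
    unfolding H_def H'_def e J1_end[OF assms] by (simp_all only:)
qed

text \<open>The second quantity is the second derivative of \<open>H f\<close>; these are exactly
  the two suprema needed for quadratic decay of the Fourier coefficients.\<close>

definition "Hbound C \<longleftrightarrow> 0 \<le> C \<and> (\<forall>f B t. continuous_on I2 f \<longrightarrow> (\<forall>s\<in>I2. norm (f s) \<le> B) \<longrightarrow> t \<in> I2 \<longrightarrow>
      norm (H f t) \<le> C * B \<and> norm (zf f t - of_real (pot t) * H f t) \<le> C * B)"

lemma H_bound: "\<exists>C. Hbound C"
proof -
  have bdd: "\<exists>M. \<forall>t\<in>I2. \<bar>g t\<bar> \<le> M" if "continuous_on I2 g" for g :: "real \<Rightarrow> real"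
  proof -
    have "bounded (g ` I2)" by (intro compact_imp_bounded compact_continuous_image that compact_Icc)
    then show ?thesis unfolding bounded_iff by auto
  qed
  obtain Ma Mb Mc where Ms: "\<forall>t\<in>I2. \<bar>q1 t\<bar> \<le> Ma" "\<forall>t\<in>I2. \<bar>p2 t\<bar> \<le> Mb" "\<forall>t\<in>I2. \<bar>pot t\<bar> \<le> Mc"
    using bdd[OF cont(2)] bdd[OF cont(3)] bdd[OF cont(5)] by blast
  define M where "M = max 0 (max Ma (max Mb Mc))"
  have "Ma \<le> M" "Mb \<le> M" "Mc \<le> M" by (simp_all add: M_def)
  then have M: "0 \<le> M" "\<And>t. t \<in> I2 \<Longrightarrow> \<bar>q1 t\<bar> \<le> M" "\<And>t. t \<in> I2 \<Longrightarrow> \<bar>p2 t\<bar> \<le> M" "\<And>t. t \<in> I2 \<Longrightarrow> \<bar>pot t\<bar> \<le> M"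
    using order_trans[OF bspec[OF Ms(1)]] order_trans[OF bspec[OF Ms(2)]] order_trans[OF bspec[OF Ms(3)]]
    by (simp add: M_def, blast+)
  define Z where "Z = 1 + M * (2*pi) / s0"
  have Z: "0 \<le> Z" using M(1) s0_pos by (simp add: Z_def)
  define N where "N = Z * M * (2*pi)"
  have N: "0 \<le> N" using Z M(1) by (simp add: N_def)
  define C1 where "C1 = (M * (N + N / (2*pi)) + M * N) / wron"
  have C1: "0 \<le> C1" using N M(1) wron_pos unfolding C1_def by (intro divide_nonneg_pos add_nonneg_nonneg mult_nonneg_nonneg) auto
  have "Hbound (C1 + (Z + M * C1))"
    unfolding Hbound_def
  proof (intro conjI allI impI)
    show "0 \<le> C1 + (Z + M * C1)" using C1 Z M(1) by simp
    fix f :: "real \<Rightarrow> complex" and B t :: real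
    assume f: "continuous_on I2 f" and B: "\<forall>s\<in>I2. norm (f s) \<le> B" and t: "t \<in> I2"
    note B = B[rule_format]
    have B0: "0 \<le> B" using order_trans[OF norm_ge_zero B[OF t]] .
    have "norm (integral I2 (\<lambda>s. f s * of_real (q1 s))) \<le> B * M * (2*pi - 0)"
      by (rule integral_bound) (use B M(2) B0 in \<open>auto simp: norm_mult intro!: continuous_intros contc f mult_mono\<close>)
    then have "norm (mu f) \<le> B * (M * (2*pi) / s0)"
      using s0_pos by (simp add: mu_def norm_divide field_simps)
    then have zb: "norm (zf f s) \<le> Z * B" if "s \<in> I2" for s
    proof -
      have "norm (zf f s) \<le> norm (f s) + norm (mu f * of_real (cos s))" unfolding zf_def by (rule norm_triangle_ineq4)
      also have "norm (mu f * of_real (cos s)) \<le> norm (mu f) * 1"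
        unfolding norm_mult by (rule mult_left_mono) auto
      also have "norm (f s) + norm (mu f) * 1 \<le> B + B * (M * (2*pi) / s0)"
        using B[OF that] \<open>norm (mu f) \<le> _\<close> by simp
      finally show ?thesis by (simp add: Z_def algebra_simps)
    qed
    have Jb: "norm (integral {0..u} (\<lambda>s. zf f s * of_real (g s))) \<le> N * B"
      if u: "u \<in> I2" and g: "continuous_on I2 g" "\<And>s. s \<in> I2 \<Longrightarrow> \<bar>g s\<bar> \<le> M" for u g
    proof -
      have "norm (integral {0..u} (\<lambda>s. zf f s * of_real (g s))) \<le> (Z * B * M) * (u - 0)"
      proof (rule integral_bound)
        show "continuous_on {0..u} (\<lambda>s. zf f s * of_real (g s))"
          by (rule continuous_on_subset[of I2]) (use u in \<open>auto intro!: continuous_intros cont_zf f g\<close>)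
        fix s assume "s \<in> {0..u}"
        then have "s \<in> I2" using u by auto
        then show "norm (zf f s * of_real (g s)) \<le> Z * B * M"
          using zb g(2) Z B0 by (auto simp: norm_mult intro!: mult_mono)
      qed (use u in auto)
      also have "\<dots> \<le> (Z * B * M) * (2*pi)"
        using u Z B0 M(1) by (intro mult_left_mono) auto
      finally show ?thesis by (simp add: N_def mult_ac)
    qed
    have 2: "2*pi \<in> I2" by simp
    have J: "norm (J1 f t) \<le> N * B" "norm (J2 f t) \<le> N * B" "norm (J2 f (2*pi)) \<le> N * B"
      unfolding J1_def J2_def by (rule Jb; fact t 2 cont M)+
    have "norm (J1 f t + J2 f (2*pi) / of_real (2*pi)) \<le> norm (J1 f t) + norm (J2 f (2*pi) / of_real (2*pi))"
      by (rule norm_triangle_ineq)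
    also have "\<dots> \<le> N * B + N * B / (2*pi)"
      using J by (intro add_mono) (simp_all add: norm_divide divide_right_mono)
    finally have Ja: "norm (J1 f t + J2 f (2*pi) / of_real (2*pi)) \<le> N * B + N * B / (2*pi)" .
    have "norm (of_real (p2 t) * (J1 f t + J2 f (2*pi) / of_real (2*pi)) - of_real (q1 t) * J2 f t)
      \<le> norm (of_real (p2 t) * (J1 f t + J2 f (2*pi) / of_real (2*pi))) + norm (of_real (q1 t) * J2 f t)"
      by (rule norm_triangle_ineq4)
    also have "\<dots> \<le> M * (N * B + N * B / (2*pi)) + M * (N * B)"
      unfolding norm_mult norm_of_real by (intro add_mono mult_mono Ja J M t) (use M(1) in auto)
    finally have "norm (H f t) \<le> (M * (N * B + N * B / (2*pi)) + M * (N * B)) / wron"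
      unfolding H_def norm_divide using wron_pos by (simp add: divide_right_mono)
    also have "\<dots> = C1 * B" by (simp add: C1_def field_simps)
    finally have Hb: "norm (H f t) \<le> C1 * B" .
    have "norm (zf f t - of_real (pot t) * H f t) \<le> norm (zf f t) + norm (of_real (pot t) * H f t)"
      by (rule norm_triangle_ineq4)
    also have "\<dots> \<le> Z * B + M * (C1 * B)"
      unfolding norm_mult norm_of_real by (intro add_mono mult_mono zb Hb M t) (use M(1) in auto)
    finally have "norm (zf f t - of_real (pot t) * H f t) \<le> (Z + M * C1) * B" by (simp add: algebra_simps)
    moreover have "C1 * B \<le> (C1 + (Z + M * C1)) * B" "(Z + M * C1) * B \<le> (C1 + (Z + M * C1)) * B"
      using C1 Z M(1) B0 by (auto intro!: mult_right_mono)
    ultimately show "norm (H f t) \<le> (C1 + (Z + M * C1)) * B"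
      "norm (zf f t - of_real (pot t) * H f t) \<le> (C1 + (Z + M * C1)) * B"
      using Hb by linarith+
  qed
  then show ?thesis ..
qed

definition G :: "int l1 \<Rightarrow> int l1" where
  "G y = Abs_l1 (fc (H (ev1 y)))"

definition ql :: "int l1" where
  "ql = Abs_l1 (fc (\<lambda>t. of_real (q t)))"

definition potl :: "int l1" where
  "potl = (c * real (2*d - 1)) *\<^sub>R ql ^ (2*d - 2)"

lemma cont_H: "continuous_on I2 f \<Longrightarrow> continuous_on I2 (H f)"
  using dH has_vector_derivative_continuous continuous_on_eq_continuous_within by blast

lemma
  shows summ_q: "fc (\<lambda>t. of_real (q t)) abs_summable_on UNIV"
    and q_eq: "- (of_int l)\<^sup>2 * coef ql l = - of_real c * coef (ql ^ (2*d - 1)) l"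
    and ev1_ql: "t \<in> I2 \<Longrightarrow> ev1 ql t = of_real (q t)"
proof -
  have d2: "x \<in> I2 \<Longrightarrow> ((\<lambda>t. complex_of_real (q t)) has_vector_derivative of_real (q1 x)) (at x within I2)"
    "x \<in> I2 \<Longrightarrow> ((\<lambda>t. complex_of_real (q1 t)) has_vector_derivative of_real (- c * q x ^ (2*d - 1))) (at x within I2)" for x
    by (rule vd_of_real, rule dq dq1)+
  have cc: "continuous_on I2 (\<lambda>x. complex_of_real (- c * q x ^ (2*d - 1)))" by (intro continuous_intros cont)
  have bdd: "\<exists>M. \<forall>t\<in>I2. norm (g t) \<le> M" if "continuous_on I2 g" for g :: "real \<Rightarrow> complex"
  proof -
    have "bounded (g ` I2)" by (intro compact_imp_bounded compact_continuous_image that compact_Icc)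
    then show ?thesis unfolding bounded_iff by auto
  qed
  obtain A B where A: "\<forall>t\<in>I2. norm (complex_of_real (q t)) \<le> A"
    and B: "\<forall>t\<in>I2. norm (complex_of_real (- c * q t ^ (2*d - 1))) \<le> B"
    using bdd[OF contc(4)] bdd[OF cc] by blast
  have pq: "complex_of_real (q 0) = of_real (q (2*pi))" "complex_of_real (q1 0) = of_real (q1 (2*pi))"
    using per[of 0] by simp_all
  note C2 = C2_fc[OF d2 cc pq A[rule_format] B[rule_format]]
  show summ: "fc (\<lambda>t. of_real (q t)) abs_summable_on UNIV"
    by (rule inv_sq_abs_summable) (rule C2(2))
  show ev: "ev1 ql t = of_real (q t)" if "t \<in> I2" for t
    unfolding ql_def by (rule fourier_inversion[OF contc(4) summ that, symmetric])
  have "coef (ql ^ (2*d - 1)) l = fc (ev1 (ql ^ (2*d - 1))) l" by (simp add: fc_ev1)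
  also have "\<dots> = fc (\<lambda>t. of_real (q t ^ (2*d - 1))) l"
    by (rule fc_cong) (simp add: e1.evl1_power ev)
  finally have "- of_real c * coef (ql ^ (2*d - 1)) l = fc (\<lambda>t. of_real (- c * q t ^ (2*d - 1))) l"
    using fc_cmult[of "- of_real c" "\<lambda>t. of_real (q t ^ (2*d - 1))" l] by simp
  then show "- (of_int l)\<^sup>2 * coef ql l = - of_real c * coef (ql ^ (2*d - 1)) l"
    using C2(1)[of l] by (simp add: ql_def coef_Abs_l1[OF summ])
qed

lemma real_ql: "real_l1 ql"
  unfolding ql_def by (rule real_l1_ivp[OF contc(4) _ summ_q]) simp

text \<open>Nonvanishing of one mode of the unperturbed solution. It survives small perturbations
  and later gives both \<nu> = 0 and nontriviality.\<close>

lemma Im_coef_ql: "Im (coef ql 1) < 0"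
proof -
  have "((\<lambda>t. Im (of_real (q t) * cis (- (of_int 1 * t)))) has_integral Im (of_real (2*pi) * fc (\<lambda>t. of_real (q t)) 1)) I2"
    by (rule has_integral_linear[OF fc_has_integral[OF contc(4)] bounded_linear_Im, unfolded o_def])
  then have "((\<lambda>t. - (q t * sin t)) has_integral 2*pi * Im (coef ql 1)) I2"
    by (simp add: ql_def coef_Abs_l1[OF summ_q])
  from integral_unique[OF has_integral_neg[OF this]] have "integral I2 (\<lambda>t. q t * sin t) = - (2*pi * Im (coef ql 1))"
    by simp
  then have "2*pi * Im (coef ql 1) < 0" using pos by linarith
  then show ?thesis by (simp add: mult_less_0_iff)
qed

lemma ev1_potl: "t \<in> I2 \<Longrightarrow> ev1 potl t = of_real (pot t)"
  unfolding potl_def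
  by (simp add: ev1_lin e1.evl1_power ev1_ql pot_def)

lemma cont_H'': "continuous_on I2 f \<Longrightarrow> continuous_on I2 (\<lambda>t. zf f t - of_real (pot t) * H f t)"
  by (intro continuous_intros cont_zf contc cont_H)

lemma summ_H: "fc (H (ev1 y)) abs_summable_on UNIV"
  and G_bound: "\<exists>C>0. \<forall>y. norm (G y) \<le> C * norm y"
proof -
  obtain C where "Hbound C" using H_bound by blast
  then have C: "0 \<le> C" "\<And>f B t. continuous_on I2 f \<Longrightarrow> (\<And>s. s \<in> I2 \<Longrightarrow> norm (f s) \<le> B) \<Longrightarrow> t \<in> I2 \<Longrightarrow>
      norm (H f t) \<le> C * B \<and> norm (zf f t - of_real (pot t) * H f t) \<le> C * B"
    by (auto simp: Hbound_def)
  have *: "(1 + (real_of_int l)\<^sup>2) * norm (fc (H (ev1 y)) l) \<le> C * norm y + C * norm y" for y l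
    by (rule C2_fc_bound[OF dH[OF continuous_ev1] dH'[OF continuous_ev1] cont_H''[OF continuous_ev1]
          H_per(1)[OF continuous_ev1] H_per(2)[OF continuous_ev1]
          conjunct1[OF C(2)[OF continuous_ev1 norm_evl1_le[OF e1.char_le]]]
          conjunct2[OF C(2)[OF continuous_ev1 norm_evl1_le[OF e1.char_le]]]])
  have "norm (G y) \<le> (C * norm y + C * norm y) * sum_inv_sq" for y
    unfolding G_def by (rule inv_sq_norm_le[OF *])
  also have "(C * norm y + C * norm y) * sum_inv_sq \<le> (2 * C * sum_inv_sq + 1) * norm y" for y :: "int l1"
    by (simp add: algebra_simps)
  finally have "norm (G y) \<le> (2 * C * sum_inv_sq + 1) * norm y" for y .
  moreover have "0 \<le> sum_inv_sq" by (rule has_sum_nonneg[OF inv_sq_has_sum]) (simp add: add_nonneg_nonneg)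
  then have "0 < 2 * C * sum_inv_sq + 1" using C(1) by (intro add_nonneg_pos mult_nonneg_nonneg) auto
  ultimately show "\<exists>C>0. \<forall>y. norm (G y) \<le> C * norm y" by blast
  show "fc (H (ev1 y)) abs_summable_on UNIV" by (rule inv_sq_abs_summable[OF *])
qed

lemma coef_G: "coef (G y) l = fc (H (ev1 y)) l"
  by (simp add: G_def coef_Abs_l1[OF summ_H])

lemma ev1_G: "t \<in> I2 \<Longrightarrow> ev1 (G y) t = H (ev1 y) t"
  unfolding G_def by (rule fourier_inversion[OF cont_H[OF continuous_ev1] summ_H, symmetric])

lemma bounded_linear_G: "bounded_linear G"
proof -
  obtain C where C: "\<And>y. norm (G y) \<le> C * norm y" using G_bound by blast
  show ?thesis
  proof (rule bounded_linear_intro[of _ C])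
    fix v w :: "int l1" and a :: real
    have "fc (H (ev1 (v + w))) l = fc (\<lambda>t. H (ev1 v) t + H (ev1 w) t) l" for l
      by (rule fc_cong) (simp add: ev1_lin H_lin(1)[OF continuous_ev1 continuous_ev1, symmetric])
    then show "G (v + w) = G v + G w"
      by (intro l1_eqI) (simp add: coef_G coef_simps fc_add cont_H continuous_ev1)
    have "fc (H (ev1 (a *\<^sub>R v))) l = fc (\<lambda>t. of_real a * H (ev1 v) t) l" for l
      by (rule fc_cong) (simp add: ev1_lin H_lin(2)[OF continuous_ev1 continuous_ev1, symmetric])
    then show "G (a *\<^sub>R v) = a *\<^sub>R G v"
      by (intro l1_eqI) (simp only: coef_G coef_scaleR fc_cmult, simp only: scaleR_conv_of_real)
    show "norm (G v) \<le> norm v * C" using C[of v] by (simp add: mult.commute)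
  qed
qed

lemma real_G:
  assumes "real_l1 y"
  shows "real_l1 (G y)"
  unfolding G_def
proof (rule real_l1_ivp[OF cont_H[OF continuous_ev1] _ summ_H])
  fix t assume t: "t \<in> I2"
  have "cnj (ev1 y t) = ev1 y t" for t by (metis real_ev1[OF assms] complex_cnj_complex_of_real)
  then have "(\<lambda>t. cnj (ev1 y t)) = ev1 y" by (rule ext)
  then show "cnj (H (ev1 y) t) = H (ev1 y) t"
    using H_lin(3)[OF continuous_ev1[where w = y] continuous_ev1[where w = y] t] by simp
qed

text \<open>The differential equation for \<open>H\<close> read on Fourier coefficients. The cosine
  term is the price of the one-dimensional cokernel and reappears as the multiplier \<nu>.\<close>

lemma G_eq: "- (of_int l)\<^sup>2 * coef (G y) l + coef (potl * G y) l = coef y l - mu (ev1 y) * coef cos_l1 l"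
proof -
  obtain C where "Hbound C" using H_bound by blast
  then have C: "0 \<le> C" "\<And>f B t. continuous_on I2 f \<Longrightarrow> (\<And>s. s \<in> I2 \<Longrightarrow> norm (f s) \<le> B) \<Longrightarrow> t \<in> I2 \<Longrightarrow>
      norm (H f t) \<le> C * B \<and> norm (zf f t - of_real (pot t) * H f t) \<le> C * B"
    by (auto simp: Hbound_def)
  let ?f = "ev1 y"
  have "fc (\<lambda>t. zf ?f t - of_real (pot t) * H ?f t) l = - (of_int l)\<^sup>2 * fc (H ?f) l"
    by (rule fc_deriv2[OF dH[OF continuous_ev1] dH'[OF continuous_ev1] cont_H''[OF continuous_ev1]
          H_per(1)[OF continuous_ev1] H_per(2)[OF continuous_ev1]
          conjunct1[OF C(2)[OF continuous_ev1 norm_evl1_le[OF e1.char_le]]]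
          conjunct2[OF C(2)[OF continuous_ev1 norm_evl1_le[OF e1.char_le]]]])
  moreover have "fc (\<lambda>t. zf ?f t - of_real (pot t) * H ?f t) l = fc (zf ?f) l - fc (\<lambda>t. of_real (pot t) * H ?f t) l"
    by (rule fc_diff) (intro cont_zf continuous_intros contc cont_H continuous_ev1)+
  moreover have "fc (zf ?f) l = fc ?f l - fc (\<lambda>t. mu ?f * of_real (cos t)) l"
    unfolding zf_def by (rule fc_diff) (intro continuous_intros contc continuous_ev1)+
  moreover have "fc (\<lambda>t. mu ?f * of_real (cos t)) l = mu ?f * coef cos_l1 l"
    by (simp only: fc_cmult ev1_cos_l1[symmetric] fc_ev1)
  moreover have "fc (\<lambda>t. of_real (pot t) * H ?f t) l = fc (ev1 (potl * G y)) l"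
    by (rule fc_cong) (simp add: e1.evl1_mult ev1_potl ev1_G)
  ultimately have "- (of_int l)\<^sup>2 * coef (G y) l = coef y l - mu ?f * coef cos_l1 l - coef (potl * G y) l"
    by (simp only: fc_ev1 coef_G)
  then show ?thesis by (simp only: diff_add_cancel)
qed

end

subsection \<open>The nonlinearity as an analytic map of the algebra\<close>

text \<open>A geometric constant instead of the sharp \<open>k * R^(k-1)\<close>; the radius of
  convergence absorbs it.\<close>

lemma power_diff_le:
  fixes v w :: "'a::{real_normed_algebra_1, comm_ring_1}"
  assumes "norm v \<le> R" "norm w \<le> R" "1 \<le> R"
  shows "norm (v ^ k - w ^ k) \<le> (2 * R) ^ k * norm (v - w)"
proof (induction k)
  case (Suc k)
  have wk: "norm (w ^ k) \<le> R ^ k" by (rule order_trans[OF norm_power_ineq power_mono[OF assms(2) norm_ge_zero]])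
  have "v ^ Suc k - w ^ Suc k = v * (v ^ k - w ^ k) + (v - w) * w ^ k" by (simp add: algebra_simps)
  also have "norm \<dots> \<le> R * ((2 * R) ^ k * norm (v - w)) + norm (v - w) * R ^ k"
    by (intro norm_triangle_le add_mono norm_mult_ineq[THEN order_trans] mult_mono Suc assms wk) (use assms in auto)
  also have "\<dots> \<le> R * ((2 * R) ^ k * norm (v - w)) + R * ((2 * R) ^ k * norm (v - w))"
  proof -
    have "R ^ k \<le> (2 * R) ^ k" using assms(3) by (intro power_mono) auto
    also have "\<dots> \<le> R * (2 * R) ^ k" using mult_right_mono[of 1 R "(2 * R) ^ k"] assms(3) by simp
    finally have "norm (v - w) * R ^ k \<le> norm (v - w) * (R * (2 * R) ^ k)" by (rule mult_left_mono) simp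
    then show ?thesis by (simp add: mult_ac)
  qed
  also have "\<dots> = (2 * R) ^ Suc k * norm (v - w)" by (simp add: algebra_simps)
  finally show ?case .
qed simp

text \<open>Second-order Taylor estimate around \<open>q\<close>. The constant is uniform in
  \<open>v\<close>, \<open>w\<close> and \<tau>, so \<tau> can later be taken as the radius of the
  contraction ball.\<close>

lemma power_linearisation:
  fixes q :: "'a::{real_normed_algebra_1, comm_ring_1}"
  assumes R: "1 \<le> R" "norm q \<le> R"
  shows "\<exists>C\<ge>0. \<forall>v w \<tau>. norm v \<le> R \<longrightarrow> norm w \<le> R \<longrightarrow> norm (v - q) \<le> \<tau> \<longrightarrow> norm (w - q) \<le> \<tau> \<longrightarrow>
    norm (v ^ k - w ^ k - of_nat k * q ^ (k - 1) * (v - w)) \<le> C * \<tau> * norm (v - w)"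
proof (induction k)
  case (Suc k)
  then obtain C where C: "0 \<le> C" "\<And>v w \<tau>. norm v \<le> R \<Longrightarrow> norm w \<le> R \<Longrightarrow> norm (v - q) \<le> \<tau> \<Longrightarrow> norm (w - q) \<le> \<tau> \<Longrightarrow>
    norm (v ^ k - w ^ k - of_nat k * q ^ (k - 1) * (v - w)) \<le> C * \<tau> * norm (v - w)" by blast
  define C2 where "C2 = norm (of_nat k * q ^ (k - 1))"
  have C2: "0 \<le> C2" by (simp add: C2_def)
  show ?case
  proof (intro exI[of _ "R * C + C2 + (2 * R) ^ k"] conjI allI impI)
    show "0 \<le> R * C + C2 + (2 * R) ^ k" using R C C2 by simp
    fix v w \<tau>
    assume v: "norm v \<le> R" and w: "norm w \<le> R" and vq: "norm (v - q) \<le> \<tau>" and wq: "norm (w - q) \<le> \<tau>"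
    have \<tau>: "0 \<le> \<tau>" using order_trans[OF norm_ge_zero vq] .
    have k: "q * (of_nat k * q ^ (k - 1)) = of_nat k * q ^ k" by (cases k) (simp_all add: mult_ac)
    \<comment> \<open>In the linear term one factor \<open>v\<close> is exchanged for
      \<open>q\<close>, in the last term \<open>w ^ k\<close> for \<open>q ^ k\<close>; each
      exchange costs a factor of order \<tau>.\<close>
    have "v ^ Suc k - w ^ Suc k - of_nat (Suc k) * q ^ k * (v - w) =
        v * (v ^ k - w ^ k - of_nat k * q ^ (k - 1) * (v - w)) + (v - q) * ((of_nat k * q ^ (k - 1)) * (v - w))
        + (w ^ k - q ^ k) * (v - w)"
      using k by (simp add: algebra_simps)
    also have "norm \<dots> \<le> R * (C * \<tau> * norm (v - w)) + \<tau> * (C2 * norm (v - w)) + ((2 * R) ^ k * \<tau>) * norm (v - w)"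
    proof (intro norm_triangle_le add_mono)
      show "norm (v * (v ^ k - w ^ k - of_nat k * q ^ (k - 1) * (v - w))) \<le> R * (C * \<tau> * norm (v - w))"
        using R by (intro order_trans[OF norm_mult_ineq mult_mono[OF v C(2)[OF v w vq wq]]]) auto
      show "norm ((v - q) * ((of_nat k * q ^ (k - 1)) * (v - w))) \<le> \<tau> * (C2 * norm (v - w))"
        unfolding C2_def by (intro order_trans[OF norm_mult_ineq mult_mono[OF vq norm_mult_ineq]] \<tau> norm_ge_zero)
      have "norm (w ^ k - q ^ k) \<le> (2 * R) ^ k * \<tau>"
        using R by (intro order_trans[OF power_diff_le[OF w R(2) R(1)] mult_left_mono[OF wq]]) auto
      then show "norm ((w ^ k - q ^ k) * (v - w)) \<le> ((2 * R) ^ k * \<tau>) * norm (v - w)"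
        by (intro order_trans[OF norm_mult_ineq mult_right_mono]) auto
    qed
    also have "\<dots> = (R * C + C2 + (2 * R) ^ k) * \<tau> * norm (v - w)" by (simp add: algebra_simps)
    finally show "norm (v ^ Suc k - w ^ Suc k - of_nat (Suc k) * q ^ (Suc k - 1) * (v - w))
        \<le> (R * C + C2 + (2 * R) ^ k) * \<tau> * norm (v - w)" by simp
  qed
qed (auto intro: exI[of _ 0])

text \<open>\<open>A j\<close> stands for the coefficient of the power \<open>m + j\<close>, a
  function of the first variable alone (\<open>A_supp\<close>). The majorant \<open>b\<close> is
  separate from the norms because the same \<open>b\<close> will also bound weighted norms. After
  \<open>u = \<delta> * w\<close> and division by \<open>\<delta>^m\<close> the nonlinearity becomes
  \<open>N\<close>, a perturbation of \<open>A 0 * w ^ m\<close>.\<close>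

locale nonlinearity =
  fixes A :: "nat \<Rightarrow> (int \<times> int) l1" and b :: "nat \<Rightarrow> real" and \<rho> :: real and m :: nat
  assumes m: "0 < m" and \<rho>: "0 < \<rho>" and b: "\<And>j. norm (A j) \<le> b j" and bsum: "summable (\<lambda>j. b j * \<rho> ^ j)"
    and A_real: "\<And>j. real_l1 (A j)"
    and A_supp: "\<And>j l. snd l \<noteq> 0 \<Longrightarrow> coef (A j) l = 0"
begin

definition N :: "real \<Rightarrow> (int \<times> int) l1 \<Rightarrow> (int \<times> int) l1" where
  "N \<delta> w = (\<Sum>j. \<delta> ^ j *\<^sub>R (A j * w ^ (m + j)))"

definition "Sb = (\<Sum>j. b j * \<rho> ^ j)"
definition "L R = (2 * R) ^ m * Sb + (2 * R) ^ Suc m * Sb / \<rho>"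

lemma b0: "0 \<le> b j" using order_trans[OF norm_ge_zero b] .

lemma Sb0: "0 \<le> Sb" unfolding Sb_def using b0 \<rho> by (intro suminf_nonneg bsum) simp

lemma L0: "0 \<le> R \<Longrightarrow> 0 \<le> L R" unfolding L_def using Sb0 \<rho> by simp

lemma delta_pow:
  assumes "0 \<le> \<delta>" "2 * R * \<delta> \<le> \<rho>" "1 \<le> R"
  shows "\<delta> ^ j * (2 * R) ^ (m + j) \<le> (2 * R) ^ m * \<rho> ^ j"
proof -
  have "(2 * R * \<delta>) ^ j \<le> \<rho> ^ j" using assms by (intro power_mono) auto
  then have "(2 * R) ^ m * (2 * R * \<delta>) ^ j \<le> (2 * R) ^ m * \<rho> ^ j" using assms by (intro mult_left_mono) auto
  then show ?thesis by (simp add: power_add power_mult_distrib mult_ac)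
qed

lemma norm_scaled_term:
  assumes "0 \<le> a" "norm x \<le> B"
  shows "norm (a *\<^sub>R (A j * x)) \<le> a * (b j * B)"
proof -
  have "norm (A j * x) \<le> b j * B"
    by (rule order_trans[OF norm_mult_ineq mult_mono[OF b assms(2) b0 norm_ge_zero]])
  then show ?thesis using assms(1) by (simp add: mult_left_mono)
qed

lemma term_diff:
  assumes \<delta>: "0 \<le> \<delta>" "2 * R * \<delta> \<le> \<rho>" "1 \<le> R" and v: "norm v \<le> R" and w: "norm w \<le> R"
  shows "norm (\<delta> ^ j *\<^sub>R (A j * v ^ (m + j)) - \<delta> ^ j *\<^sub>R (A j * w ^ (m + j))) \<le> (2 * R) ^ m * norm (v - w) * (b j * \<rho> ^ j)"
proof -
  have "\<delta> ^ j *\<^sub>R (A j * v ^ (m + j)) - \<delta> ^ j *\<^sub>R (A j * w ^ (m + j)) = \<delta> ^ j *\<^sub>R (A j * (v ^ (m + j) - w ^ (m + j)))"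
    by (simp add: algebra_simps)
  also have "norm \<dots> \<le> \<delta> ^ j * (b j * ((2 * R) ^ (m + j) * norm (v - w)))"
    using \<delta> by (intro norm_scaled_term power_diff_le v w) auto
  also have "\<dots> = (\<delta> ^ j * (2 * R) ^ (m + j)) * (b j * norm (v - w))" by (simp add: mult_ac)
  also have "\<dots> \<le> ((2 * R) ^ m * \<rho> ^ j) * (b j * norm (v - w))"
    using b0 by (intro mult_right_mono delta_pow \<delta>) simp
  finally show ?thesis by (simp add: mult_ac)
qed

lemma term_summable:
  assumes \<delta>: "0 \<le> \<delta>" "2 * R * \<delta> \<le> \<rho>" "1 \<le> R" and v: "norm v \<le> R"
  shows "summable (\<lambda>j. \<delta> ^ j *\<^sub>R (A j * v ^ (m + j)))"
proof (rule summable_comparison_test'[OF summable_mult[OF bsum, of "(2 * R) ^ m * norm v"], of 0])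
  fix j
  have z: "(0 :: (int \<times> int) l1) ^ (m + j) = 0" using m by (cases "m + j") auto
  show "norm (\<delta> ^ j *\<^sub>R (A j * v ^ (m + j))) \<le> (2 * R) ^ m * norm v * (b j * \<rho> ^ j)"
    using term_diff[OF \<delta> v, of 0 j] \<delta> by (simp add: z)
qed

lemma N_zero: "N \<delta> 0 = 0"
proof -
  have z: "(0 :: (int \<times> int) l1) ^ (m + j) = 0" for j using m by (cases "m + j") auto
  show ?thesis by (simp add: N_def z)
qed

text \<open>The second estimate gains a factor \<delta> because the leading term is the only one
  carrying no power of \<delta>; \<open>L R\<close> is large enough for both.\<close>

lemma N_lipschitz:
  assumes \<delta>: "0 \<le> \<delta>" "2 * R * \<delta> \<le> \<rho>" "1 \<le> R" and v: "norm v \<le> R" and w: "norm w \<le> R"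
  shows "norm (N \<delta> v - N \<delta> w) \<le> L R * norm (v - w)"
    "norm ((N \<delta> v - A 0 * v ^ m) - (N \<delta> w - A 0 * w ^ m)) \<le> \<delta> * L R * norm (v - w)"
proof -
  note S = term_summable[OF \<delta>]
  let ?t = "\<lambda>v j. \<delta> ^ j *\<^sub>R (A j * v ^ (m + j))"
  have "N \<delta> v - N \<delta> w = (\<Sum>j. ?t v j - ?t w j)"
    unfolding N_def by (rule suminf_diff[OF S[OF v] S[OF w]])
  also have "norm \<dots> \<le> (\<Sum>j. (2 * R) ^ m * norm (v - w) * (b j * \<rho> ^ j))"
    by (rule norm_suminf_le[OF term_diff[OF \<delta> v w] summable_mult[OF bsum]])
  also have "\<dots> = (2 * R) ^ m * Sb * norm (v - w)"
    unfolding Sb_def suminf_mult[OF bsum] by (simp only: mult_ac)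
  also have "\<dots> \<le> L R * norm (v - w)"
    unfolding L_def using \<delta> \<rho> Sb0 by (intro mult_right_mono) auto
  finally show "norm (N \<delta> v - N \<delta> w) \<le> L R * norm (v - w)" .
  have split: "N \<delta> v - A 0 * v ^ m = (\<Sum>j. ?t v (Suc j))" if "norm v \<le> R" for v
    unfolding N_def using suminf_split_head[OF S[OF that]] by simp
  have S': "summable (\<lambda>j. ?t v (Suc j))" if "norm v \<le> R" for v
    using S[OF that] by (subst summable_Suc_iff)
  have bs': "summable (\<lambda>j. b (Suc j) * \<rho> ^ Suc j)" using bsum by (subst summable_Suc_iff)
  have td: "norm (?t v (Suc j) - ?t w (Suc j)) \<le> \<delta> * (2 * R) ^ Suc m * norm (v - w) / \<rho> * (b (Suc j) * \<rho> ^ Suc j)" for j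
  proof -
    have "?t v (Suc j) - ?t w (Suc j) = \<delta> ^ Suc j *\<^sub>R (A (Suc j) * (v ^ (m + Suc j) - w ^ (m + Suc j)))"
      by (simp add: algebra_simps)
    also have "norm \<dots> \<le> \<delta> ^ Suc j * (b (Suc j) * ((2 * R) ^ (m + Suc j) * norm (v - w)))"
      using \<delta> by (intro norm_scaled_term power_diff_le v w) auto
    also have "\<dots> = (\<delta> ^ j * (2 * R) ^ (m + j)) * (\<delta> * (2 * R) * b (Suc j) * norm (v - w))" by (simp add: mult_ac)
    also have "\<dots> \<le> ((2 * R) ^ m * \<rho> ^ j) * (\<delta> * (2 * R) * b (Suc j) * norm (v - w))"
      using b0 \<delta> by (intro mult_right_mono delta_pow \<delta>) auto
    also have "\<dots> = \<delta> * (2 * R) ^ Suc m * norm (v - w) / \<rho> * (b (Suc j) * \<rho> ^ Suc j)"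
      using \<rho> by simp
    finally show ?thesis .
  qed
  have "(N \<delta> v - A 0 * v ^ m) - (N \<delta> w - A 0 * w ^ m) = (\<Sum>j. ?t v (Suc j) - ?t w (Suc j))"
    unfolding split[OF v] split[OF w] by (rule suminf_diff[OF S'[OF v] S'[OF w]])
  also have "norm \<dots> \<le> (\<Sum>j. \<delta> * (2 * R) ^ Suc m * norm (v - w) / \<rho> * (b (Suc j) * \<rho> ^ Suc j))"
    by (rule norm_suminf_le[OF td summable_mult[OF bs']])
  also have "\<dots> = \<delta> * (2 * R) ^ Suc m * norm (v - w) / \<rho> * (Sb - b 0)"
    unfolding suminf_mult[OF bs'] Sb_def suminf_split_head[OF bsum] by simp
  also have "\<dots> \<le> \<delta> * (2 * R) ^ Suc m * norm (v - w) / \<rho> * Sb"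
    using b0[of 0] \<delta> \<rho> by (intro mult_left_mono) auto
  also have "\<dots> \<le> \<delta> * L R * norm (v - w)"
  proof -
    have "(2 * R) ^ Suc m * Sb / \<rho> \<le> L R" unfolding L_def using Sb0 \<delta>(3) by simp
    then have "(\<delta> * norm (v - w)) * ((2 * R) ^ Suc m * Sb / \<rho>) \<le> (\<delta> * norm (v - w)) * L R"
      using \<delta> by (intro mult_left_mono) auto
    then show ?thesis by (simp add: mult_ac)
  qed
  finally show "norm ((N \<delta> v - A 0 * v ^ m) - (N \<delta> w - A 0 * w ^ m)) \<le> \<delta> * L R * norm (v - w)" .
qed

lemma N_bound:
  assumes \<delta>: "0 \<le> \<delta>" "2 * R * \<delta> \<le> \<rho>" "1 \<le> R" and v: "norm v \<le> R"
  shows "norm (N \<delta> v) \<le> L R * R" "norm (N \<delta> v - A 0 * v ^ m) \<le> \<delta> * L R * R"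
proof -
  have "0 ^ m = (0 :: (int \<times> int) l1)" using m by (cases m) auto
  then have 1: "norm (N \<delta> v) \<le> L R * norm v" "norm (N \<delta> v - A 0 * v ^ m) \<le> \<delta> * L R * norm v"
    using N_lipschitz[OF \<delta> v, of 0] \<delta> by (simp_all add: N_zero)
  have "L R * norm v \<le> L R * R" "\<delta> * L R * norm v \<le> \<delta> * L R * R"
    using v L0[of R] \<delta> by (auto intro!: mult_left_mono)
  with 1 show "norm (N \<delta> v) \<le> L R * R" "norm (N \<delta> v - A 0 * v ^ m) \<le> \<delta> * L R * R" by linarith+
qed

lemma real_N:
  assumes \<delta>: "0 \<le> \<delta>" "2 * R * \<delta> \<le> \<rho>" "1 \<le> R" and v: "norm v \<le> R" "real_l1 v"
  shows "real_l1 (N \<delta> v)"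
  unfolding N_def
  by (intro real_l1_suminf term_summable[OF \<delta> v(1)] real_l1_scaleR real_l1_mult A_real real_l1_power v)

lemma wle_N:
  assumes \<delta>: "0 \<le> \<delta>" "2 * R * \<delta> \<le> \<rho>" "1 \<le> R" and v: "norm v \<le> R" "wle W v R"
    and W: "\<And>l. 0 \<le> W l" "\<And>l k. W (l + k) \<le> W l * W k" and A: "\<And>j. wle W (A j) (b j)"
  shows "wle W (N \<delta> v) (L R)"
proof -
  have "wle W (\<delta> ^ j *\<^sub>R (A j * v ^ (m + j))) ((2 * R) ^ m * (b j * \<rho> ^ j))" for j
  proof -
    obtain k where k: "m + j = Suc k" using m by (cases "m + j") auto
    have "wle W (\<delta> ^ j *\<^sub>R (A j * v ^ (m + j))) (\<bar>\<delta> ^ j\<bar> * (b j * R ^ (m + j)))"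
      unfolding k by (intro wle_scaleR wle_mult A wle_power v W)
    moreover have "\<bar>\<delta> ^ j\<bar> * (b j * R ^ (m + j)) \<le> (2 * R) ^ m * (b j * \<rho> ^ j)"
    proof -
      have "\<delta> ^ j * R ^ (m + j) \<le> \<delta> ^ j * (2 * R) ^ (m + j)"
        using \<delta> by (intro mult_left_mono power_mono) auto
      also have "\<dots> \<le> (2 * R) ^ m * \<rho> ^ j" by (rule delta_pow[OF \<delta>])
      finally have "b j * (\<delta> ^ j * R ^ (m + j)) \<le> b j * ((2 * R) ^ m * \<rho> ^ j)" using b0 by (rule mult_left_mono)
      then show ?thesis using \<delta> by (simp add: mult_ac)
    qed
    ultimately show ?thesis by (rule wle_le)
  qed
  then have "wle W (N \<delta> v) (\<Sum>j. (2 * R) ^ m * (b j * \<rho> ^ j))"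
    unfolding N_def by (rule wle_suminf[OF term_summable[OF \<delta> v(1)] _ summable_mult[OF bsum] W(1)])
  moreover have "(\<Sum>j. (2 * R) ^ m * (b j * \<rho> ^ j)) \<le> L R"
    unfolding suminf_mult[OF bsum] Sb_def[symmetric] L_def using Sb0 \<rho> \<delta>(3) by simp
  ultimately show ?thesis by (rule wle_le)
qed

text \<open>\<open>hasd v v'\<close>: \<open>v'\<close> is the derivative of \<open>v\<close> with respect to \<open>\<phi>\<^sub>2\<close>.\<close>

definition hasd :: "(int \<times> int) l1 \<Rightarrow> (int \<times> int) l1 \<Rightarrow> bool" where
  "hasd v v' \<longleftrightarrow> (\<forall>l. coef v' l = \<i> * of_int (snd l) * coef v l)"

lemma hasd_mult:
  assumes "hasd v v'" "hasd w w'"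
  shows "hasd (v * w) (v' * w + v * w')"
  unfolding hasd_def
proof
  fix l
  have "((\<lambda>k. coef v' k * coef w (l - k) + coef v k * coef w' (l - k)) has_sum coef (v' * w) l + coef (v * w') l) UNIV"
    by (intro has_sum_add coef_mult_has_sum)
  moreover have "coef v' k * coef w (l - k) + coef v k * coef w' (l - k) = \<i> * of_int (snd l) * (coef v k * coef w (l - k))" for k
    by (simp only: assms[unfolded hasd_def, rule_format] snd_diff of_int_diff) (simp add: algebra_simps)
  moreover have "((\<lambda>k. \<i> * of_int (snd l) * (coef v k * coef w (l - k))) has_sum \<i> * of_int (snd l) * coef (v * w) l) UNIV"
    by (intro has_sum_cmult_right coef_mult_has_sum)
  ultimately show "coef (v' * w + v * w') l = \<i> * of_int (snd l) * coef (v * w) l"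
    using has_sum_unique by (simp add: coef_plus) blast
qed

lemma hasd_power: "hasd v v' \<Longrightarrow> hasd (v ^ Suc k) (of_nat (Suc k) * v ^ k * v')"
proof (induction k)
  case (Suc k)
  from hasd_mult[OF Suc(2) Suc(1)[OF Suc(2)]] show ?case by (simp add: algebra_simps)
qed simp

lemma hasd_A: "hasd (A j) 0"
  unfolding hasd_def
proof
  show "coef 0 l = \<i> * of_int (snd l) * coef (A j) l" for l
    by (cases "snd l = 0") (simp_all add: coef_zero A_supp)
qed

lemma hasd_coef_0: "hasd v v' \<Longrightarrow> coef v' 0 = 0"
  unfolding hasd_def by (drule spec[of _ 0]) simp

text \<open>The nonlinearity is a gradient, so it is orthogonal to translations in \<open>\<phi>\<^sub>2\<close>.\<close>

lemma N_orthogonal: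
  assumes \<delta>: "0 \<le> \<delta>" "2 * R * \<delta> \<le> \<rho>" "1 \<le> R" and v: "norm v \<le> R" "hasd v v'"
  shows "coef (v' * N \<delta> v) 0 = 0"
proof -
  \<comment> \<open>\<open>v' * (A j * v ^ k)\<close> is, up to the factor \<open>Suc k\<close>, the
    derivative in the second variable of \<open>A j * v ^ Suc k\<close>, and a derivative has mean
    zero. The coefficient at index 0 is the mean over the torus.\<close>
  have z: "coef (v' * (A j * v ^ k)) 0 = 0" for j k
  proof -
    have "hasd (A j * v ^ Suc k) (0 * v ^ Suc k + A j * (of_nat (Suc k) * v ^ k * v'))"
      by (intro hasd_mult hasd_A hasd_power v)
    from hasd_coef_0[OF this] have "coef (A j * (of_nat (Suc k) * v ^ k * v')) 0 = 0" by simp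
    moreover have "A j * (of_nat (Suc k) * v ^ k * v') = real (Suc k) *\<^sub>R (v' * (A j * v ^ k))"
      by (simp add: scaleR_conv_of_real mult_ac del: of_nat_Suc)
    ultimately show ?thesis by (simp add: coef_scaleR)
  qed
  have "coef (v' * N \<delta> v) 0 = (\<Sum>j. coef (v' * (\<delta> ^ j *\<^sub>R (A j * v ^ (m + j)))) 0)"
    unfolding N_def
    using bounded_linear.suminf[OF bounded_linear_compose[OF bounded_linear_coef[of 0] bounded_linear_mult_right[of v']] term_summable[OF \<delta> v(1)]]
    by simp
  also have "\<dots> = 0" by (simp add: coef_scaleR z)
  finally show ?thesis .
qed

end

subsection \<open>The fixed point argument\<close>

lemma coef_mono_mult: "coef (mono_l1 a z * x) l = z * coef x (l - a)"
proof -
  have "((\<lambda>m. coef (mono_l1 a z) m * coef x (l - m)) has_sum z * coef x (l - a)) UNIV"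
    by (rule has_sum_finite_neutralI[of "{a}"]) (auto simp: coef_mono)
  then show ?thesis using coef_mult_has_sum has_sum_unique by blast
qed

definition j2 :: "int \<Rightarrow> int \<times> int" where "j2 l = (0, l)"

lemma inj_j2: "inj j2" and j2_add: "j2 (l + m) = j2 l + j2 m"
  by (auto simp: j2_def inj_def)

text \<open>\<open>ps (pl w)\<close> is the part of \<open>w\<close> independent of the first
  variable, and \<open>w - ps (pl w)\<close> carries the modes with nonzero first index.\<close>

abbreviation "ps \<equiv> push j2"
abbreviation "pl \<equiv> pull j2"

lemmas bounded_linear_ps = bounded_linear_push[OF inj_j2]
lemmas bounded_linear_pl = bounded_linear_pull[OF inj_j2]
lemmas ps_linear = bounded_linear.linear[OF bounded_linear_ps]
lemmas pl_linear = bounded_linear.linear[OF bounded_linear_pl]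
lemmas ps_simps = linear_add[OF ps_linear] linear_diff[OF ps_linear] linear_scale[OF ps_linear]
lemmas pl_simps = linear_add[OF pl_linear] linear_diff[OF pl_linear] linear_scale[OF pl_linear]
lemmas norm_ps = norm_push_le[OF inj_j2]
lemmas norm_pl = norm_pull_le[OF inj_j2]

lemma coef_pl: "coef (pl w) l = coef w (0, l)"
  by (simp add: coef_pull[OF inj_j2] j2_def)

lemma coef_ps: "coef (ps u) l = (if fst l = 0 then coef u (snd l) else 0)"
proof (cases "fst l = 0")
  case True
  then have "l = j2 (snd l)" by (simp add: j2_def prod_eq_iff)
  then show ?thesis using coef_push_image[OF inj_j2, of u "snd l"] True by simp
next
  case False
  then have "l \<notin> range j2" by (auto simp: j2_def)
  then show ?thesis using False by (simp add: coef_push[OF inj_j2])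
qed

lemma pl_ps: "pl (ps u) = u"
  by (rule l1_eqI) (simp add: coef_pl coef_ps)

lemma ps_mono: "ps (mono_l1 a z) = mono_l1 (0, a) z"
  by (simp add: push_mono[OF inj_j2] j2_def)

lemma pl_ps_mult: "pl (ps u * x) = u * pl x"
proof (rule bounded_linear_eq_mono[of "\<lambda>u. pl (ps u * x)" "\<lambda>u. u * pl x"])
  show "bounded_linear (\<lambda>u. pl (ps u * x))"
    by (rule bounded_linear_compose[OF bounded_linear_pl bounded_linear_compose[OF bounded_linear_mult_left bounded_linear_ps]])
  show "bounded_linear (\<lambda>u. u * pl x)" by (rule bounded_linear_mult_left)
  show "pl (ps (mono_l1 l c) * x) = mono_l1 l c * pl x" for l c
    by (rule l1_eqI) (simp add: coef_pl ps_mono coef_mono_mult)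
qed

lemma real_ps: "real_l1 u \<Longrightarrow> real_l1 (ps u)"
  unfolding real_l1_def by (simp add: coef_ps)

lemma real_pl: "real_l1 w \<Longrightarrow> real_l1 (pl w)"
  unfolding real_l1_def coef_pl by (metis uminus_Pair neg_equal_zero)

lemma ps_power: "ps (u ^ n) = ps u ^ n"
  by (rule push_power[OF inj_j2 j2_add])

lemma fixed_point_in_closed:
  fixes f :: "'a::banach \<Rightarrow> 'a"
  assumes "closed S" "S \<noteq> {}" "\<And>x. x \<in> S \<Longrightarrow> f x \<in> S"
    "\<And>x y. x \<in> S \<Longrightarrow> y \<in> S \<Longrightarrow> norm (f x - f y) \<le> (1/2) * norm (x - y)"
  shows "\<exists>x\<in>S. f x = x"
proof -
  have "\<exists>!x. x \<in> S \<and> f x = x"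
    by (rule Banach_fix[of S "1/2"])
       (use assms in \<open>auto simp: complete_eq_closed dist_norm\<close>)
  then show ?thesis by blast
qed

text \<open>\<eta> is the sign of the mean of \<open>A 0\<close>. The normalisation
  \<open>2 * c\<close> fits \<open>D (0, k) = \<epsilon> (2 + \<epsilon>) k^2\<close>: after
  division by |\<epsilon>| the averaged equation tends to the oscillator with force constant
  \<open>c\<close>. The weight \<open>W1\<close> acts on the first index only.\<close>

locale forced = oscillator d c q q1 + nonlinearity A b \<rho> m
  for d c q q1 A b \<rho> m +
  fixes \<eta> \<gamma>0 :: real and W1 :: "int \<Rightarrow> real"
  assumes m_eq: "m = 2*d - 1" and \<eta>: "\<eta> = 1 \<or> \<eta> = -1" and mean: "coef (A 0) 0 = of_real (\<eta> * 2 * c)" and \<gamma>0: "0 < \<gamma>0"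
    and W1: "\<And>l. 1 \<le> W1 l" "\<And>l k. W1 (l + k) \<le> W1 l * W1 k"
    and A_wle: "\<And>j. wle (\<lambda>l. W1 (fst l)) (A j) (b j)"
begin

lemma pl_A0_ps: "pl (A 0 * ps u) = (\<eta> * 2 * c) *\<^sub>R u"
proof (rule bounded_linear_eq_mono[of "\<lambda>u. pl (A 0 * ps u)" "\<lambda>u. (\<eta> * 2 * c) *\<^sub>R u"])
  show "bounded_linear (\<lambda>u. pl (A 0 * ps u))"
    by (rule bounded_linear_compose[OF bounded_linear_pl bounded_linear_compose[OF bounded_linear_mult_right bounded_linear_ps]])
  show "bounded_linear (\<lambda>u :: int l1. (\<eta> * 2 * c) *\<^sub>R u)" by (rule bounded_linear_scaleR_right)
  show "pl (A 0 * ps (mono_l1 a z)) = (\<eta> * 2 * c) *\<^sub>R mono_l1 a z" for a z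
  proof (rule l1_eqI)
    fix l
    have "coef (A 0) (0, l - a) = (if l = a then of_real (\<eta> * 2 * c) else 0)"
      using mean A_supp[of "(0, l - a)" 0] by (auto simp: zero_prod_def)
    then show "coef (pl (A 0 * ps (mono_l1 a z))) l = coef ((\<eta> * 2 * c) *\<^sub>R mono_l1 a z) l"
      by (simp add: coef_pl ps_mono mult.commute[of "A 0"] coef_mono_mult coef_scaleR coef_mono)
         (simp add: scaleR_conv_of_real)
  qed
qed

abbreviation "q0 \<equiv> ps ql"
text \<open>The margin keeps the contraction ball around \<open>q0\<close>, and its image under
  \<open>vof\<close>, within radius \<open>R0\<close>; it also gives
  \<open>1 \<le> R0\<close>.\<close>

definition "R0 = norm ql + 2"
definition "U = real m *\<^sub>R ql ^ (m - 1)"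

lemma R0: "1 \<le> R0" "norm q0 \<le> R0" "norm ql \<le> R0"
  using norm_ps[of ql] by (simp_all add: R0_def add_increasing2)

lemma potl_U: "potl = c *\<^sub>R U"
proof -
  have "2*d - 2 = m - 1" by (simp add: m_eq)
  then show ?thesis unfolding potl_def U_def m_eq[symmetric] by simp
qed

lemma ps_U: "ps U = of_nat m * q0 ^ (m - 1)"
  unfolding U_def ps_simps ps_power by (simp add: scaleR_conv_of_real)

text \<open>All that the fixed point argument knows about the symbol of the wave operator. Evenness
  preserves real-valuedness and is used again when the multiplier is removed.\<close>

definition adm :: "real \<Rightarrow> (int \<times> int \<Rightarrow> real) \<Rightarrow> bool" where
  "adm \<epsilon> D \<longleftrightarrow> (\<forall>l. fst l \<noteq> 0 \<longrightarrow> \<gamma>0 \<le> \<bar>D l\<bar>) \<and> (\<forall>k. D (0, k) = \<epsilon> * (2 + \<epsilon>) * (of_int k)\<^sup>2) \<and> (\<forall>l. D (- l) = D l)"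

definition "kp \<epsilon> D l = (if fst l = 0 then 0 else of_real (\<bar>\<epsilon>\<bar> / D l) :: complex)"
definition "pn \<epsilon> D \<delta> w = mulop (kp \<epsilon> D) (N \<delta> w)"
text \<open>With \<open>pl v = ql + z\<close> the averaged equation reads
  \<open>z'' + potl * z = Y\<close>: the linearisation at \<open>ql\<close> is moved to the left,
  and \<open>c *\<^sub>R ql ^ m\<close> comes from the oscillator equation.\<close>

definition "Y \<epsilon> \<delta> v = potl * (pl v - ql) + c *\<^sub>R ql ^ m - (\<eta> / (2 + \<epsilon>)) *\<^sub>R pl (N \<delta> v)"
text \<open>\<open>Y\<close> depends on the modes with nonzero first index without any small factor.
  Feeding it \<open>pn\<close>, whose Lipschitz constant is of order
  \<open>|\<epsilon>| / \<gamma>0\<close>, instead of the current modes of \<open>w\<close> is what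
  makes \<open>T\<close> a contraction.\<close>

definition "vof \<epsilon> D \<delta> w = ps (pl w) + pn \<epsilon> D \<delta> w"
definition "T \<epsilon> D \<delta> w = ps (ql + G (Y \<epsilon> \<delta> (vof \<epsilon> D \<delta> w))) + pn \<epsilon> D \<delta> w"

lemma kp_le: "adm \<epsilon> D \<Longrightarrow> norm (kp \<epsilon> D l) \<le> \<bar>\<epsilon>\<bar> / \<gamma>0"
proof (cases "fst l = 0")
  case False
  assume "adm \<epsilon> D"
  then have D: "\<gamma>0 \<le> \<bar>D l\<bar>" using False unfolding adm_def by blast
  have "\<bar>\<epsilon>\<bar> / \<bar>D l\<bar> \<le> \<bar>\<epsilon>\<bar> / \<gamma>0"
    by (rule divide_left_mono[OF D]) (use D \<gamma>0 in auto)
  then show ?thesis using False by (simp add: kp_def norm_divide abs_divide)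
qed (use \<gamma>0 in \<open>simp add: kp_def\<close>)

lemma coef_pn: "adm \<epsilon> D \<Longrightarrow> coef (pn \<epsilon> D \<delta> w) l = kp \<epsilon> D l * coef (N \<delta> w) l"
  unfolding pn_def by (rule coef_mulop[OF kp_le])

lemma pl_pn: "adm \<epsilon> D \<Longrightarrow> pl (pn \<epsilon> D \<delta> w) = 0"
  by (rule l1_eqI) (simp add: coef_pl coef_pn kp_def coef_zero)

lemma theta:
  assumes "\<bar>\<epsilon>\<bar> \<le> 1/2"
  shows "\<bar>\<eta> / (2 + \<epsilon>)\<bar> \<le> 1" "\<bar>c - (\<eta> / (2 + \<epsilon>)) * (\<eta> * 2 * c)\<bar> \<le> c * \<bar>\<epsilon>\<bar>"
proof -
  have p: "1 \<le> 2 + \<epsilon>" using assms by linarith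
  show "\<bar>\<eta> / (2 + \<epsilon>)\<bar> \<le> 1" using \<eta> p by (auto simp: abs_divide)
  have "\<eta> * \<eta> = 1" using \<eta> by auto
  then have "c - (\<eta> / (2 + \<epsilon>)) * (\<eta> * 2 * c) = c * \<epsilon> / (2 + \<epsilon>)"
    using p by (simp add: field_simps)
  then have "\<bar>c - (\<eta> / (2 + \<epsilon>)) * (\<eta> * 2 * c)\<bar> = c * \<bar>\<epsilon>\<bar> / (2 + \<epsilon>)"
    using c p by (simp add: abs_mult abs_divide)
  also have "\<dots> \<le> c * \<bar>\<epsilon>\<bar> / 1" using c p by (intro divide_left_mono) auto
  finally show "\<bar>c - (\<eta> / (2 + \<epsilon>)) * (\<eta> * 2 * c)\<bar> \<le> c * \<bar>\<epsilon>\<bar>" by simp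
qed

text \<open>On functions of the second variable the linear terms cancel:
  \<open>potl = c *\<^sub>R U\<close>, while the nonlinearity contributes
  \<open>2 * c / (2 + \<epsilon>)\<close> times \<open>U\<close>. What is left is of order
  \<epsilon>, \<delta> or \<tau>, apart from the last summand, which sees only modes with nonzero
  first index.\<close>

lemma Y_lipschitz:
  "\<exists>K\<ge>0. \<forall>\<epsilon> \<delta> \<tau> v v'. \<bar>\<epsilon>\<bar> \<le> 1/2 \<longrightarrow> 0 \<le> \<delta> \<longrightarrow> 2 * R0 * \<delta> \<le> \<rho> \<longrightarrow> norm v \<le> R0 \<longrightarrow> norm v' \<le> R0 \<longrightarrow>
     norm (v - q0) \<le> \<tau> \<longrightarrow> norm (v' - q0) \<le> \<tau> \<longrightarrow>
     norm (Y \<epsilon> \<delta> v - Y \<epsilon> \<delta> v') \<le> K * ((\<bar>\<epsilon>\<bar> + \<delta> + \<tau>) * norm (v - v') + norm ((v - v') - ps (pl (v - v'))))"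
proof -
  obtain C1 where C1: "0 \<le> C1" "\<And>v w \<tau>. norm v \<le> R0 \<Longrightarrow> norm w \<le> R0 \<Longrightarrow> norm (v - q0) \<le> \<tau> \<Longrightarrow> norm (w - q0) \<le> \<tau> \<Longrightarrow>
    norm (v ^ m - w ^ m - of_nat m * q0 ^ (m - 1) * (v - w)) \<le> C1 * \<tau> * norm (v - w)"
    using power_linearisation[OF R0(1,2), of "m"] by blast
  define K where "K = c * norm U + norm U * b 0 + b 0 * C1 + L R0"
  have parts: "0 \<le> c * norm U" "0 \<le> norm U * b 0" "0 \<le> b 0 * C1" "0 \<le> L R0"
    using c b0[of 0] C1(1) L0[of R0] R0(1) by auto
  show ?thesis
  proof (intro exI[of _ K] conjI allI impI)
    show "0 \<le> K" unfolding K_def using parts by linarith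
    fix \<epsilon> \<delta> \<tau> :: real and v v' :: "(int \<times> int) l1"
    assume \<epsilon>: "\<bar>\<epsilon>\<bar> \<le> 1/2" and \<delta>: "0 \<le> \<delta>" "2 * R0 * \<delta> \<le> \<rho>" and v: "norm v \<le> R0" "norm v' \<le> R0"
      "norm (v - q0) \<le> \<tau>" "norm (v' - q0) \<le> \<tau>"
    define \<theta> where "\<theta> = \<eta> / (2 + \<epsilon>)"
    define \<Delta> where "\<Delta> = v - v'"
    define \<Delta>p where "\<Delta>p = \<Delta> - ps (pl \<Delta>)"
    define E1 where "E1 = v ^ m - v' ^ m - ps U * \<Delta>"
    define E2 where "E2 = (N \<delta> v - A 0 * v ^ m) - (N \<delta> v' - A 0 * v' ^ m)"
    have \<tau>: "0 \<le> \<tau>" using order_trans[OF norm_ge_zero v(3)] .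
    have E1: "norm E1 \<le> C1 * \<tau> * norm \<Delta>"
      unfolding E1_def ps_U \<Delta>_def by (rule C1(2)[OF v])
    have E2: "norm E2 \<le> \<delta> * L R0 * norm \<Delta>"
      unfolding E2_def \<Delta>_def by (rule N_lipschitz(2)[OF \<delta> R0(1) v(1,2)])
    have "N \<delta> v - N \<delta> v' = ps U * (A 0 * ps (pl \<Delta>)) + ps U * (A 0 * \<Delta>p) + A 0 * E1 + E2"
      by (simp add: E1_def E2_def \<Delta>p_def algebra_simps)
    then have pN: "pl (N \<delta> v) - pl (N \<delta> v') = (\<eta> * 2 * c) *\<^sub>R (U * pl \<Delta>) + U * pl (A 0 * \<Delta>p) + pl (A 0 * E1) + pl E2"
      by (simp only: pl_simps(2)[symmetric]) (simp only: pl_simps pl_ps_mult pl_A0_ps mult_scaleR_right)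
    have "Y \<epsilon> \<delta> v - Y \<epsilon> \<delta> v' = potl * pl \<Delta> - \<theta> *\<^sub>R (pl (N \<delta> v) - pl (N \<delta> v'))"
      by (simp add: Y_def \<theta>_def \<Delta>_def pl_simps algebra_simps)
    also have "\<dots> = (c - \<theta> * (\<eta> * 2 * c)) *\<^sub>R (U * pl \<Delta>) - \<theta> *\<^sub>R (U * pl (A 0 * \<Delta>p) + pl (A 0 * E1) + pl E2)"
      unfolding pN potl_U by (simp add: scaleR_add_right scaleR_diff_left)
    also have "norm \<dots> \<le> c * \<bar>\<epsilon>\<bar> * (norm U * norm \<Delta>) + 1 * (norm U * (b 0 * norm \<Delta>p) + b 0 * (C1 * \<tau> * norm \<Delta>) + \<delta> * L R0 * norm \<Delta>)"
    proof (rule order_trans[OF norm_triangle_ineq4 add_mono])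
      show "norm ((c - \<theta> * (\<eta> * 2 * c)) *\<^sub>R (U * pl \<Delta>)) \<le> c * \<bar>\<epsilon>\<bar> * (norm U * norm \<Delta>)"
        unfolding norm_scaleR \<theta>_def using c
        by (intro mult_mono theta[OF \<epsilon>] order_trans[OF norm_mult_ineq mult_left_mono[OF norm_pl]]) auto
      have A0: "norm (A 0 * x) \<le> b 0 * B" if "norm x \<le> B" for x B
        by (rule order_trans[OF norm_mult_ineq mult_mono[OF b that b0 norm_ge_zero]])
      show "norm (\<theta> *\<^sub>R (U * pl (A 0 * \<Delta>p) + pl (A 0 * E1) + pl E2))
        \<le> 1 * (norm U * (b 0 * norm \<Delta>p) + b 0 * (C1 * \<tau> * norm \<Delta>) + \<delta> * L R0 * norm \<Delta>)"
        unfolding norm_scaleR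
      proof (intro mult_mono norm_triangle_le add_mono)
        show "\<bar>\<theta>\<bar> \<le> 1" unfolding \<theta>_def by (rule theta[OF \<epsilon>])
        show "norm (U * pl (A 0 * \<Delta>p)) \<le> norm U * (b 0 * norm \<Delta>p)"
          by (intro order_trans[OF norm_mult_ineq mult_left_mono] order_trans[OF norm_pl A0] order_refl norm_ge_zero)
        show "norm (pl (A 0 * E1)) \<le> b 0 * (C1 * \<tau> * norm \<Delta>)" by (rule order_trans[OF norm_pl A0[OF E1]])
        show "norm (pl E2) \<le> \<delta> * L R0 * norm \<Delta>" by (rule order_trans[OF norm_pl E2])
      qed auto
    qed
    also have "\<dots> = (c * norm U) * (\<bar>\<epsilon>\<bar> * norm \<Delta>) + (norm U * b 0) * norm \<Delta>p + (b 0 * C1) * (\<tau> * norm \<Delta>) + L R0 * (\<delta> * norm \<Delta>)"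
      by (simp add: mult_ac)
    also have "\<dots> \<le> K * (\<bar>\<epsilon>\<bar> * norm \<Delta>) + K * norm \<Delta>p + K * (\<tau> * norm \<Delta>) + K * (\<delta> * norm \<Delta>)"
      unfolding K_def using parts \<tau> \<delta>(1) by (intro add_mono mult_right_mono) auto
    also have "\<dots> = K * ((\<bar>\<epsilon>\<bar> + \<delta> + \<tau>) * norm \<Delta> + norm \<Delta>p)" by (simp add: algebra_simps)
    finally show "norm (Y \<epsilon> \<delta> v - Y \<epsilon> \<delta> v') \<le> K * ((\<bar>\<epsilon>\<bar> + \<delta> + \<tau>) * norm (v - v') + norm ((v - v') - ps (pl (v - v'))))"
      unfolding \<Delta>p_def \<Delta>_def .
  qed
qed

text \<open>The defect of the unperturbed oscillator in the averaged equation: detuning of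
  \<open>2 + \<epsilon>\<close> from 2, and the terms of higher degree.\<close>

lemma Y_q0:
  assumes \<epsilon>: "\<bar>\<epsilon>\<bar> \<le> 1/2" and \<delta>: "0 \<le> \<delta>" "2 * R0 * \<delta> \<le> \<rho>"
  shows "norm (Y \<epsilon> \<delta> q0) \<le> c * \<bar>\<epsilon>\<bar> * norm (ql ^ m) + \<delta> * L R0 * R0"
proof -
  define \<theta> where "\<theta> = \<eta> / (2 + \<epsilon>)"
  define E where "E = N \<delta> q0 - A 0 * q0 ^ m"
  have "N \<delta> q0 = A 0 * ps (ql ^ m) + E" by (simp add: E_def ps_power)
  then have "pl (N \<delta> q0) = (\<eta> * 2 * c) *\<^sub>R ql ^ m + pl E"
    by (simp only: pl_simps pl_A0_ps)
  then have "Y \<epsilon> \<delta> q0 = (c - \<theta> * (\<eta> * 2 * c)) *\<^sub>R ql ^ m - \<theta> *\<^sub>R pl E"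
    by (simp add: Y_def \<theta>_def pl_ps scaleR_add_right scaleR_diff_left)
  also have "norm \<dots> \<le> c * \<bar>\<epsilon>\<bar> * norm (ql ^ m) + 1 * (\<delta> * L R0 * R0)"
  proof (rule order_trans[OF norm_triangle_ineq4 add_mono])
    show "norm ((c - \<theta> * (\<eta> * 2 * c)) *\<^sub>R ql ^ m) \<le> c * \<bar>\<epsilon>\<bar> * norm (ql ^ m)"
      unfolding norm_scaleR \<theta>_def by (intro mult_right_mono theta[OF \<epsilon>]) auto
    show "norm (\<theta> *\<^sub>R pl E) \<le> 1 * (\<delta> * L R0 * R0)"
      unfolding norm_scaleR \<theta>_def E_def
      by (intro mult_mono theta[OF \<epsilon>] order_trans[OF norm_pl N_bound(2)[OF \<delta> R0(1,2)]]) auto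
  qed
  finally show ?thesis by simp
qed

lemma real_T:
  assumes D: "adm \<epsilon> D" and \<delta>: "0 \<le> \<delta>" "2 * R0 * \<delta> \<le> \<rho>"
    and w: "real_l1 w" "norm w \<le> R0" "norm (vof \<epsilon> D \<delta> w) \<le> R0"
  shows "real_l1 (T \<epsilon> D \<delta> w)"
proof -
  have pn: "real_l1 (pn \<epsilon> D \<delta> w)"
    unfolding real_l1_def coef_pn[OF D]
    using real_N[OF \<delta> R0(1) w(2,1)] D by (simp add: real_l1_def kp_def adm_def del: split_paired_All)
  then have v: "real_l1 (vof \<epsilon> D \<delta> w)"
    unfolding vof_def by (intro real_l1_add real_ps real_pl w)
  have pot: "real_l1 potl" unfolding potl_def by (intro real_l1_scaleR real_l1_power real_ql)
  have "real_l1 (Y \<epsilon> \<delta> (vof \<epsilon> D \<delta> w))"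
    unfolding Y_def
    by (intro real_l1_diff real_l1_add real_l1_mult real_l1_scaleR real_l1_power real_pl real_ql v pot
        real_N[OF \<delta> R0(1) w(3) v])
  then show ?thesis
    unfolding T_def by (intro real_l1_add real_ps real_ql real_G pn)
qed

lemma fixed_point_exists:
  assumes \<tau>: "0 < \<tau>"
  shows "\<exists>\<kappa>>0. \<forall>\<epsilon> \<delta> D. adm \<epsilon> D \<longrightarrow> \<bar>\<epsilon>\<bar> \<le> \<kappa> \<longrightarrow> 0 < \<delta> \<longrightarrow> \<delta> \<le> \<kappa> \<longrightarrow>
    2 * R0 * \<delta> \<le> \<rho> \<and> (\<exists>w. norm (w - q0) \<le> \<tau> \<and> norm w \<le> R0 \<and> real_l1 w \<and> T \<epsilon> D \<delta> w = w)"
proof -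
  obtain CG where CG: "0 < CG" "\<And>y. norm (G y) \<le> CG * norm y" using G_bound by blast
  obtain K where K: "0 \<le> K" "\<And>\<epsilon> \<delta> \<tau> v v'. \<bar>\<epsilon>\<bar> \<le> 1/2 \<Longrightarrow> 0 \<le> \<delta> \<Longrightarrow> 2 * R0 * \<delta> \<le> \<rho> \<Longrightarrow> norm v \<le> R0 \<Longrightarrow> norm v' \<le> R0 \<Longrightarrow>
     norm (v - q0) \<le> \<tau> \<Longrightarrow> norm (v' - q0) \<le> \<tau> \<Longrightarrow>
     norm (Y \<epsilon> \<delta> v - Y \<epsilon> \<delta> v') \<le> K * ((\<bar>\<epsilon>\<bar> + \<delta> + \<tau>) * norm (v - v') + norm ((v - v') - ps (pl (v - v'))))"
    using Y_lipschitz by blast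
  define X where "X = CG * K"
  have X: "0 \<le> X" using CG K(1) by (simp add: X_def)
  \<comment> \<open>Radius of the ball. In the contraction estimate it enters as
    \<open>6 * (X * t)\<close>, which this choice keeps below 1/4.\<close>
  define t where "t = min \<tau> (1 / (24 * (X + 1)))"
  have t: "0 < t" "t \<le> \<tau>" "t * (24 * (X + 1)) \<le> 1" "t \<le> 1/24"
  proof -
    show "0 < t" "t \<le> \<tau>" using \<tau> X by (auto simp: t_def)
    have "t \<le> 1 / (24 * (X + 1))" by (simp add: t_def)
    then show "t * (24 * (X + 1)) \<le> 1" using X by (simp add: pos_le_divide_eq)
    then have "24 * (t * X) + 24 * t \<le> 1" by (simp add: algebra_simps)
    moreover have "0 \<le> t * X" using X \<open>0 < t\<close> by simp
    ultimately show "t \<le> 1/24" by linarith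
  qed
  \<comment> \<open>Target for the Lipschitz constant of \<open>pn\<close>. The first bound makes
    \<open>X * P\<close> and \<open>P\<close> at most 1/8, so the contraction factor is 1/4 + 1/8 +
    1/8; the second makes the displacement \<open>P * R0\<close> of the centre at most
    \<open>t / 32\<close>.\<close>
  define P where "P = min (1 / (8 * (X + 1))) (t / (32 * (X + 1) * R0))"
  define Y1 where "Y1 = c * norm (ql ^ m) + L R0 * R0"
  \<comment> \<open>The four bounds give in turn \<open>|\<epsilon>| + \<delta> \<le> t\<close>,
    convergence of \<open>N\<close>, Lipschitz constant \<open>P\<close> for \<open>pn\<close>, and
    a defect of at most \<open>t / 8\<close> after applying \<open>G\<close>.\<close>
  define \<kappa> where "\<kappa> = min (min (t/2) (\<rho> / (2 * R0))) (min (P * \<gamma>0 / (L R0 + 1)) (t / (8 * (CG * Y1 + 1))))"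
  have R0p: "0 < R0" using R0 by linarith
  have LR: "0 \<le> L R0" by (rule L0) (use R0p in simp)
  have Y1: "0 \<le> Y1" unfolding Y1_def using c LR R0p by simp
  have P: "0 < P" "P * (8 * (X + 1)) \<le> 1" "P * (32 * (X + 1) * R0) \<le> t"
  proof -
    show "0 < P" using X t(1) R0p by (simp add: P_def)
    have "P \<le> 1 / (8 * (X + 1))" "P \<le> t / (32 * (X + 1) * R0)" by (simp_all add: P_def)
    moreover have "0 < 8 * (X + 1)" "0 < 32 * (X + 1) * R0" using X R0p by simp_all
    ultimately show "P * (8 * (X + 1)) \<le> 1" "P * (32 * (X + 1) * R0) \<le> t"
      by (simp_all only: pos_le_divide_eq)
  qed
  have XP: "0 \<le> X * P" "0 \<le> X * (P * R0)" "0 \<le> P * R0" "0 \<le> X * t" using X P(1) R0p t(1) by simp_all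
  have small: "6 * (X * t) \<le> 1/4" "X * P \<le> 1/8" "P \<le> 1/8" "32 * (X * (P * R0)) \<le> t" "32 * (P * R0) \<le> t"
  proof -
    have "24 * (X * t) + 24 * t \<le> 1" using t(3) by (simp add: algebra_simps)
    then show "6 * (X * t) \<le> 1/4" using t(1) by linarith
    have "8 * (X * P) + 8 * P \<le> 1" using P(2) by (simp add: algebra_simps)
    then show "X * P \<le> 1/8" "P \<le> 1/8" using XP(1) P(1) by linarith+
    have "32 * (X * (P * R0)) + 32 * (P * R0) \<le> t" using P(3) by (simp add: algebra_simps)
    then show "32 * (X * (P * R0)) \<le> t" "32 * (P * R0) \<le> t" using XP by linarith+
  qed
  show ?thesis
  proof (intro exI[of _ \<kappa>] conjI allI impI)
    show "0 < \<kappa>" unfolding \<kappa>_def using t(1) \<rho> R0p P(1) \<gamma>0 LR CG(1) Y1 by (simp add: add_nonneg_pos)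
    fix \<epsilon> \<delta> D
    assume D: "adm \<epsilon> D" and \<epsilon>: "\<bar>\<epsilon>\<bar> \<le> \<kappa>" and \<delta>0: "0 < \<delta>" and \<delta>: "\<delta> \<le> \<kappa>"
    have \<kappa>: "\<kappa> \<le> t/2" "\<kappa> \<le> \<rho> / (2 * R0)" "\<kappa> \<le> P * \<gamma>0 / (L R0 + 1)" "\<kappa> \<le> t / (8 * (CG * Y1 + 1))"
      by (simp_all only: \<kappa>_def min_le_iff_disj order_refl simp_thms)
    have \<epsilon>2: "\<bar>\<epsilon>\<bar> \<le> 1/2" using \<epsilon> \<kappa>(1) t(4) by linarith
    have "\<delta> \<le> \<rho> / (2 * R0)" using \<delta> \<kappa>(2) by linarith
    then show \<delta>R: "2 * R0 * \<delta> \<le> \<rho>" using R0p by (simp add: pos_le_divide_eq mult_ac)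
    have \<delta>': "0 \<le> \<delta>" using \<delta>0 by simp
    have PL: "\<bar>\<epsilon>\<bar> / \<gamma>0 * L R0 \<le> P"
    proof -
      have "\<bar>\<epsilon>\<bar> \<le> P * \<gamma>0 / (L R0 + 1)" using \<epsilon> \<kappa>(3) by linarith
      then have "\<bar>\<epsilon>\<bar> * (L R0 + 1) \<le> P * \<gamma>0" using LR by (simp add: pos_le_divide_eq)
      then have "\<bar>\<epsilon>\<bar> * L R0 \<le> P * \<gamma>0" by (simp add: distrib_left)
      then show ?thesis using \<gamma>0 by (simp add: pos_divide_le_eq)
    qed
    have YB: "CG * (c * \<bar>\<epsilon>\<bar> * norm (ql ^ m) + \<delta> * L R0 * R0) \<le> t / 8"
    proof -
      have "c * \<bar>\<epsilon>\<bar> * norm (ql ^ m) \<le> c * \<kappa> * norm (ql ^ m)" "\<delta> * L R0 * R0 \<le> \<kappa> * L R0 * R0"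
        using \<epsilon> \<delta> c LR R0p by (auto intro!: mult_right_mono mult_left_mono)
      then have "c * \<bar>\<epsilon>\<bar> * norm (ql ^ m) + \<delta> * L R0 * R0 \<le> \<kappa> * Y1" by (simp add: Y1_def algebra_simps)
      then have "CG * (c * \<bar>\<epsilon>\<bar> * norm (ql ^ m) + \<delta> * L R0 * R0) \<le> CG * (\<kappa> * Y1)" using CG(1) by (intro mult_left_mono) auto
      moreover have "\<kappa> * (8 * (CG * Y1 + 1)) \<le> t" 
        using CG(1) Y1 by (intro pos_le_divide_eq[THEN iffD1, OF _ \<kappa>(4)] mult_pos_pos add_nonneg_pos mult_nonneg_nonneg) auto
      moreover have "\<kappa> * (8 * (CG * Y1 + 1)) = 8 * (CG * (\<kappa> * Y1)) + 8 * \<kappa>" by (simp add: algebra_simps)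
      ultimately show ?thesis using \<open>0 < \<kappa>\<close> by linarith
    qed
    note NL = N_lipschitz(1)[OF \<delta>' \<delta>R R0(1)]
    have pnL: "norm (pn \<epsilon> D \<delta> w - pn \<epsilon> D \<delta> w') \<le> P * norm (w - w')" if "norm w \<le> R0" "norm w' \<le> R0" for w w'
    proof -
      have "pn \<epsilon> D \<delta> w - pn \<epsilon> D \<delta> w' = mulop (kp \<epsilon> D) (N \<delta> w - N \<delta> w')"
        unfolding pn_def by (simp add: linear_diff[OF bounded_linear.linear[OF bounded_linear_mulop[OF kp_le[OF D]]]])
      also have "norm \<dots> \<le> \<bar>\<epsilon>\<bar> / \<gamma>0 * norm (N \<delta> w - N \<delta> w')" by (rule norm_mulop_le[OF kp_le[OF D]])
      also have "\<dots> \<le> \<bar>\<epsilon>\<bar> / \<gamma>0 * (L R0 * norm (w - w'))" using NL[OF that] \<gamma>0 by (intro mult_left_mono) auto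
      also have "\<dots> = (\<bar>\<epsilon>\<bar> / \<gamma>0 * L R0) * norm (w - w')" by simp
      also have "\<dots> \<le> P * norm (w - w')" using PL by (intro mult_right_mono) auto
      finally show ?thesis .
    qed
    have pn0: "pn \<epsilon> D \<delta> 0 = 0" by (rule l1_eqI) (simp add: coef_pn[OF D] N_zero coef_zero)
    have pnB: "norm (pn \<epsilon> D \<delta> w) \<le> P * R0" if "norm w \<le> R0" for w
    proof -
      have "norm (0 :: (int \<times> int) l1) \<le> R0" using R0p by simp
      from pnL[OF that this] have "norm (pn \<epsilon> D \<delta> w) \<le> P * norm w" by (simp only: pn0 diff_zero)
      also have "\<dots> \<le> P * R0" using that P(1) by (intro mult_left_mono) auto
      finally show ?thesis .
    qed
    define S where "S = cball q0 t \<inter> {w. real_l1 w}"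
    have inS: "norm (w - q0) \<le> t" "real_l1 w" "norm w \<le> R0" "norm (vof \<epsilon> D \<delta> w - q0) \<le> 2 * t" "norm (vof \<epsilon> D \<delta> w) \<le> R0"
      if "w \<in> S" for w
    proof -
      show 1: "norm (w - q0) \<le> t" "real_l1 w" using that by (auto simp: S_def dist_norm norm_minus_commute)
      have nq: "norm q0 \<le> R0 - 2" using norm_ps[of ql] by (simp add: R0_def)
      show 2: "norm w \<le> R0" using 1(1) t(4) nq norm_triangle_sub[of w q0] by linarith
      have "vof \<epsilon> D \<delta> w - q0 = ps (pl (w - q0)) + pn \<epsilon> D \<delta> w" by (simp add: vof_def pl_simps ps_simps pl_ps)
      also have "norm \<dots> \<le> norm (w - q0) + P * R0"
        by (intro norm_triangle_le add_mono pnB 2 order_trans[OF norm_ps norm_pl])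
      finally show 3: "norm (vof \<epsilon> D \<delta> w - q0) \<le> 2 * t" using 1(1) small(5) t(1) by linarith
      show "norm (vof \<epsilon> D \<delta> w) \<le> R0" using 3 t(4) nq norm_triangle_sub[of "vof \<epsilon> D \<delta> w" q0] by linarith
    qed
    have YL: "CG * norm (Y \<epsilon> \<delta> (vof \<epsilon> D \<delta> w) - Y \<epsilon> \<delta> v') \<le> X * (3 * t * (2 * n) + P * n)"
      if w: "w \<in> S" and v': "norm v' \<le> R0" "norm (v' - q0) \<le> 2 * t"
        "norm (vof \<epsilon> D \<delta> w - v') \<le> 2 * n" "norm ((vof \<epsilon> D \<delta> w - v') - ps (pl (vof \<epsilon> D \<delta> w - v'))) \<le> P * n" for w v' n
    proof -
      have "norm (Y \<epsilon> \<delta> (vof \<epsilon> D \<delta> w) - Y \<epsilon> \<delta> v') \<le> K * ((\<bar>\<epsilon>\<bar> + \<delta> + 2 * t) * norm (vof \<epsilon> D \<delta> w - v')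
          + norm ((vof \<epsilon> D \<delta> w - v') - ps (pl (vof \<epsilon> D \<delta> w - v'))))"
        by (rule K(2)[OF \<epsilon>2 \<delta>' \<delta>R inS(5)[OF w] v'(1) inS(4)[OF w] v'(2)])
      also have "\<dots> \<le> K * (3 * t * (2 * n) + P * n)"
        using \<epsilon> \<delta> \<delta>' \<kappa>(1) t(1) v'(3,4) K(1) by (intro mult_left_mono add_mono mult_mono) auto
      finally have "CG * norm (Y \<epsilon> \<delta> (vof \<epsilon> D \<delta> w) - Y \<epsilon> \<delta> v') \<le> CG * (K * (3 * t * (2 * n) + P * n))"
        using CG(1) by (intro mult_left_mono) auto
      then show ?thesis by (simp add: X_def mult.assoc)
    qed
    have Gd: "norm (G y - G y') \<le> CG * norm (y - y')" for y y'
      using CG(2)[of "y - y'"] linear_diff[OF bounded_linear.linear[OF bounded_linear_G]] by simp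
    have contr: "norm (T \<epsilon> D \<delta> w - T \<epsilon> D \<delta> w') \<le> (1/2) * norm (w - w')" if w: "w \<in> S" "w' \<in> S" for w w'
    proof -
      define n where "n = norm (w - w')"
      have dv: "vof \<epsilon> D \<delta> w - vof \<epsilon> D \<delta> w' = ps (pl (w - w')) + (pn \<epsilon> D \<delta> w - pn \<epsilon> D \<delta> w')"
        by (simp add: vof_def pl_simps ps_simps)
      note pd = pnL[OF inS(3)[OF w(1)] inS(3)[OF w(2)], folded n_def]
      have n1: "norm (vof \<epsilon> D \<delta> w - vof \<epsilon> D \<delta> w') \<le> 2 * n"
      proof -
        have "norm (vof \<epsilon> D \<delta> w - vof \<epsilon> D \<delta> w') \<le> n + P * n"
          unfolding dv n_def by (intro norm_triangle_le add_mono pd[unfolded n_def] order_trans[OF norm_ps norm_pl])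
        also have "P * n \<le> 1 * n" using small(3) by (intro mult_right_mono) (auto simp: n_def)
        finally show ?thesis by simp
      qed
      have n2: "norm ((vof \<epsilon> D \<delta> w - vof \<epsilon> D \<delta> w') - ps (pl (vof \<epsilon> D \<delta> w - vof \<epsilon> D \<delta> w'))) \<le> P * n"
        unfolding dv using pd by (simp add: pl_simps pl_pn[OF D] pl_ps)
      have "T \<epsilon> D \<delta> w - T \<epsilon> D \<delta> w' = ps (G (Y \<epsilon> \<delta> (vof \<epsilon> D \<delta> w)) - G (Y \<epsilon> \<delta> (vof \<epsilon> D \<delta> w'))) + (pn \<epsilon> D \<delta> w - pn \<epsilon> D \<delta> w')"
        by (simp add: T_def ps_simps)
      also have "norm \<dots> \<le> X * (3 * t * (2 * n) + P * n) + P * n"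
        by (intro norm_triangle_le add_mono pd order_trans[OF norm_ps order_trans[OF Gd YL]] w inS n1 n2)
      also have "\<dots> = (6 * (X * t) + X * P + P) * n" by (simp add: algebra_simps)
      also have "\<dots> \<le> (1/2) * n" using small(1-3) by (intro mult_right_mono) (auto simp: n_def)
      finally show ?thesis by (simp add: n_def)
    qed
    have q0S: "q0 \<in> S" using t(1) real_ps[OF real_ql] by (simp add: S_def)
    have Tq0: "norm (T \<epsilon> D \<delta> q0 - q0) \<le> t / 2"
    proof -
      have dv: "vof \<epsilon> D \<delta> q0 - q0 = pn \<epsilon> D \<delta> q0" by (simp add: vof_def pl_ps)
      have "norm (Y \<epsilon> \<delta> (vof \<epsilon> D \<delta> q0) - Y \<epsilon> \<delta> q0) \<le> K * ((\<bar>\<epsilon>\<bar> + \<delta> + 2 * t) * norm (vof \<epsilon> D \<delta> q0 - q0)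
          + norm ((vof \<epsilon> D \<delta> q0 - q0) - ps (pl (vof \<epsilon> D \<delta> q0 - q0))))"
        by (rule K(2)[OF \<epsilon>2 \<delta>' \<delta>R inS(5)[OF q0S] R0(2) inS(4)[OF q0S]]) (use t(1) in simp)
      also have "\<dots> \<le> K * (1 * (P * R0) + P * R0)"
        unfolding dv using \<epsilon> \<delta> \<delta>' \<kappa>(1) t K(1) pnB[OF R0(2)]
        by (intro mult_left_mono add_mono mult_mono) (auto simp: pl_pn[OF D] linear_0[OF ps_linear])
      finally have "CG * norm (Y \<epsilon> \<delta> (vof \<epsilon> D \<delta> q0) - Y \<epsilon> \<delta> q0) \<le> CG * (K * (1 * (P * R0) + P * R0))"
        using CG(1) by (intro mult_left_mono) auto
      also have "\<dots> = 2 * (X * (P * R0))" by (simp add: X_def algebra_simps)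
      finally have a: "CG * norm (Y \<epsilon> \<delta> (vof \<epsilon> D \<delta> q0) - Y \<epsilon> \<delta> q0) \<le> t / 16" using small(4) by linarith
      have "CG * norm (Y \<epsilon> \<delta> q0) \<le> CG * (c * \<bar>\<epsilon>\<bar> * norm (ql ^ m) + \<delta> * L R0 * R0)"
        using CG(1) Y_q0[OF \<epsilon>2 \<delta>' \<delta>R] by (intro mult_left_mono) auto
      then have b: "CG * norm (Y \<epsilon> \<delta> q0) \<le> t / 8" using YB by linarith
      have "norm (Y \<epsilon> \<delta> (vof \<epsilon> D \<delta> q0)) \<le> norm (Y \<epsilon> \<delta> (vof \<epsilon> D \<delta> q0) - Y \<epsilon> \<delta> q0) + norm (Y \<epsilon> \<delta> q0)"
        using norm_triangle_ineq[of "Y \<epsilon> \<delta> (vof \<epsilon> D \<delta> q0) - Y \<epsilon> \<delta> q0" "Y \<epsilon> \<delta> q0"] by (simp only: diff_add_cancel)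
      then have "CG * norm (Y \<epsilon> \<delta> (vof \<epsilon> D \<delta> q0)) \<le> CG * (norm (Y \<epsilon> \<delta> (vof \<epsilon> D \<delta> q0) - Y \<epsilon> \<delta> q0) + norm (Y \<epsilon> \<delta> q0))"
        using CG(1) by (intro mult_left_mono) auto
      then have c: "CG * norm (Y \<epsilon> \<delta> (vof \<epsilon> D \<delta> q0)) \<le> t/16 + t/8" using a b by (simp add: distrib_left)
      have "T \<epsilon> D \<delta> q0 - q0 = ps (G (Y \<epsilon> \<delta> (vof \<epsilon> D \<delta> q0))) + pn \<epsilon> D \<delta> q0"
        by (simp add: T_def ps_simps)
      also have "norm \<dots> \<le> (t/16 + t/8) + P * R0"
        by (intro norm_triangle_le add_mono pnB R0 order_trans[OF norm_ps order_trans[OF CG(2) c]])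
      finally show ?thesis using small(5) t(1) by linarith
    qed
    have "\<exists>w\<in>S. T \<epsilon> D \<delta> w = w"
    proof (rule fixed_point_in_closed)
      show "closed S" unfolding S_def by (intro closed_Int closed_cball closed_real_l1)
      show "S \<noteq> {}" using q0S by blast
      fix w assume w: "w \<in> S"
      have "norm (T \<epsilon> D \<delta> w - q0) \<le> norm (T \<epsilon> D \<delta> w - T \<epsilon> D \<delta> q0) + norm (T \<epsilon> D \<delta> q0 - q0)"
        using norm_triangle_ineq[of "T \<epsilon> D \<delta> w - T \<epsilon> D \<delta> q0" "T \<epsilon> D \<delta> q0 - q0"] by simp
      also have "\<dots> \<le> (1/2) * t + t / 2"
        using contr[OF w q0S] inS(1)[OF w] Tq0 by linarith
      finally have "norm (T \<epsilon> D \<delta> w - q0) \<le> t" by simp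
      moreover have "real_l1 (T \<epsilon> D \<delta> w)" by (rule real_T[OF D \<delta>' \<delta>R inS(2,3,5)[OF w]])
      ultimately show "T \<epsilon> D \<delta> w \<in> S" by (simp add: S_def dist_norm norm_minus_commute)
    qed (rule contr)
    then obtain w where "w \<in> S" "T \<epsilon> D \<delta> w = w" by blast
    then show "\<exists>w. norm (w - q0) \<le> \<tau> \<and> norm w \<le> R0 \<and> real_l1 w \<and> T \<epsilon> D \<delta> w = w"
      using inS[of w] t(2) by (intro exI[of _ w]) auto
  qed
qed

end

subsection \<open>Regularity of the fixed point and removal of the multiplier\<close>

context forced
begin

text \<open>At a fixed point \<open>vof\<close> returns \<open>w\<close>, so the two parts of
  \<open>T\<close> give the equation on \<open>fst l = 0\<close> and off it. The sign condition
  turns \<open>\<epsilon> * \<eta>\<close> into |\<epsilon>|, and \<nu> collects the cosine term of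
  \<open>G_eq\<close>.\<close>

lemma fixed_point_equation:
  assumes D: "adm \<epsilon> D" and w: "T \<epsilon> D \<delta> w = w" and \<epsilon>: "0 < \<epsilon> * \<eta>" "\<bar>\<epsilon>\<bar> \<le> 1/2"
  shows "\<exists>\<nu>. \<forall>l. of_real (D l) * coef w l = of_real \<bar>\<epsilon>\<bar> * coef (N \<delta> w) l - \<nu> * coef (ps cos_l1) l"
proof -
  define \<theta> where "\<theta> = \<eta> / (2 + \<epsilon>)"
  have plw: "pl w = ql + G (Y \<epsilon> \<delta> (vof \<epsilon> D \<delta> w))"
    using arg_cong[OF w, of pl] by (simp add: T_def pl_simps pl_ps pl_pn[OF D])
  then have v: "vof \<epsilon> D \<delta> w = w" using w by (simp add: T_def vof_def)
  define y where "y = Y \<epsilon> \<delta> w"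
  have plw: "pl w = ql + G y" using plw unfolding v y_def .
  define \<nu> where "\<nu> = - of_real (\<epsilon> * (2 + \<epsilon>)) * mu (ev1 y)"
  have "of_real (D l) * coef w l = of_real \<bar>\<epsilon>\<bar> * coef (N \<delta> w) l - \<nu> * coef (ps cos_l1) l" for l
  proof (cases "fst l = 0")
    case True
    define k where "k = snd l"
    have l: "l = (0, k)" using True by (simp add: k_def prod_eq_iff)
    have wk: "coef w l = coef ql k + coef (G y) k"
      using arg_cong[OF plw, of "\<lambda>u. coef u k"] by (simp add: coef_pl coef_plus l)
    have yk: "coef y k = coef (potl * G y) k + of_real c * coef (ql ^ m) k - of_real \<theta> * coef (N \<delta> w) l"
    proof -
      have "coef (Y \<epsilon> \<delta> w) k = coef (potl * (pl w - ql)) k + of_real c * coef (ql ^ m) k - of_real \<theta> * coef (N \<delta> w) l"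
        unfolding Y_def coef_plus coef_minus coef_scaleR coef_pl l \<theta>_def[symmetric] by (simp only: scaleR_conv_of_real)
      moreover have "pl w - ql = G y" by (simp add: plw)
      ultimately show ?thesis by (simp only: y_def)
    qed
    have "- (of_int k)\<^sup>2 * coef w l = - (of_int k)\<^sup>2 * coef ql k + - (of_int k)\<^sup>2 * coef (G y) k"
      by (simp add: wk distrib_left)
    also have "- (of_int k)\<^sup>2 * coef (G y) k = coef y k - mu (ev1 y) * coef cos_l1 k - coef (potl * G y) k"
      using G_eq[of k y] by (simp only: eq_diff_eq)
    also have "- (of_int k)\<^sup>2 * coef ql k = - of_real c * coef (ql ^ m) k"
      using q_eq[of k] by (simp only: m_eq)
    finally have e: "(of_int k)\<^sup>2 * coef w l = of_real \<theta> * coef (N \<delta> w) l + mu (ev1 y) * coef cos_l1 k"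
      unfolding yk by (simp add: algebra_simps)
    have "2 + \<epsilon> \<noteq> 0" using \<epsilon>(2) by linarith
    then have t: "\<epsilon> * (2 + \<epsilon>) * \<theta> = \<bar>\<epsilon>\<bar>" using \<epsilon>(1) \<eta> by (auto simp: \<theta>_def)
    have "of_real (D l) * coef w l = of_real (\<epsilon> * (2 + \<epsilon>)) * ((of_int k)\<^sup>2 * coef w l)"
      using D by (simp add: adm_def l)
    also have "\<dots> = of_real (\<epsilon> * (2 + \<epsilon>) * \<theta>) * coef (N \<delta> w) l - \<nu> * coef cos_l1 k"
      unfolding e \<nu>_def by (simp add: algebra_simps)
    finally show ?thesis unfolding t by (simp add: coef_ps l)
  next
    case False
    have "coef w l = coef (ps (ql + G (Y \<epsilon> \<delta> (vof \<epsilon> D \<delta> w)))) l + coef (pn \<epsilon> D \<delta> w) l"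
      using arg_cong[OF w, of "\<lambda>u. coef u l"] by (simp add: T_def coef_plus)
    then have "coef w l = of_real (\<bar>\<epsilon>\<bar> / D l) * coef (N \<delta> w) l"
      using False by (simp add: coef_ps coef_pn[OF D] kp_def)
    moreover have "D l \<noteq> 0"
    proof -
      have "\<gamma>0 \<le> \<bar>D l\<bar>" using D False unfolding adm_def by blast
      then show ?thesis using \<gamma>0 by auto
    qed
    ultimately show ?thesis using False by (simp add: coef_ps)
  qed
  then show ?thesis by blast
qed

definition Wt :: "real \<Rightarrow> int \<times> int \<Rightarrow> real" where
  "Wt \<sigma> l = W1 (fst l) * exp (\<sigma> * of_int \<bar>snd l\<bar>)"

lemma Wt:
  assumes "0 < \<sigma>"
  shows "1 \<le> Wt \<sigma> l" "0 \<le> Wt \<sigma> l" "Wt \<sigma> (l + k) \<le> Wt \<sigma> l * Wt \<sigma> k"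
proof -
  have "1 * 1 \<le> Wt \<sigma> l" unfolding Wt_def using W1(1)[of "fst l"] assms by (intro mult_mono) auto
  then show "1 \<le> Wt \<sigma> l" by simp
  then show "0 \<le> Wt \<sigma> l" by linarith
  have "exp (\<sigma> * of_int \<bar>snd (l + k)\<bar>) \<le> exp (\<sigma> * of_int \<bar>snd l\<bar>) * exp (\<sigma> * of_int \<bar>snd k\<bar>)"
  proof -
    have "\<bar>snd (l + k)\<bar> \<le> \<bar>snd l\<bar> + \<bar>snd k\<bar>" by simp
    then have "real_of_int \<bar>snd (l + k)\<bar> \<le> of_int \<bar>snd l\<bar> + of_int \<bar>snd k\<bar>" by linarith
    then have "\<sigma> * of_int \<bar>snd (l + k)\<bar> \<le> \<sigma> * (of_int \<bar>snd l\<bar> + of_int \<bar>snd k\<bar>)" using assms by (intro mult_left_mono) auto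
    then show ?thesis by (simp add: exp_add[symmetric] distrib_left)
  qed
  then have "Wt \<sigma> (l + k) \<le> (W1 (fst l) * W1 (fst k)) * (exp (\<sigma> * of_int \<bar>snd l\<bar>) * exp (\<sigma> * of_int \<bar>snd k\<bar>))"
    unfolding Wt_def using W1(2)[of "fst l" "fst k"] W1(1)[of "fst l"] W1(1)[of "fst k"]
    by (intro mult_mono) auto
  then show "Wt \<sigma> (l + k) \<le> Wt \<sigma> l * Wt \<sigma> k" by (simp add: Wt_def mult_ac)
qed

lemma A_Wt: "wle (Wt \<sigma>) (A j) (b j)"
  unfolding wle_def
proof safe
  fix F :: "(int \<times> int) set" assume F: "finite F"
  have "(\<Sum>l\<in>F. norm (coef (A j) l) * Wt \<sigma> l) = (\<Sum>l\<in>F. norm (coef (A j) l) * W1 (fst l))"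
  proof (rule sum.cong[OF refl])
    fix l
    show "norm (coef (A j) l) * Wt \<sigma> l = norm (coef (A j) l) * W1 (fst l)"
      using A_supp[of l j] by (cases "snd l = 0") (simp_all add: Wt_def)
  qed
  also have "\<dots> \<le> b j" by (rule wleD[OF A_wle F])
  finally show "(\<Sum>l\<in>F. norm (coef (A j) l) * Wt \<sigma> l) \<le> b j" .
qed

text \<open>All but finitely many \<open>\<phi>\<^sub>1\<close>-independent modes solve a contracting equation; running the
  contraction in the weighted ball and comparing with the unweighted one transfers the regularity.\<close>

lemma regularity:
  "\<exists>\<sigma> R2 \<kappa> C. 0 < \<sigma> \<and> R0 \<le> R2 \<and> 0 < \<kappa> \<and> 0 \<le> C \<and> (\<forall>\<epsilon> \<delta> D w \<nu>. adm \<epsilon> D \<longrightarrow> \<bar>\<epsilon>\<bar> \<le> \<kappa> \<longrightarrow> 0 < \<delta> \<longrightarrow> \<delta> \<le> \<kappa> \<longrightarrow>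
     \<epsilon> \<noteq> 0 \<longrightarrow> norm w \<le> R0 \<longrightarrow>
     (\<forall>l. of_real (D l) * coef w l = of_real \<bar>\<epsilon>\<bar> * coef (N \<delta> w) l - \<nu> * coef (ps cos_l1) l) \<longrightarrow>
     2 * R2 * \<delta> \<le> \<rho> \<and> wle (Wt \<sigma>) w R2 \<and> wle (Wt \<sigma>) (w - ps (pl w)) (C * \<bar>\<epsilon>\<bar>))"
proof -
  define R2 where "R2 = 2 * (W1 0 * exp 1) * R0"
  have e1: "1 \<le> W1 0 * exp 1" using W1(1)[of 0] mult_mono[of 1 "W1 0" 1 "exp 1 :: real"] by simp
  have R2: "R0 \<le> R2" "1 \<le> R2"
  proof -
    have "1 * R0 \<le> 2 * (W1 0 * exp 1) * R0" using e1 R0(1) by (intro mult_right_mono) auto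
    then show "R0 \<le> R2" by (simp add: R2_def)
    then show "1 \<le> R2" using R0(1) by linarith
  qed
  define LL where "LL = L R2"
  have LL: "0 \<le> LL" unfolding LL_def by (rule L0) (use R2 in simp)
  \<comment> \<open>Bound for the multiplier on all other modes: \<open>B * LL \<le> 1/2\<close>
    serves as contraction factor and keeps the nonlinear part within the other half of the
    ball.\<close>
  define B where "B = 1 / (2 * LL + 1)"
  have B: "0 < B" "B * LL \<le> 1/2" using LL by (simp_all add: B_def field_simps)
  \<comment> \<open>For \<open>fst l = 0\<close> and second index beyond \<open>K\<close>, the
    quotient \<open>|\<epsilon>| / |D l|\<close> is at most \<open>1 / K\<close>, hence at most
    \<open>B\<close>, uniformly in \<epsilon>.\<close>
  obtain K :: nat where K: "2 * LL + 1 \<le> real K" using real_arch_simple by blast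
  have K1: "1 \<le> real K" using K LL by linarith
  define \<sigma> where "\<sigma> = 1 / real K"
  have \<sigma>: "0 < \<sigma>" using K1 by (simp add: \<sigma>_def)
  define \<kappa> where "\<kappa> = min (1/2) (min (\<rho> / (2 * R2)) (B * \<gamma>0))"
  have \<kappa>: "\<kappa> \<le> 1/2" "\<kappa> \<le> \<rho> / (2 * R2)" "\<kappa> \<le> B * \<gamma>0"
    by (simp_all only: \<kappa>_def min_le_iff_disj order_refl simp_thms)
  have \<kappa>0: "0 < \<kappa>" unfolding \<kappa>_def using \<rho> R2 B \<gamma>0 by simp
  have main: "2 * R2 * \<delta> \<le> \<rho> \<and> wle (Wt \<sigma>) w R2 \<and> wle (Wt \<sigma>) (w - ps (pl w)) (LL / \<gamma>0 * \<bar>\<epsilon>\<bar>)"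
    if D: "adm \<epsilon> D" and \<epsilon>: "\<bar>\<epsilon>\<bar> \<le> \<kappa>" and \<delta>0: "0 < \<delta>" and \<delta>: "\<delta> \<le> \<kappa>" and \<epsilon>0: "\<epsilon> \<noteq> 0" and nw: "norm w \<le> R0"
      and eq: "\<forall>l. of_real (D l) * coef w l = of_real \<bar>\<epsilon>\<bar> * coef (N \<delta> w) l - \<nu> * coef (ps cos_l1) l"
    for \<epsilon> \<delta> D w \<nu>
  proof -
    have "\<delta> \<le> \<rho> / (2 * R2)" using \<delta> \<kappa>(2) by linarith
    then have \<delta>R: "2 * R2 * \<delta> \<le> \<rho>" using R2 by (simp add: pos_le_divide_eq mult_ac)
    have \<delta>': "0 \<le> \<delta>" using \<delta>0 by simp
    define low where "low l \<longleftrightarrow> fst l = 0 \<and> \<bar>snd l\<bar> \<le> int K" for l :: "int \<times> int"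
    define lo where "lo l = (if low l then 1 else 0 :: complex)" for l
    define \<Lambda> where "\<Lambda> l = (if low l then 0 else of_real (\<bar>\<epsilon>\<bar> / D l) :: complex)" for l
    have eg: "\<bar>\<epsilon>\<bar> / \<gamma>0 \<le> B" using \<epsilon> \<kappa>(3) \<gamma>0 by (simp add: pos_divide_le_eq)
    have Dl: "\<gamma>0 \<le> \<bar>D l\<bar>" if "fst l \<noteq> 0" for l using D that unfolding adm_def by blast
    have Dl0: "\<bar>\<epsilon>\<bar> * real K \<le> \<bar>D l\<bar>" if "fst l = 0" "int K < \<bar>snd l\<bar>" for l
    proof -
      have "D (0, snd l) = \<epsilon> * (2 + \<epsilon>) * (of_int (snd l))\<^sup>2" using D by (simp add: adm_def)
      moreover have "l = (0, snd l)" using that(1) by (simp add: prod_eq_iff)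
      ultimately have "\<bar>D l\<bar> = \<bar>\<epsilon>\<bar> * \<bar>2 + \<epsilon>\<bar> * (of_int (snd l))\<^sup>2" by (metis abs_mult abs_power2)
      moreover have "1 * real K \<le> \<bar>2 + \<epsilon>\<bar> * (of_int (snd l))\<^sup>2"
      proof (rule mult_mono)
        show "1 \<le> \<bar>2 + \<epsilon>\<bar>" using \<epsilon> \<kappa>(1) by linarith
        have k: "real K \<le> \<bar>of_int (snd l)\<bar>" using that(2) by linarith
        then have "real K * 1 \<le> \<bar>of_int (snd l)\<bar> * \<bar>of_int (snd l)\<bar>" using K1 by (intro mult_mono) auto
        then show "real K \<le> (of_int (snd l))\<^sup>2" by (simp add: power2_eq_square)
      qed auto
      then have "\<bar>\<epsilon>\<bar> * (1 * real K) \<le> \<bar>\<epsilon>\<bar> * (\<bar>2 + \<epsilon>\<bar> * (of_int (snd l))\<^sup>2)" by (rule mult_left_mono) simp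
      ultimately show ?thesis by (simp add: mult.assoc)
    qed
    have Dn0: "D l \<noteq> 0" if "\<not> low l" for l
    proof (cases "fst l = 0")
      case True
      then have "\<bar>\<epsilon>\<bar> * real K \<le> \<bar>D l\<bar>" using that by (intro Dl0) (auto simp: low_def)
      moreover have "0 < \<bar>\<epsilon>\<bar> * real K" using \<epsilon>0 K1 by simp
      ultimately show ?thesis by auto
    qed (use Dl[of l] \<gamma>0 in auto)
    have \<Lambda>B: "norm (\<Lambda> l) \<le> B" for l
    proof (cases "low l")
      case False
      have "\<bar>\<epsilon>\<bar> / \<bar>D l\<bar> \<le> B"
      proof (cases "fst l = 0")
        case True
        then have "\<bar>\<epsilon>\<bar> * real K \<le> \<bar>D l\<bar>" using False by (intro Dl0) (auto simp: low_def)
        moreover have "0 < \<bar>\<epsilon>\<bar> * real K" using \<epsilon>0 K1 by simp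
        ultimately have "\<bar>\<epsilon>\<bar> / \<bar>D l\<bar> \<le> \<bar>\<epsilon>\<bar> / (\<bar>\<epsilon>\<bar> * real K)" by (intro divide_left_mono) auto
        also have "\<dots> = 1 / real K" using \<epsilon>0 by simp
        also have "\<dots> \<le> B" unfolding B_def using K LL by (intro divide_left_mono) auto
        finally show ?thesis .
      next
        case False
        have "\<bar>\<epsilon>\<bar> / \<bar>D l\<bar> \<le> \<bar>\<epsilon>\<bar> / \<gamma>0" by (rule divide_left_mono[OF Dl[OF False]]) (use Dl[OF False] \<gamma>0 in auto)
        then show ?thesis using eg by linarith
      qed
      then show ?thesis using False by (simp add: \<Lambda>_def norm_divide abs_divide)
    qed (use B in \<open>simp add: \<Lambda>_def\<close>)
    have loB: "norm (lo l) \<le> 1" for l by (simp add: lo_def)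
    \<comment> \<open>Low modes are frozen at those of the given \<open>w\<close>, and only the
      others are solved for.\<close>
    define T2 where "T2 v = mulop lo w + mulop \<Lambda> (N \<delta> v)" for v
    have T2c: "coef (T2 v) l = lo l * coef w l + \<Lambda> l * coef (N \<delta> v) l" for v l
      by (simp add: T2_def coef_plus coef_mulop[OF loB] coef_mulop[OF \<Lambda>B])
    \<comment> \<open>The cosine occupies the modes \<open>(0, 1)\<close> and
      \<open>(0, -1)\<close>, which are low since \<open>K\<close> is at least 1; so \<nu> is absent
      here.\<close>
    have sol: "coef w l = of_real (\<bar>\<epsilon>\<bar> / D l) * coef (N \<delta> w) l" if "\<not> low l" for l
    proof -
      have "coef (ps cos_l1) l = 0" using that K1 by (auto simp: coef_ps coef_cos_l1 low_def)
      then have "of_real (D l) * coef w l = of_real \<bar>\<epsilon>\<bar> * coef (N \<delta> w) l" using eq by (simp del: split_paired_All)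
      then show ?thesis using Dn0[OF that] by (simp add: field_simps)
    qed
    have T2w: "T2 w = w"
    proof (rule l1_eqI)
      show "coef (T2 w) l = coef w l" for l
        using sol[of l] by (cases "low l") (simp_all add: T2c lo_def \<Lambda>_def)
    qed
    have T2L: "norm (T2 v - T2 v') \<le> (1/2) * norm (v - v')" if "norm v \<le> R2" "norm v' \<le> R2" for v v'
    proof -
      have "T2 v - T2 v' = mulop \<Lambda> (N \<delta> v - N \<delta> v')"
        by (rule l1_eqI) (simp add: T2c coef_minus coef_mulop[OF \<Lambda>B] algebra_simps)
      also have "norm \<dots> \<le> B * norm (N \<delta> v - N \<delta> v')" by (rule norm_mulop_le[OF \<Lambda>B])
      also have "\<dots> \<le> B * (LL * norm (v - v'))"
        unfolding LL_def using B(1) N_lipschitz(1)[OF \<delta>' \<delta>R R2(2) that] by (intro mult_left_mono) auto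
      also have "\<dots> = (B * LL) * norm (v - v')" by simp
      also have "\<dots> \<le> (1/2) * norm (v - v')" using B(2) by (intro mult_right_mono) auto
      finally show ?thesis .
    qed
    note Ws = Wt(2,3)[OF \<sigma>]
    have wlo: "wle (Wt \<sigma>) (mulop lo w) (R2 / 2)"
      unfolding wle_def
    proof safe
      fix F :: "(int \<times> int) set" assume F: "finite F"
      have "norm (coef (mulop lo w) l) * Wt \<sigma> l \<le> (W1 0 * exp 1) * norm (coef w l)" for l
      proof (cases "low l")
        case True
        have "real_of_int \<bar>snd l\<bar> \<le> real K" using True unfolding low_def by linarith
        then have "\<sigma> * of_int \<bar>snd l\<bar> \<le> 1" using K1 by (simp add: \<sigma>_def pos_divide_le_eq)
        then have "Wt \<sigma> l \<le> W1 0 * exp 1" unfolding Wt_def using True W1(1)[of 0] by (simp add: low_def mult_left_mono)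
        then show ?thesis using True mult_left_mono[of "Wt \<sigma> l" "W1 0 * exp 1" "norm (coef w l)"]
          by (simp add: coef_mulop[OF loB] lo_def mult_ac)
      qed (use e1 in \<open>simp add: coef_mulop[OF loB] lo_def\<close>)
      then have "(\<Sum>l\<in>F. norm (coef (mulop lo w) l) * Wt \<sigma> l) \<le> (\<Sum>l\<in>F. (W1 0 * exp 1) * norm (coef w l))"
        by (intro sum_mono)
      also have "\<dots> = (W1 0 * exp 1) * (\<Sum>l\<in>F. norm (coef w l))" by (simp add: sum_distrib_left)
      also have "\<dots> \<le> (W1 0 * exp 1) * R0"
        using e1 sum_coef_le_norm[OF F, of w] nw by (intro mult_left_mono) auto
      finally show "(\<Sum>l\<in>F. norm (coef (mulop lo w) l) * Wt \<sigma> l) \<le> R2 / 2" by (simp add: R2_def)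
    qed
    have NW: "wle (Wt \<sigma>) (N \<delta> v) LL" if "wle (Wt \<sigma>) v R2" for v
      unfolding LL_def by (rule wle_N[OF \<delta>' \<delta>R R2(2) wle_norm[OF that Wt(1)[OF \<sigma>]] that Ws A_Wt])
    \<comment> \<open>The contraction is measured in the unweighted norm; the weighted ball only has
      to be closed and invariant.\<close>
    have "\<exists>v\<in>{v. wle (Wt \<sigma>) v R2}. T2 v = v"
    proof (rule fixed_point_in_closed)
      show "closed {v. wle (Wt \<sigma>) v R2}"
        unfolding closed_sequential_limits using wle_limit by blast
      have "0 \<in> {v. wle (Wt \<sigma>) v R2}" using R2 by (simp add: wle_def coef_zero)
      then show "{v. wle (Wt \<sigma>) v R2} \<noteq> {}" by blast
      show "norm (T2 v - T2 v') \<le> (1/2) * norm (v - v')" if "v \<in> {v. wle (Wt \<sigma>) v R2}" "v' \<in> {v. wle (Wt \<sigma>) v R2}" for v v'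
        by (rule T2L; rule wle_norm[OF _ Wt(1)[OF \<sigma>]]; use that in simp)
      fix v assume "v \<in> {v. wle (Wt \<sigma>) v R2}"
      then have v: "wle (Wt \<sigma>) v R2" by simp
      have "wle (Wt \<sigma>) (mulop \<Lambda> (N \<delta> v)) (B * LL)"
        using B(1) \<Lambda>B by (intro wle_dominated[OF NW[OF v] Ws(1)]) (auto simp: coef_mulop[OF \<Lambda>B] norm_mult intro: mult_right_mono)
      from wle_add[OF wlo this Ws(1)] have "wle (Wt \<sigma>) (T2 v) (R2 / 2 + B * LL)" by (simp add: T2_def)
      then have "wle (Wt \<sigma>) (T2 v) R2" by (rule wle_le) (use B(2) R2(2) in linarith)
      then show "T2 v \<in> {v. wle (Wt \<sigma>) v R2}" by simp
    qed
    then obtain v where v: "wle (Wt \<sigma>) v R2" "T2 v = v" by blast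
    \<comment> \<open>\<open>w\<close> is a fixed point of the same contraction on the unweighted
      ball of radius \<open>R2\<close>, so it coincides with the regular one.\<close>
    have "norm (v - w) \<le> (1/2) * norm (v - w)"
      using T2L[OF wle_norm[OF v(1) Wt(1)[OF \<sigma>]], of w] nw R2(1) by (simp add: v(2) T2w)
    then have "v = w" by simp
    with v have ww: "wle (Wt \<sigma>) w R2" by simp
    have "wle (Wt \<sigma>) (w - ps (pl w)) (\<bar>\<epsilon>\<bar> / \<gamma>0 * LL)"
    proof (rule wle_dominated[OF NW[OF ww] Ws(1)])
      show "0 \<le> \<bar>\<epsilon>\<bar> / \<gamma>0" using \<gamma>0 by simp
      fix l
      show "norm (coef (w - ps (pl w)) l) \<le> \<bar>\<epsilon>\<bar> / \<gamma>0 * norm (coef (N \<delta> w) l)"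
      proof (cases "fst l = 0")
        case True
        then have "l = (0, snd l)" by (simp add: prod_eq_iff)
        then have "coef (w - ps (pl w)) l = 0" by (simp add: coef_minus coef_ps coef_pl True)
        then show ?thesis using \<gamma>0 by simp
      next
        case False
        have "\<bar>\<epsilon>\<bar> / \<bar>D l\<bar> \<le> \<bar>\<epsilon>\<bar> / \<gamma>0" by (rule divide_left_mono[OF Dl[OF False]]) (use Dl[OF False] \<gamma>0 in auto)
        moreover have "norm (coef (w - ps (pl w)) l) = \<bar>\<epsilon>\<bar> / \<bar>D l\<bar> * norm (coef (N \<delta> w) l)"
          using sol[of l] False by (simp add: coef_minus coef_ps low_def norm_mult norm_divide abs_divide)
        ultimately show ?thesis by (simp only:) (rule mult_right_mono, assumption, simp)
      qed
    qed
    then show ?thesis using \<delta>R ww by (simp add: mult_ac)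
  qed
  have "0 \<le> LL / \<gamma>0" using LL \<gamma>0 by simp
  show ?thesis
    by (rule exI[of _ \<sigma>], rule exI[of _ R2], rule exI[of _ \<kappa>], rule exI[of _ "LL / \<gamma>0"],
        intro conjI[OF \<sigma>] conjI[OF R2(1)] conjI[OF \<kappa>0] conjI[OF \<open>0 \<le> LL / \<gamma>0\<close>] allI impI)
       (rule main, assumption+)
qed

text \<open>Pairing the equation with \<open>dw\<close> kills the linear part by oddness and the
  nonlinear part by \<open>N_orthogonal\<close>. What remains is \<nu> times the mean of
  \<open>dw * cos\<close>, that is \<open>-\<nu> * Im (coef w (0, 1))\<close>.\<close>

lemma multiplier_zero:
  assumes D: "adm \<epsilon> D" and \<delta>: "0 \<le> \<delta>" "2 * R2 * \<delta> \<le> \<rho>" "1 \<le> R2" and \<sigma>: "0 < \<sigma>"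
    and w: "wle (Wt \<sigma>) w R2" "real_l1 w" "Im (coef w (0, 1)) \<noteq> 0"
    and eq: "\<And>l. of_real (D l) * coef w l = of_real \<bar>\<epsilon>\<bar> * coef (N \<delta> w) l - \<nu> * coef (ps cos_l1) l"
  shows "\<nu> = 0"
proof -
  define dw where "dw = Abs_l1 (\<lambda>l :: int \<times> int. \<i> * of_int (snd l) * coef w l)"
  have "(\<lambda>l :: int \<times> int. \<i> * of_int (snd l) * coef w l) abs_summable_on UNIV"
  \<comment> \<open>The exponential weight pays for one derivative: \<open>\<sigma> * |l2|\<close>
    is at most \<open>exp (\<sigma> * |l2|)\<close>.\<close>
  proof (rule Infinite_Sum.abs_summable_on_comparison_test'[OF summable_on_cmult_right[OF wle_summable(1)[OF w(1) Wt(2)[OF \<sigma>]], of "1 / \<sigma>"]])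
    fix l :: "int \<times> int"
    have "\<sigma> * of_int \<bar>snd l\<bar> \<le> exp (\<sigma> * of_int \<bar>snd l\<bar>)" using exp_ge_add_one_self[of "\<sigma> * of_int \<bar>snd l\<bar>"] by linarith
    also have "\<dots> \<le> W1 (fst l) * exp (\<sigma> * of_int \<bar>snd l\<bar>)" using mult_right_mono[OF W1(1)[of "fst l"], of "exp (\<sigma> * of_int \<bar>snd l\<bar>)"] by simp
    finally have "\<bar>of_int (snd l)\<bar> \<le> 1 / \<sigma> * Wt \<sigma> l" using \<sigma> by (simp add: Wt_def field_simps)
    from mult_right_mono[OF this norm_ge_zero[of "coef w l"]]
    show "norm (\<i> * of_int (snd l) * coef w l) \<le> 1 / \<sigma> * (norm (coef w l) * Wt \<sigma> l)"
      by (simp add: norm_mult mult_ac)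
  qed
  then have dw: "coef dw l = \<i> * of_int (snd l) * coef w l" for l by (simp add: dw_def coef_Abs_l1)
  define X where "X = \<bar>\<epsilon>\<bar> *\<^sub>R N \<delta> w - mono_l1 0 \<nu> * ps cos_l1"
  have X: "coef X l = of_real (D l) * coef w l" for l
    unfolding eq X_def coef_minus coef_scaleR coef_mono_mult by (simp add: scaleR_conv_of_real)
  \<comment> \<open>The summand is odd: \<open>D\<close> is even, the two coefficients swap under
    negation and the factor \<open>snd k\<close> changes sign. So the sum equals its own
    negative.\<close>
  define f where "f k = \<i> * of_int (snd k) * coef w k * (of_real (D k) * coef w (- k))" for k
  have Dm: "D (- k) = D k" for k using D unfolding adm_def by blast
  have f: "(f has_sum coef (dw * X) 0) UNIV"
    using coef_mult_has_sum[of dw X 0] by (simp add: f_def[abs_def] dw X Dm)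
  have "((\<lambda>k. f (- k)) has_sum coef (dw * X) 0) UNIV"
    using f has_sum_reindex_bij_betw[OF bij_uminus, of f "coef (dw * X) 0"] by (simp only:)
  moreover have "f (- k) = - f k" for k
    unfolding f_def Dm by (simp add: mult_ac)
  ultimately have "((\<lambda>k. - f k) has_sum coef (dw * X) 0) UNIV" by (simp only:)
  then have "(f has_sum - coef (dw * X) 0) UNIV" by (simp only: has_sum_uminus)
  then have "coef (dw * X) 0 = - coef (dw * X) 0" using f has_sum_unique by blast
  then have z: "coef (dw * X) 0 = 0" by simp
  have "hasd w dw" unfolding hasd_def using dw by blast
  from N_orthogonal[OF \<delta> wle_norm[OF w(1) Wt(1)[OF \<sigma>]] this]
  have "coef (dw * N \<delta> w) 0 = 0" .
  moreover have "dw * X = \<bar>\<epsilon>\<bar> *\<^sub>R (dw * N \<delta> w) - mono_l1 0 \<nu> * (dw * ps cos_l1)"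
    by (simp add: X_def algebra_simps)
  ultimately have "\<nu> * coef (dw * ps cos_l1) 0 = 0"
    using z by (simp add: coef_minus coef_scaleR coef_mono_mult)
  moreover have "coef (dw * ps cos_l1) 0 = - of_real (Im (coef w (0, 1)))"
  proof -
    have "dw * ps cos_l1 = mono_l1 (0, 1) (1/2) * dw + mono_l1 (0, -1) (1/2) * dw"
      by (simp add: cos_l1_def ps_simps ps_mono algebra_simps)
    then have "coef (dw * ps cos_l1) 0 = 1/2 * coef dw (0, -1) + 1/2 * coef dw (0, 1)"
      by (simp add: coef_plus coef_mono_mult zero_prod_def)
    also have "\<dots> = \<i> / 2 * (coef w (0, 1) - coef w (- (0, 1)))" by (simp add: dw algebra_simps)
    also have "coef w (- (0, 1)) = cnj (coef w (0, 1))" using w(2) unfolding real_l1_def by blast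
    finally show ?thesis by (simp add: complex_eq_iff)
  qed
  ultimately show "\<nu> = 0" using w(3) by simp
qed

theorem forced_solution:
  "\<exists>\<kappa> \<sigma> R2 C. 0 < \<kappa> \<and> 0 < \<sigma> \<and> 1 \<le> R2 \<and> 0 \<le> C \<and> (\<forall>\<epsilon> \<delta> D. adm \<epsilon> D \<longrightarrow> \<bar>\<epsilon>\<bar> \<le> \<kappa> \<longrightarrow> 0 < \<delta> \<longrightarrow> \<delta> \<le> \<kappa> \<longrightarrow> 0 < \<epsilon> * \<eta> \<longrightarrow>
     2 * R2 * \<delta> \<le> \<rho> \<and> (\<exists>w. real_l1 w \<and> wle (Wt \<sigma>) w R2 \<and> wle (Wt \<sigma>) (w - ps (pl w)) (C * \<bar>\<epsilon>\<bar>) \<and>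
       coef w (0, 1) \<noteq> 0 \<and> (\<forall>l. of_real (D l) * coef w l = of_real \<bar>\<epsilon>\<bar> * coef (N \<delta> w) l)))"
proof -
  \<comment> \<open>Half the size of the nonvanishing imaginary part, so that it cannot vanish for
    any \<open>w\<close> within \<tau> of \<open>q0\<close>.\<close>
  define \<tau> where "\<tau> = - Im (coef ql 1) / 2"
  have \<tau>: "0 < \<tau>" using Im_coef_ql by (simp add: \<tau>_def)
  obtain \<kappa>1 where \<kappa>1: "0 < \<kappa>1" "\<And>\<epsilon> \<delta> D. adm \<epsilon> D \<Longrightarrow> \<bar>\<epsilon>\<bar> \<le> \<kappa>1 \<Longrightarrow> 0 < \<delta> \<Longrightarrow> \<delta> \<le> \<kappa>1 \<Longrightarrow>
    \<exists>w. norm (w - q0) \<le> \<tau> \<and> norm w \<le> R0 \<and> real_l1 w \<and> T \<epsilon> D \<delta> w = w"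
    using fixed_point_exists[OF \<tau>] by blast
  obtain \<sigma> R2 \<kappa>2 C where reg: "0 < \<sigma>" "R0 \<le> R2" "0 < \<kappa>2" "0 \<le> C"
    "\<And>\<epsilon> \<delta> D w \<nu>. adm \<epsilon> D \<Longrightarrow> \<bar>\<epsilon>\<bar> \<le> \<kappa>2 \<Longrightarrow> 0 < \<delta> \<Longrightarrow> \<delta> \<le> \<kappa>2 \<Longrightarrow> \<epsilon> \<noteq> 0 \<Longrightarrow> norm w \<le> R0 \<Longrightarrow>
     (\<forall>l. of_real (D l) * coef w l = of_real \<bar>\<epsilon>\<bar> * coef (N \<delta> w) l - \<nu> * coef (ps cos_l1) l) \<Longrightarrow>
     2 * R2 * \<delta> \<le> \<rho> \<and> wle (Wt \<sigma>) w R2 \<and> wle (Wt \<sigma>) (w - ps (pl w)) (C * \<bar>\<epsilon>\<bar>)"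
    using regularity by blast
  have R2: "1 \<le> R2" using reg(2) R0(1) by linarith
  have "2 * R2 * \<delta> \<le> \<rho> \<and> (\<exists>w. real_l1 w \<and> wle (Wt \<sigma>) w R2 \<and> wle (Wt \<sigma>) (w - ps (pl w)) (C * \<bar>\<epsilon>\<bar>) \<and>
       coef w (0, 1) \<noteq> 0 \<and> (\<forall>l. of_real (D l) * coef w l = of_real \<bar>\<epsilon>\<bar> * coef (N \<delta> w) l))"
    if D: "adm \<epsilon> D" and \<epsilon>: "\<bar>\<epsilon>\<bar> \<le> min (1/2) (min \<kappa>1 \<kappa>2)" and \<delta>: "0 < \<delta>" "\<delta> \<le> min (1/2) (min \<kappa>1 \<kappa>2)" and \<epsilon>\<eta>: "0 < \<epsilon> * \<eta>" for \<epsilon> \<delta> D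
  proof -
    obtain w where w: "norm (w - q0) \<le> \<tau>" "norm w \<le> R0" "real_l1 w" "T \<epsilon> D \<delta> w = w"
      using \<kappa>1(2)[OF D _ \<delta>(1)] \<epsilon> \<delta>(2) by auto
    have \<epsilon>0: "\<epsilon> \<noteq> 0" using \<epsilon>\<eta> by auto
    obtain \<nu> where \<nu>: "\<forall>l. of_real (D l) * coef w l = of_real \<bar>\<epsilon>\<bar> * coef (N \<delta> w) l - \<nu> * coef (ps cos_l1) l"
      using fixed_point_equation[OF D w(4) \<epsilon>\<eta>] \<epsilon> by auto
    have r: "2 * R2 * \<delta> \<le> \<rho>" "wle (Wt \<sigma>) w R2" "wle (Wt \<sigma>) (w - ps (pl w)) (C * \<bar>\<epsilon>\<bar>)"
      using reg(5)[OF D _ \<delta>(1) _ \<epsilon>0 w(2) \<nu>] \<epsilon> \<delta>(2) by auto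
    have "\<bar>Im (coef (w - q0) (0, 1))\<bar> \<le> norm (coef (w - q0) (0, 1))" by (rule abs_Im_le_cmod)
    also have "\<dots> \<le> \<tau>" using norm_coef_le[of "w - q0" "(0, 1)"] w(1) by linarith
    finally have "\<bar>Im (coef w (0, 1)) - Im (coef ql 1)\<bar> \<le> \<tau>" by (simp add: coef_minus coef_ps)
    then have Im: "Im (coef w (0, 1)) \<noteq> 0" using \<tau> by (auto simp: \<tau>_def)
    have "\<nu> = 0"
      by (rule multiplier_zero[OF D less_imp_le[OF \<delta>(1)] r(1) R2 reg(1) r(2) w(3) Im]) (use \<nu> in blast)
    then have "\<forall>l. of_real (D l) * coef w l = of_real \<bar>\<epsilon>\<bar> * coef (N \<delta> w) l" using \<nu> by (simp del: split_paired_All)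
    moreover have "coef w (0, 1) \<noteq> 0" using Im by auto
    ultimately show ?thesis using r w(3) by blast
  qed
  moreover have "0 < min (1/2) (min \<kappa>1 \<kappa>2)" using \<kappa>1(1) reg(3) by simp
  ultimately show ?thesis using reg(1,4) R2 by blast
qed

end

subsection \<open>Regularity of the Taylor coefficients of the nonlinearity\<close>

text \<open>Greedy choice: take the least point of \<open>E\<close> and discard everything closer
  than \<tau> to it, which removes measure at most \<tau>.\<close>

lemma spread_points:
  assumes "compact E" "0 < \<tau>" "ennreal (real n * \<tau>) < emeasure lborel E"
  shows "\<exists>x :: nat \<Rightarrow> real. (\<forall>i\<le>n. x i \<in> E) \<and> (\<forall>i<n. x i + \<tau> \<le> x (Suc i))"
  using assms
proof (induction n arbitrary: E)
  case 0
  then have "E \<noteq> {}" by auto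
  then obtain e where "e \<in> E" by blast
  then show ?case by (intro exI[of _ "\<lambda>_. e"]) simp
next
  case (Suc n)
  have "E \<noteq> {}" using Suc.prems by auto
  have bdd: "bdd_below E" using Suc.prems(1) by (simp add: bounded_imp_bdd_below compact_imp_bounded)
  define a where "a = Inf E"
  have a: "a \<in> E" unfolding a_def
    by (rule closed_contains_Inf[OF \<open>E \<noteq> {}\<close> bdd compact_imp_closed[OF Suc.prems(1)]])
  have lower: "a \<le> e" if "e \<in> E" for e unfolding a_def using bdd that by (rule cInf_lower[rotated])
  define E' where "E' = E \<inter> {a + \<tau>..}"
  have cE': "compact E'" unfolding E'_def by (rule compact_Int_closed[OF Suc.prems(1) closed_atLeast])
  have meas: "E \<in> sets lborel" "E' \<in> sets lborel" using Suc.prems(1) cE' by (auto simp: borel_compact)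
  have "ennreal (real n * \<tau>) < emeasure lborel E'"
  proof (rule ccontr)
    assume "\<not> ennreal (real n * \<tau>) < emeasure lborel E'"
    then have le: "emeasure lborel E' \<le> ennreal (real n * \<tau>)" by simp
    have "emeasure lborel E \<le> emeasure lborel ({a..a + \<tau>} \<union> E')"
      by (rule emeasure_mono) (use lower meas in \<open>auto simp: E'_def\<close>)
    also have "\<dots> \<le> emeasure lborel {a..a + \<tau>} + emeasure lborel E'"
      by (rule emeasure_subadditive) (use meas in auto)
    also have "\<dots> \<le> ennreal \<tau> + ennreal (real n * \<tau>)"
      using le Suc.prems(2) by (intro add_mono) auto
    also have "\<dots> = ennreal (real (Suc n) * \<tau>)"
      using Suc.prems(2) by (subst ennreal_plus[symmetric]) (auto simp: algebra_simps)
    finally show False using Suc.prems(3) by simp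
  qed
  from Suc.IH[OF cE' Suc.prems(2) this] obtain x where x: "\<forall>i\<le>n. x i \<in> E'" "\<forall>i<n. x i + \<tau> \<le> x (Suc i)" by blast
  define y where "y i = (case i of 0 \<Rightarrow> a | Suc j \<Rightarrow> x j)" for i
  have "y i \<in> E" if "i \<le> Suc n" for i using that x(1) a by (cases i) (auto simp: y_def E'_def)
  moreover have "y i + \<tau> \<le> y (Suc i)" if "i < Suc n" for i
    using that x by (cases i) (auto simp: y_def E'_def)
  ultimately show ?case by blast
qed

text \<open>With the \<open>k\<close>-th coefficient weighted by \<open>\<rho> ^ k\<close>, each
  linear factor multiplies the largest weighted coefficient by at most
  \<open>2 * \<rho>\<close>.\<close>

lemma coeff_prod_linear_bound:
  fixes x :: "'i \<Rightarrow> complex"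
  assumes "finite I" "0 < \<rho>" "\<And>j. j \<in> I \<Longrightarrow> norm (x j) \<le> \<rho>"
  shows "norm (coeff (\<Prod>j\<in>I. [:- x j, 1:]) k) * \<rho> ^ k \<le> (2 * \<rho>) ^ card I"
  using assms(1,3)
proof (induction I arbitrary: k rule: finite_induct)
  case empty
  show ?case by (cases k) (simp_all add: coeff_1)
next
  case (insert i I)
  define P where "P = (\<Prod>j\<in>I. [:- x j, 1:])"
  have IH: "norm (coeff P k) * \<rho> ^ k \<le> (2 * \<rho>) ^ card I" for k
    unfolding P_def by (rule insert.IH) (use insert.prems in auto)
  have xi: "norm (x i) \<le> \<rho>" using insert.prems by auto
  have 1: "norm (x i * coeff P k) * \<rho> ^ k \<le> \<rho> * (2 * \<rho>) ^ card I"
    unfolding norm_mult mult.assoc using IH[of k] xi assms(2) by (intro mult_mono) auto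
  have "coeff ([:- x i, 1:] * P) k = - x i * coeff P k + (case k of 0 \<Rightarrow> 0 | Suc j \<Rightarrow> coeff P j)"
    by (simp add: coeff_pCons split: nat.split)
  then have "norm (coeff ([:- x i, 1:] * P) k) * \<rho> ^ k \<le> (norm (x i * coeff P k) + norm (case k of 0 \<Rightarrow> 0 | Suc j \<Rightarrow> coeff P j)) * \<rho> ^ k"
    using norm_triangle_ineq[of "- x i * coeff P k" "case k of 0 \<Rightarrow> 0 | Suc j \<Rightarrow> coeff P j"] assms(2)
    by (intro mult_right_mono) auto
  also have "\<dots> \<le> \<rho> * (2 * \<rho>) ^ card I + \<rho> * (2 * \<rho>) ^ card I"
    unfolding distrib_right
  proof (rule add_mono[OF 1])
    show "norm (case k of 0 \<Rightarrow> 0 | Suc j \<Rightarrow> coeff P j) * \<rho> ^ k \<le> \<rho> * (2 * \<rho>) ^ card I"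
    proof (cases k)
      case (Suc j)
      then show ?thesis using mult_left_mono[OF IH[of j], of \<rho>] assms(2) by (simp add: mult_ac)
    qed (use assms(2) in simp)
  qed
  also have "\<dots> = (2 * \<rho>) ^ card (insert i I)" by (simp add: insert.hyps)
  finally show ?case unfolding prod.insert[OF insert.hyps] P_def .
qed

lemma prod_abs_diff_fact:
  assumes "i \<le> n"
  shows "(\<Prod>j\<in>{..n} - {i}. \<bar>real i - real j\<bar>) = fact i * fact (n - i)"
proof -
  have e: "{..n} - {i} = {..<i} \<union> {Suc i..n}" using assms by auto
  have "(\<Prod>j\<in>{..n} - {i}. \<bar>real i - real j\<bar>) = (\<Prod>j<i. \<bar>real i - real j\<bar>) * (\<Prod>j\<in>{Suc i..n}. \<bar>real i - real j\<bar>)"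
    unfolding e by (rule prod.union_disjoint) auto
  also have "(\<Prod>j<i. \<bar>real i - real j\<bar>) = (\<Prod>k\<in>{1..i}. real k)"
    by (rule prod.reindex_bij_witness[of _ "\<lambda>k. i - k" "\<lambda>j. i - j"]) auto
  also have "(\<Prod>j\<in>{Suc i..n}. \<bar>real i - real j\<bar>) = (\<Prod>k\<in>{1..n - i}. real k)"
    by (rule prod.reindex_bij_witness[of _ "\<lambda>k. i + k" "\<lambda>j. j - i"]) auto
  finally show ?thesis by (simp add: fact_prod)
qed

lemma power_le_exp_fact: "real n ^ n \<le> exp (real n) * fact n"
proof -
  have "(\<Sum>k\<in>{n}. real n ^ k /\<^sub>R fact k) \<le> (\<Sum>k. real n ^ k /\<^sub>R fact k)"
    by (rule sum_le_suminf[OF summable_exp_generic]) auto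
  then have "real n ^ n /\<^sub>R fact n \<le> exp (real n)" by (simp add: exp_def)
  then show ?thesis by (simp add: field_simps)
qed

text \<open>A binomial coefficient is at most \<open>2 ^ n\<close>, and
  \<open>(n+1)^n / n! = (n+1)^(n+1) / (n+1)!\<close> is at most \<open>exp (n+1)\<close>, hence at
  most \<open>3 ^ (n+1)\<close>. Together \<open>4 * 2 * 3 = 24\<close>.\<close>

lemma interpolation_constant:
  assumes "i \<le> n"
  shows "(4 * (real n + 1)) ^ n / (fact i * fact (n - i)) \<le> 3 * 24 ^ n"
proof -
  have ch: "real (n choose i) \<le> 2 ^ n"
    using binomial_le_pow2[of n i] by (metis of_nat_le_iff of_nat_numeral of_nat_power)
  have "1 / (fact i * fact (n - i)) = real (n choose i) / fact n"
    using binomial_fact[OF assms, where 'a = real] by simp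
  then have "(4 * (real n + 1)) ^ n / (fact i * fact (n - i)) = (4 * (real n + 1)) ^ n * (real (n choose i) / fact n)"
    by (simp add: divide_inverse)
  also have "\<dots> \<le> (4 * (real n + 1)) ^ n * (2 ^ n / fact n)"
    using ch by (intro mult_left_mono divide_right_mono) auto
  also have "\<dots> = 8 ^ n * ((real n + 1) ^ n / fact n)"
  proof -
    have "(4 * X) ^ n * 2 ^ n = (4 * X * 2) ^ n" "4 * X * 2 = 8 * X" for X :: real by (simp only: power_mult_distrib, simp)
    then have "(4 * (real n + 1)) ^ n * 2 ^ n = 8 ^ n * (real n + 1) ^ n" by (simp only: power_mult_distrib)
    then show ?thesis by simp
  qed
  also have "(real n + 1) ^ n / fact n = real (Suc n) ^ Suc n / fact (Suc n)"
  proof -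
    have "real (Suc n) ^ Suc n / fact (Suc n) = (real (Suc n) * real (Suc n) ^ n) / (real (Suc n) * fact n)" by simp
    also have "\<dots> = real (Suc n) ^ n / fact n" by (simp del: of_nat_Suc)
    finally show ?thesis by (simp add: add.commute)
  qed
  also have "\<dots> \<le> exp (real (Suc n))"
    using power_le_exp_fact[of "Suc n"] by (simp add: pos_divide_le_eq del: fact_Suc power_Suc of_nat_Suc)
  also have "exp (real (Suc n)) \<le> 3 ^ Suc n"
  proof -
    have "exp (real (Suc n)) = exp 1 ^ Suc n" by (simp only: exp_of_nat_mult[symmetric] mult_1_right)
    also have "\<dots> \<le> 3 ^ Suc n" using exp_le by (intro power_mono) auto
    finally show ?thesis .
  qed
  finally have "(4 * (real n + 1)) ^ n / (fact i * fact (n - i)) \<le> 8 ^ n * 3 ^ Suc n" by simp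
  also have "\<dots> = 3 * (8 * 3) ^ n" unfolding power_mult_distrib by simp
  finally show ?thesis by simp
qed

text \<open>The nodes are at least as spread as an equispaced grid, so the Lagrange denominators are
  at least \<open>\<tau>^n * i! * (n-i)!\<close>. Recovering a coefficient from values then loses a
  geometric factor in \<open>n\<close>, not a factorial.\<close>

lemma lagrange_bound:
  fixes x :: "nat \<Rightarrow> real"
  assumes \<rho>: "0 < \<rho>" and x: "\<And>i. i \<le> n \<Longrightarrow> x i \<in> {0..\<rho>}"
    and gap: "\<And>i j. i \<le> n \<Longrightarrow> j \<le> n \<Longrightarrow> \<rho> / (2 * (real n + 1)) * \<bar>real i - real j\<bar> \<le> \<bar>x i - x j\<bar>"
  shows "\<exists>c :: nat \<Rightarrow> nat \<Rightarrow> complex. (\<forall>p k. degree p \<le> n \<longrightarrow> coeff p k = (\<Sum>i\<le>n. c i k * poly p (of_real (x i)))) \<and>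
     (\<forall>i\<le>n. \<forall>k. norm (c i k) * \<rho> ^ k \<le> 3 * 24 ^ n)"
proof -
  define X where "X i = complex_of_real (x i)" for i
  define J where "J i = {..n} - {i}" for i
  define w where "w i = (\<Prod>j\<in>J i. X i - X j)" for i
  define P where "P i = (\<Prod>j\<in>J i. [:- X j, 1:])" for i
  define \<tau> where "\<tau> = \<rho> / (2 * (real n + 1))"
  have \<tau>: "0 < \<tau>" using \<rho> by (simp add: \<tau>_def)
  have inj: "X i \<noteq> X j" if "i \<le> n" "j \<le> n" "i \<noteq> j" for i j
  proof -
    have "0 < \<tau> * \<bar>real i - real j\<bar>" using \<tau> that by simp
    then have "0 < \<bar>x i - x j\<bar>" using gap[OF that(1,2)] unfolding \<tau>_def by linarith
    then show ?thesis by (simp add: X_def)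
  qed
  have w0: "w i \<noteq> 0" if "i \<le> n" for i
    unfolding w_def using inj[OF that] by (auto simp: J_def)
  have cJ: "card (J i) = n" "finite (J i)" if "i \<le> n" for i using that by (simp_all add: J_def)
  have Pi: "poly (P i) (X j) = (if i = j then w i else 0)" if "i \<le> n" "j \<le> n" for i j
    unfolding P_def w_def poly_prod using that by (auto simp: J_def intro!: prod.cong)
  have degP: "degree (P i) \<le> n" if "i \<le> n" for i
    unfolding P_def using degree_prod_sum_le[OF cJ(2)[OF that], of "\<lambda>j. [:- X j, 1:]"] cJ(1)[OF that] by (simp add: o_def)
  have wlow: "(\<tau> ^ n) * (fact i * fact (n - i)) \<le> norm (w i)" if "i \<le> n" for i
  proof -
    have "(\<tau> ^ n) * (fact i * fact (n - i)) = (\<Prod>j\<in>J i. \<tau> * \<bar>real i - real j\<bar>)"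
      using prod_abs_diff_fact[OF that] cJ[OF that] by (simp add: prod.distrib J_def)
    also have "\<dots> \<le> (\<Prod>j\<in>J i. norm (X i - X j))"
    proof (rule prod_mono)
      fix j assume "j \<in> J i"
      then have "j \<le> n" by (simp add: J_def)
      then show "0 \<le> \<tau> * \<bar>real i - real j\<bar> \<and> \<tau> * \<bar>real i - real j\<bar> \<le> norm (X i - X j)"
        using gap[OF that, of j] mult_nonneg_nonneg[OF less_imp_le[OF \<tau>] abs_ge_zero]
        unfolding X_def of_real_diff[symmetric] norm_of_real \<tau>_def by blast
    qed
    finally show ?thesis by (simp add: w_def prod_norm)
  qed
  define c where "c i k = coeff (P i) k / w i" for i k
  have "norm (c i k) * \<rho> ^ k \<le> 3 * 24 ^ n" if "i \<le> n" for i k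
  proof -
    have "norm (coeff (P i) k) * \<rho> ^ k \<le> (2 * \<rho>) ^ n"
      unfolding P_def using coeff_prod_linear_bound[OF cJ(2)[OF that] \<rho>, of X k] x cJ(1)[OF that]
      by (auto simp: X_def J_def)
    then have "norm (c i k) * \<rho> ^ k \<le> (2 * \<rho>) ^ n / norm (w i)"
      unfolding c_def norm_divide by (simp add: divide_right_mono)
    also have "\<dots> \<le> (2 * \<rho>) ^ n / ((\<tau> ^ n) * (fact i * fact (n - i)))"
      using wlow[OF that] \<rho> \<tau> w0[OF that] by (intro divide_left_mono) auto
    also have "\<dots> = ((2 * \<rho>) / \<tau>) ^ n / (fact i * fact (n - i))" by (simp add: power_divide)
    also have "(2 * \<rho>) / \<tau> = 4 * (real n + 1)" using \<rho> by (simp add: \<tau>_def field_simps)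
    also have "(4 * (real n + 1)) ^ n / (fact i * fact (n - i)) \<le> 3 * 24 ^ n" by (rule interpolation_constant[OF that])
    finally show ?thesis .
  qed
  moreover have "coeff p k = (\<Sum>i\<le>n. c i k * poly p (X i))" if p: "degree p \<le> n" for p k
  proof -
    have "p = (\<Sum>i\<le>n. smult (poly p (X i) / w i) (P i))"
    proof (rule poly_eqI_degree[of "X ` {..n}"])
      fix z assume "z \<in> X ` {..n}"
      then obtain j where j: "j \<le> n" "z = X j" by auto
      have "poly (\<Sum>i\<le>n. smult (poly p (X i) / w i) (P i)) z = (\<Sum>i\<le>n. if i = j then poly p (X j) else 0)"
        unfolding poly_sum poly_smult j(2) using j(1) w0 by (intro sum.cong) (auto simp: Pi)
      then show "poly p z = poly (\<Sum>i\<le>n. smult (poly p (X i) / w i) (P i)) z" using j by simp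
    next
      have "inj_on X {..n}" using inj by (auto simp: inj_on_def)
      then have card: "card (X ` {..n}) = Suc n" by (simp add: card_image)
      then show "degree p < card (X ` {..n})" using p by simp
      have "degree (\<Sum>i\<le>n. smult (poly p (X i) / w i) (P i)) \<le> n"
        by (rule degree_sum_le) (simp_all add: degP)
      then show "degree (\<Sum>i\<le>n. smult (poly p (X i) / w i) (P i)) < card (X ` {..n})" using card by simp
    qed
    then have "coeff p k = coeff (\<Sum>i\<le>n. smult (poly p (X i) / w i) (P i)) k" by simp
    then show ?thesis by (simp add: coeff_sum c_def mult.commute)
  qed
  ultimately show ?thesis unfolding X_def by blast
qed

text \<open>The bracket \<open>[l]\<close> of the weighted norm, as a real number.\<close>

definition jap :: "int \<Rightarrow> real" where "jap l = max \<bar>of_int l\<bar> 1"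

lemma jap_ge1: "1 \<le> jap l" by (simp add: jap_def)

lemma card_jap_le:
  assumes "finite F" "\<And>l. l \<in> F \<Longrightarrow> jap l < b" "1 \<le> b"
  shows "real (card F) \<le> 3 * b"
proof -
  have "F \<subseteq> {- \<lfloor>b\<rfloor>..\<lfloor>b\<rfloor>}"
  proof
    fix l assume "l \<in> F"
    then have "\<bar>real_of_int l\<bar> < b" using assms(2)[of l] by (simp add: jap_def)
    then show "l \<in> {- \<lfloor>b\<rfloor>..\<lfloor>b\<rfloor>}" by (auto simp: le_floor_iff) linarith
  qed
  then have "card F \<le> card {- \<lfloor>b\<rfloor>..\<lfloor>b\<rfloor>}" by (intro card_mono) auto
  then have "real (card F) \<le> 2 * of_int \<lfloor>b\<rfloor> + 1" using assms(3) by (simp add: le_floor_iff) linarith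
  also have "\<dots> \<le> 3 * b" using assms(3) of_int_floor_le[of b] by linarith
  finally show ?thesis .
qed


lemma geometric_tail:
  fixes f :: "nat \<Rightarrow> complex"
  assumes f: "\<And>k. norm (f k) \<le> M * t ^ k" and t: "0 \<le> t" "t \<le> 1/2" and M: "0 \<le> M"
  shows "summable f" "norm ((\<Sum>k. f k) - (\<Sum>k\<le>n. f k)) \<le> 2 * M * t ^ Suc n"
proof -
  have g: "summable (\<lambda>k. M * t ^ k)" using t by (intro summable_mult summable_geometric) auto
  show s: "summable f" by (rule summable_comparison_test'[OF g, of 0]) (rule f)
  have "(\<Sum>k. f k) - (\<Sum>k\<le>n. f k) = (\<Sum>k. f (k + Suc n))"
    using suminf_minus_initial_segment[OF s, of "Suc n"] by (simp add: lessThan_Suc_atMost)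
  also have "norm \<dots> \<le> (\<Sum>k. M * t ^ Suc n * t ^ k)"
  proof (rule norm_suminf_le)
    show "norm (f (k + Suc n)) \<le> M * t ^ Suc n * t ^ k" for k
      using f[of "k + Suc n"] by (simp add: power_add mult_ac)
    show "summable (\<lambda>k. M * t ^ Suc n * t ^ k)" using t by (intro summable_mult summable_geometric) auto
  qed
  also have "\<dots> = M * t ^ Suc n * (1 / (1 - t))"
    using t by (subst suminf_mult) (auto simp: suminf_geometric intro!: summable_geometric)
  also have "\<dots> \<le> M * t ^ Suc n * 2" using t M by (intro mult_left_mono) (auto simp: field_simps)
  finally show "norm ((\<Sum>k. f k) - (\<Sum>k\<le>n. f k)) \<le> 2 * M * t ^ Suc n" by (simp add: mult_ac)
qed

text \<open>The map \<open>u \<mapsto> f(\<cdot>,u)\<close> need not be locally bounded at \<open>0\<close> in the stronger norm. It is bounded on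
  a subset of \<open>[0,\<rho>]\<close> of measure at least \<open>\<rho>/2\<close>; Lagrange interpolation at points of this set loses
  a factor \<open>C\<^sup>n\<close>, which is absorbed in the frequency block \<open>B\<^sup>n \<le> |l| < B\<^sup>n\<^sup>+\<^sup>1\<close> by an arbitrarily
  small power of \<open>|l|\<close>, while Taylor coefficients of order above \<open>n\<close> are controlled by the smallness of \<open>\<rho>\<close>.\<close>

lemma coefficient_regularity:
  fixes \<alpha> :: "nat \<Rightarrow> int \<Rightarrow> complex" and r M s' sb :: real
  assumes r: "0 < r" and sb: "0 \<le> sb" "sb < s'"
    and \<alpha>: "\<And>k l. norm (\<alpha> k l) * r ^ k \<le> M"
    and val: "\<And>u. u \<in> {0..r} \<Longrightarrow>
      \<exists>b. \<forall>F. finite F \<longrightarrow> (\<Sum>l\<in>F. jap l powr s' * norm (\<Sum>k. \<alpha> k l * of_real u ^ k)) \<le> b"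
  shows "\<exists>\<rho>>0. \<exists>C\<ge>0. \<forall>k F. finite F \<longrightarrow> (\<Sum>l\<in>F. jap l powr sb * norm (\<alpha> k l)) * \<rho> ^ k \<le> C"
proof -
  have M: "0 \<le> M" using order_trans[OF norm_ge_zero, of "\<alpha> 0 0" M] \<alpha>[of 0 0] by simp
  define \<theta> where "\<theta> = s' - sb"
  have \<theta>: "0 < \<theta>" using sb by (simp add: \<theta>_def)
  \<comment> \<open>Block ratio. The surrendered regularity \<theta> yields \<open>192 ^ n\<close>
    on block \<open>n\<close>, where 192 = 24 * 8: 24 pays for the interpolation constant and 8 for
    the number of nodes, with a geometric decay to spare.\<close>
  define B where "B = max 8 (192 powr (1 / \<theta>))"
  have B: "8 \<le> B" "192 \<le> B powr \<theta>"
  proof -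
    show "8 \<le> B" by (simp add: B_def)
    have "192 = (192 powr (1 / \<theta>)) powr \<theta>" using \<theta> by (simp add: powr_powr)
    also have "\<dots> \<le> B powr \<theta>" using \<theta> by (intro powr_mono2) (auto simp: B_def)
    finally show "192 \<le> B powr \<theta>" .
  qed
  have B1: "1 < B" "0 < B" "1 \<le> B" using B(1) by linarith+
  \<comment> \<open>So large that \<open>t ^ Suc n\<close> outweighs both the number of modes in
    block \<open>n\<close>, at most \<open>3 * B ^ Suc n\<close>, and their weight.\<close>
  obtain p :: nat where p: "s' + 3 \<le> real p" using real_arch_simple by blast
  have p1: "1 \<le> p" using p sb by (cases p) auto
  define t where "t = 1 / B ^ p"
  have Bp: "8 \<le> B ^ p" using power_increasing[OF p1 B1(3)] B(1) by simp
  have t: "0 < t" "t \<le> 1/8" using Bp by (auto simp: t_def field_simps)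
  define \<rho> where "\<rho> = r * t"
  have \<rho>: "0 < \<rho>" "\<rho> \<le> r / 8" using r t mult_left_mono[OF t(2), of r] by (simp_all add: \<rho>_def)
  have \<alpha>t: "norm (\<alpha> k l) * u ^ k \<le> M * (u / r) ^ k" if "0 \<le> u" for u k l
  proof -
    have "norm (\<alpha> k l) * u ^ k = (norm (\<alpha> k l) * r ^ k) * (u / r) ^ k" using r by (simp add: power_divide)
    also have "\<dots> \<le> M * (u / r) ^ k" using \<alpha> that r by (intro mult_right_mono) auto
    finally show ?thesis .
  qed
  have small: "norm (\<alpha> k l * of_real u ^ k) \<le> M * t ^ k" if "u \<in> {0..\<rho>}" for u k l
  proof -
    have "(u / r) ^ k \<le> t ^ k" using that r by (intro power_mono) (auto simp: \<rho>_def pos_divide_le_eq mult.commute)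
    then have "M * (u / r) ^ k \<le> M * t ^ k" using M by (rule mult_left_mono)
    then show ?thesis using \<alpha>t[of u k l] that by (simp add: norm_mult norm_power)
  qed
  define g where "g l u = (\<Sum>k. \<alpha> k l * of_real u ^ k)" for l and u :: real
  have gc: "continuous_on {0..\<rho>} (g l)" for l
  proof (rule continuous_on_subset[of "{0..\<rho>}"])
    have lim: "uniform_limit {0..\<rho>} (\<lambda>n u. \<Sum>k<n. \<alpha> k l * of_real u ^ k) (g l) sequentially"
      unfolding g_def[abs_def]
      by (rule Weierstrass_m_test[where M = "\<lambda>k. M * t ^ k"])
         (use small t in \<open>auto intro!: summable_mult summable_geometric\<close>)
    show "continuous_on {0..\<rho>} (g l)"
      by (rule uniform_limit_theorem[OF _ lim]) (auto intro!: always_eventually continuous_intros)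
  qed simp
  define Q where "Q F u = (\<Sum>l\<in>F. jap l powr s' * norm (g l u))" for F u
  have Qc: "continuous_on {0..\<rho>} (Q F)" for F
    unfolding Q_def by (intro continuous_on_sum continuous_on_mult continuous_on_const continuous_on_norm gc)
  \<comment> \<open>Sublevel sets of the pointwise finite weighted norm. Each is compact, as only
    continuous finite sums occur, and they increase to the whole interval.\<close>
  define E where "E N = {u \<in> {0..\<rho>}. \<forall>F. finite F \<longrightarrow> Q F u \<le> real N}" for N :: nat
  have Ec: "compact (E N)" for N
  proof -
    have e: "E N = {0..\<rho>} \<inter> (\<Inter>F\<in>{F. finite F}. {u \<in> {0..\<rho>}. Q F u \<le> real N})"
    proof (rule set_eqI)
      show "u \<in> E N \<longleftrightarrow> u \<in> {0..\<rho>} \<inter> (\<Inter>F\<in>{F. finite F}. {u \<in> {0..\<rho>}. Q F u \<le> real N})" for u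
        unfolding E_def Int_iff INT_iff mem_Collect_eq by blast
    qed
    have c: "closed {u \<in> {0..\<rho>}. Q F u \<le> real N}" for F
      by (rule continuous_on_closed_Collect_le[OF Qc continuous_on_const closed_atLeastAtMost])
    have "closed (\<Inter>F\<in>{F. finite F}. {u \<in> {0..\<rho>}. Q F u \<le> real N})"
      by (rule closed_INT) (rule ballI, rule c)
    then show ?thesis unfolding e by (rule compact_Int_closed[OF compact_Icc])
  qed
  have Einc: "incseq E"
  proof (rule incseq_SucI)
    show "E n \<subseteq> E (Suc n)" for n
    proof
      fix u assume "u \<in> E n"
      then have "u \<in> {0..\<rho>}" "Q F u \<le> real (Suc n)" if "finite F" for F
        using that unfolding E_def by force+
      then show "u \<in> E (Suc n)" unfolding E_def by blast
    qed
  qed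
  have Eun: "(\<Union>N. E N) = {0..\<rho>}"
  proof
    show "{0..\<rho>} \<subseteq> (\<Union>N. E N)"
    proof
      fix u assume u: "u \<in> {0..\<rho>}"
      then have "u \<in> {0..r}" using \<rho> r by auto
      then obtain b where b: "\<forall>F. finite F \<longrightarrow> Q F u \<le> b" using val unfolding Q_def g_def by blast
      obtain N :: nat where "b \<le> real N" using real_arch_simple by blast
      then have "u \<in> E N" using b u order_trans[OF _ \<open>b \<le> real N\<close>] unfolding E_def by blast
      then show "u \<in> (\<Union>N. E N)" by blast
    qed
    show "(\<Union>N. E N) \<subseteq> {0..\<rho>}" unfolding E_def by blast
  qed
  \<comment> \<open>Continuity from below of the measure replaces a Baire argument: uniform
    boundedness holds on a set of more than half the measure, which need not contain an interval but
    has room for well-spread nodes.\<close>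
  have "(\<lambda>N. emeasure lborel (E N)) \<longlonglongrightarrow> emeasure lborel {0..\<rho>}"
    unfolding Eun[symmetric] by (rule Lim_emeasure_incseq[OF _ Einc]) (simp add: image_subset_iff borel_compact[OF Ec])
  moreover have "ennreal (\<rho> / 2) < emeasure lborel {0..\<rho>}" using \<rho> by (simp add: ennreal_lessI)
  ultimately have "\<forall>\<^sub>F N in sequentially. ennreal (\<rho> / 2) < emeasure lborel (E N)" by (rule order_tendstoD)
  then obtain N where N: "ennreal (\<rho> / 2) < emeasure lborel (E N)" by (auto simp: eventually_sequentially)
  have points: "\<exists>x :: nat \<Rightarrow> real. (\<forall>i\<le>n. x i \<in> E N) \<and>
      (\<forall>i j. i \<le> n \<longrightarrow> j \<le> n \<longrightarrow> \<rho> / (2 * (real n + 1)) * \<bar>real i - real j\<bar> \<le> \<bar>x i - x j\<bar>)" for n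
  proof -
    define \<tau> where "\<tau> = \<rho> / (2 * (real n + 1))"
    have \<tau>: "0 < \<tau>" "real n * \<tau> \<le> \<rho> / 2" using \<rho> by (simp_all add: \<tau>_def field_simps)
    have "ennreal (real n * \<tau>) \<le> ennreal (\<rho> / 2)" using \<tau>(2) by (rule ennreal_leI)
    then obtain x where x: "\<forall>i\<le>n. x i \<in> E N" "\<forall>i<n. x i + \<tau> \<le> x (Suc i)"
      using spread_points[OF Ec \<tau>(1) order_le_less_trans[OF _ N], of n] by blast
    have up: "x i + \<tau> * real k \<le> x (i + k)" if "i + k \<le> n" for i k
      using that
    proof (induction k)
      case (Suc k)
      then have "x (i + k) + \<tau> \<le> x (i + Suc k)" using x(2) by simp
      then show ?case using Suc by (simp add: algebra_simps)
    qed simp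
    have "\<tau> * \<bar>real i - real j\<bar> \<le> \<bar>x i - x j\<bar>" if "i \<le> n" "j \<le> n" for i j
    proof (cases "i \<le> j")
      case True
      then show ?thesis using up[of i "j - i"] that by (simp add: of_nat_diff)
    next
      case False
      then show ?thesis using up[of j "i - j"] that by (simp add: of_nat_diff)
    qed
    then show ?thesis using x(1) unfolding \<tau>_def by blast
  qed
  define N3 where "N3 = 3 * (real N + 6 * M) + 3 * M"
  have N3: "0 \<le> N3" using M by (simp add: N3_def)
  \<comment> \<open>One dyadic-type block of frequencies, treated with interpolation of degree
    \<open>n\<close> equal to the block index and uniformly in \<open>k\<close>.\<close>
  have block: "(\<Sum>l\<in>F. jap l powr sb * norm (\<alpha> k l)) * \<rho> ^ k \<le> N3 * (1/2) ^ n"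
    if F: "finite F" "\<And>l. l \<in> F \<Longrightarrow> B ^ n \<le> jap l" "\<And>l. l \<in> F \<Longrightarrow> jap l < B ^ Suc n" for F n k
  proof -
    have cF: "real (card F) \<le> 3 * B ^ Suc n"
      by (rule card_jap_le[OF F(1,3) one_le_power[OF B1(3)]])
    have tn: "B ^ Suc n * (B ^ Suc n) powr x * t ^ Suc n \<le> (1 / B) ^ Suc n" if "x \<le> s'" for x
    proof -
      have "B ^ Suc n * (B ^ Suc n) powr x * t ^ Suc n = B powr (real (Suc n) * (1 + x - real p))"
      proof -
        have "t ^ Suc n = B powr (- real p * real (Suc n))"
          using B1 by (simp add: t_def powr_minus powr_realpow[symmetric] powr_powr power_mult[symmetric] power_one_over inverse_eq_divide del: power_Suc)
        moreover have "B ^ Suc n = B powr real (Suc n)" using B1 by (simp only: powr_realpow)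
        ultimately show ?thesis using B1
          by (simp only: powr_powr powr_add[symmetric]) (simp add: algebra_simps)
      qed
      also have "\<dots> \<le> B powr (real (Suc n) * (- 1))"
        using p that B1 by (intro powr_mono mult_left_mono) auto
      also have "\<dots> = (1 / B) ^ Suc n"
        using B1 by (simp add: powr_minus powr_realpow power_one_over inverse_eq_divide del: power_Suc of_nat_Suc)
      finally show ?thesis .
    qed
    have Bhalf: "(1 / B) ^ Suc n \<le> (1/2) ^ n"
    proof -
      have "(1 / B) ^ Suc n \<le> (1 / 2) ^ Suc n" using B(1) by (intro power_mono) (auto simp: field_simps)
      also have "\<dots> \<le> (1/2) ^ n" by simp
      finally show ?thesis .
    qed
    have japs: "jap l powr x \<le> (B ^ Suc n) powr x" if "l \<in> F" "0 \<le> x" for l x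
      using F(3)[OF that(1)] jap_ge1[of l] that(2) by (intro powr_mono2) auto
    show ?thesis
    proof (cases "k \<le> n")
      \<comment> \<open>Orders above the block index: \<open>\<rho>^k\<close> contributes at least
        \<open>t ^ Suc n\<close>, and no information on the stronger norm is used.\<close>
      case False
      have "(\<Sum>l\<in>F. jap l powr sb * norm (\<alpha> k l)) * \<rho> ^ k = (\<Sum>l\<in>F. jap l powr sb * (norm (\<alpha> k l) * \<rho> ^ k))"
        by (simp add: sum_distrib_right mult.assoc)
      also have "\<dots> \<le> (\<Sum>l\<in>F. (B ^ Suc n) powr sb * (M * t ^ Suc n))"
      proof (rule sum_mono, rule mult_mono)
        fix l assume "l \<in> F"
        then show "jap l powr sb \<le> (B ^ Suc n) powr sb" using sb by (intro japs)
        have "norm (\<alpha> k l) * \<rho> ^ k \<le> M * t ^ k" using \<alpha>t[of \<rho> k l] \<rho> r by (simp add: \<rho>_def)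
        also have "t ^ k \<le> t ^ Suc n" using False t by (intro power_decreasing) auto
        finally show "norm (\<alpha> k l) * \<rho> ^ k \<le> M * t ^ Suc n" using M by (simp add: mult_left_mono)
      qed (use sb \<rho> in auto)
      also have "\<dots> = real (card F) * ((B ^ Suc n) powr sb * (M * t ^ Suc n))" by simp
      also have "\<dots> \<le> (3 * B ^ Suc n) * ((B ^ Suc n) powr sb * (M * t ^ Suc n))"
        using cF M t by (intro mult_right_mono) auto
      also have "\<dots> = 3 * M * (B ^ Suc n * (B ^ Suc n) powr sb * t ^ Suc n)" by (simp only: mult_ac)
      also have "\<dots> \<le> 3 * M * (1/2) ^ n"
        using M order_trans[OF tn Bhalf, of sb] sb by (intro mult_left_mono) auto
      also have "\<dots> \<le> N3 * (1/2) ^ n" using M by (intro mult_right_mono) (auto simp: N3_def)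
      finally show ?thesis .
    next
      case True
      \<comment> \<open>Orders up to \<open>n\<close>: interpolate the Taylor polynomial at nodes of
        \<open>E N\<close>, where the full series is bounded by \<open>N\<close> and the tail is of
        order \<open>t ^ Suc n\<close>.\<close>
      obtain x where x: "\<forall>i\<le>n. x i \<in> E N"
        "\<forall>i j. i \<le> n \<longrightarrow> j \<le> n \<longrightarrow> \<rho> / (2 * (real n + 1)) * \<bar>real i - real j\<bar> \<le> \<bar>x i - x j\<bar>"
        using points by blast
      have xE: "x i \<in> {0..\<rho>}" if "i \<le> n" for i using x(1) that by (auto simp: E_def)
      have gap: "\<rho> / (2 * (real n + 1)) * \<bar>real i - real j\<bar> \<le> \<bar>x i - x j\<bar>" if "i \<le> n" "j \<le> n" for i j
        using x(2) that by blast
      from lagrange_bound[OF \<rho>(1) xE gap] obtain c :: "nat \<Rightarrow> nat \<Rightarrow> complex" where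
        c0: "(\<forall>p k. degree p \<le> n \<longrightarrow> coeff p k = (\<Sum>i\<le>n. c i k * poly p (of_real (x i)))) \<and>
          (\<forall>i\<le>n. \<forall>k. norm (c i k) * \<rho> ^ k \<le> 3 * 24 ^ n)" by (rule exE)
      note c = conjunct1[OF c0, rule_format] conjunct2[OF c0, rule_format]
      define P where "P l = (\<Sum>j\<le>n. monom (\<alpha> j l) j)" for l
      have Pdeg: "degree (P l) \<le> n" for l unfolding P_def by (rule degree_sum_le) (auto intro: order_trans[OF degree_monom_le])
      have Pk: "coeff (P l) k = \<alpha> k l" for l using True by (simp add: P_def coeff_sum)
      have Pev: "poly (P l) (of_real u) = (\<Sum>j\<le>n. \<alpha> j l * of_real u ^ j)" for l u by (simp add: P_def poly_sum poly_monom)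
      have Px: "(\<Sum>l\<in>F. jap l powr s' * norm (poly (P l) (of_real (x i)))) \<le> real N + 6 * M" if i: "i \<le> n" for i
      proof -
        have e: "norm (poly (P l) (of_real (x i))) \<le> norm (g l (x i)) + 2 * M * t ^ Suc n" for l
        proof -
          have "norm (g l (x i) - poly (P l) (of_real (x i))) \<le> 2 * M * t ^ Suc n"
            unfolding Pev g_def by (rule geometric_tail(2)[OF small[OF xE[OF i]]]) (use t M in auto)
          then show ?thesis
            using norm_triangle_sub[of "poly (P l) (of_real (x i))" "g l (x i)"] by (simp add: norm_minus_commute)
        qed
        have "(\<Sum>l\<in>F. jap l powr s' * norm (poly (P l) (of_real (x i)))) \<le> (\<Sum>l\<in>F. jap l powr s' * (norm (g l (x i)) + 2 * M * t ^ Suc n))"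
          by (intro sum_mono mult_left_mono e) simp
        also have "\<dots> = Q F (x i) + (\<Sum>l\<in>F. jap l powr s' * (2 * M * t ^ Suc n))"
          by (simp add: Q_def distrib_left sum.distrib)
        also have "Q F (x i) \<le> real N" using x(1) i F(1) by (auto simp: E_def)
        also have "(\<Sum>l\<in>F. jap l powr s' * (2 * M * t ^ Suc n)) \<le> (\<Sum>l\<in>F. (B ^ Suc n) powr s' * (2 * M * t ^ Suc n))"
          using M t sb by (intro sum_mono mult_right_mono japs) auto
        also have "\<dots> = real (card F) * ((B ^ Suc n) powr s' * (2 * M * t ^ Suc n))" by simp
        also have "\<dots> \<le> (3 * B ^ Suc n) * ((B ^ Suc n) powr s' * (2 * M * t ^ Suc n))"
          using cF M t by (intro mult_right_mono) auto
        also have "\<dots> = 6 * M * (B ^ Suc n * (B ^ Suc n) powr s' * t ^ Suc n)" by simp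
        also have "\<dots> \<le> 6 * M * 1"
        proof (intro mult_left_mono order_trans[OF tn])
          show "(1 / B) ^ Suc n \<le> 1" using B1 by (intro power_le_one) auto
        qed (use M in auto)
        finally show ?thesis by simp
      qed
      \<comment> \<open>Here the excess \<open>\<theta> = s' - sb\<close> is spent: on this block
        \<open>jap l powr \<theta>\<close> is at least \<open>192 ^ n\<close>.\<close>
      have "(\<Sum>l\<in>F. jap l powr sb * norm (\<alpha> k l)) * \<rho> ^ k \<le> (\<Sum>l\<in>F. (1/192) ^ n * (jap l powr s' * norm (\<alpha> k l))) * \<rho> ^ k"
      proof (intro mult_right_mono sum_mono)
        fix l assume l: "l \<in> F"
        have "192 ^ n \<le> (B powr \<theta>) ^ n" using B(2) by (intro power_mono) auto
        also have "\<dots> = (B ^ n) powr \<theta>" using B1 by (simp add: powr_realpow[symmetric] powr_powr mult.commute)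
        also have "\<dots> \<le> jap l powr \<theta>" using F(2)[OF l] \<theta> B1 by (intro powr_mono2) auto
        finally have "192 ^ n * jap l powr sb \<le> jap l powr \<theta> * jap l powr sb" by (rule mult_right_mono) simp
        also have "\<dots> = jap l powr s'" by (simp add: powr_add[symmetric] \<theta>_def)
        finally have "jap l powr sb \<le> (1/192) ^ n * jap l powr s'" by (simp add: power_one_over field_simps)
        from mult_right_mono[OF this norm_ge_zero[of "\<alpha> k l"]]
        show "jap l powr sb * norm (\<alpha> k l) \<le> (1/192) ^ n * (jap l powr s' * norm (\<alpha> k l))" by (simp add: mult.assoc)
      qed (use \<rho> in simp)
      also have "\<dots> = (1/192) ^ n * (\<Sum>l\<in>F. jap l powr s' * (norm (\<alpha> k l) * \<rho> ^ k))"
        unfolding sum_distrib_left sum_distrib_right by (intro sum.cong refl) (simp only: mult_ac)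
      also have "(\<Sum>l\<in>F. jap l powr s' * (norm (\<alpha> k l) * \<rho> ^ k)) \<le>
          (\<Sum>l\<in>F. jap l powr s' * (\<Sum>i\<le>n. (3 * 24 ^ n) * norm (poly (P l) (of_real (x i)))))"
      proof (intro sum_mono mult_left_mono)
        fix l
        have "norm (\<alpha> k l) \<le> (\<Sum>i\<le>n. norm (c i k) * norm (poly (P l) (of_real (x i))))"
          unfolding Pk[of l, symmetric] c(1)[OF Pdeg] by (rule order_trans[OF norm_sum]) (simp add: norm_mult)
        then have "norm (\<alpha> k l) * \<rho> ^ k \<le> (\<Sum>i\<le>n. norm (c i k) * norm (poly (P l) (of_real (x i)))) * \<rho> ^ k"
          using \<rho> by (intro mult_right_mono) auto
        also have "\<dots> = (\<Sum>i\<le>n. (norm (c i k) * \<rho> ^ k) * norm (poly (P l) (of_real (x i))))"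
          unfolding sum_distrib_right by (intro sum.cong refl) (simp only: mult_ac)
        also have "\<dots> \<le> (\<Sum>i\<le>n. (3 * 24 ^ n) * norm (poly (P l) (of_real (x i))))"
          using c(2) by (intro sum_mono mult_right_mono) auto
        finally show "norm (\<alpha> k l) * \<rho> ^ k \<le> (\<Sum>i\<le>n. (3 * 24 ^ n) * norm (poly (P l) (of_real (x i))))" .
      qed simp
      also have "(\<Sum>l\<in>F. jap l powr s' * (\<Sum>i\<le>n. (3 * 24 ^ n) * norm (poly (P l) (of_real (x i)))))
          = (3 * 24 ^ n) * (\<Sum>i\<le>n. \<Sum>l\<in>F. jap l powr s' * norm (poly (P l) (of_real (x i))))"
        unfolding sum_distrib_left by (subst sum.swap) (intro sum.cong refl, simp only: mult_ac)
      also have "\<dots> \<le> (3 * 24 ^ n) * (\<Sum>i\<le>n. real N + 6 * M)"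
        by (intro mult_left_mono sum_mono Px) auto
      also have "\<dots> = (3 * 24 ^ n) * (real (Suc n) * (real N + 6 * M))" by simp
      also have "(1/192) ^ n * ((3 * 24 ^ n) * (real (Suc n) * (real N + 6 * M))) =
          3 * (real N + 6 * M) * (((1/192) * 24) ^ n * real (Suc n))"
        unfolding power_mult_distrib by (simp only: mult_ac)
      also have "\<dots> \<le> 3 * (real N + 6 * M) * (1/2) ^ n"
      proof (rule mult_left_mono)
        have "real (Suc n) \<le> 2 ^ n" by (induction n) auto
        then have "(1/8) ^ n * real (Suc n) \<le> (1/8) ^ n * 2 ^ n" by (intro mult_left_mono) auto
        also have "\<dots> = (1/4) ^ n" unfolding power_mult_distrib[symmetric] by simp
        also have "\<dots> \<le> (1/2) ^ n" by (intro power_mono) auto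
        finally show "((1/192) * 24) ^ n * real (Suc n) \<le> (1/2 :: real) ^ n" by simp
      qed (use M in simp)
      also have "\<dots> \<le> N3 * (1/2) ^ n" using M by (intro mult_right_mono) (auto simp: N3_def)
      finally show ?thesis by (simp add: mult_left_mono)
    qed
  qed
  \<comment> \<open>Index of the block containing a frequency; it splits any finite set of modes
    into blocks with geometrically decaying bounds.\<close>
  define nb where "nb l = nat \<lfloor>log B (jap l)\<rfloor>" for l
  have nb: "B ^ nb l \<le> jap l" "jap l < B ^ Suc (nb l)" for l
  proof -
    have j: "0 < jap l" using jap_ge1[of l] by linarith
    have "0 \<le> log B (jap l)" using zero_le_log_cancel_iff[OF B1(1) j] jap_ge1[of l] by simp
    then have "real (nb l) = of_int \<lfloor>log B (jap l)\<rfloor>" by (simp add: nb_def)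
    then have n: "real (nb l) \<le> log B (jap l)" "log B (jap l) < real (Suc (nb l))"
      using floor_correct[of "log B (jap l)"] by linarith+
    then have "B powr real (nb l) \<le> jap l" "jap l < B powr real (Suc (nb l))"
      using B1 j by (simp_all only: le_log_iff log_less_iff)
    then show "B ^ nb l \<le> jap l" "jap l < B ^ Suc (nb l)" using B1 by (simp_all only: powr_realpow)
  qed
  have "(\<Sum>l\<in>F. jap l powr sb * norm (\<alpha> k l)) * \<rho> ^ k \<le> 2 * N3" if F: "finite F" for F k
  proof -
    have "(\<Sum>l\<in>F. jap l powr sb * norm (\<alpha> k l)) * \<rho> ^ k
        = (\<Sum>n\<in>nb ` F. (\<Sum>l\<in>{l\<in>F. nb l = n}. jap l powr sb * norm (\<alpha> k l)) * \<rho> ^ k)"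
      by (subst sum.image_gen[OF F, of _ nb]) (simp add: sum_distrib_right)
    also have "\<dots> \<le> (\<Sum>n\<in>nb ` F. N3 * (1/2) ^ n)"
      by (intro sum_mono block) (use F nb in auto)
    also have "\<dots> \<le> (\<Sum>n. N3 * (1/2) ^ n)"
      by (rule sum_le_suminf) (use F N3 in \<open>auto intro!: summable_mult summable_geometric\<close>)
    also have "\<dots> = 2 * N3" by (subst suminf_mult) (auto simp: suminf_geometric intro!: summable_geometric)
    finally show ?thesis .
  qed
  then show ?thesis using \<rho>(1) N3 by (intro exI[of _ \<rho>] conjI exI[of _ "2 * N3"] allI impI) auto
qed

subsection \<open>Distributional solutions of the wave equation\<close>

text \<open>The outside of the ball is open along every coordinate line, so vanishing there passes
  to each further partial derivative with the same radius.\<close>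

lemma test_function_support:
  assumes D: "test_function D"
  shows "\<exists>R. \<forall>i j z. norm z > R \<longrightarrow> D i j z = 0"
proof -
  obtain R where R: "\<And>z. norm z > R \<Longrightarrow> D 0 0 z = 0" using D unfolding test_function_def by blast
  have dt: "((\<lambda>t. D i j (t, x)) has_real_derivative D (Suc i) j (t, x)) (at t)"
    and dx: "((\<lambda>x. D i j (t, x)) has_real_derivative D i (Suc j) (t, x)) (at x)" for i j t x
    using D unfolding test_function_def by blast+
  have 1: "\<forall>z. norm z > R \<longrightarrow> D (Suc i) j z = 0" if "\<forall>z. norm z > R \<longrightarrow> D i j z = 0" for i j
  proof (intro allI impI)
    fix z :: "real \<times> real" assume z: "norm z > R"
    obtain t x where tx: "z = (t, x)" by (cases z)
    have o: "open {s. R < norm (s, x)}" by (intro open_Collect_less continuous_intros)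
    have "((\<lambda>s. D i j (s, x)) has_real_derivative 0) (at t)"
    proof (rule has_field_derivative_transform_within_open[OF DERIV_const o])
      show "t \<in> {s. R < norm (s, x)}" using z by (simp only: tx mem_Collect_eq)
      fix s :: real assume "s \<in> {s. R < norm (s, x)}"
      then have "R < norm (s, x)" by (rule CollectD)
      then show "0 = D i j (s, x)" by (rule that[rule_format, symmetric])
    qed
    then show "D (Suc i) j z = 0" using DERIV_unique[OF dt] tx by blast
  qed
  have 2: "\<forall>z. norm z > R \<longrightarrow> D i (Suc j) z = 0" if "\<forall>z. norm z > R \<longrightarrow> D i j z = 0" for i j
  proof (intro allI impI)
    fix z :: "real \<times> real" assume z: "norm z > R"
    obtain t x where tx: "z = (t, x)" by (cases z)
    have o: "open {s. R < norm (t, s)}" by (intro open_Collect_less continuous_intros)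
    have "((\<lambda>s. D i j (t, s)) has_real_derivative 0) (at x)"
    proof (rule has_field_derivative_transform_within_open[OF DERIV_const o])
      show "x \<in> {s. R < norm (t, s)}" using z by (simp only: tx mem_Collect_eq)
      fix s :: real assume "s \<in> {s. R < norm (t, s)}"
      then have "R < norm (t, s)" by (rule CollectD)
      then show "0 = D i j (t, s)" by (rule that[rule_format, symmetric])
    qed
    then show "D i (Suc j) z = 0" using DERIV_unique[OF dx] tx by blast
  qed
  have "\<forall>z. norm z > R \<longrightarrow> D 0 j z = 0" for j
    by (induction j) (use R 2 in blast)+
  then have "\<forall>z. norm z > R \<longrightarrow> D i j z = 0" for i j
    by (induction i) (use 1 in blast)+
  then show ?thesis by blast
qed

lemma integral_cis_deriv2:
  fixes g0 g1 g2 :: "real \<Rightarrow> real"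
  assumes g: "\<And>t. (g0 has_real_derivative g1 t) (at t)" "\<And>t. (g1 has_real_derivative g2 t) (at t)"
    and cont: "continuous_on {-R..R} g2" and R: "0 \<le> R"
    and z: "g0 R = 0" "g1 R = 0" "g0 (-R) = 0" "g1 (-R) = 0"
  shows "integral {-R..R} (\<lambda>t. cis (\<alpha> * t + b) * of_real (g2 t)) =
    - of_real (\<alpha>\<^sup>2) * integral {-R..R} (\<lambda>t. cis (\<alpha> * t + b) * of_real (g0 t))"
proof -
  define E where "E t = cis (\<alpha> * t + b)" for t
  have dE: "(E has_vector_derivative \<i> * of_real \<alpha> * E t) (at t within S)" for t S
    unfolding E_def[abs_def] by (rule cis_vector_derivative)
  have "((\<lambda>t. E t * of_real (g1 t) - \<i> * of_real \<alpha> * (E t * of_real (g0 t))) has_vector_derivative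
     (E t * of_real (g2 t) + (\<i> * of_real \<alpha> * E t) * of_real (g1 t)) -
     \<i> * of_real \<alpha> * (E t * of_real (g1 t) + (\<i> * of_real \<alpha> * E t) * of_real (g0 t))) (at t within {-R..R})" for t
    by (intro has_vector_derivative_diff has_vector_derivative_mult has_vector_derivative_mult_right dE
        has_vector_derivative_of_real has_field_derivative_at_within[OF g(1)] has_field_derivative_at_within[OF g(2)])
  moreover have "(E t * of_real (g2 t) + (\<i> * of_real \<alpha> * E t) * of_real (g1 t)) -
     \<i> * of_real \<alpha> * (E t * of_real (g1 t) + (\<i> * of_real \<alpha> * E t) * of_real (g0 t))
     = E t * of_real (g2 t) + of_real (\<alpha>\<^sup>2) * (E t * of_real (g0 t))" for t
    by (simp add: power2_eq_square algebra_simps)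
  ultimately have "((\<lambda>t. E t * of_real (g1 t) - \<i> * of_real \<alpha> * (E t * of_real (g0 t))) has_vector_derivative
     E t * of_real (g2 t) + of_real (\<alpha>\<^sup>2) * (E t * of_real (g0 t))) (at t within {-R..R})" for t
    by (simp only:)
  then have "((\<lambda>t. E t * of_real (g2 t) + of_real (\<alpha>\<^sup>2) * (E t * of_real (g0 t))) has_integral
     (E R * of_real (g1 R) - \<i> * of_real \<alpha> * (E R * of_real (g0 R))) - (E (-R) * of_real (g1 (-R)) - \<i> * of_real \<alpha> * (E (-R) * of_real (g0 (-R))))) {-R..R}"
    using R by (intro fundamental_theorem_of_calculus) auto
  then have "integral {-R..R} (\<lambda>t. E t * of_real (g2 t) + of_real (\<alpha>\<^sup>2) * (E t * of_real (g0 t))) = 0"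
    by (simp add: z integral_unique)
  moreover have Ec: "continuous_on {-R..R} E" unfolding E_def by (intro continuous_intros)
  have gc: "continuous_on {-R..R} g0" using g(1) by (meson DERIV_isCont continuous_at_imp_continuous_on)
  have "integral {-R..R} (\<lambda>t. E t * of_real (g2 t) + of_real (\<alpha>\<^sup>2) * (E t * of_real (g0 t))) =
     integral {-R..R} (\<lambda>t. E t * of_real (g2 t)) + integral {-R..R} (\<lambda>t. of_real (\<alpha>\<^sup>2) * (E t * of_real (g0 t)))"
    by (rule integral_add) (intro integrable_continuous_interval continuous_intros Ec gc cont)+
  ultimately have "integral {-R..R} (\<lambda>t. E t * of_real (g2 t)) = - (of_real (\<alpha>\<^sup>2) * integral {-R..R} (\<lambda>t. E t * of_real (g0 t)))"
    unfolding integral_mult_right by (simp add: eq_neg_iff_add_eq_0)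
  then show ?thesis unfolding E_def by simp
qed

text \<open>Two integrations by parts in each variable, with the square chosen larger than the
  support so that all boundary terms vanish. Fubini selects the variable that is integrated
  first.\<close>

lemma plane_wave_test:
  assumes D: "test_function D" and R: "\<And>i j z. norm z > R \<Longrightarrow> D i j z = 0" "0 \<le> R" "R < S"
  shows "integral (cbox (-S, -S) (S, S)) (\<lambda>z. cis (\<alpha> * fst z + \<beta> * snd z) * of_real (D 2 0 z - D 0 2 z)) =
    - of_real (\<alpha>\<^sup>2 - \<beta>\<^sup>2) * integral (cbox (-S, -S) (S, S)) (\<lambda>z. cis (\<alpha> * fst z + \<beta> * snd z) * of_real (D 0 0 z))"
proof -
  have cD: "continuous_on A (D i j)" for A i j
    using D continuous_on_subset[of UNIV "D i j" A] unfolding test_function_def by blast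
  have dt: "((\<lambda>t. D i j (t, x)) has_real_derivative D (Suc i) j (t, x)) (at t)"
    and dx: "((\<lambda>x. D i j (t, x)) has_real_derivative D i (Suc j) (t, x)) (at x)" for i j t x
    using D unfolding test_function_def by blast+
  have n1: "R < norm (t, x)" if "\<bar>t\<bar> = S \<or> \<bar>x\<bar> = S" for t x :: real
    using norm_fst_le[of t x] norm_snd_le[of x t] that R(3) by auto
  let ?E = "\<lambda>z :: real \<times> real. cis (\<alpha> * fst z + \<beta> * snd z)"
  let ?I = "\<lambda>i j. integral (cbox (-S, -S) (S, S)) (\<lambda>z. ?E z * of_real (D i j z))"
  have cont: "continuous_on A (\<lambda>z. ?E z * of_real (D i j z))" for A i j
    by (intro continuous_intros cD)
  have S0: "0 \<le> S" using R by linarith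
  have cc: "continuous_on A (\<lambda>t. D i j (t, x))" "continuous_on A (\<lambda>x. D i j (t, x))" for A i j t x
    by (rule continuous_on_compose2[OF cD[of UNIV]], intro continuous_intros, simp)+
  have P1: "?I i j = integral {-S..S} (\<lambda>t. integral {-S..S} (\<lambda>x. cis (\<beta> * x + \<alpha> * t) * of_real (D i j (t, x))))" for i j
    by (subst integral_prod_continuous[OF cont]) (simp add: add.commute)
  have P2: "?I i j = integral {-S..S} (\<lambda>x. integral {-S..S} (\<lambda>t. cis (\<alpha> * t + \<beta> * x) * of_real (D i j (t, x))))" for i j
  proof -
    have c: "continuous_on (cbox (-S, -S) (S, S)) (\<lambda>(t, x). cis (\<alpha> * t + \<beta> * x) * of_real (D i j (t, x)))"
      using cont by (simp add: case_prod_unfold)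
    show ?thesis
      using integral_swap_continuous[OF c] by (subst integral_prod_continuous[OF cont]) simp
  qed
  have "?I 2 0 = - of_real (\<alpha>\<^sup>2) * ?I 0 0"
  proof -
    have "integral {-S..S} (\<lambda>t. cis (\<alpha> * t + \<beta> * x) * of_real (D 2 0 (t, x))) =
      - of_real (\<alpha>\<^sup>2) * integral {-S..S} (\<lambda>t. cis (\<alpha> * t + \<beta> * x) * of_real (D 0 0 (t, x)))" for x
      using dt[of 0 0 x] dt[of "Suc 0" 0 x] S0
      by (intro integral_cis_deriv2[of _ "\<lambda>t. D (Suc 0) 0 (t, x)"] cc) (auto simp: numeral_2_eq_2 R(1) n1)
    then show ?thesis unfolding P2 by simp
  qed
  moreover have "?I 0 2 = - of_real (\<beta>\<^sup>2) * ?I 0 0"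
  proof -
    have "integral {-S..S} (\<lambda>x. cis (\<beta> * x + \<alpha> * t) * of_real (D 0 2 (t, x))) =
      - of_real (\<beta>\<^sup>2) * integral {-S..S} (\<lambda>x. cis (\<beta> * x + \<alpha> * t) * of_real (D 0 0 (t, x)))" for t
      using dx[of 0 0 t] dx[of 0 "Suc 0" t] S0
      by (intro integral_cis_deriv2[of _ "\<lambda>x. D 0 (Suc 0) (t, x)"] cc) (auto simp: numeral_2_eq_2 R(1) n1)
    then show ?thesis unfolding P1 by simp
  qed
  moreover have "integral (cbox (-S, -S) (S, S)) (\<lambda>z. ?E z * of_real (D 2 0 z - D 0 2 z)) = ?I 2 0 - ?I 0 2"
    unfolding of_real_diff right_diff_distrib by (intro integral_diff integrable_continuous cont)
  ultimately show ?thesis by (simp add: left_diff_distrib)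
qed

text \<open>In the wave variables the mode \<open>(k, l)\<close> is a plane wave with time frequency
  \<open>\<omega>1 * k + \<omega>2 * l\<close> and space frequency \<open>l\<close>, so the
  coefficient equation is its dispersion relation. Absolute convergence allows testing mode by
  mode.\<close>

lemma wave_weak:
  fixes U F :: "(int \<times> int) l1"
  assumes eq: "\<And>k l. of_real ((\<omega>1 * of_int k + \<omega>2 * of_int l)\<^sup>2 - (of_int l)\<^sup>2) * coef U (k, l) = coef F (k, l)"
    and D: "test_function D"
  shows "((\<lambda>(t, x). Re (ev2 U (\<omega>1 * t, x + \<omega>2 * t)) * (D 2 0 (t, x) - D 0 2 (t, x)) + Re (ev2 F (\<omega>1 * t, x + \<omega>2 * t)) * D 0 0 (t, x))
     has_integral 0) UNIV"
proof -
  obtain R0 where R0: "\<And>i j z. norm z > R0 \<Longrightarrow> D i j z = 0" using test_function_support[OF D] by blast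
  define R where "R = max R0 0"
  define S where "S = R + 1"
  have R: "\<And>i j z. norm z > R \<Longrightarrow> D i j z = 0" "0 \<le> R" "R < S" using R0 by (auto simp: R_def S_def)
  define K where "K = cbox (-S, -S) (S, S)"
  have cD: "continuous_on A (D i j)" for A i j
    using D continuous_on_subset[of UNIV "D i j" A] unfolding test_function_def by blast
  define \<psi> where "\<psi> z l = e2 (\<omega>1 * fst z, snd z + \<omega>2 * fst z) l" for z and l :: "int \<times> int"
  have \<psi>c: "continuous_on K (\<lambda>z. \<psi> z l)" for l unfolding \<psi>_def e2_def by (intro continuous_intros)
  have \<psi>n: "norm (\<psi> z l) \<le> 1" for z l unfolding \<psi>_def by (rule e2.char_le)
  have \<psi>w: "\<psi> z (k, l) = cis ((\<omega>1 * of_int k + \<omega>2 * of_int l) * fst z + of_int l * snd z)" for z k l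
    by (simp add: \<psi>_def e2_def algebra_simps)
  define J where "J l = integral K (\<lambda>z. \<psi> z l * of_real (D 0 0 z))" for l
  note BL = bounded_linear_integral_evl1[where \<psi> = \<psi>, OF \<psi>c[unfolded K_def] \<psi>n, folded K_def]
  have c2: "continuous_on K (\<lambda>z. complex_of_real (D 2 0 z - D 0 2 z))" "continuous_on K (\<lambda>z. complex_of_real (D 0 0 z))"
    by (intro continuous_intros cD)+
  have "((\<lambda>l. integral K (\<lambda>z. evl1 (\<psi> z) (mono_l1 l (coef U l)) * of_real (D 2 0 z - D 0 2 z))) has_sum
      integral K (\<lambda>z. evl1 (\<psi> z) U * of_real (D 2 0 z - D 0 2 z))) UNIV"
    by (rule bounded_linear_has_sum_mono[OF BL[OF c2(1)]])
  moreover have "integral K (\<lambda>z. evl1 (\<psi> z) (mono_l1 l (coef U l)) * of_real (D 2 0 z - D 0 2 z)) = - (coef F l * J l)" for l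
  proof -
    obtain k n where l: "l = (k, n)" by (cases l)
    have "integral K (\<lambda>z. evl1 (\<psi> z) (mono_l1 l (coef U l)) * of_real (D 2 0 z - D 0 2 z))
       = coef U l * integral K (\<lambda>z. \<psi> z l * of_real (D 2 0 z - D 0 2 z))"
      by (simp only: evl1_mono mult.assoc integral_mult_right)
    also have "integral K (\<lambda>z. \<psi> z l * of_real (D 2 0 z - D 0 2 z)) =
       - of_real ((\<omega>1 * of_int k + \<omega>2 * of_int n)\<^sup>2 - (of_int n)\<^sup>2) * J l"
      unfolding J_def K_def l \<psi>w by (rule plane_wave_test[OF D R])
    also have "coef U l * (- of_real ((\<omega>1 * of_int k + \<omega>2 * of_int n)\<^sup>2 - (of_int n)\<^sup>2) * J l) = - (coef F l * J l)"
      unfolding l eq[symmetric] by (simp only: mult_ac mult_minus_left mult_minus_right)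
    finally show ?thesis .
  qed
  ultimately have 1: "((\<lambda>l. - (coef F l * J l)) has_sum integral K (\<lambda>z. evl1 (\<psi> z) U * of_real (D 2 0 z - D 0 2 z))) UNIV"
    by (simp only:)
  have "((\<lambda>l. integral K (\<lambda>z. evl1 (\<psi> z) (mono_l1 l (coef F l)) * of_real (D 0 0 z))) has_sum
      integral K (\<lambda>z. evl1 (\<psi> z) F * of_real (D 0 0 z))) UNIV"
    by (rule bounded_linear_has_sum_mono[OF BL[OF c2(2)]])
  moreover have "integral K (\<lambda>z. evl1 (\<psi> z) (mono_l1 l (coef F l)) * of_real (D 0 0 z)) = coef F l * J l" for l
    unfolding J_def by (simp only: evl1_mono mult.assoc integral_mult_right)
  ultimately have 2: "((\<lambda>l. coef F l * J l) has_sum integral K (\<lambda>z. evl1 (\<psi> z) F * of_real (D 0 0 z))) UNIV"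
    by (simp only:)
  have "((\<lambda>l :: int \<times> int. 0 :: complex) has_sum (integral K (\<lambda>z. evl1 (\<psi> z) U * of_real (D 2 0 z - D 0 2 z)) +
      integral K (\<lambda>z. evl1 (\<psi> z) F * of_real (D 0 0 z)))) UNIV"
    using has_sum_add[OF 1 2] by simp
  then have z: "integral K (\<lambda>z. evl1 (\<psi> z) U * of_real (D 2 0 z - D 0 2 z)) + integral K (\<lambda>z. evl1 (\<psi> z) F * of_real (D 0 0 z)) = 0"
    using has_sum_0_simp has_sum_unique by blast
  have evc: "continuous_on K (\<lambda>z. evl1 (\<psi> z) w)" for w by (rule continuous_on_evl1[OF \<psi>c \<psi>n])
  have I: "(\<lambda>z. evl1 (\<psi> z) U * of_real (D 2 0 z - D 0 2 z)) integrable_on K" "(\<lambda>z. evl1 (\<psi> z) F * of_real (D 0 0 z)) integrable_on K"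
    using integrable_continuous[OF continuous_on_mult[OF evc c2(1), unfolded K_def]]
      integrable_continuous[OF continuous_on_mult[OF evc c2(2), unfolded K_def]] by (simp_all only: K_def)
  have "((\<lambda>z. evl1 (\<psi> z) U * of_real (D 2 0 z - D 0 2 z) + evl1 (\<psi> z) F * of_real (D 0 0 z)) has_integral 0) K"
    using has_integral_add[OF integrable_integral[OF I(1)] integrable_integral[OF I(2)]] unfolding z .
  from has_integral_linear[OF this bounded_linear_Re]
  have "((\<lambda>z. Re (evl1 (\<psi> z) U * of_real (D 2 0 z - D 0 2 z) + evl1 (\<psi> z) F * of_real (D 0 0 z))) has_integral 0) K"
    by (simp add: o_def)
  then have "((\<lambda>z. Re (evl1 (\<psi> z) U) * (D 2 0 z - D 0 2 z) + Re (evl1 (\<psi> z) F) * D 0 0 z) has_integral 0) K"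
    by simp
  then have "((\<lambda>z. Re (evl1 (\<psi> z) U) * (D 2 0 z - D 0 2 z) + Re (evl1 (\<psi> z) F) * D 0 0 z) has_integral 0) UNIV"
  proof (rule has_integral_on_superset)
    fix z :: "real \<times> real" assume z: "z \<notin> K"
    obtain t x where tx: "z = (t, x)" by (cases z)
    have "S < \<bar>t\<bar> \<or> S < \<bar>x\<bar>" using z by (auto simp: K_def tx)
    then have "R < norm z" using norm_fst_le[of t x] norm_snd_le[of x t] R(3) by (auto simp: tx)
    then show "Re (evl1 (\<psi> z) U) * (D 2 0 z - D 0 2 z) + Re (evl1 (\<psi> z) F) * D 0 0 z = 0" by (simp add: R(1))
  qed simp
  then show ?thesis by (simp add: case_prod_unfold \<psi>_def[abs_def])
qed

lemma has_sum_finite_sum: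
  fixes f :: "'i \<Rightarrow> 'a \<Rightarrow> 'b :: topological_comm_monoid_add"
  assumes "finite F" "\<And>k. (f k has_sum s k) A"
  shows "((\<lambda>l. \<Sum>k\<in>F. f k l) has_sum (\<Sum>k\<in>F. s k)) A"
  using assms(1) by (induction F rule: finite_induct) (simp_all add: has_sum_add assms(2))

text \<open>At a fixed time the torus series becomes a series on the circle: coefficients with equal
  second index are added with unimodular factors, which cannot increase a norm weighted in that
  index alone.\<close>

lemma slice:
  fixes w :: "(int \<times> int) l1" and E :: "int \<Rightarrow> real"
  assumes w: "wle (\<lambda>l. E (snd l)) w B" and E: "\<And>k. 1 \<le> E k"
  shows "\<exists>c. (\<forall>x. ev1 c x = ev2 w (t1, x + t2)) \<and> wle E c B"
proof -
  define ck where "ck k = (\<Sum>\<^sub>\<infinity>l. coef w (l, k) * e2 (t1, t2) (l, k))" for k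
  have sw: "((\<lambda>(k, l). g (l, k)) has_sum S) (UNIV \<times> UNIV)" if "(g has_sum S) UNIV" for g :: "int \<times> int \<Rightarrow> 'b::topological_comm_monoid_add" and S
    using that[folded UNIV_Times_UNIV, THEN has_sum_swap[THEN iffD1]] by (simp add: case_prod_unfold)
  have ns: "(\<lambda>l. norm (coef w (l, k))) summable_on UNIV" for k
    using summable_on_SigmaD1[OF has_sum_imp_summable[OF sw[OF has_sum_norm_l1[of w]]], of k] by simp
  have cs: "(\<lambda>l. coef w (l, k) * e2 (t1, t2) (l, k)) abs_summable_on UNIV" for k
    using ns[of k] by (simp add: norm_mult e2.norm_char)
  have ckn: "norm (ck k) \<le> (\<Sum>\<^sub>\<infinity>l. norm (coef w (l, k)))" for k
    using norm_infsum_bound[OF cs[of k]] unfolding ck_def by (simp add: norm_mult e2.norm_char)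
  have bound: "(\<Sum>k\<in>F. norm (ck k) * E k) \<le> B" if F: "finite F" for F
  proof -
    have sm: "(\<lambda>l. norm (coef w (l, k)) * E k) summable_on UNIV" for k by (rule summable_on_cmult_left[OF ns])
    have "(\<Sum>k\<in>F. norm (ck k) * E k) \<le> (\<Sum>k\<in>F. (\<Sum>\<^sub>\<infinity>l. norm (coef w (l, k))) * E k)"
      by (intro sum_mono mult_right_mono ckn) (use E order_trans[OF zero_le_one] in blast)
    also have "\<dots> = (\<Sum>k\<in>F. \<Sum>\<^sub>\<infinity>l. norm (coef w (l, k)) * E k)" by (simp add: infsum_cmult_left')
    also have "\<dots> = (\<Sum>\<^sub>\<infinity>l. \<Sum>k\<in>F. norm (coef w (l, k)) * E k)"
      by (rule infsumI[symmetric], rule has_sum_finite_sum[OF F has_sum_infsum[OF sm]])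
    also have "\<dots> \<le> B"
    proof (rule infsum_le_finite_sums)
      show "(\<lambda>l. \<Sum>k\<in>F. norm (coef w (l, k)) * E k) summable_on UNIV"
        by (rule has_sum_imp_summable[OF has_sum_finite_sum[OF F has_sum_infsum[OF sm]]])
      fix G :: "int set" assume G: "finite G" "G \<subseteq> UNIV"
      have "(\<Sum>l\<in>G. \<Sum>k\<in>F. norm (coef w (l, k)) * E k) = (\<Sum>l\<in>G \<times> F. norm (coef w l) * E (snd l))"
        by (simp add: sum.cartesian_product case_prod_unfold)
      also have "\<dots> \<le> B" by (rule wleD[OF w]) (use F G in simp)
      finally show "(\<Sum>l\<in>G. \<Sum>k\<in>F. norm (coef w (l, k)) * E k) \<le> B" .
    qed
    finally show ?thesis .
  qed
  have "ck abs_summable_on UNIV"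
  proof (rule abs_summable_bdd)
    fix F :: "int set" assume F: "finite F"
    have "(\<Sum>k\<in>F. norm (ck k)) \<le> (\<Sum>k\<in>F. norm (ck k) * E k)"
      by (intro sum_mono) (use E in \<open>simp add: mult_le_cancel_left1\<close>)
    then show "(\<Sum>k\<in>F. norm (ck k)) \<le> B" using bound[OF F] by linarith
  qed
  then have c: "coef (Abs_l1 ck) = ck" by (rule coef_Abs_l1)
  have "ev1 (Abs_l1 ck) x = ev2 w (t1, x + t2)" for x
  proof -
    have e: "e2 (t1, x + t2) (l, k) = e2 (t1, t2) (l, k) * e1 x k" for l k
      by (simp add: e2_def e1_def cis_mult algebra_simps)
    have "((\<lambda>k. ck k * e1 x k) has_sum ev2 w (t1, x + t2)) UNIV"
    proof (rule has_sum_SigmaD[OF sw[OF evl1_has_sum[OF e2.char_le]]])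
      fix k :: int
      have "((\<lambda>l. coef w (l, k) * e2 (t1, t2) (l, k)) has_sum ck k) UNIV"
        unfolding ck_def by (rule has_sum_infsum[OF abs_summable_summable[OF cs]])
      from has_sum_cmult_left[OF this, of "e1 x k"]
      show "((\<lambda>l. case (k, l) of (k, l) \<Rightarrow> coef w (l, k) * e2 (t1, x + t2) (l, k)) has_sum ck k * e1 x k) UNIV"
        by (simp add: e mult.assoc)
    qed
    moreover have "((\<lambda>k. ck k * e1 x k) has_sum ev1 (Abs_l1 ck) x) UNIV"
      using evl1_has_sum[of "e1 x" "Abs_l1 ck", OF e1.char_le] by (simp add: c)
    ultimately show ?thesis using has_sum_unique by blast
  qed
  moreover have "wle E (Abs_l1 ck) B" unfolding wle_def c using bound by blast
  ultimately show ?thesis by blast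
qed

subsection \<open>Sobolev regularity and the Fourier series of the nonlinearity\<close>

lemma young_weighted:
  fixes x J Y :: real
  assumes "0 < Y"
  shows "J * x \<le> (1/2) * (Y * x\<^sup>2 + J\<^sup>2 / Y)"
proof -
  have "0 \<le> (Y * x - J)\<^sup>2 / Y" using assms by simp
  also have "(Y * x - J)\<^sup>2 / Y = Y * x\<^sup>2 - 2 * (J * x) + J\<^sup>2 / Y"
    using assms by (simp add: power2_diff power_mult_distrib diff_divide_distrib add_divide_distrib) (simp add: power2_eq_square)
  finally show ?thesis by simp
qed

lemma sobolev1_l1:
  assumes h: "h \<in> sobolev 1"
  shows "fourier1 h abs_summable_on UNIV" "norm (Abs_l1 (fourier1 h)) \<le> (1/2 + sum_inv_sq / 2) * sobolev_norm 1 h"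
proof -
  define x where "x l = norm (fourier1 h l)" for l
  define H where "H = sobolev_norm 1 h"
  have pw: "(1 + (real_of_int l)\<^sup>2) powr 1 = 1 + (of_int l)\<^sup>2" for l by (simp add: add_nonneg_nonneg)
  have summ: "(\<lambda>l. (1 + (real_of_int l)\<^sup>2) * (x l)\<^sup>2) summable_on UNIV"
    using h unfolding sobolev_def mem_Collect_eq pw x_def by blast
  define T where "T = (\<Sum>\<^sub>\<infinity>l. (1 + (real_of_int l)\<^sup>2) * (x l)\<^sup>2)"
  have T0: "0 \<le> T" unfolding T_def by (rule infsum_nonneg) (simp add: add_nonneg_nonneg)
  have H: "H = sqrt T" unfolding H_def sobolev_norm_def pw T_def x_def ..
  have H2: "H\<^sup>2 = T" "0 \<le> H" using T0 by (simp_all add: H)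
  have fin: "(\<Sum>l\<in>F. (1 + (real_of_int l)\<^sup>2) * (x l)\<^sup>2) \<le> H\<^sup>2" if "finite F" for F
    unfolding H2 T_def by (rule finite_sum_le_infsum[OF summ that]) (auto simp: add_nonneg_nonneg)
  have B: "(\<Sum>l\<in>F. x l) \<le> (1/2 + sum_inv_sq / 2) * H" if F: "finite F" for F
  proof (cases "H = 0")
    case True
    have "x l = 0" for l
    proof -
      have "(1 + (real_of_int l)\<^sup>2) * (x l)\<^sup>2 \<le> 0" using fin[of "{l}"] True by simp
      moreover have "0 < 1 + (real_of_int l)\<^sup>2" by (simp add: add_pos_nonneg)
      ultimately have "(x l)\<^sup>2 \<le> 0" by (simp add: mult_le_0_iff)
      then show ?thesis by simp
    qed
    then show ?thesis using True by simp
  next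
    case False
    then have Hp: "0 < H" using H2 by simp
    \<comment> \<open>The weighted Young inequality takes the place of Cauchy-Schwarz. The extra
      factor \<open>H\<close> makes both resulting terms quadratic in \<open>H\<close>, so the final
      bound is linear.\<close>
    have "H * (\<Sum>l\<in>F. x l) = (\<Sum>l\<in>F. H * x l)" by (rule sum_distrib_left)
    also have "\<dots> \<le> (\<Sum>l\<in>F. (1/2) * ((1 + (real_of_int l)\<^sup>2) * (x l)\<^sup>2 + H\<^sup>2 / (1 + (real_of_int l)\<^sup>2)))"
      by (intro sum_mono young_weighted) (simp add: add_pos_nonneg)
    also have "\<dots> = (1/2) * ((\<Sum>l\<in>F. (1 + (real_of_int l)\<^sup>2) * (x l)\<^sup>2) + H\<^sup>2 * (\<Sum>l\<in>F. 1 / (1 + (real_of_int l)\<^sup>2)))"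
      by (simp add: sum_distrib_left sum.distrib distrib_left)
    also have "\<dots> \<le> (1/2) * (H\<^sup>2 + H\<^sup>2 * sum_inv_sq)"
    proof -
      have "(\<Sum>l\<in>F. 1 / (1 + (real_of_int l)\<^sup>2)) \<le> sum_inv_sq"
        by (rule finite_sum_le_has_sum[OF inv_sq_has_sum F]) (auto simp: add_nonneg_nonneg)
      then show ?thesis using fin[OF F] by (intro mult_left_mono add_mono) auto
    qed
    also have "\<dots> = H * ((1/2 + sum_inv_sq / 2) * H)" by (simp add: power2_eq_square algebra_simps)
    finally show ?thesis using Hp by simp
  qed
  show s: "fourier1 h abs_summable_on UNIV"
    by (rule abs_summable_bdd[OF B[unfolded x_def]])
  show "norm (Abs_l1 (fourier1 h)) \<le> (1/2 + sum_inv_sq / 2) * sobolev_norm 1 h"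
    by (rule norm_l1_le) (use B in \<open>simp add: coef_Abs_l1[OF s] x_def H_def\<close>)
qed

lemma jap_powr_summable:
  assumes "1 < e"
  shows "(\<lambda>l. jap l powr (- e)) summable_on UNIV"
proof -
  have "summable (\<lambda>n. jap (int n) powr (- e))"
  proof (rule summable_comparison_test_ev)
    show "\<forall>\<^sub>F n in sequentially. norm (jap (int n) powr (- e)) \<le> real n powr (- e)"
      using eventually_gt_at_top[of 0] by eventually_elim (simp add: jap_def max_absorb1)
    show "summable (\<lambda>n. real n powr (- e))" using assms by (simp add: summable_real_powr_iff)
  qed
  then have N: "(\<lambda>n. jap (int n) powr (- e)) summable_on UNIV"
    by (intro norm_summable_imp_summable_on) simp
  have "(\<lambda>l. jap l powr (- e)) summable_on range int"
    by (subst summable_on_reindex) (use N in \<open>auto simp: o_def\<close>)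
  moreover have "(\<lambda>l. jap l powr (- e)) summable_on range (\<lambda>n. - int n)"
    by (subst summable_on_reindex) (use N in \<open>auto simp: o_def inj_def jap_def\<close>)
  moreover have "(UNIV :: int set) = range int \<union> range (\<lambda>n. - int n)"
    by (auto, metis int_cases4 rangeI)
  ultimately show ?thesis by (metis summable_on_union)
qed

text \<open>The passage from a square-summable to an absolutely summable weighted norm costs more
  than half a derivative: \<open>2 * (s - s')\<close> has to exceed 1.\<close>

lemma sobolev_weighted_l1:
  assumes h: "h \<in> sobolev s" and s: "0 \<le> s" "s' < s - 1/2"
  shows "\<exists>b. \<forall>F. finite F \<longrightarrow> (\<Sum>l\<in>F. jap l powr s' * norm (fourier1 h l)) \<le> b"
proof -
  define Y where "Y l = (1 + (real_of_int l)\<^sup>2) powr s" for l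
  have S1: "(\<lambda>l. Y l * (norm (fourier1 h l))\<^sup>2) summable_on UNIV"
    using h unfolding sobolev_def Y_def by blast
  define e where "e = 2 * s - 2 * s'"
  have S2: "(\<lambda>l. jap l powr (- e)) summable_on UNIV" by (rule jap_powr_summable) (use s in \<open>simp add: e_def\<close>)
  have Y: "0 < Y l" "(jap l powr s')\<^sup>2 / Y l \<le> jap l powr (- e)" for l
  proof -
    have p: "0 < 1 + (real_of_int l)\<^sup>2" by (simp add: add_pos_nonneg)
    then show "0 < Y l" by (simp add: Y_def)
    have j: "0 < jap l" using jap_ge1[of l] by linarith
    have "(jap l)\<^sup>2 \<le> 1 + (real_of_int l)\<^sup>2" by (auto simp: jap_def max_def)
    then have "((jap l)\<^sup>2) powr s \<le> Y l" unfolding Y_def using s by (intro powr_mono2) auto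
    then have "jap l powr (2 * s) \<le> Y l" using j by (simp add: powr_powr[symmetric] powr_numeral)
    then have "(jap l powr s')\<^sup>2 / Y l \<le> (jap l powr s')\<^sup>2 / jap l powr (2 * s)" using j \<open>0 < Y l\<close> by (intro divide_left_mono) auto
    also have "(jap l powr s')\<^sup>2 / jap l powr (2 * s) = jap l powr (2 * s' - 2 * s)"
      by (simp add: powr_diff power2_eq_square powr_add[symmetric])
    finally show "(jap l powr s')\<^sup>2 / Y l \<le> jap l powr (- e)" by (simp add: e_def)
  qed
  show ?thesis
  proof (intro exI allI impI)
    fix F :: "int set" assume F: "finite F"
    have "(\<Sum>l\<in>F. jap l powr s' * norm (fourier1 h l)) \<le> (\<Sum>l\<in>F. (1/2) * (Y l * (norm (fourier1 h l))\<^sup>2 + jap l powr (- e)))"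
    proof (rule sum_mono)
      fix l
      show "jap l powr s' * norm (fourier1 h l) \<le> (1/2) * (Y l * (norm (fourier1 h l))\<^sup>2 + jap l powr (- e))"
        using young_weighted[OF Y(1), of "jap l powr s'" "norm (fourier1 h l)" l] Y(2)[of l] by simp
    qed
    also have "\<dots> = (1/2) * ((\<Sum>l\<in>F. Y l * (norm (fourier1 h l))\<^sup>2) + (\<Sum>l\<in>F. jap l powr (- e)))"
      by (simp add: sum_distrib_left sum.distrib distrib_left add_divide_distrib sum_divide_distrib)
    also have "\<dots> \<le> (1/2) * ((\<Sum>\<^sub>\<infinity>l. Y l * (norm (fourier1 h l))\<^sup>2) + (\<Sum>\<^sub>\<infinity>l. jap l powr (- e)))"
      using Y(1) by (intro mult_left_mono add_mono finite_sum_le_infsum S1 S2 F) (auto simp: less_imp_le)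
    finally show "(\<Sum>l\<in>F. jap l powr s' * norm (fourier1 h l)) \<le>
      (1/2) * ((\<Sum>\<^sub>\<infinity>l. Y l * (norm (fourier1 h l))\<^sup>2) + (\<Sum>\<^sub>\<infinity>l. jap l powr (- e)))" .
  qed
qed

text \<open>Inversion is available on one period; both sides are periodic, and \<open>y\<close> is
  the representative of \<open>x\<close> there.\<close>

lemma sobolev1_fourier_series:
  assumes h: "h \<in> sobolev 1" "continuous_on UNIV h"
  shows "of_real (h x) = ev1 (Abs_l1 (fourier1 h)) x"
proof -
  have per: "h (x + 2*pi) = h x" for x using h(1) unfolding sobolev_def by blast
  have pern: "h (x + 2*pi * real n) = h x" for x n
  proof (induction n)
    case (Suc n)
    then show ?case using per[of "x + 2*pi * real n"] by (simp add: algebra_simps)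
  qed simp
  have peri: "h (x + 2*pi * of_int k) = h x" for x k
  proof (cases "0 \<le> k")
    case True
    then show ?thesis using pern[of x "nat k"] by simp
  next
    case False
    then show ?thesis using pern[of "x + 2*pi * of_int k" "nat (- k)"] by simp
  qed
  have ev: "ev1 w (x + 2*pi * of_int k) = ev1 w x" for w x k
  proof -
    have "e1 (x + 2*pi * of_int k) l = e1 x l" for l
    proof -
      have "e1 (x + 2*pi * of_int k) l = e1 x l * cis (2*pi * of_int (k * l))"
        by (simp add: e1_def cis_mult algebra_simps)
      then show ?thesis by (simp add: cis_multiple_2pi)
    qed
    then show ?thesis by (simp add: evl1_def)
  qed
  have fe: "fourier1 h = fc (\<lambda>x. of_real (h x))" by (rule ext) (rule fourier1_fc)
  define k where "k = - \<lfloor>x / (2*pi)\<rfloor>"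
  define y where "y = x + 2*pi * of_int k"
  have pi2_pos: "0 < 2 * pi" by simp
  have y: "y \<in> {0..2*pi}"
  proof -
    have "of_int \<lfloor>x / (2*pi)\<rfloor> \<le> x / (2*pi)" "x / (2*pi) < of_int \<lfloor>x / (2*pi)\<rfloor> + 1"
      using floor_correct[of "x / (2*pi)"] by auto
    then have "of_int \<lfloor>x / (2*pi)\<rfloor> * (2*pi) \<le> x" "x < (of_int \<lfloor>x / (2*pi)\<rfloor> + 1) * (2*pi)"
      by (simp_all only: pos_le_divide_eq[OF pi2_pos] pos_divide_less_eq[OF pi2_pos])
    then show ?thesis by (simp add: y_def k_def algebra_simps)
  qed
  have "of_real (h y) = ev1 (Abs_l1 (fourier1 h)) y"
    unfolding fe by (rule fourier_inversion)
      (use sobolev1_l1(1)[OF h(1)] y continuous_on_subset[OF h(2)] in \<open>auto simp: fe intro!: continuous_intros\<close>)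
  then show ?thesis using peri[of x k] ev[of x k] unfolding y_def by (simp only:)
qed

subsection \<open>Forcing terms in Fourier variables\<close>

locale potential_series =
  fixes d :: nat and a :: "nat \<Rightarrow> real \<Rightarrow> real" and r :: real
  assumes H: "assumption_H d a r"
begin

definition "m = 2*d - 1"
definition "an j = Abs_l1 (fourier1 (a (m + j)))"

lemma d: "1 < d" and r: "0 < r"
  and sob: "a (m + j) \<in> sobolev 1" and cont: "continuous_on UNIV (a (m + j))"
  and sob_summable: "(\<lambda>k. sobolev_norm 1 (a k) * r ^ k) summable_on {m..}"
  using H unfolding assumption_H_def m_def by simp_all

lemma coef_an: "coef (an j) = fourier1 (a (m + j))"
  unfolding an_def by (rule coef_Abs_l1[OF sobolev1_l1(1)[OF sob]])

lemma ev1_an: "ev1 (an j) x = of_real (a (m + j) x)"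
  unfolding an_def by (rule sobolev1_fourier_series[OF sob cont, symmetric])

lemma real_an: "real_l1 (an j)"
  using fc_cnj[of "\<lambda>x. of_real (a (m + j) x)"] by (simp add: real_l1_def coef_an fourier1_fc)

lemma bij_shift: "bij_betw ((+) m) UNIV {m..}"
  by (rule bij_betwI[of _ _ _ "\<lambda>k. k - m"]) auto

lemma summable_an: "summable (\<lambda>j. norm (an j) * r ^ (m + j))"
proof -
  define c where "c = 1/2 + sum_inv_sq / 2"
  have "(\<lambda>j. sobolev_norm 1 (a (m + j)) * r ^ (m + j)) summable_on UNIV"
    using sob_summable summable_on_reindex_bij_betw[OF bij_shift, of "\<lambda>k. sobolev_norm 1 (a k) * r ^ k"] by simp
  moreover have "0 \<le> sobolev_norm 1 (a (m + j)) * r ^ (m + j)" for j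
    using r unfolding sobolev_norm_def by (intro mult_nonneg_nonneg real_sqrt_ge_zero infsum_nonneg) auto
  ultimately have "summable (\<lambda>j. sobolev_norm 1 (a (m + j)) * r ^ (m + j))"
    by (subst (asm) summable_on_UNIV_nonneg_real_iff) auto
  then have s: "summable (\<lambda>j. c * (sobolev_norm 1 (a (m + j)) * r ^ (m + j)))" by (rule summable_mult)
  show ?thesis
  proof (rule summable_comparison_test'[OF s, of 0])
    fix j
    have "norm (an j) * r ^ (m + j) \<le> (c * sobolev_norm 1 (a (m + j))) * r ^ (m + j)"
      using sobolev1_l1(2)[OF sob, of j] r unfolding an_def c_def by (intro mult_right_mono) auto
    then show "norm (norm (an j) * r ^ (m + j)) \<le> c * (sobolev_norm 1 (a (m + j)) * r ^ (m + j))"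
      using r by (simp add: mult.assoc)
  qed
qed

definition "M = (\<Sum>j. norm (an j) * r ^ (m + j))"

lemma an_le_M: "norm (an j) * r ^ (m + j) \<le> M"
proof -
  have "(\<Sum>j\<in>{j}. norm (an j) * r ^ (m + j)) \<le> M"
    unfolding M_def using r by (intro sum_le_suminf summable_an) auto
  then show ?thesis by simp
qed

lemma nonlin_sums:
  assumes u: "\<bar>u\<bar> \<le> r"
  shows "(\<lambda>j. a (m + j) x * u ^ (m + j)) sums nonlin d a x u"
proof -
  have le: "norm (a (m + j) x * u ^ (m + j)) \<le> norm (an j) * r ^ (m + j)" for j
  proof -
    have "\<bar>a (m + j) x\<bar> \<le> norm (an j)" using norm_evl1_le[of "e1 x" "an j", OF e1.char_le] by (simp add: ev1_an)
    then show ?thesis using u by (auto simp: abs_mult power_abs intro!: mult_mono power_mono)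
  qed
  have s: "summable (\<lambda>j. norm (a (m + j) x * u ^ (m + j)))"
    by (rule summable_comparison_test'[OF summable_an, of 0]) (use le in simp)
  from norm_summable_imp_has_sum[OF s summable_sums[OF summable_norm_cancel[OF s]]]
  have "(\<Sum>\<^sub>\<infinity>j. a (m + j) x * u ^ (m + j)) = (\<Sum>j. a (m + j) x * u ^ (m + j))" by (rule infsumI)
  moreover have "nonlin d a x u = (\<Sum>\<^sub>\<infinity>j. a (m + j) x * u ^ (m + j))"
    unfolding nonlin_def m_def[symmetric] using infsum_reindex_bij_betw[OF bij_shift, of "\<lambda>k. a k x * u ^ k"] by simp
  ultimately show ?thesis using summable_sums[OF summable_norm_cancel[OF s]] by simp
qed

text \<open>For fixed frequency the Fourier coefficient of \<open>f\<close> is a power series in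
  \<open>u\<close>. This turns regularity of \<open>f\<close> for each single \<open>u\<close> into
  an interpolation problem for the \<open>an j\<close>.\<close>

lemma fourier_nonlin:
  assumes u: "\<bar>u\<bar> \<le> r"
  shows "(\<lambda>j. coef (an j) l * of_real u ^ (m + j)) sums fourier1 (\<lambda>x. nonlin d a x u) l"
proof -
  have s: "summable (\<lambda>j. u ^ (m + j) *\<^sub>R an j)"
  proof (rule summable_comparison_test'[OF summable_an, of 0])
    fix j
    have "\<bar>u\<bar> ^ (m + j) * norm (an j) \<le> r ^ (m + j) * norm (an j)"
      using u by (intro mult_right_mono power_mono) auto
    then show "norm (u ^ (m + j) *\<^sub>R an j) \<le> norm (an j) * r ^ (m + j)" by (simp add: power_abs mult.commute)
  qed
  define Z where "Z = (\<Sum>j. u ^ (m + j) *\<^sub>R an j)"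
  have "ev1 Z x = of_real (nonlin d a x u)" for x
  proof -
    have "(\<lambda>j. evl1 (e1 x) (u ^ (m + j) *\<^sub>R an j)) sums ev1 Z x"
      unfolding Z_def by (rule bounded_linear.sums[OF bounded_linear_evl1[OF e1.char_le] summable_sums[OF s]])
    moreover have "evl1 (e1 x) (u ^ (m + j) *\<^sub>R an j) = of_real (a (m + j) x * u ^ (m + j))" for j
      unfolding linear_scale[OF bounded_linear.linear[OF bounded_linear_evl1[OF e1.char_le]]] ev1_an
      by (simp add: scaleR_conv_of_real)
    ultimately have "(\<lambda>j. complex_of_real (a (m + j) x * u ^ (m + j))) sums ev1 Z x" by (simp only:)
    then show ?thesis using sums_of_real[OF nonlin_sums[OF u, of x], where 'a = complex] sums_unique2 by blast
  qed
  then have "fourier1 (\<lambda>x. nonlin d a x u) l = fc (ev1 Z) l" unfolding fourier1_fc by simp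
  then have "fourier1 (\<lambda>x. nonlin d a x u) l = coef Z l" by (simp only: fc_ev1)
  moreover have "(\<lambda>j. coef (u ^ (m + j) *\<^sub>R an j) l) sums coef Z l"
    unfolding Z_def by (rule bounded_linear.sums[OF bounded_linear_coef summable_sums[OF s]])
  moreover have "coef (u ^ (m + j) *\<^sub>R an j) l = coef (an j) l * of_real u ^ (m + j)" for j
    unfolding coef_scaleR by (simp add: scaleR_conv_of_real)
  ultimately show ?thesis by (simp only:)
qed

lemma weighted_coefficients:
  assumes s: "0 \<le> s" "0 < sb" "sb < s - 1/2" and f: "\<And>u. \<bar>u\<bar> \<le> r \<Longrightarrow> (\<lambda>x. nonlin d a x u) \<in> sobolev s"
  shows "\<exists>\<rho>>0. \<exists>C\<ge>0. \<forall>j F. finite F \<longrightarrow> (\<Sum>l\<in>F. jap l powr sb * norm (coef (an j) l)) * \<rho> ^ (m + j) \<le> C"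
proof -
  \<comment> \<open>Zero padding below \<open>m\<close> makes this a full power series in
    \<open>u\<close>.\<close>
  define \<alpha> where "\<alpha> k l = (if k < m then 0 else coef (an (k - m)) l)" for k l
  \<comment> \<open>Strictly between the target and the bound, since two losses occur: one from
    square summability to absolute summability, one in the interpolation.\<close>
  define s' where "s' = (sb + (s - 1/2)) / 2"
  have s': "sb < s'" "s' < s - 1/2" "0 \<le> sb" using s by (simp_all add: s'_def)
  have M0: "0 \<le> M" using order_trans[OF _ an_le_M[of 0]] r by simp
  have b: "norm (\<alpha> k l) * r ^ k \<le> M" for k l
  proof (cases "k < m")
    case False
    have "norm (coef (an (k - m)) l) * r ^ (m + (k - m)) \<le> norm (an (k - m)) * r ^ (m + (k - m))"
      using r by (intro mult_right_mono norm_coef_le) simp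
    also have "\<dots> \<le> M" by (rule an_le_M)
    finally show ?thesis using False by (simp add: \<alpha>_def)
  qed (use M0 in \<open>simp add: \<alpha>_def\<close>)
  have v: "(\<Sum>k. \<alpha> k l * of_real u ^ k) = fourier1 (\<lambda>x. nonlin d a x u) l" if "u \<in> {0..r}" for u l
  proof -
    have "(\<lambda>j. \<alpha> (j + m) l * of_real u ^ (j + m)) sums fourier1 (\<lambda>x. nonlin d a x u) l"
      using fourier_nonlin[of u l] that by (simp add: \<alpha>_def add.commute)
    then have "(\<lambda>k. \<alpha> k l * of_real u ^ k) sums fourier1 (\<lambda>x. nonlin d a x u) l"
      by (subst (asm) sums_zero_iff_shift) (simp_all add: \<alpha>_def)
    then show ?thesis by (rule sums_unique[symmetric])
  qed
  have "\<exists>\<rho>>0. \<exists>C\<ge>0. \<forall>k F. finite F \<longrightarrow> (\<Sum>l\<in>F. jap l powr sb * norm (\<alpha> k l)) * \<rho> ^ k \<le> C"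
  proof (rule coefficient_regularity[OF r s'(3) s'(1) b])
    fix u assume u: "u \<in> {0..r}"
    have "\<exists>b. \<forall>F. finite F \<longrightarrow> (\<Sum>l\<in>F. jap l powr s' * norm (fourier1 (\<lambda>x. nonlin d a x u) l)) \<le> b"
      by (rule sobolev_weighted_l1[OF f s(1) s'(2)]) (use u in simp)
    then show "\<exists>b. \<forall>F. finite F \<longrightarrow> (\<Sum>l\<in>F. jap l powr s' * norm (\<Sum>k. \<alpha> k l * of_real u ^ k)) \<le> b"
      unfolding v[OF u] .
  qed
  then obtain \<rho> C where \<rho>: "0 < \<rho>" "0 \<le> C" and le: "\<And>k F. finite F \<Longrightarrow> (\<Sum>l\<in>F. jap l powr sb * norm (\<alpha> k l)) * \<rho> ^ k \<le> C" by blast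
  have "(\<Sum>l\<in>F. jap l powr sb * norm (coef (an j) l)) * \<rho> ^ (m + j) \<le> C" if "finite F" for j F
    using le[OF that, of "m + j"] by (simp add: \<alpha>_def)
  then show ?thesis using \<rho> by blast
qed

end

section \<open>From coefficient sequences back to functions and weak solutions\<close>

definition j1 :: "int \<Rightarrow> int \<times> int" where "j1 l = (l, 0)"

lemma inj_j1: "inj j1" by (auto simp: j1_def inj_def)

lemma inv_j1: "inv j1 (l, 0) = l"
  using inv_f_f[OF inj_j1, of l] by (simp add: j1_def)

lemma ev2_push_j1: "ev2 (push j1 w) x = ev1 w (fst x)"
proof -
  have "e2 x \<circ> j1 = e1 (fst x)" by (rule ext) (simp add: j1_def e1_def e2_def)
  then show ?thesis by (simp add: evl1_push[OF inj_j1 e2.char_le])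
qed

lemma ev2_ps: "ev2 (ps w) x = ev1 w (snd x)"
proof -
  have "e2 x \<circ> j2 = e1 (snd x)" by (rule ext) (simp add: j2_def e1_def e2_def)
  then show ?thesis by (simp add: evl1_push[OF inj_j2 e2.char_le])
qed

lemma wle_push:
  assumes j: "inj j" and w: "wle (\<lambda>l. W (j l)) w B"
  shows "wle W (push j w) B"
  unfolding wle_def
proof (intro allI impI)
  fix F :: "'b set" assume F: "finite F"
  have "(\<Sum>l\<in>F. norm (coef (push j w) l) * W l) = (\<Sum>l\<in>j ` (j -` F). norm (coef (push j w) l) * W l)"
    using F by (intro sum.mono_neutral_right) (auto simp: coef_push[OF j])
  also have "\<dots> = (\<Sum>l\<in>j -` F. norm (coef w l) * W (j l))"
    using j by (subst sum.reindex) (auto simp: coef_push_image[OF j] intro: inj_on_subset)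
  also have "\<dots> \<le> B" by (rule wleD[OF w finite_vimageI[OF F j]])
  finally show "(\<Sum>l\<in>F. norm (coef (push j w) l) * W l) \<le> B" .
qed

lemma wle_weight_mono:
  assumes "wle W w B" "\<And>l. V l \<le> W l"
  shows "wle V w B"
  unfolding wle_def
proof (intro allI impI)
  fix F :: "'a set" assume "finite F"
  have "(\<Sum>l\<in>F. norm (coef w l) * V l) \<le> (\<Sum>l\<in>F. norm (coef w l) * W l)"
    by (intro sum_mono mult_left_mono assms(2)) simp
  also have "\<dots> \<le> B" by (rule wleD[OF assms(1) \<open>finite F\<close>])
  finally show "(\<Sum>l\<in>F. norm (coef w l) * V l) \<le> B" .
qed

lemma wle_pl:
  assumes "wle W w B"
  shows "wle (\<lambda>l. W (0, l)) (pl w) B"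
  unfolding wle_def
proof (intro allI impI)
  fix F :: "int set" assume F: "finite F"
  have "(\<Sum>l\<in>F. norm (coef (pl w) l) * W (0, l)) = (\<Sum>l\<in>Pair 0 ` F. norm (coef w l) * W l)"
    by (subst sum.reindex) (auto simp: coef_pl inj_on_def)
  also have "\<dots> \<le> B" by (rule wleD[OF assms]) (use F in simp)
  finally show "(\<Sum>l\<in>F. norm (coef (pl w) l) * W (0, l)) \<le> B" .
qed

lemma H_an_ev1:
  assumes g: "\<And>x. of_real (g x) = ev1 w x" and w: "wle (\<lambda>l. exp (\<sigma> * of_int \<bar>l\<bar>)) w B"
  shows "g \<in> H_an \<sigma>" "H_an_norm \<sigma> g \<le> B"
proof -
  have f: "fourier1 g = coef w" by (rule ext) (simp add: fourier1_fc g fc_ev1)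
  show "g \<in> H_an \<sigma>"
    unfolding H_an_def mem_Collect_eq f g
    using wle_summable(1)[OF w] evl1_has_sum[of "e1 x" w for x, OF e1.char_le] by (auto simp: e1_def)
  show "H_an_norm \<sigma> g \<le> B" unfolding H_an_norm_def f by (rule wle_summable(2)[OF w]) simp
qed

lemma H_space_ev2:
  assumes g: "\<And>x. of_real (g x) = ev2 w x" and w: "wle (H_weight \<sigma> s) w B"
  shows "g \<in> H_space \<sigma> s" "H_norm \<sigma> s g \<le> B"
proof -
  have f: "fourier2 g = coef w" by (rule ext) (simp add: fourier2_fc2 g fc2_ev2)
  have p: "0 \<le> H_weight \<sigma> s l" for l by (simp add: H_weight_def)
  show "g \<in> H_space \<sigma> s"
    unfolding H_space_def mem_Collect_eq f g
    using wle_summable(1)[OF w p] evl1_has_sum[of "e2 x" w for x, OF e2.char_le] by (auto simp: e2_def)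
  show "H_norm \<sigma> s g \<le> B" unfolding H_norm_def f by (rule wle_summable(2)[OF w p])
qed

lemma continuous_real_ev2:
  assumes "\<And>x. of_real (g x) = ev2 w x"
  shows "continuous_on S g"
proof -
  have "g = (\<lambda>x. Re (ev2 w x))" by (rule ext) (simp flip: assms)
  then show ?thesis by (simp add: continuous_on_Re continuous_ev2)
qed

lemma weak_torus:
  assumes u: "\<And>x. of_real (u x) = ev2 U x" and G: "\<And>x. of_real (f (fst x) (u x)) = ev2 G x"
    and eq: "\<And>k l. of_real ((\<omega>1 * of_int k + \<omega>2 * of_int l)\<^sup>2 - (of_int l)\<^sup>2) * coef U (k, l) = coef G (k, l)"
  shows "weak_solution_torus f \<omega>1 \<omega>2 u"
  unfolding weak_solution_torus_def
proof (intro conjI allI, goal_cases)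
  case 1
  show ?case by (rule absolutely_integrable_continuous[OF continuous_real_ev2[OF u]])
next
  case 2
  show ?case by (rule absolutely_integrable_continuous[OF continuous_real_ev2[OF G]])
next
  case (3 k l)
  have "fourier2 u (k, l) = coef U (k, l)" "fourier2 (\<lambda>x. f (fst x) (u x)) (k, l) = coef G (k, l)"
    by (simp_all add: fourier2_fc2 u G fc2_ev2)
  then show ?case using eq[of k l, symmetric] by (simp add: power2_eq_square algebra_simps)
qed

lemma weak_wave:
  assumes u: "\<And>x. of_real (u x) = ev2 U x" and G: "\<And>x. of_real (f (fst x) (u x)) = ev2 G x"
    and eq: "\<And>k l. of_real ((\<omega>1 * of_int k + \<omega>2 * of_int l)\<^sup>2 - (of_int l)\<^sup>2) * coef U (k, l) = coef G (k, l)"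
  shows "weak_solution_wave f \<omega>1 (\<lambda>t x. u (\<omega>1 * t, x + \<omega>2 * t))"
proof -
  have Re: "u x = Re (ev2 U x)" "f (fst x) (u x) = Re (ev2 G x)" for x by (simp_all flip: u G)
  have "e2 (x, y + 2*pi) l = e2 (x, y) l" for x y l
  proof -
    have "e2 (x, y + 2*pi) l = e2 (x, y) l * cis (2*pi * of_int (snd l))"
      by (simp add: e2_def cis_mult algebra_simps)
    then show ?thesis by (simp add: cis_multiple_2pi)
  qed
  then have "e2 (x, y + 2*pi) = e2 (x, y)" for x y by blast
  then have p2: "u (x, y) = u (x, y + 2*pi)" for x y by (simp add: Re)
  have c: "continuous_on S (\<lambda>(t, x). u (\<omega>1 * t, x + \<omega>2 * t))"
    "continuous_on S (\<lambda>(t, x). f (\<omega>1 * t) (u (\<omega>1 * t, x + \<omega>2 * t)))" for S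
    using continuous_on_compose2[OF continuous_real_ev2[OF u, of UNIV], of S "\<lambda>z. (\<omega>1 * fst z, snd z + \<omega>2 * fst z)"]
      continuous_on_compose2[OF continuous_real_ev2[OF G, of UNIV], of S "\<lambda>z. (\<omega>1 * fst z, snd z + \<omega>2 * fst z)"]
    by (simp_all add: case_prod_unfold continuous_intros)
  show ?thesis
    unfolding weak_solution_wave_def
  proof (intro conjI allI impI)
    show "u (\<omega>1 * t, x + \<omega>2 * t) = u (\<omega>1 * t, x + 2*pi + \<omega>2 * t)" for t x
      using p2[of "\<omega>1 * t" "x + \<omega>2 * t"] by (simp add: add_ac)
    show "(\<lambda>(t, x). u (\<omega>1 * t, x + \<omega>2 * t)) absolutely_integrable_on cbox p q"
      "(\<lambda>(t, x). f (\<omega>1 * t) (u (\<omega>1 * t, x + \<omega>2 * t))) absolutely_integrable_on cbox p q" for p q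
      by (rule absolutely_integrable_continuous, rule c)+
    show "((\<lambda>(t, x). u (\<omega>1 * t, x + \<omega>2 * t) * (D 2 0 (t, x) - D 0 2 (t, x)) +
        f (\<omega>1 * t) (u (\<omega>1 * t, x + \<omega>2 * t)) * D 0 0 (t, x)) has_integral 0) UNIV" if "test_function D" for D
      using wave_weak[OF eq that] Re(2)[of "(\<omega>1 * t, x + \<omega>2 * t)" for t x] by (simp add: Re(1))
  qed
qed


section \<open>Small divisors on the Cantor set\<close>

lemma small_divisor:
  assumes C: "(\<epsilon>, \<omega>1) \<in> cantor_set \<epsilon>0 \<gamma>" and \<gamma>: "0 < \<gamma>" "\<gamma> < 1/6" and \<epsilon>: "\<bar>\<epsilon>\<bar> \<le> 1/4" and k: "k \<noteq> 0"
  shows "3/8 * \<gamma> \<le> \<bar>(\<omega>1 * of_int k + (1 + \<epsilon>) * of_int l)\<^sup>2 - (of_int l)\<^sup>2\<bar>"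
proof -
  define x where "x = \<omega>1 * of_int k + \<epsilon> * of_int l"
  define y where "y = \<omega>1 * of_int k + (2 + \<epsilon>) * of_int l"
  have f: "(\<omega>1 * of_int k + (1 + \<epsilon>) * of_int l)\<^sup>2 - (of_int l)\<^sup>2 = x * y"
    by (simp add: x_def y_def power2_eq_square algebra_simps)
  have w: "1 < \<omega>1" using C by (simp add: cantor_set_def)
  have k1: "1 \<le> \<bar>real_of_int k\<bar>" using k by linarith
  have wk: "\<bar>real_of_int k\<bar> \<le> \<bar>\<omega>1 * of_int k\<bar>" using w by (simp add: abs_mult mult_le_cancel_right1)
  show ?thesis
  proof (cases "l = 0")
    case True
    \<comment> \<open>The Diophantine condition speaks only of nonzero pairs; for
      \<open>l = 0\<close> both factors equal \<open>\<omega>1 * k\<close>, of modulus at least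
      1.\<close>
    have "1 * 1 \<le> \<bar>\<omega>1 * of_int k\<bar> * \<bar>\<omega>1 * of_int k\<bar>" using wk k1 by (intro mult_mono) auto
    then show ?thesis using \<gamma> True unfolding f by (simp add: x_def y_def abs_mult)
  next
    case False
    define L where "L = \<bar>real_of_int k\<bar> + \<bar>real_of_int l\<bar>"
    have L: "0 < L" using k1 by (simp add: L_def)
    have xy: "\<gamma> / L < \<bar>x\<bar>" "\<gamma> / L < \<bar>y\<bar>"
      using C k False unfolding cantor_set_def x_def y_def L_def by auto
    have el: "\<bar>\<epsilon> * of_int l\<bar> \<le> 1/4 * \<bar>real_of_int l\<bar>"
      unfolding abs_mult by (rule mult_right_mono[OF \<epsilon>]) simp
    have yx: "y = x + 2 * of_int l" by (simp add: x_def y_def algebra_simps)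
    \<comment> \<open>If \<open>|l| \<le> |k|\<close>, then \<open>|x|\<close> is at least
      \<open>|k| - |l|/4\<close>; equality at \<open>|l| = |k|\<close> is the origin of 3/8.
      Otherwise \<open>y - x = 2 * l\<close> prevents both factors from being small.\<close>
    have "3/8 * L \<le> \<bar>x\<bar> \<or> 3/8 * L \<le> \<bar>y\<bar>"
    proof (cases "\<bar>real_of_int l\<bar> \<le> \<bar>real_of_int k\<bar>")
      case True
      have "\<bar>\<omega>1 * of_int k\<bar> - \<bar>\<epsilon> * of_int l\<bar> \<le> \<bar>x\<bar>" unfolding x_def by linarith
      moreover have "3/8 * (K + K') \<le> X" if "P - E \<le> X" "K \<le> P" "E \<le> 1/4 * K'" "K' \<le> K" for K K' P E X :: real
        using that by argo
      ultimately have "3/8 * L \<le> \<bar>x\<bar>" using wk el True unfolding L_def by blast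
      then show ?thesis ..
    next
      case False
      have "2 * \<bar>real_of_int l\<bar> \<le> \<bar>x\<bar> + \<bar>y\<bar>" unfolding yx by linarith
      then have "\<not> (\<bar>x\<bar> < 3/8 * L \<and> \<bar>y\<bar> < 3/8 * L)" using L False unfolding L_def by argo
      then show ?thesis by (auto simp: not_less)
    qed
    moreover have "\<gamma> / L * (3/8 * L) \<le> \<bar>x\<bar> * \<bar>y\<bar>" if "3/8 * L \<le> \<bar>x\<bar> \<or> 3/8 * L \<le> \<bar>y\<bar>"
      using that
    proof
      assume "3/8 * L \<le> \<bar>y\<bar>"
      then show ?thesis using xy L \<gamma> by (intro mult_mono) auto
    next
      assume "3/8 * L \<le> \<bar>x\<bar>"
      then have "\<gamma> / L * (3/8 * L) \<le> \<bar>y\<bar> * \<bar>x\<bar>" using xy L \<gamma> by (intro mult_mono) auto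
      then show ?thesis by (simp only: mult.commute)
    qed
    ultimately show ?thesis using L unfolding f abs_mult by simp
  qed
qed

section \<open>The rescaled equation for the given nonlinearity\<close>

context potential_series
begin

lemma nonlin_ev2:
  fixes w :: "(int \<times> int) l1"
  assumes s: "summable (\<lambda>j. \<delta> ^ j *\<^sub>R (push j1 (an j) * w ^ (m + j)))"
    and u: "of_real u = ev2 (\<delta> *\<^sub>R w) x" "\<bar>u\<bar> \<le> r"
  shows "of_real (nonlin d a (fst x) u) = ev2 (\<delta> ^ m *\<^sub>R (\<Sum>j. \<delta> ^ j *\<^sub>R (push j1 (an j) * w ^ (m + j)))) x"
proof -
  note lin = linear_scale[OF bounded_linear.linear[OF bounded_linear_evl1[OF e2.char_le]]]
  have "(\<lambda>j. \<delta> ^ m *\<^sub>R evl1 (e2 x) (\<delta> ^ j *\<^sub>R (push j1 (an j) * w ^ (m + j)))) sums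
      (\<delta> ^ m *\<^sub>R evl1 (e2 x) (\<Sum>j. \<delta> ^ j *\<^sub>R (push j1 (an j) * w ^ (m + j))))"
    by (rule sums_scaleR_right[OF bounded_linear.sums[OF bounded_linear_evl1[OF e2.char_le] summable_sums[OF s]]])
  moreover have "\<delta> ^ m *\<^sub>R evl1 (e2 x) (\<delta> ^ j *\<^sub>R (push j1 (an j) * w ^ (m + j))) = of_real (a (m + j) (fst x) * u ^ (m + j))" for j
  proof -
    have "complex_of_real (u ^ (m + j)) = (\<delta> *\<^sub>R ev2 w x) ^ (m + j)" using u(1) by (simp only: of_real_power lin)
    then show ?thesis
      unfolding lin e2.evl1_mult e2.evl1_power ev2_push_j1 ev1_an
      by (simp add: scaleR_conv_of_real power_mult_distrib power_add mult_ac)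
  qed
  ultimately have "(\<lambda>j. complex_of_real (a (m + j) (fst x) * u ^ (m + j))) sums
      (\<delta> ^ m *\<^sub>R evl1 (e2 x) (\<Sum>j. \<delta> ^ j *\<^sub>R (push j1 (an j) * w ^ (m + j))))" by (simp only:)
  then show ?thesis
    using sums_of_real[OF nonlin_sums[OF u(2), of "fst x"], where 'a = complex] unfolding lin by (rule sums_unique2[rotated])
qed

lemma mean_an: "coef (an 0) 0 = of_real (integral {0..2*pi} (a m) / (2*pi))"
proof -
  have "(a m has_integral integral {0..2*pi} (a m)) {0..2*pi}"
    using integrable_continuous_interval[OF continuous_on_subset[OF cont[of 0]], of 0 "2*pi"] by (simp add: integrable_integral)
  from has_integral_linear[OF this bounded_linear_of_real[where 'a = complex]]
  have "integral {0..2*pi} (\<lambda>x. complex_of_real (a m x)) = of_real (integral {0..2*pi} (a m))"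
    by (simp add: o_def integral_unique)
  then show ?thesis by (simp add: coef_an fourier1_def)
qed

text \<open>The clauses of \<open>adm\<close> are spelled out because that predicate belongs to
  \<open>forced\<close>, which is interpreted only inside the proof, once an oscillator has been
  constructed.\<close>

lemma amplitude_exists:
  assumes s: "0 \<le> s" "0 < sb" "sb < s - 1/2" and f: "\<And>u. \<bar>u\<bar> \<le> r \<Longrightarrow> (\<lambda>x. nonlin d a x u) \<in> sobolev s"
    and I: "integral {0..2*pi} (a m) \<noteq> 0" and \<gamma>0: "0 < \<gamma>0"
  shows "\<exists>\<kappa> \<sigma> R C. 0 < \<kappa> \<and> 0 < \<sigma> \<and> 1 \<le> R \<and> 0 \<le> C \<and> (\<forall>\<epsilon> \<delta> D.
     (\<forall>l. fst l \<noteq> 0 \<longrightarrow> \<gamma>0 \<le> \<bar>D l\<bar>) \<longrightarrow> (\<forall>k. D (0, k) = \<epsilon> * (2 + \<epsilon>) * (of_int k)\<^sup>2) \<longrightarrow> (\<forall>l. D (- l) = D l) \<longrightarrow>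
     \<bar>\<epsilon>\<bar> \<le> \<kappa> \<longrightarrow> 0 < \<delta> \<longrightarrow> \<delta> \<le> \<kappa> \<longrightarrow> 0 < \<epsilon> * integral {0..2*pi} (a m) \<longrightarrow>
     (\<exists>w. real_l1 w \<and> norm w \<le> R \<and> wle (H_weight \<sigma> sb) w R \<and> wle (H_weight \<sigma> sb) (w - ps (pl w)) (C * \<bar>\<epsilon>\<bar>) \<and>
       coef w (0, 1) \<noteq> 0 \<and> summable (\<lambda>j. \<delta> ^ j *\<^sub>R (push j1 (an j) * w ^ (m + j))) \<and>
       (\<forall>l. of_real (D l) * coef w l = of_real \<bar>\<epsilon>\<bar> * coef (\<Sum>j. \<delta> ^ j *\<^sub>R (push j1 (an j) * w ^ (m + j))) l)))"
proof -
  define \<I> where "\<I> = integral {0..2*pi} (a m)"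
  define \<eta> where "\<eta> = sgn \<I>"
  \<comment> \<open>Chosen so that the mean \<open>\<I> / (2*pi)\<close> of the leading coefficient
    equals \<open>\<eta> * 2 * c\<close>.\<close>
  define c where "c = \<bar>\<I>\<bar> / (4*pi)"
  have \<eta>: "\<eta> = 1 \<or> \<eta> = -1" using I by (simp add: \<eta>_def \<I>_def sgn_real_def)
  have c: "0 < c" using I by (simp add: c_def \<I>_def)
  obtain \<rho>1 C1 where \<rho>1: "0 < \<rho>1" "0 \<le> C1"
    and C1: "\<And>j F. finite F \<Longrightarrow> (\<Sum>l\<in>F. jap l powr sb * norm (coef (an j) l)) * \<rho>1 ^ (m + j) \<le> C1"
    using weighted_coefficients[OF s f] by blast
  \<comment> \<open>The factor 2 makes the bracket submultiplicative, since
    \<open>jap (l + k) \<le> 2 * jap l * jap k\<close>.\<close>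
  define W1 where "W1 l = (2 * jap l) powr sb" for l
  define b where "b j = 2 powr sb * C1 / \<rho>1 ^ (m + j)" for j
  \<comment> \<open>The coefficient bound is only uniform at radius \<open>\<rho>1\<close>; halving
    it makes the majorant series geometric.\<close>
  define \<rho> where "\<rho> = \<rho>1 / 2"
  define A where "A j = push j1 (an j)" for j
  have W1: "1 \<le> W1 l" "W1 (l + k) \<le> W1 l * W1 k" for l k
  proof -
    show "1 \<le> W1 l" unfolding W1_def using jap_ge1[of l] s by (intro ge_one_powr_ge_zero) auto
    have "jap (l + k) \<le> jap l + jap k" by (auto simp: jap_def)
    also have "\<dots> \<le> jap l * jap k + jap l * jap k"
      using mult_left_mono[OF jap_ge1[of k], of "jap l"] mult_right_mono[OF jap_ge1[of l], of "jap k"] jap_ge1[of l] jap_ge1[of k]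
      by (intro add_mono) auto
    finally have "2 * jap (l + k) \<le> (2 * jap l) * (2 * jap k)" by simp
    then have "W1 (l + k) \<le> ((2 * jap l) * (2 * jap k)) powr sb"
      unfolding W1_def using s jap_ge1[of "l + k"] by (intro powr_mono2) auto
    also have "((2 * jap l) * (2 * jap k)) powr sb = W1 l * W1 k"
      unfolding W1_def by (rule powr_mult)
    finally show "W1 (l + k) \<le> W1 l * W1 k" .
  qed
  have wan: "wle W1 (an j) (b j)" for j
    unfolding wle_def
  proof (intro allI impI)
    fix F :: "int set" assume F: "finite F"
    have "(\<Sum>l\<in>F. norm (coef (an j) l) * W1 l) = 2 powr sb * (\<Sum>l\<in>F. jap l powr sb * norm (coef (an j) l))"
      unfolding sum_distrib_left W1_def using jap_ge1 order_trans[OF zero_le_one jap_ge1]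
      by (intro sum.cong refl) (simp add: powr_mult mult_ac)
    also have "\<dots> \<le> 2 powr sb * (C1 / \<rho>1 ^ (m + j))"
      using C1[OF F, of j] \<rho>1 by (intro mult_left_mono) (auto simp: pos_le_divide_eq)
    finally show "(\<Sum>l\<in>F. norm (coef (an j) l) * W1 l) \<le> b j" by (simp add: b_def)
  qed
  have wA: "wle (\<lambda>l. W1 (fst l)) (A j) (b j)" for j
    unfolding A_def by (rule wle_push[OF inj_j1]) (simp add: j1_def wan)
  have d2: "2 \<le> d" using d by simp
  obtain q q1 where q: "\<And>t. (q has_real_derivative q1 t) (at t)"
    "\<And>t. (q1 has_real_derivative - c * q t ^ (2*d - 1)) (at t)"
    "\<And>t. q (t + 2*pi) = q t" "\<And>t. q1 (t + 2*pi) = q1 t"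
    "0 < integral {0..2*pi} (\<lambda>t. q t * sin t)"
    by (rule oscillator_exists[OF d2 c], rule that)
  interpret forced d c q q1 A b \<rho> m \<eta> \<gamma>0 W1
  proof
    show "2 \<le> d" "0 < m" using d by (auto simp: m_def)
    show "summable (\<lambda>j. b j * \<rho> ^ j)"
    proof -
      have "b j * \<rho> ^ j = 2 powr sb * C1 / \<rho>1 ^ m * (1/2) ^ j" for j
        using \<rho>1 by (simp add: b_def \<rho>_def power_add power_divide)
      then show ?thesis by (simp add: summable_mult summable_geometric)
    qed
    show "norm (A j) \<le> b j" for j by (rule wle_norm[OF wA]) (rule W1)
    show "real_l1 (A j)" for j
      using real_an[of j] by (auto simp: A_def real_l1_def coef_push[OF inj_j1] j1_def inv_j1)
    show "coef (A j) l = 0" if "snd l \<noteq> 0" for j l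
      using that by (auto simp: A_def coef_push[OF inj_j1] j1_def)
    have "coef (A 0) (j1 0) = of_real (\<I> / (2*pi))" unfolding A_def coef_push_image[OF inj_j1] mean_an \<I>_def ..
    also have "\<I> / (2*pi) = \<eta> * 2 * c" by (simp add: \<eta>_def c_def abs_mult_sgn)
    finally show "coef (A 0) 0 = of_real (\<eta> * 2 * c)" by (simp add: j1_def zero_prod_def)
  qed (use q c \<rho>1 \<eta> \<gamma>0 W1 wA in \<open>simp_all add: \<rho>_def m_def\<close>)
  obtain \<kappa> \<sigma> R C where K: "0 < \<kappa>" "0 < \<sigma>" "1 \<le> R" "0 \<le> C"
    and sol: "\<And>\<epsilon> \<delta> D. adm \<epsilon> D \<Longrightarrow> \<bar>\<epsilon>\<bar> \<le> \<kappa> \<Longrightarrow> 0 < \<delta> \<Longrightarrow> \<delta> \<le> \<kappa> \<Longrightarrow> 0 < \<epsilon> * \<eta> \<Longrightarrow>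
     2 * R * \<delta> \<le> \<rho> \<and> (\<exists>w. real_l1 w \<and> wle (Wt \<sigma>) w R \<and> wle (Wt \<sigma>) (w - ps (pl w)) (C * \<bar>\<epsilon>\<bar>) \<and>
       coef w (0, 1) \<noteq> 0 \<and> (\<forall>l. of_real (D l) * coef w l = of_real \<bar>\<epsilon>\<bar> * coef (N \<delta> w) l))"
    using forced_solution by blast
  have wt: "H_weight \<sigma> sb l \<le> Wt \<sigma> l" for l
  proof -
    have "jap (fst l) powr sb \<le> W1 (fst l)" unfolding W1_def using jap_ge1[of "fst l"] s by (intro powr_mono2) auto
    moreover have "of_int (max \<bar>fst l\<bar> 1) = jap (fst l)" by (simp add: jap_def)
    ultimately show ?thesis unfolding H_weight_def Wt_def by (simp add: mult.commute)
  qed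
  show ?thesis
  proof (rule exI[of _ \<kappa>], rule exI[of _ \<sigma>], rule exI[of _ R], rule exI[of _ C], intro conjI allI impI)
    fix \<epsilon> \<delta> :: real and D :: "int \<times> int \<Rightarrow> real"
    assume D: "\<forall>l. fst l \<noteq> 0 \<longrightarrow> \<gamma>0 \<le> \<bar>D l\<bar>" "\<forall>k. D (0, k) = \<epsilon> * (2 + \<epsilon>) * (of_int k)\<^sup>2" "\<forall>l. D (- l) = D l"
      and \<epsilon>: "\<bar>\<epsilon>\<bar> \<le> \<kappa>" and \<delta>: "0 < \<delta>" "\<delta> \<le> \<kappa>" and pos: "0 < \<epsilon> * integral {0..2*pi} (a m)"
    have adm: "adm \<epsilon> D" unfolding adm_def using D by blast
    have "0 < \<epsilon> * \<eta>" using pos by (auto simp: \<eta>_def \<I>_def zero_less_mult_iff sgn_real_def)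
    from sol[OF adm \<epsilon> \<delta> this] obtain w where R\<delta>: "2 * R * \<delta> \<le> \<rho>" and w: "real_l1 w" "wle (Wt \<sigma>) w R" "wle (Wt \<sigma>) (w - ps (pl w)) (C * \<bar>\<epsilon>\<bar>)"
       "coef w (0, 1) \<noteq> 0" "\<forall>l. of_real (D l) * coef w l = of_real \<bar>\<epsilon>\<bar> * coef (N \<delta> w) l" by blast
    have nw: "norm w \<le> R" by (rule wle_norm[OF w(2) Wt(1)[OF K(2)]])
    show "\<exists>w. real_l1 w \<and> norm w \<le> R \<and> wle (H_weight \<sigma> sb) w R \<and> wle (H_weight \<sigma> sb) (w - ps (pl w)) (C * \<bar>\<epsilon>\<bar>) \<and>
       coef w (0, 1) \<noteq> 0 \<and> summable (\<lambda>j. \<delta> ^ j *\<^sub>R (push j1 (an j) * w ^ (m + j))) \<and>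
       (\<forall>l. of_real (D l) * coef w l = of_real \<bar>\<epsilon>\<bar> * coef (\<Sum>j. \<delta> ^ j *\<^sub>R (push j1 (an j) * w ^ (m + j))) l)"
      using w(1,4) nw wle_weight_mono[OF w(2) wt] wle_weight_mono[OF w(3) wt]
        term_summable[OF less_imp_le[OF \<delta>(1)] R\<delta> K(3) nw, unfolded A_def] w(5)[unfolded N_def A_def] by blast
  qed (fact K)+
qed

end

theorem theoremB:
  fixes d :: nat and a :: "nat \<Rightarrow> real \<Rightarrow> real"
    and r s \<epsilon>\<^sub>0 \<gamma> s_bar :: real
  assumes "0 < \<epsilon>\<^sub>0"
    and "assumption_H d a r"
    and "integral {0..2*pi} (a (2*d-1)) \<noteq> 0"
    and "1 \<le> s"
    and "\<forall>u. \<bar>u\<bar> \<le> r \<longrightarrow> (\<lambda>x. nonlin d a x u) \<in> sobolev s"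
    and "0 < \<gamma>" and "\<gamma> < 1/6"
    and "0 < s_bar" and "s_bar < s - 1/2"
  shows "\<exists>\<epsilon>_bar C_bar \<sigma>_bar K. 0 < \<epsilon>_bar \<and> 0 < C_bar \<and> 0 < \<sigma>_bar \<and> 0 < K \<and>
    (\<forall>\<epsilon> \<omega>\<^sub>1. (\<epsilon>, \<omega>\<^sub>1) \<in> cantor_set \<epsilon>\<^sub>0 \<gamma> \<longrightarrow>
       \<bar>\<epsilon>\<bar> * inverse \<gamma> < \<epsilon>_bar \<longrightarrow>
       \<epsilon> * integral {0..2*pi} (a (2*d-1)) > 0 \<longrightarrow>
       (\<exists>u q v.
          u \<in> H_space \<sigma>_bar s_bar \<and> u \<noteq> (\<lambda>_. 0) \<and>
          (\<forall>x. \<bar>u x\<bar> \<le> r) \<and> weak_solution_torus (nonlin d a) \<omega>\<^sub>1 (1 + \<epsilon>) u \<and>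
          q \<in> H_an \<sigma>_bar \<and> q \<noteq> (\<lambda>_. 0) \<and>
          H_norm \<sigma>_bar s_bar (\<lambda>x. u x - \<bar>\<epsilon>\<bar> powr (1 / (2 * (real d - 1))) * q (snd x))
            \<le> C_bar * (\<bar>\<epsilon>\<bar> / \<gamma>) * \<bar>\<epsilon>\<bar> powr (1 / (2 * (real d - 1))) \<and>
          v = (\<lambda>t x. u (\<omega>\<^sub>1 * t, x + (1 + \<epsilon>) * t)) \<and>
          v \<noteq> (\<lambda>_ _. 0) \<and> quasi_periodic \<omega>\<^sub>1 (1 + \<epsilon>) v \<and>
          weak_solution_wave (nonlin d a) \<omega>\<^sub>1 v \<and>
          (\<forall>t. v t \<in> H_an \<sigma>_bar \<and>
             H_an_norm \<sigma>_bar
               (\<lambda>x. v t x - \<bar>\<epsilon>\<bar> powr (1 / (2 * (real d - 1))) * q (x + (1 + \<epsilon>) * t))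
               \<le> K * (inverse \<gamma> * \<bar>\<epsilon>\<bar> powr ((2 * real d - 1) / (2 * (real d - 1)))))))"
proof -
  interpret potential_series d a r by standard fact
  define I where "I = integral {0..2*pi} (a m)"
  have I: "integral {0..2*pi} (a (2*d-1)) = I" by (simp add: I_def m_def)
  have f: "(\<lambda>x. nonlin d a x u) \<in> sobolev s" if "\<bar>u\<bar> \<le> r" for u using assms(5) that by blast
  have s0: "0 \<le> s" and \<gamma>0: "0 < 3/8 * \<gamma>" using assms by simp_all
  have I0: "integral {0..2*pi} (a m) \<noteq> 0" using assms(3) unfolding I I_def .
  obtain \<kappa> \<sigma> R C where K: "0 < \<kappa>" "0 < \<sigma>" "1 \<le> R" "0 \<le> C"
    and sol: "\<And>\<epsilon> \<delta> D. \<forall>l. fst l \<noteq> 0 \<longrightarrow> 3/8 * \<gamma> \<le> \<bar>D l\<bar> \<Longrightarrow> \<forall>k. D (0, k) = \<epsilon> * (2 + \<epsilon>) * (of_int k)\<^sup>2 \<Longrightarrow>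
       \<forall>l. D (- l) = D l \<Longrightarrow> \<bar>\<epsilon>\<bar> \<le> \<kappa> \<Longrightarrow> 0 < \<delta> \<Longrightarrow> \<delta> \<le> \<kappa> \<Longrightarrow> 0 < \<epsilon> * I \<Longrightarrow>
     \<exists>w. real_l1 w \<and> norm w \<le> R \<and> wle (H_weight \<sigma> s_bar) w R \<and> wle (H_weight \<sigma> s_bar) (w - ps (pl w)) (C * \<bar>\<epsilon>\<bar>) \<and>
       coef w (0, 1) \<noteq> 0 \<and> summable (\<lambda>j. \<delta> ^ j *\<^sub>R (push j1 (an j) * w ^ (m + j))) \<and>
       (\<forall>l. of_real (D l) * coef w l = of_real \<bar>\<epsilon>\<bar> * coef (\<Sum>j. \<delta> ^ j *\<^sub>R (push j1 (an j) * w ^ (m + j))) l)"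
    using amplitude_exists[OF s0 assms(8,9) f I0 \<gamma>0] unfolding I_def by blast
  \<comment> \<open>Then \<open>\<delta> ^ n = |\<epsilon>|\<close> and \<open>m = n + 1\<close>, so
    \<open>\<delta> ^ m = \<delta> * |\<epsilon>|\<close>: undoing the scaling reproduces the
    right-hand side exactly.\<close>
  define n where "n = 2 * (d - 1)"
  have n: "real n = 2 * (real d - 1)" "0 < n" "m = Suc n" using d by (auto simp: n_def m_def)
  \<comment> \<open>The bound \<open>r / R\<close> keeps \<open>|u| \<le> \<delta> * R\<close>
    within the domain of the power series.\<close>
  define \<kappa>' where "\<kappa>' = min \<kappa> (r / R)"
  have \<kappa>': "0 < \<kappa>'" "\<kappa>' \<le> \<kappa>" "\<kappa>' * R \<le> r" using K r by (auto simp: \<kappa>'_def min_def field_simps)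
  define e0 where "e0 = min (1/4) (min \<kappa> (\<kappa>' ^ n))"
  have e0: "0 < e0" "e0 \<le> 1/4" "e0 \<le> \<kappa>" "e0 \<le> \<kappa>' ^ n" using K \<kappa>' by (auto simp: e0_def)
  \<comment> \<open>The error bound \<open>C * |\<epsilon>| * \<delta>\<close> is rewritten with the
    factor \<open>|\<epsilon>| / \<gamma>\<close>; the summand 1 makes the constant
    positive.\<close>
  define K0 where "K0 = C * \<gamma> + 1"
  have K0: "0 < K0" "C * \<gamma> \<le> K0" using K assms by (auto simp: K0_def intro: add_nonneg_pos)
  show ?thesis
    unfolding I n(1)[symmetric]
  proof (rule exI[of _ e0], rule exI[of _ K0], rule exI[of _ \<sigma>], rule exI[of _ K0], intro conjI allI impI)
    fix \<epsilon> \<omega>1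
    assume cs: "(\<epsilon>, \<omega>1) \<in> cantor_set \<epsilon>\<^sub>0 \<gamma>" and small: "\<bar>\<epsilon>\<bar> * inverse \<gamma> < e0" and pos: "0 < \<epsilon> * I"
    have "\<bar>\<epsilon>\<bar> < e0 * \<gamma>" using small assms(6) by (simp add: divide_inverse[symmetric] pos_divide_less_eq)
    also have "\<dots> \<le> e0 * 1" using e0 assms(7) by (intro mult_left_mono) auto
    finally have \<epsilon>: "\<bar>\<epsilon>\<bar> \<le> 1/4" "\<bar>\<epsilon>\<bar> \<le> \<kappa>" "\<bar>\<epsilon>\<bar> \<le> \<kappa>' ^ n" using e0 by linarith+
    have \<epsilon>0: "0 < \<bar>\<epsilon>\<bar>" using pos by auto
    define \<delta> where "\<delta> = \<bar>\<epsilon>\<bar> powr (1 / real n)"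
    have \<delta>0: "0 < \<delta>" using \<epsilon>0 by (simp add: \<delta>_def)
    have \<delta>n: "\<delta> ^ n = \<bar>\<epsilon>\<bar>"
      unfolding powr_realpow[OF \<delta>0, symmetric] unfolding \<delta>_def powr_powr using n(2) \<epsilon>0 by simp
    have \<delta>': "\<delta> \<le> \<kappa>'"
      by (rule power_le_imp_le_base[of _ "n - 1"]) (use \<delta>n \<epsilon>(3) n(2) \<kappa>'(1) in simp_all)
    define D where "D l = (\<omega>1 * of_int (fst l) + (1 + \<epsilon>) * of_int (snd l))\<^sup>2 - (of_int (snd l))\<^sup>2" for l :: "int \<times> int"
    have "\<exists>w. real_l1 w \<and> norm w \<le> R \<and> wle (H_weight \<sigma> s_bar) w R \<and> wle (H_weight \<sigma> s_bar) (w - ps (pl w)) (C * \<bar>\<epsilon>\<bar>) \<and>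
       coef w (0, 1) \<noteq> 0 \<and> summable (\<lambda>j. \<delta> ^ j *\<^sub>R (push j1 (an j) * w ^ (m + j))) \<and>
       (\<forall>l. of_real (D l) * coef w l = of_real \<bar>\<epsilon>\<bar> * coef (\<Sum>j. \<delta> ^ j *\<^sub>R (push j1 (an j) * w ^ (m + j))) l)"
    proof (rule sol[OF _ _ _ \<epsilon>(2) \<delta>0 order_trans[OF \<delta>' \<kappa>'(2)] pos])
      show "\<forall>l. fst l \<noteq> 0 \<longrightarrow> 3/8 * \<gamma> \<le> \<bar>D l\<bar>"
        unfolding D_def using small_divisor[OF cs assms(6,7) \<epsilon>(1)] by blast
      show "\<forall>k. D (0, k) = \<epsilon> * (2 + \<epsilon>) * (of_int k)\<^sup>2" by (simp add: D_def power2_eq_square algebra_simps)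
      show "\<forall>l. D (- l) = D l" by (simp add: D_def power2_eq_square algebra_simps)
    qed
    then obtain w where w: "real_l1 w" "norm w \<le> R" "wle (H_weight \<sigma> s_bar) w R" "wle (H_weight \<sigma> s_bar) (w - ps (pl w)) (C * \<bar>\<epsilon>\<bar>)"
      "coef w (0, 1) \<noteq> 0" "summable (\<lambda>j. \<delta> ^ j *\<^sub>R (push j1 (an j) * w ^ (m + j)))"
      and eqw: "\<And>l. of_real (D l) * coef w l = of_real \<bar>\<epsilon>\<bar> * coef (\<Sum>j. \<delta> ^ j *\<^sub>R (push j1 (an j) * w ^ (m + j))) l"
      by blast
    define U where "U = \<delta> *\<^sub>R w"
    define V where "V = \<delta> *\<^sub>R (w - ps (pl w))"
    define G where "G = \<delta> ^ m *\<^sub>R (\<Sum>j. \<delta> ^ j *\<^sub>R (push j1 (an j) * w ^ (m + j)))"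
    define u where "u x = Re (ev2 U x)" for x
    \<comment> \<open>The profile is the full average of \<open>w\<close> over the first variable,
      not the limiting oscillator. So \<open>u - \<delta> * q\<close> contains only modes with
      nonzero first index, which are of order |\<epsilon>| relative to \<delta>.\<close>
    define q where "q x = Re (ev1 (pl w) x)" for x
    define v where "v = (\<lambda>t x. u (\<omega>1 * t, x + (1 + \<epsilon>) * t))"
    have "coef w (- (0, l)) = cnj (coef w (0, l))" for l using w(1) unfolding real_l1_def by blast
    then have real_plw: "real_l1 (pl w)" by (simp add: real_l1_def coef_pl)
    have u: "of_real (u x) = ev2 U x" for x unfolding u_def U_def by (rule real_ev2[OF real_l1_scaleR[OF w(1)]])
    have q: "of_real (q x) = ev1 (pl w) x" for x unfolding q_def by (rule real_ev1[OF real_plw])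
    have Wp: "0 \<le> H_weight \<sigma> s_bar l" for l by (simp add: H_weight_def)
    have Wge: "exp (\<sigma> * of_int \<bar>snd l\<bar>) \<le> H_weight \<sigma> s_bar l" for l
    proof -
      have "1 \<le> of_int (max \<bar>fst l\<bar> 1) powr s_bar" using assms(8) by (intro ge_one_powr_ge_zero) auto
      then show ?thesis by (simp add: H_weight_def mult.commute)
    qed
    have wU: "wle (H_weight \<sigma> s_bar) U (\<bar>\<delta>\<bar> * R)" unfolding U_def by (rule wle_scaleR[OF w(3) Wp])
    have wV: "wle (H_weight \<sigma> s_bar) V (\<bar>\<delta>\<bar> * (C * \<bar>\<epsilon>\<bar>))" unfolding V_def by (rule wle_scaleR[OF w(4) Wp])
    have bound: "\<bar>\<delta>\<bar> * (C * \<bar>\<epsilon>\<bar>) \<le> K0 * (\<bar>\<epsilon>\<bar> / \<gamma>) * \<delta>"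
    proof -
      have "C * \<gamma> * (\<bar>\<epsilon>\<bar> / \<gamma> * \<delta>) \<le> K0 * (\<bar>\<epsilon>\<bar> / \<gamma> * \<delta>)"
        using K0(2) \<delta>0 assms(6) by (intro mult_right_mono) auto
      then show ?thesis using \<delta>0 assms(6) by (simp add: mult_ac)
    qed
    have ur: "\<bar>u x\<bar> \<le> r" for x
    proof -
      have "\<bar>u x\<bar> \<le> norm U" unfolding u_def
        by (rule order_trans[OF abs_Re_le_cmod norm_evl1_le[OF e2.char_le]])
      also have "\<dots> \<le> \<kappa>' * R" unfolding U_def using \<delta>0 \<delta>' w(2) by (simp add: mult_mono)
      finally show ?thesis using \<kappa>'(3) by linarith
    qed
    have G: "of_real (nonlin d a (fst x) (u x)) = ev2 G x" for x
      unfolding G_def by (rule nonlin_ev2[OF w(6) _ ur]) (use u in \<open>simp add: U_def\<close>)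
    have eq: "of_real ((\<omega>1 * of_int k + (1 + \<epsilon>) * of_int l)\<^sup>2 - (of_int l)\<^sup>2) * coef U (k, l) = coef G (k, l)" for k l
    proof -
      have "of_real (D (k, l)) * coef U (k, l) = \<delta> *\<^sub>R (of_real (D (k, l)) * coef w (k, l))" by (simp add: U_def coef_scaleR)
      also have "\<dots> = \<delta> *\<^sub>R (\<bar>\<epsilon>\<bar> *\<^sub>R coef (\<Sum>j. \<delta> ^ j *\<^sub>R (push j1 (an j) * w ^ (m + j))) (k, l))"
        unfolding eqw scaleR_conv_of_real ..
      also have "\<dots> = coef G (k, l)" by (simp only: G_def coef_scaleR n(3) power_Suc \<delta>n scaleR_scaleR)
      finally show ?thesis by (simp add: D_def)
    qed
    have diff: "of_real (u x - \<delta> * q (snd x)) = ev2 V x" for x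
    proof -
      note lin = bounded_linear.linear[OF bounded_linear_evl1[of "e2 x", OF e2.char_le]]
      show ?thesis
        unfolding V_def linear_scale[OF lin] linear_diff[OF lin] ev2_ps q[symmetric] of_real_diff u U_def
        by (simp add: scaleR_conv_of_real algebra_simps)
    qed
    have u0: "u \<noteq> (\<lambda>_. 0)"
    proof
      assume z: "u = (\<lambda>_. 0)"
      have "coef U (0, 1) = fc2 (\<lambda>x. of_real (u x)) (0, 1)" unfolding u fc2_ev2 ..
      then have "coef U (0, 1) = 0" by (simp add: z fc2_def)
      then show False using w(5) \<delta>0 by (simp add: U_def coef_scaleR)
    qed
    have q0: "q \<noteq> (\<lambda>_. 0)"
    proof
      assume z: "q = (\<lambda>_. 0)"
      have "coef (pl w) 1 = fc (\<lambda>x. of_real (q x)) 1" unfolding q fc_ev1 ..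
      then show False using w(5) by (simp add: z fc_def coef_pl)
    qed
    have wq: "wle (\<lambda>l. exp (\<sigma> * of_int \<bar>l\<bar>)) (pl w) R"
      using wle_pl[OF wle_weight_mono[OF w(3) Wge]] by simp
    have per2: "e2 (x + 2*pi, y) = e2 (x, y)" "e2 (x, y + 2*pi) = e2 (x, y)" for x y
    proof -
      have "e2 (x + 2*pi, y) l = e2 (x, y) l * cis (2*pi * of_int (fst l))" "e2 (x, y + 2*pi) l = e2 (x, y) l * cis (2*pi * of_int (snd l))" for l
        by (simp_all add: e2_def cis_mult algebra_simps)
      then show "e2 (x + 2*pi, y) = e2 (x, y)" "e2 (x, y + 2*pi) = e2 (x, y)" by (auto simp: cis_multiple_2pi)
    qed
    have exp1: "1 \<le> exp (\<sigma> * of_int \<bar>l\<bar>)" for l using K(2) by simp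
    have pw: "\<bar>\<epsilon>\<bar> powr ((2 * real d - 1) / real n) = \<bar>\<epsilon>\<bar> * \<delta>"
    proof -
      have "(2 * real d - 1) / real n = 1 + 1 / real n" using n(1,2) by (simp add: field_simps)
      then show ?thesis using \<epsilon>0 by (simp add: powr_add \<delta>_def)
    qed
    have vt: "v t \<in> H_an \<sigma>" "H_an_norm \<sigma> (\<lambda>x. v t x - \<delta> * q (x + (1 + \<epsilon>) * t)) \<le> K0 * (inverse \<gamma> * (\<bar>\<epsilon>\<bar> * \<delta>))" for t
    proof -
      obtain c1 where c1: "\<forall>x. ev1 c1 x = ev2 U (\<omega>1 * t, x + (1 + \<epsilon>) * t)" "wle (\<lambda>l. exp (\<sigma> * of_int \<bar>l\<bar>)) c1 (\<bar>\<delta>\<bar> * R)"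
        using slice[OF wle_weight_mono[OF wU Wge] exp1] by blast
      show "v t \<in> H_an \<sigma>" by (rule H_an_ev1(1)[OF _ c1(2)]) (simp only: v_def u c1(1)[rule_format])
      obtain c2 where c2: "\<forall>x. ev1 c2 x = ev2 V (\<omega>1 * t, x + (1 + \<epsilon>) * t)" "wle (\<lambda>l. exp (\<sigma> * of_int \<bar>l\<bar>)) c2 (\<bar>\<delta>\<bar> * (C * \<bar>\<epsilon>\<bar>))"
        using slice[OF wle_weight_mono[OF wV Wge] exp1] by blast
      have "H_an_norm \<sigma> (\<lambda>x. v t x - \<delta> * q (x + (1 + \<epsilon>) * t)) \<le> \<bar>\<delta>\<bar> * (C * \<bar>\<epsilon>\<bar>)"
      proof (rule H_an_ev1(2)[OF _ c2(2)])
        fix x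
        show "of_real (v t x - \<delta> * q (x + (1 + \<epsilon>) * t)) = ev1 c2 x"
          using diff[of "(\<omega>1 * t, x + (1 + \<epsilon>) * t)"] by (simp only: v_def c2(1)[rule_format] snd_conv)
      qed
      also note bound
      finally show "H_an_norm \<sigma> (\<lambda>x. v t x - \<delta> * q (x + (1 + \<epsilon>) * t)) \<le> K0 * (inverse \<gamma> * (\<bar>\<epsilon>\<bar> * \<delta>))"
        by (simp add: divide_inverse mult_ac)
    qed
    show "\<exists>u q v.
          u \<in> H_space \<sigma> s_bar \<and> u \<noteq> (\<lambda>_. 0) \<and>
          (\<forall>x. \<bar>u x\<bar> \<le> r) \<and> weak_solution_torus (nonlin d a) \<omega>1 (1 + \<epsilon>) u \<and>
          q \<in> H_an \<sigma> \<and> q \<noteq> (\<lambda>_. 0) \<and>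
          H_norm \<sigma> s_bar (\<lambda>x. u x - \<bar>\<epsilon>\<bar> powr (1 / real n) * q (snd x))
            \<le> K0 * (\<bar>\<epsilon>\<bar> / \<gamma>) * \<bar>\<epsilon>\<bar> powr (1 / real n) \<and>
          v = (\<lambda>t x. u (\<omega>1 * t, x + (1 + \<epsilon>) * t)) \<and>
          v \<noteq> (\<lambda>_ _. 0) \<and> quasi_periodic \<omega>1 (1 + \<epsilon>) v \<and>
          weak_solution_wave (nonlin d a) \<omega>1 v \<and>
          (\<forall>t. v t \<in> H_an \<sigma> \<and>
             H_an_norm \<sigma>
               (\<lambda>x. v t x - \<bar>\<epsilon>\<bar> powr (1 / real n) * q (x + (1 + \<epsilon>) * t))
               \<le> K0 * (inverse \<gamma> * \<bar>\<epsilon>\<bar> powr ((2 * real d - 1) / real n)))"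
      unfolding pw unfolding \<delta>_def[symmetric]
    proof (intro exI[of _ u] exI[of _ q] exI[of _ v] conjI allI)
      show "u \<in> H_space \<sigma> s_bar" by (rule H_space_ev2(1)[OF u wU])
      show "weak_solution_torus (nonlin d a) \<omega>1 (1 + \<epsilon>) u" by (rule weak_torus[OF u G eq])
      show "q \<in> H_an \<sigma>" by (rule H_an_ev1(1)[OF q wq])
      show "H_norm \<sigma> s_bar (\<lambda>x. u x - \<delta> * q (snd x)) \<le> K0 * (\<bar>\<epsilon>\<bar> / \<gamma>) * \<delta>"
        by (rule order_trans[OF H_space_ev2(2)[OF diff wV] bound])
      show "v \<noteq> (\<lambda>_ _. 0)"
      proof
        assume z: "v = (\<lambda>_ _. 0)"
        have "u (x, y) = 0" for x y
        proof -
          have "1 < \<omega>1" using cs by (simp add: cantor_set_def)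
          \<comment> \<open>Since \<omega>1 is nonzero, the map to the torus variables is onto the
            plane, so \<open>v\<close> cannot vanish without \<open>u\<close>.\<close>
          then have "u (x, y) = v (x / \<omega>1) (y - (1 + \<epsilon>) * (x / \<omega>1))" by (simp add: v_def)
          then show ?thesis by (simp add: z)
        qed
        then show False using u0 by (auto simp: fun_eq_iff)
      qed
      show "quasi_periodic \<omega>1 (1 + \<epsilon>) v"
        unfolding quasi_periodic_def by (intro exI[of _ u]) (simp add: u_def v_def per2 add.commute)
      show "weak_solution_wave (nonlin d a) \<omega>1 v" unfolding v_def by (rule weak_wave[OF u G eq])
    qed (fact u0 ur q0 v_def vt)+
  qed (fact e0 K0 K)+
qed

end
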